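(* Let $k$ be a field of characteristic zero and $A$ an affine Poisson $k$-algebra. Then a Poisson prime ideal $P$ of $A$ is Poisson rational if and only if the set of Poisson prime ideals $Q\supseteq P$ with $\mathrm{ht}(Q)=\mathrm{ht}(P)+1$ is finite.
   Context: A Poisson $k$-algebra is a commutative $k$-algebra $A$ with a $k$-bilinear Lie bracket $\{-,-\}$ such that $\{-,x\}$ is a derivation for each $x\in A$. Affine means finitely generated over $k$ and an integral domain. A Poisson prime ideal is a prime ideal $P$ with $\{P,A\}\subseteq P$. $P$ is Poisson rational if the Poisson centre $\{z:\{z,-\}\equiv0\}$ of $\operatorname{Frac}(A/P)$ (with induced bracket) is algebraic over $k$. $\mathrm{ht}$ denotes height. *)

theory Defs
  imports "HOL-Computational_Algebra.Polynomial" "HOL-Library.Extended_Nat"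
begin

text \<open>The ambient commutative domain A is the type 'a (A = UNIV); the base field k is
a subfield K of A (A is a k-algebra containing k).\<close>

definition subfield :: "'a::idom set \<Rightarrow> bool" where
  "subfield K \<longleftrightarrow> 0 \<in> K \<and> 1 \<in> K \<and>
     (\<forall>x\<in>K. \<forall>y\<in>K. x + y \<in> K \<and> x - y \<in> K \<and> x * y \<in> K) \<and>
     (\<forall>x\<in>K. x \<noteq> 0 \<longrightarrow> (\<exists>y\<in>K. x * y = 1))"

inductive_set gen_alg :: "'a::comm_ring_1 set \<Rightarrow> 'a set \<Rightarrow> 'a set" for K S where
  base_K: "c \<in> K \<Longrightarrow> c \<in> gen_alg K S"
| base_S: "s \<in> S \<Longrightarrow> s \<in> gen_alg K S"
| add: "x \<in> gen_alg K S \<Longrightarrow> y \<in> gen_alg K S \<Longrightarrow> x + y \<in> gen_alg K S"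
| mult: "x \<in> gen_alg K S \<Longrightarrow> y \<in> gen_alg K S \<Longrightarrow> x * y \<in> gen_alg K S"
| neg: "x \<in> gen_alg K S \<Longrightarrow> - x \<in> gen_alg K S"

definition affine_over :: "'a::idom set \<Rightarrow> bool" where
  "affine_over K \<longleftrightarrow> (\<exists>S. finite S \<and> gen_alg K S = UNIV)"

definition poisson_bracket :: "'a::idom set \<Rightarrow> ('a \<Rightarrow> 'a \<Rightarrow> 'a) \<Rightarrow> bool" where
  "poisson_bracket K br \<longleftrightarrow>
     (\<forall>x y z. br (x + y) z = br x z + br y z) \<and>
     (\<forall>x y z. br x (y + z) = br x y + br x z) \<and>
     (\<forall>c\<in>K. \<forall>x y. br (c * x) y = c * br x y) \<and>
     (\<forall>c\<in>K. \<forall>x y. br x (c * y) = c * br x y) \<and>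
     (\<forall>x. br x x = 0) \<and>
     (\<forall>x y z. br x (br y z) + br y (br z x) + br z (br x y) = 0) \<and>
     (\<forall>x y z. br (x * y) z = x * br y z + br x z * y)"

definition is_ideal :: "'a::comm_ring_1 set \<Rightarrow> bool" where
  "is_ideal I \<longleftrightarrow> 0 \<in> I \<and> (\<forall>x\<in>I. \<forall>y\<in>I. x + y \<in> I) \<and> (\<forall>x\<in>I. \<forall>a. a * x \<in> I)"

definition prime_ideal :: "'a::comm_ring_1 set \<Rightarrow> bool" where
  "prime_ideal P \<longleftrightarrow> is_ideal P \<and> P \<noteq> UNIV \<and> (\<forall>a b. a * b \<in> P \<longrightarrow> a \<in> P \<or> b \<in> P)"

definition poisson_prime :: "('a::comm_ring_1 \<Rightarrow> 'a \<Rightarrow> 'a) \<Rightarrow> 'a set \<Rightarrow> bool" where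
  "poisson_prime br P \<longleftrightarrow> prime_ideal P \<and> (\<forall>p\<in>P. \<forall>a. br p a \<in> P)"

definition height :: "'a::comm_ring_1 set \<Rightarrow> enat" where
  "height P = Sup {enat n | n. \<exists>f :: nat \<Rightarrow> 'a set.
      (\<forall>i\<le>n. prime_ideal (f i)) \<and> (\<forall>i<n. f i \<subset> f (Suc i)) \<and> f n = P}"

text \<open>Frac(A/P) for a prime P: pairs (a,b) with b \<notin> P, standing for the class of a / b,
where (a,b) and (c,d) denote the same element iff a d - b c \<in> P.\<close>
definition frac_elems :: "'a::comm_ring_1 set \<Rightarrow> ('a \<times> 'a) set" where
  "frac_elems P = {(a, b). b \<notin> P}"

definition frac_eq :: "'a::comm_ring_1 set \<Rightarrow> 'a \<times> 'a \<Rightarrow> 'a \<times> 'a \<Rightarrow> bool" where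
  "frac_eq P u v \<longleftrightarrow> fst u * snd v - snd u * fst v \<in> P"

text \<open>Induced bracket on Frac(A/P) (quotient rule):
 {a/b, c/d} = ({a,c} b d - a {b,c} d - c {a,d} b + a c {b,d}) / (b^2 d^2).\<close>
definition frac_br :: "('a::comm_ring_1 \<Rightarrow> 'a \<Rightarrow> 'a) \<Rightarrow> 'a \<times> 'a \<Rightarrow> 'a \<times> 'a \<Rightarrow> 'a \<times> 'a" where
  "frac_br br u v = (let (a, b) = u; (c, d) = v in
     (br a c * b * d - a * br b c * d - c * br a d * b + a * c * br b d, b^2 * d^2))"

definition frac_poisson_centre ::
  "('a::comm_ring_1 \<Rightarrow> 'a \<Rightarrow> 'a) \<Rightarrow> 'a set \<Rightarrow> ('a \<times> 'a) set" where
  "frac_poisson_centre br P = {z \<in> frac_elems P. \<forall>w \<in> frac_elems P. frac_eq P (frac_br br z w) (0, 1)}"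

text \<open>Evaluation of a polynomial with coefficients in A (mapped into A/P) at a/b in Frac(A/P):
 sum_i c_i (a/b)^i = (sum_i c_i a^i b^(n-i)) / b^n, n = degree.\<close>
definition frac_poly_eval :: "'a::comm_ring_1 poly \<Rightarrow> 'a \<times> 'a \<Rightarrow> 'a \<times> 'a" where
  "frac_poly_eval p u = (let (a, b) = u in
     ((\<Sum>i\<le>degree p. coeff p i * a ^ i * b ^ (degree p - i)), b ^ degree p))"

text \<open>z in Frac(A/P) is algebraic over k: it is a root of a nonzero polynomial with
coefficients in k (k embeds in A/P since K \<inter> P = {0}).\<close>
definition frac_algebraic :: "'a::comm_ring_1 set \<Rightarrow> 'a set \<Rightarrow> 'a \<times> 'a \<Rightarrow> bool" where
  "frac_algebraic K P z \<longleftrightarrow> (\<exists>p. p \<noteq> 0 \<and> (\<forall>i. coeff p i \<in> K) \<and> frac_eq P (frac_poly_eval p z) (0, 1))"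

definition poisson_rational :: "'a::comm_ring_1 set \<Rightarrow> ('a \<Rightarrow> 'a \<Rightarrow> 'a) \<Rightarrow> 'a set \<Rightarrow> bool" where
  "poisson_rational K br P \<longleftrightarrow> (\<forall>z \<in> frac_poisson_centre br P. frac_algebraic K P z)"

end

theory Submission
 imports "HOL-Algebra.Algebraic_Closure_Type" "Jordan_Normal_Form.Char_Poly" Defs
begin

text \<open>If the fraction field of \<open>A/P\<close> has a transcendental central element \<open>a/b\<close>, infinitely many primes
are minimal over \<open>P\<close> and some \<open>a - \<lambda> b\<close>. They are Poisson, since in characteristic zero the largest stable
ideal inside a prime is prime.

Conversely, following Jouanolou, let \<open>K[X] \<subseteq> A/P\<close> be a Noether normalization. A Poisson prime \<open>Q\<close>
minimal over \<open>P\<close> meets \<open>K[X]\<close> in a principal prime \<open>(p)\<close> and gives a form \<open>\<omega> = e dp/p\<close>, where \<open>e\<close> is a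
lift of the idempotent that isolates \<open>Q\<close> modulo \<open>p\<close>. The conductor theorem bounds the degree of \<open>e dp\<close>
by that of \<open>p\<close> plus a constant; as \<open>Q\<close> is stable, the values of \<open>\<omega>\<close> at the Hamiltonian derivations
and the coefficients of \<open>d\<omega>\<close> have no pole along \<open>p\<close>, hence lie in finite-dimensional spaces independent
of \<open>Q\<close>. Among many \<open>Q\<close> there are therefore more than \<open>card X\<close> combinations of the \<open>\<omega>\<close> that are closed and
vanish on all Hamiltonian derivations. They are dependent over the function field and solve a linear
differential system, so they are dependent over its constants, which are algebraic over \<open>K\<close> when \<open>P\<close> is
rational. This contradicts the different poles of the \<open>\<omega>\<close>.\<close>

text \<open>The obstacle is uniformity in \<open>Q\<close>. No single equation cuts out
  \<open>Q\<close> in \<open>A/P\<close>, but its contraction \<open>(p)\<close> to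
  \<open>K[X]\<close> is principal. The price is that \<open>p\<close> also vanishes on the other
  primes over \<open>(p)\<close>, and \<open>e\<close> has to hide them. Modulo \<open>p\<close> the
  coefficients of such an \<open>e\<close> are only fractions that are integral over
  \<open>K[X]/(p)\<close>, and a lift could have any degree. Multiplying by a derivative of
  \<open>p\<close> brings them back into \<open>K[X]/(p)\<close> at a cost of \<open>deg p\<close>
  plus a constant. Because \<open>deg p\<close> enters with slope one, the division by
  \<open>p\<close> that follows leaves a bound that is the same for all \<open>Q\<close>.

  Quotients are never built as types. Every \<open>A/P\<close> is realized as the image of
  \<open>A\<close> in one algebraically closed field, and every ring of the proof is a subset of
  that field. The field contains an element \<open>T\<close> that is transcendental over all these
  images. It is the spare coordinate in Noether normalization and the homogenizing variable that
  turns degree bounds into integrality statements.\<close>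

no_notation Polynomials.var (\<open>X\<index>\<close>)

section \<open>Subrings, polynomials and integral dependence\<close>

text \<open>Rings are carrier sets inside a type, so that residue rings, their fraction fields and
  their extensions can share one field.\<close>

definition subring_set :: "'a::comm_ring_1 set \<Rightarrow> bool" where
 "subring_set D \<longleftrightarrow> 1 \<in> D \<and> (\<forall>x\<in>D. \<forall>y\<in>D. x - y \<in> D \<and> x * y \<in> D)"

lemma subring_setI:
 assumes "1 \<in> D" "\<And>x y. x \<in> D \<Longrightarrow> y \<in> D \<Longrightarrow> x - y \<in> D" "\<And>x y. x \<in> D \<Longrightarrow> y \<in> D \<Longrightarrow> x * y \<in> D"
 shows "subring_set D"
 using assms by (auto simp: subring_set_def)

context
 fixes D :: "'a::comm_ring_1 set"
 assumes D: "subring_set D"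
begin

lemma sr_one: "1 \<in> D" and sr_diff: "x \<in> D \<Longrightarrow> y \<in> D \<Longrightarrow> x - y \<in> D"
 and sr_mult: "x \<in> D \<Longrightarrow> y \<in> D \<Longrightarrow> x * y \<in> D"
 using D by (auto simp: subring_set_def)

lemma sr_zero: "0 \<in> D"
 using sr_diff[OF sr_one sr_one] by simp

lemma sr_uminus: "x \<in> D \<Longrightarrow> - x \<in> D"
 using sr_diff[OF sr_zero] by fastforce

lemma sr_add: "x \<in> D \<Longrightarrow> y \<in> D \<Longrightarrow> x + y \<in> D"
 using sr_diff[of x "- y"] sr_uminus by auto

lemma sr_power: "x \<in> D \<Longrightarrow> x ^ n \<in> D"
 by (induction n) (auto intro: sr_one sr_mult)

lemma sr_sum: "(\<And>i. i \<in> I \<Longrightarrow> f i \<in> D) \<Longrightarrow> sum f I \<in> D"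
 by (induction I rule: infinite_finite_induct) (auto intro: sr_zero sr_add)

lemma sr_prod: "(\<And>i. i \<in> I \<Longrightarrow> f i \<in> D) \<Longrightarrow> prod f I \<in> D"
 by (induction I rule: infinite_finite_induct) (auto intro: sr_one sr_mult)

lemma sr_of_nat: "of_nat n \<in> D"
 by (induction n) (auto intro: sr_zero sr_one sr_add)

lemmas sr_closed = sr_one sr_zero sr_diff sr_mult sr_add sr_uminus sr_power sr_sum sr_prod sr_of_nat

end

section \<open>Polynomials with coefficients in a subring\<close>

definition polys :: "'a::zero set \<Rightarrow> 'a poly set" where
 "polys D = {p. \<forall>i. coeff p i \<in> D}"

lemma polysI: "(\<And>i. coeff p i \<in> D) \<Longrightarrow> p \<in> polys D"
 and polysD: "p \<in> polys D \<Longrightarrow> coeff p i \<in> D"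
 by (auto simp: polys_def)

lemma polys_mono: "D \<subseteq> E \<Longrightarrow> polys D \<subseteq> polys E"
 by (auto simp: polys_def)

lemma polys_UNIV [simp]: "polys UNIV = UNIV"
 by (auto simp: polys_def)

context
 fixes D :: "'a::idom set"
 assumes D: "subring_set D"
begin

lemma po_subring: "subring_set (polys D)"
 using D by (intro subring_setI polysI)
  (auto simp: coeff_mult dest: polysD intro!: sr_closed split: if_splits)

lemma po_const: "c \<in> D \<Longrightarrow> [:c:] \<in> polys D"
 by (auto simp: polys_def coeff_pCons split: nat.splits intro: sr_closed[OF D])

lemma po_pCons: "c \<in> D \<Longrightarrow> p \<in> polys D \<Longrightarrow> pCons c p \<in> polys D"
 by (auto simp: polys_def coeff_pCons split: nat.splits)

lemma po_monom: "c \<in> D \<Longrightarrow> monom c n \<in> polys D"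
 by (auto simp: polys_def sr_closed[OF D])

lemma po_smult: "c \<in> D \<Longrightarrow> p \<in> polys D \<Longrightarrow> smult c p \<in> polys D"
 by (auto simp: polys_def intro: sr_closed[OF D])

lemma po_pderiv: "p \<in> polys D \<Longrightarrow> pderiv p \<in> polys D"
proof (intro polysI)
 fix i assume "p \<in> polys D"
 then have "of_nat (Suc i) * coeff p (Suc i) \<in> D"
  by (intro sr_closed[OF D] polysD)
 then show "coeff (pderiv p) i \<in> D" by (simp add: coeff_pderiv)
qed

lemma po_pcompose: "p \<in> polys D \<Longrightarrow> q \<in> polys D \<Longrightarrow> pcompose p q \<in> polys D"
proof (induction p)
 case 0
 then show ?case by simp
next
 case (pCons a p)
 have "a \<in> D" using polysD[OF pCons.prems(1), of 0] by simp
 moreover have "p \<in> polys D"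
  by (rule polysI) (use polysD[OF pCons.prems(1), of "Suc _"] in simp)
 ultimately show ?case using pCons
  by (auto simp: pcompose_pCons intro!: sr_closed[OF po_subring] po_const)
qed

lemmas po_closed = sr_closed[OF po_subring] po_const po_pCons po_monom po_smult po_pderiv po_pcompose

lemma po_eval: "p \<in> polys D \<Longrightarrow> x \<in> D \<Longrightarrow> poly p x \<in> D"
 unfolding poly_altdef by (intro sr_closed[OF D]) (auto dest: polysD)

text \<open>Each round multiplies \<open>h\<close> by the leading coefficient of \<open>q\<close>
  instead of dividing by it, so the coefficients never leave \<open>D\<close>.\<close>

lemma po_pseudo_div:
 assumes q: "q \<in> polys D" and h: "h \<in> polys D" and d: "degree q > 0"
 obtains k u r where "u \<in> polys D" "r \<in> polys D"
  "smult (lead_coeff q ^ k) h = q * u + r" "degree r < degree q"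
proof -
 have "\<exists>k u r. u \<in> polys D \<and> r \<in> polys D \<and>
   smult (lead_coeff q ^ k) h = q * u + r \<and> degree r < degree q"
  using h
 proof (induction "degree h" arbitrary: h rule: less_induct)
  case less
  show ?case
  proof (cases "degree h < degree q")
   case True
   then show ?thesis using less.prems
    by (intro exI[of _ 0] exI[of _ 0] exI[of _ h]) (auto intro: po_closed)
  next
   case False
   define c where "c = lead_coeff q"
   define m where "m = monom (lead_coeff h) (degree h - degree q)"
   define h' where "h' = smult c h - q * m"
   have cD: "c \<in> D" using q by (auto simp: c_def dest: polysD)
   have m: "m \<in> polys D" using less.prems by (auto simp: m_def intro: po_closed dest: polysD)
   have h'D: "h' \<in> polys D" unfolding h'_def using q less.prems cD m by (intro po_closed)
   have "degree h' < degree h"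
   proof -
    have "degree h > 0" using False d by simp
    have le: "degree h' \<le> degree h" unfolding h'_def
    proof (rule degree_diff_le)
     show "degree (smult c h) \<le> degree h" by (rule degree_smult_le)
     have "degree (q * m) \<le> degree q + degree m" by (rule degree_mult_le)
     also have "\<dots> \<le> degree q + (degree h - degree q)"
      unfolding m_def using degree_monom_le by (rule add_left_mono)
     finally show "degree (q * m) \<le> degree h" using False by simp
    qed
    have "coeff h' (degree h) = 0"
    proof -
     have "coeff (q * m) (degree h) = coeff (monom (lead_coeff h) (degree h - degree q) * q) (degree h)"
      by (simp add: m_def mult.commute)
     also have "\<dots> = lead_coeff h * c" using False
      by (simp add: coeff_monom_mult c_def)
     finally show ?thesis by (simp add: h'_def mult.commute)
    qed
    then show ?thesis using le \<open>degree h > 0\<close>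
     by (metis coeff_0 degree_0 le_neq_implies_less leading_coeff_0_iff)
   qed
   from less.hyps[OF this h'D] obtain k u r where
    IH: "u \<in> polys D" "r \<in> polys D" "smult (c ^ k) h' = q * u + r" "degree r < degree q"
    unfolding c_def by blast
   have "smult (c ^ Suc k) h = q * (smult (c ^ k) m + u) + r"
   proof -
    have "smult (c ^ Suc k) h = smult (c ^ k) (smult c h)" by (simp add: mult.commute)
    also have "smult c h = h' + q * m" by (simp add: h'_def)
    also have "smult (c ^ k) (h' + q * m) = q * u + r + q * smult (c ^ k) m"
     by (simp add: smult_add_right IH(3))
    finally show ?thesis by (simp add: algebra_simps)
   qed
   moreover have "smult (c ^ k) m + u \<in> polys D"
    using IH(1) m cD by (intro po_closed sr_closed[OF D])
   ultimately show ?thesis using IH(2,4) unfolding c_def by blast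
  qed
 qed
 then show thesis using that by blast
qed

lemma po_monic_div:
 assumes q: "q \<in> polys D" and h: "h \<in> polys D" and d: "degree q > 0" "lead_coeff q = 1"
 obtains u r where "u \<in> polys D" "r \<in> polys D" "h = q * u + r" "degree r < degree q"
 using po_pseudo_div[OF q h d(1)] d(2) by (metis power_one smult_1_left)

end

section \<open>Generated subalgebras\<close>

lemma ga_subring:
 fixes K S :: "'a::comm_ring_1 set"
 assumes "subring_set K"
 shows "subring_set (gen_alg K S)"
proof (rule subring_setI)
 show "1 \<in> gen_alg K S" using sr_one[OF assms] by (rule gen_alg.base_K)
 show "x - y \<in> gen_alg K S" if "x \<in> gen_alg K S" "y \<in> gen_alg K S" for x y
  using gen_alg.add[OF that(1) gen_alg.neg[OF that(2)]] by simp
qed (rule gen_alg.mult)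

lemma ga_least:
 assumes "subring_set D" "K \<subseteq> D" "S \<subseteq> D"
 shows "gen_alg K S \<subseteq> D"
proof
 fix x assume "x \<in> gen_alg K S"
 then show "x \<in> D" by induction (use assms in \<open>auto intro: sr_closed\<close>)
qed

lemma ga_base:
 fixes K S :: "'a::comm_ring_1 set"
 shows "K \<subseteq> gen_alg K S" and "S \<subseteq> gen_alg K S"
 by (auto intro: gen_alg.intros)

lemma ga_mono: "K \<subseteq> K' \<Longrightarrow> S \<subseteq> S' \<Longrightarrow> gen_alg K S \<subseteq> gen_alg K' S'"
proof
 fix x assume sub: "K \<subseteq> K'" "S \<subseteq> S'" and "x \<in> gen_alg K S"
 from this(3) show "x \<in> gen_alg K' S'" by induction (use sub in \<open>auto intro: gen_alg.intros\<close>)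
qed

lemma ga_empty: "subring_set K \<Longrightarrow> gen_alg K {} = K"
 using ga_least[of K K "{}"] ga_base[of K "{}"] by blast

lemma ga_un: "gen_alg (gen_alg K S) S' = gen_alg K (S \<union> S')" if "subring_set K"
proof
 show "gen_alg (gen_alg K S) S' \<subseteq> gen_alg K (S \<union> S')"
  by (intro ga_least ga_subring ga_mono that) (use ga_base(2)[of "S \<union> S'" K] in auto)
 have "K \<subseteq> gen_alg (gen_alg K S) S'" "S \<subseteq> gen_alg (gen_alg K S) S'" "S' \<subseteq> gen_alg (gen_alg K S) S'"
  using ga_base(1)[of "gen_alg K S" S'] ga_base(2)[of S' "gen_alg K S"] ga_base(1)[of K S]
   ga_base(2)[of S K] by blast+
 then show "gen_alg K (S \<union> S') \<subseteq> gen_alg (gen_alg K S) S'"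
  using ga_least[OF ga_subring[OF ga_subring[OF that]]] by (metis Un_least)
qed

text \<open>Adjoining one generator at a time reduces questions about \<open>gen_alg\<close> to
  polynomials in one variable over the previous ring.\<close>

lemma ga_insert:
 fixes K S :: "'a::idom set"
 assumes "subring_set K"
 shows "gen_alg K (insert z S) = (\<lambda>h. poly h z) ` polys (gen_alg K S)"
proof
 let ?D = "gen_alg K S"
 have D: "subring_set ?D" using assms by (rule ga_subring)
 have sr: "subring_set ((\<lambda>h. poly h z) ` polys ?D)"
 proof (rule subring_setI)
  show "1 \<in> (\<lambda>h. poly h z) ` polys ?D"
   by (rule image_eqI[of _ _ 1]) (auto intro: po_closed[OF D])
  show "x - y \<in> (\<lambda>h. poly h z) ` polys ?D" "x * y \<in> (\<lambda>h. poly h z) ` polys ?D"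
   if "x \<in> (\<lambda>h. poly h z) ` polys ?D" "y \<in> (\<lambda>h. poly h z) ` polys ?D" for x y
   using that by (auto simp flip: poly_diff poly_mult intro!: imageI po_closed[OF D])
 qed
 have const: "x \<in> (\<lambda>h. poly h z) ` polys ?D" if "x \<in> ?D" for x
  by (rule image_eqI[of _ _ "[:x:]"]) (auto intro: po_closed[OF D] that)
 show "gen_alg K (insert z S) \<subseteq> (\<lambda>h. poly h z) ` polys ?D"
 proof (rule ga_least[OF sr])
  show "K \<subseteq> (\<lambda>h. poly h z) ` polys ?D" using const ga_base by blast
  have "z \<in> (\<lambda>h. poly h z) ` polys ?D"
   by (rule image_eqI[of _ _ "[:0,1:]"]) (auto intro!: po_closed[OF D] sr_closed[OF D])
  then show "insert z S \<subseteq> (\<lambda>h. poly h z) ` polys ?D" using const ga_base by blast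
 qed
 show "(\<lambda>h. poly h z) ` polys ?D \<subseteq> gen_alg K (insert z S)"
 proof clarify
  fix h assume "h \<in> polys ?D"
  then have "h \<in> polys (gen_alg K (insert z S))"
   using polys_mono[OF ga_mono[of K K S "insert z S"]] by blast
  then show "poly h z \<in> gen_alg K (insert z S)"
   by (intro po_eval ga_subring assms gen_alg.base_S) auto
 qed
qed

lemma ga_singleton: "subring_set (D :: 'a::idom set) \<Longrightarrow> gen_alg D {z} = (\<lambda>h. poly h z) ` polys D"
 using ga_insert[of D z "{}"] ga_empty[of D] by simp

section \<open>Integral dependence and finite modules\<close>

definition integral_over :: "'a::comm_ring_1 set \<Rightarrow> 'a \<Rightarrow> bool" where
 "integral_over D z \<longleftrightarrow> (\<exists>p\<in>polys D. lead_coeff p = 1 \<and> poly p z = 0)"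

inductive_set dspan :: "'a::comm_ring_1 set \<Rightarrow> 'a set \<Rightarrow> 'a set" for D M where
 zero: "0 \<in> dspan D M"
| add: "c \<in> D \<Longrightarrow> m \<in> M \<Longrightarrow> x \<in> dspan D M \<Longrightarrow> c * m + x \<in> dspan D M"

lemma dspan_add: "x \<in> dspan D M \<Longrightarrow> y \<in> dspan D M \<Longrightarrow> x + y \<in> dspan D M"
 by (induction rule: dspan.induct) (auto simp: add.assoc intro: dspan.intros)

lemma dspan_sum: "(\<And>i. i \<in> I \<Longrightarrow> f i \<in> dspan D M) \<Longrightarrow> sum f I \<in> dspan D M"
 by (induction I rule: infinite_finite_induct) (auto intro: dspan.zero dspan_add)

lemma dspan_base: "c \<in> D \<Longrightarrow> m \<in> M \<Longrightarrow> c * m \<in> dspan D M"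
 using dspan.add[OF _ _ dspan.zero] by fastforce

lemma dspan_mono: "x \<in> dspan D M \<Longrightarrow> D \<subseteq> D' \<Longrightarrow> M \<subseteq> M' \<Longrightarrow> x \<in> dspan D' M'"
proof (induction rule: dspan.induct)
 case (add c m x)
 then show ?case by (intro dspan.add) auto
qed (rule dspan.zero)

lemma dspan_sum_form:
 assumes "finite M" "x \<in> dspan D M" "subring_set D"
 obtains c where "\<And>m. c m \<in> D" "x = (\<Sum>m\<in>M. c m * m)"
proof -
 have "\<exists>c. (\<forall>m. c m \<in> D) \<and> x = (\<Sum>m\<in>M. c m * m)" using assms(2)
 proof induction
  case zero
  show ?case by (rule exI[of _ "\<lambda>_. 0"]) (auto intro: sr_closed assms)
 next
  case (add d m x)
  then obtain c where c: "\<forall>m. c m \<in> D" "x = (\<Sum>m\<in>M. c m * m)" by blast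
  have "d * m + x = (\<Sum>m'\<in>M. (c m' + (if m' = m then d else 0)) * m')"
   using add assms(1) by (simp add: c distrib_right sum.distrib if_distrib[of "\<lambda>x. x * _"] sum.delta cong: if_cong)
  then show ?case using c add assms(3)
   by (intro exI[of _ "\<lambda>m'. c m' + (if m' = m then d else 0)"]) (auto intro: sr_closed)
 qed
 then show thesis using that by blast
qed

lemma dspan_tower:
 assumes E: "E \<subseteq> dspan D M"
 shows "dspan E M' \<subseteq> dspan D {m * m' | m m'. m \<in> M \<and> m' \<in> M'}"
proof
 fix x assume "x \<in> dspan E M'"
 then show "x \<in> dspan D {m * m' | m m'. m \<in> M \<and> m' \<in> M'}"
 proof induction
  case (add c m' x)
  have "c \<in> dspan D M" using add E by blast
  then have "c * m' \<in> dspan D {m * m' | m m'. m \<in> M \<and> m' \<in> M'}"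
  proof induction
   case (add d m y)
   have "d * (m * m') + y * m' \<in> dspan D {m * m' | m m'. m \<in> M \<and> m' \<in> M'}"
    using add \<open>m' \<in> M'\<close> by (intro dspan.add) auto
   then show ?case by (simp add: algebra_simps)
  qed (auto intro: dspan.zero)
  then show ?case using add.IH by (rule dspan_add)
 qed (auto intro: dspan.zero)
qed

definition finite_over :: "'a::comm_ring_1 set \<Rightarrow> 'a set \<Rightarrow> bool" where
 "finite_over D E \<longleftrightarrow> (\<exists>M. finite M \<and> M \<subseteq> E \<and> E = dspan D M)"

lemma char_poly_over:
 fixes A :: "'a::idom mat"
 assumes A: "A \<in> carrier_mat n n" and D: "subring_set D"
  and AD: "\<And>i j. i < n \<Longrightarrow> j < n \<Longrightarrow> A $$ (i,j) \<in> D"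
 shows "char_poly A \<in> polys D"
proof -
 have sgn: "signof p \<in> polys D" for p :: "nat \<Rightarrow> nat"
  by (cases p rule: sign_cases) (auto intro: po_closed[OF D])
 have "char_poly_matrix A $$ (i,j) \<in> polys D" if "i < n" "j < n" for i j
  using that A AD[OF that] unfolding char_poly_matrix_def
  by (auto intro!: po_closed[OF D] sr_closed[OF D])
 moreover have "p i < n" if "p permutes {0..<n}" "i < n" for p i
  using permutes_in_image[OF that(1), of i] that by auto
 ultimately show ?thesis
  unfolding char_poly_def det_def'[OF char_poly_matrix_closed[OF A]]
  by (intro po_closed[OF D] sgn) auto
qed

text \<open>The determinant trick: multiplication by \<open>z\<close> acts on the module generators
  through a matrix over \<open>D\<close>, the vector of generators is an eigenvector for
  \<open>z\<close>, and the characteristic polynomial is monic over \<open>D\<close>.\<close>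

lemma finite_over_integral:
 fixes E :: "'a::field set"
 assumes D: "subring_set D" and E: "subring_set E" and fin: "finite_over D E" and z: "z \<in> E"
 shows "integral_over D z"
proof -
 obtain M where M: "finite M" "M \<subseteq> E" "E = dspan D M" using fin by (auto simp: finite_over_def)
 have "\<exists>c. (\<forall>m'. c m' \<in> D) \<and> z * m = (\<Sum>m'\<in>M. c m' * m')" if "m \<in> M" for m
 proof -
  have "z * m \<in> dspan D M" using z that M sr_mult[OF E] by auto
  then show ?thesis using dspan_sum_form[OF M(1) _ D] by metis
 qed
 then obtain c where c: "\<And>m m'. m \<in> M \<Longrightarrow> c m m' \<in> D" "\<And>m. m \<in> M \<Longrightarrow> z * m = (\<Sum>m'\<in>M. c m m' * m')"
  by metis
 obtain xs where xs: "set xs = M" "distinct xs" using finite_distinct_list[OF M(1)] by blast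
 define n where "n = length xs"
 define A where "A = mat n n (\<lambda>(i,j). c (xs!i) (xs!j))"
 define v where "v = vec n (\<lambda>i. xs!i)"
 have A: "A \<in> carrier_mat n n" by (simp add: A_def)
 have nth: "xs ! i \<in> M" if "i < n" for i using that xs by (auto simp: n_def)
 have "char_poly A \<in> polys D"
  by (rule char_poly_over[OF A D]) (auto simp: A_def intro: c nth)
 moreover have "lead_coeff (char_poly A) = 1" using degree_monic_char_poly[OF A] by simp
 moreover have "poly (char_poly A) z = 0"
 proof -
  have "A *\<^sub>v v = z \<cdot>\<^sub>v v"
  proof (rule eq_vecI)
   fix i assume "i < dim_vec (z \<cdot>\<^sub>v v)"
   then have i: "i < n" by (simp add: v_def)
   have "(A *\<^sub>v v) $ i = (\<Sum>j = 0..<n. c (xs!i) (xs!j) * xs!j)"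
    using i by (simp add: A_def v_def scalar_prod_def)
   also have "\<dots> = (\<Sum>m'\<in>M. c (xs!i) m' * m')"
    unfolding xs(1)[symmetric] sum_list_distinct_conv_sum_set[OF xs(2), symmetric]
    by (simp add: sum_list_sum_nth n_def)
   also have "\<dots> = z * xs!i" using c(2)[OF nth[OF i]] by simp
   finally show "(A *\<^sub>v v) $ i = (z \<cdot>\<^sub>v v) $ i" using i by (simp add: v_def)
  qed (simp add: A_def v_def)
  \<comment> \<open>Generators that all vanish would span 0, but \<open>E\<close> contains
    1.\<close>
  moreover have "v \<noteq> 0\<^sub>v n"
  proof
   assume v0: "v = 0\<^sub>v n"
   have "M \<subseteq> {0}"
   proof
    fix m assume "m \<in> M"
    then obtain i where "i < n" "m = xs!i" using xs by (metis in_set_conv_nth n_def)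
    then show "m \<in> {0}" using arg_cong[OF v0, of "\<lambda>v. vec_index v i"] by (simp add: v_def)
   qed
   have "(x::'a) = 0" if "x \<in> dspan D M" for x
    using that by induction (use \<open>M \<subseteq> {0}\<close> in auto)
   from this[of 1] show False using sr_one[OF E] M(3) by auto
  qed
  ultimately have "eigenvalue A z" unfolding eigenvalue_def eigenvector_def
   by (intro exI[of _ v]) (simp add: A_def v_def)
  then show ?thesis using eigenvalue_root_char_poly[OF A] by simp
 qed
 ultimately show ?thesis unfolding integral_over_def by blast
qed

lemma integral_overI: "p \<in> polys D \<Longrightarrow> lead_coeff p = 1 \<Longrightarrow> poly p z = 0 \<Longrightarrow> integral_over D z"
 by (auto simp: integral_over_def)

lemma integral_over_mono: "integral_over D z \<Longrightarrow> D \<subseteq> E \<Longrightarrow> integral_over E z"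
 unfolding integral_over_def using polys_mono by blast

lemma integral_over_base: "subring_set (D :: 'a::idom set) \<Longrightarrow> z \<in> D \<Longrightarrow> integral_over D z"
 by (rule integral_overI[of "[:-z, 1:]"]) (auto intro!: po_closed sr_closed)

lemma finite_over_adjoin:
 fixes D :: "'a::idom set"
 assumes D: "subring_set D" and z: "integral_over D z"
 shows "finite_over D (gen_alg D {z})"
proof -
 obtain p where p: "p \<in> polys D" "lead_coeff p = 1" "poly p z = 0"
  using z by (auto simp: integral_over_def)
 define n where "n = degree p"
 have n: "degree p > 0" using p by (cases "degree p = 0") (auto elim!: degree_eq_zeroE)
 let ?M = "(\<lambda>i. z ^ i) ` {..<n}"
 have "gen_alg D {z} \<subseteq> dspan D ?M"
 proof
  fix x assume "x \<in> gen_alg D {z}"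
  then obtain h where h: "h \<in> polys D" "x = poly h z" using ga_singleton[OF D] by auto
  obtain u r where r: "r \<in> polys D" "h = p * u + r" "degree r < degree p"
   using po_monic_div[OF D p(1) h(1) n p(2)] by metis
  have "x = poly r z" using h r p by simp
  also have "\<dots> = (\<Sum>i\<le>degree r. coeff r i * z ^ i)" by (rule poly_altdef)
  also have "\<dots> \<in> dspan D ?M"
   using r(1,3) by (intro dspan_sum dspan_base) (auto simp: n_def dest: polysD)
  finally show "x \<in> dspan D ?M" .
 qed
 moreover have z': "z \<in> gen_alg D {z}" by (simp add: gen_alg.base_S)
 have "?M \<subseteq> gen_alg D {z}"
  using sr_power[OF ga_subring[OF D] z'] by blast
 moreover have "x \<in> gen_alg D {z}" if "x \<in> dspan D ?M" for x
  using that
 proof induction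
  case zero
  show ?case by (intro sr_closed ga_subring D)
 next
  case (add c m x)
  then show ?case using \<open>?M \<subseteq> gen_alg D {z}\<close>
   by (intro gen_alg.add gen_alg.mult) (auto intro: gen_alg.base_K)
 qed
 ultimately show ?thesis unfolding finite_over_def by (intro exI[of _ ?M]) auto
qed

lemma finite_over_trans:
 fixes D :: "'a::idom set"
 assumes DE: "finite_over D E" and EF: "finite_over E F" and sub: "subring_set E" "subring_set F" "E \<subseteq> F" "D \<subseteq> E"
 shows "finite_over D F"
proof -
 obtain M where M: "finite M" "M \<subseteq> E" "E = dspan D M" using DE by (auto simp: finite_over_def)
 obtain N where N: "finite N" "N \<subseteq> F" "F = dspan E N" using EF by (auto simp: finite_over_def)
 let ?P = "{m * n | m n. m \<in> M \<and> n \<in> N}"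
 have P: "finite ?P" by (rule finite_image_set2) (use M N in auto)
 have PF: "?P \<subseteq> F" using M(2) N(2) sub(3) sr_mult[OF sub(2)] by blast
 have "dspan D ?P \<subseteq> F"
 proof
  fix x assume "x \<in> dspan D ?P"
  then show "x \<in> F"
  proof induction
   case (add c m x)
   then show ?case using PF sub by (intro sr_add[OF sub(2)] sr_mult[OF sub(2)]) auto
  qed (rule sr_zero[OF sub(2)])
 qed
 moreover have "F \<subseteq> dspan D ?P" using dspan_tower[of E D M N] M N by simp
 ultimately show ?thesis unfolding finite_over_def using P PF by (intro exI[of _ ?P]) auto
qed

lemma finite_over_gen_alg:
 fixes D :: "'a::idom set"
 assumes D: "subring_set D" and "finite S" and "\<And>s. s \<in> S \<Longrightarrow> integral_over D s"
 shows "finite_over D (gen_alg D S)"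
 using assms(2,3)
proof (induction S)
 case empty
 have "z \<in> dspan D {1}" if "z \<in> D" for z using dspan_base[of z D 1 "{1}"] that by simp
 moreover have "z \<in> D" if "z \<in> dspan D {1}" for z
  using that by induction (auto intro: sr_closed D)
 ultimately show ?case
  unfolding ga_empty[OF D] finite_over_def
  by (intro exI[of _ "{1}"]) (auto intro: sr_closed D)
next
 case (insert z S)
 let ?E = "gen_alg D S"
 have E: "subring_set ?E" by (rule ga_subring[OF D])
 have "gen_alg D (insert z S) = gen_alg ?E {z}" using ga_un[OF D, of S "{z}"] by simp
 moreover have "finite_over ?E (gen_alg ?E {z})"
  using insert.prems[of z] by (intro finite_over_adjoin E) (auto intro: integral_over_mono[OF _ ga_base(1)])
 ultimately show ?case using insert
  by (metis finite_over_trans E ga_subring ga_base(1) insertCI)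
qed

text \<open>An element involves only finitely many generators, and these span a finite module, to
  which the determinant trick applies.\<close>

lemma integral_over_gen_alg:
 fixes D :: "'a::field set"
 assumes D: "subring_set D" and S: "\<And>s. s \<in> S \<Longrightarrow> integral_over D s" and z: "z \<in> gen_alg D S"
 shows "integral_over D z"
proof -
 have "\<exists>S'. finite S' \<and> S' \<subseteq> S \<and> z \<in> gen_alg D S'" using z
 proof induction
  case (base_K c)
  then show ?case by (intro exI[of _ "{}"]) (auto intro: gen_alg.base_K)
 next
  case (base_S s)
  then show ?case by (intro exI[of _ "{s}"]) (auto intro: gen_alg.base_S)
 next
  case (add x y)
  then obtain A B where "finite A" "A \<subseteq> S" "x \<in> gen_alg D A" "finite B" "B \<subseteq> S" "y \<in> gen_alg D B" by blast
  then show ?case using ga_mono[of D D A "A \<union> B"] ga_mono[of D D B "A \<union> B"]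
   by (intro exI[of _ "A \<union> B"]) (auto intro: gen_alg.add)
 next
  case (mult x y)
  then obtain A B where "finite A" "A \<subseteq> S" "x \<in> gen_alg D A" "finite B" "B \<subseteq> S" "y \<in> gen_alg D B" by blast
  then show ?case using ga_mono[of D D A "A \<union> B"] ga_mono[of D D B "A \<union> B"]
   by (intro exI[of _ "A \<union> B"]) (auto intro: gen_alg.mult)
 qed (auto intro: gen_alg.neg)
 then obtain S' where S': "finite S'" "S' \<subseteq> S" "z \<in> gen_alg D S'" by blast
 show ?thesis
  using finite_over_integral[OF D ga_subring[OF D] finite_over_gen_alg[OF D S'(1)] S'(3)] S S' by blast
qed

lemma integral_closure_subring:
 fixes D :: "'a::field set"
 assumes D: "subring_set D"
 shows "subring_set {z. integral_over D z}"
proof (rule subring_setI)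
 let ?I = "{z. integral_over D z}"
 have I: "gen_alg D ?I \<subseteq> ?I" using integral_over_gen_alg[OF D] by blast
 show "1 \<in> ?I" by (auto intro: integral_over_base D sr_closed)
 show "x - y \<in> ?I" "x * y \<in> ?I" if "x \<in> ?I" "y \<in> ?I" for x y
  using that I sr_diff[OF ga_subring[OF D], of x ?I y] sr_mult[OF ga_subring[OF D], of x ?I y] ga_base(2)[of ?I D]
  by blast+
qed

text \<open>The finitely many coefficients of one equation for \<open>z\<close> generate a finite
  \<open>D\<close>-algebra, and adjoining \<open>z\<close> keeps it finite.\<close>

lemma integral_over_trans:
 fixes D :: "'a::field set"
 assumes D: "subring_set D" and E: "\<And>e. e \<in> E \<Longrightarrow> integral_over D e" and z: "integral_over E z"
 shows "integral_over D z"
proof -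
 obtain p where p: "p \<in> polys E" "lead_coeff p = 1" "poly p z = 0"
  using z by (auto simp: integral_over_def)
 let ?S = "coeff p ` {..degree p}"
 let ?E = "gen_alg D ?S"
 have S: "finite ?S" "\<And>s. s \<in> ?S \<Longrightarrow> integral_over D s" using p E by (auto dest: polysD)
 have Es: "subring_set ?E" by (rule ga_subring[OF D])
 have "coeff p i \<in> ?E" for i
  by (cases "i \<le> degree p") (auto intro: gen_alg.base_S sr_closed[OF Es] simp: coeff_eq_0)
 then have zE: "integral_over ?E z" using p by (intro integral_overI[of p] polysI) auto
 have "finite_over D (gen_alg ?E {z})"
  by (rule finite_over_trans[OF finite_over_gen_alg[OF D S] finite_over_adjoin[OF Es zE]])
   (auto intro: Es ga_subring ga_base gen_alg.intros)
 then show ?thesis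
  by (intro finite_over_integral[OF D ga_subring[OF Es, of "{z}"]]) (auto intro: gen_alg.base_S)
qed

section \<open>Algebraic closure and independence\<close>

definition algebraic_over :: "'a::comm_ring_1 set \<Rightarrow> 'a \<Rightarrow> bool" where
 "algebraic_over D z \<longleftrightarrow> (\<exists>p\<in>polys D. p \<noteq> 0 \<and> poly p z = 0)"

lemma integral_imp_algebraic: "integral_over D z \<Longrightarrow> algebraic_over D z"
 unfolding integral_over_def algebraic_over_def by (metis lead_coeff_1 leading_coeff_0_iff zero_neq_one)

lemma integral_lead_coeff_mult:
 fixes D :: "'a::idom set"
 assumes D: "subring_set D" and p: "p \<in> polys D" "degree p > 0" "poly p z = 0"
 shows "integral_over D (lead_coeff p * z)"
proof -
 define c where "c = lead_coeff p"
 define n where "n = degree p"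
 \<comment> \<open>This is \<open>c^(n-1) * p(Y/c)\<close> written without division: it is monic and
   has the roots of \<open>p\<close> multiplied by \<open>c\<close>.\<close>
 define q where "q = monom 1 n + (\<Sum>i<n. monom (coeff p i * c ^ (n - 1 - i)) i)"
 have c: "c \<in> D" "n > 0" using p by (auto simp: c_def n_def dest: polysD)
 have "q \<in> polys D" unfolding q_def
  using p(1) c by (auto intro!: po_closed[OF D] sr_closed[OF D] dest: polysD)
 moreover have "degree (\<Sum>i<n. monom (coeff p i * c ^ (n - 1 - i)) i) < n"
  using c(2) by (intro degree_sum_less) (auto intro: le_less_trans[OF degree_monom_le])
 then have "degree q = n" "coeff q n = 1" unfolding q_def
  by (auto simp: degree_add_eq_left degree_monom_eq coeff_eq_0)
 moreover have "poly q (c * z) = 0"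
 proof -
  have "poly q (c * z) = c ^ (n - 1) * (c * z ^ n) + (\<Sum>i<n. coeff p i * c ^ (n - 1 - i) * (c * z) ^ i)"
   using power_minus_mult[OF c(2), of c] by (simp add: q_def poly_monom poly_sum power_mult_distrib mult.assoc[symmetric])
  also have "(\<Sum>i<n. coeff p i * c ^ (n - 1 - i) * (c * z) ^ i) = c ^ (n-1) * (\<Sum>i<n. coeff p i * z ^ i)"
   unfolding sum_distrib_left
  proof (intro sum.cong refl)
   fix i assume "i \<in> {..<n}"
   then have "c ^ (n - 1 - i) * c ^ i = c ^ (n - 1)" by (simp flip: power_add)
   then show "coeff p i * c ^ (n - 1 - i) * (c * z) ^ i = c ^ (n-1) * (coeff p i * z ^ i)"
    by (simp add: power_mult_distrib mult_ac)
  qed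
  also have "c ^ (n - 1) * (c * z ^ n) + \<dots> = c ^ (n-1) * poly p z"
   unfolding poly_altdef n_def[symmetric] c_def
   by (simp add: n_def distrib_left lessThan_Suc_atMost[symmetric] algebra_simps)
  finally show ?thesis using p by simp
 qed
 ultimately show ?thesis unfolding integral_over_def c_def[symmetric] by metis
qed

text \<open>Up to a denominator, algebraic means integral. The closure properties of
  \<open>acl\<close> are thereby reduced to those of integral elements.\<close>

lemma algebraic_over_iff:
 fixes D :: "'a::idom set"
 assumes D: "subring_set D"
 shows "algebraic_over D z \<longleftrightarrow> (\<exists>c\<in>D. c \<noteq> 0 \<and> integral_over D (c * z))"
proof
 assume "algebraic_over D z"
 then obtain p where p: "p \<in> polys D" "p \<noteq> 0" "poly p z = 0" by (auto simp: algebraic_over_def)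
 then have "degree p > 0" by (cases "degree p = 0") (auto elim!: degree_eq_zeroE)
 then show "\<exists>c\<in>D. c \<noteq> 0 \<and> integral_over D (c * z)"
  using integral_lead_coeff_mult[OF D p(1) _ p(3)] p by (intro bexI[of _ "lead_coeff p"]) (auto dest: polysD)
next
 assume "\<exists>c\<in>D. c \<noteq> 0 \<and> integral_over D (c * z)"
 then obtain c p where c: "c \<in> D" "c \<noteq> 0" "p \<in> polys D" "lead_coeff p = 1" "poly p (c * z) = 0"
  by (auto simp: integral_over_def)
 have "pcompose p [:0, c:] \<in> polys D" using c by (intro po_closed[OF D] sr_closed[OF D]) (auto intro: sr_closed[OF D] po_closed[OF D])
 moreover have "pcompose p [:0, c:] \<noteq> 0" using c pcompose_eq_0[of p "[:0,c:]"] by auto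
 ultimately show "algebraic_over D z" unfolding algebraic_over_def using c
  by (intro bexI[of _ "pcompose p [:0, c:]"]) (auto simp: poly_pcompose mult.commute)
qed

text \<open>For a subring of a field this is the relative algebraic closure of its fraction field,
  since the coefficients of a relation can be cleared of denominators.\<close>

definition acl :: "'a::comm_ring_1 set \<Rightarrow> 'a set" where "acl D = {z. algebraic_over D z}"

lemma acl_mono: "D \<subseteq> E \<Longrightarrow> acl D \<subseteq> acl E"
 unfolding acl_def algebraic_over_def using polys_mono by blast

lemma acl_base: "subring_set (D :: 'a::idom set) \<Longrightarrow> D \<subseteq> acl D"
 unfolding acl_def using integral_over_base integral_imp_algebraic by blast

definition subfield_set :: "'a::field set \<Rightarrow> bool" where
 "subfield_set F \<longleftrightarrow> subring_set F \<and> (\<forall>x\<in>F. inverse x \<in> F)"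

lemma sf_sr: "subfield_set F \<Longrightarrow> subring_set F"
 and sf_inverse: "subfield_set F \<Longrightarrow> x \<in> F \<Longrightarrow> inverse x \<in> F"
 by (auto simp: subfield_set_def)

lemma sf_divide: "subfield_set F \<Longrightarrow> x \<in> F \<Longrightarrow> y \<in> F \<Longrightarrow> x / y \<in> F"
 unfolding divide_inverse by (intro sr_mult sf_sr sf_inverse)

lemma acl_subfield:
 fixes D :: "'a::field set"
 assumes D: "subring_set D"
 shows "subfield_set (acl D)"
 unfolding subfield_set_def
proof (intro conjI ballI subring_setI)
 note I = integral_closure_subring[OF D]
 note iff = algebraic_over_iff[OF D]
 show "1 \<in> acl D" using acl_base[OF D] sr_one[OF D] by blast
 fix x assume "x \<in> acl D"
 then obtain c where c: "c \<in> D" "c \<noteq> 0" "integral_over D (c * x)" by (auto simp: iff acl_def)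
 show "inverse x \<in> acl D"
 proof (cases "x = 0")
  case True
  then show ?thesis using acl_base[OF D] sr_zero[OF D] by auto
 next
  case False
  obtain p where p: "p \<in> polys D" "p \<noteq> 0" "poly p x = 0"
   using \<open>x \<in> acl D\<close> by (auto simp: acl_def algebraic_over_def)
  have "poly (reflect_poly p) (inverse x) = 0" using poly_reflect_poly_nz[of "inverse x" p] False p by simp
  moreover have "reflect_poly p \<in> polys D"
   using p(1) by (auto simp: polys_def coeff_reflect_poly sr_zero[OF D])
  ultimately show ?thesis using p by (auto simp: acl_def algebraic_over_def intro!: bexI[of _ "reflect_poly p"])
 qed
 fix y assume "y \<in> acl D"
 then obtain d where d: "d \<in> D" "d \<noteq> 0" "integral_over D (d * y)" by (auto simp: iff acl_def)
 have cd: "integral_over D c" "integral_over D d" using c d by (auto intro: integral_over_base D)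
 have "integral_over D (d * (c * x) - c * (d * y))" "integral_over D ((c * x) * (d * y))"
  using sr_diff[OF I] sr_mult[OF I] c d cd by simp_all
 then have "integral_over D ((c * d) * (x - y))" "integral_over D ((c * d) * (x * y))"
  by (simp_all add: algebra_simps)
 then show "x - y \<in> acl D" "x * y \<in> acl D" unfolding acl_def iff mem_Collect_eq
  using c d sr_mult[OF D] by (metis no_zero_divisors)+
qed

lemma common_denominator:
 fixes D :: "'a::idom set"
 assumes D: "subring_set D" and "finite I" and "\<And>i. i \<in> I \<Longrightarrow> \<exists>c\<in>D. c \<noteq> 0 \<and> Q (c * f i)"
  and Q: "\<And>c x. c \<in> D \<Longrightarrow> Q x \<Longrightarrow> Q (c * x)"
 obtains c where "c \<in> D" "c \<noteq> 0" "\<And>i. i \<in> I \<Longrightarrow> Q (c * f i)"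
proof -
 have "\<exists>c\<in>D. c \<noteq> 0 \<and> (\<forall>i\<in>I. Q (c * f i))" using assms(2,3)
 proof (induction I)
  case empty
  show ?case by (intro bexI[of _ 1]) (auto intro: sr_one D)
 next
  case (insert i I)
  then obtain c d where c: "c \<in> D" "c \<noteq> 0" "\<forall>i\<in>I. Q (c * f i)" and d: "d \<in> D" "d \<noteq> 0" "Q (d * f i)"
   by (metis insertCI)
  have "Q ((c * d) * f j)" if "j \<in> insert i I" for j
   using that Q[OF c(1) d(3)] Q[OF d(1), of "c * f j"] c(3) by (auto simp: mult_ac)
  then show ?case using c d by (intro bexI[of _ "c * d"]) (auto intro: sr_mult D)
 qed
 then show thesis using that by blast
qed

text \<open>After clearing denominators the coefficients of the relation are integral over
  \<open>D\<close>. Leading coefficient times \<open>z\<close> is then integral over integral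
  elements, hence over \<open>D\<close>, and dividing by the leading coefficient stays in the field
  \<open>acl D\<close>.\<close>

lemma acl_trans:
 fixes D :: "'a::field set"
 assumes D: "subring_set D"
 shows "acl (acl D) = acl D"
proof
 note A = sf_sr[OF acl_subfield[OF D]]
 show "acl D \<subseteq> acl (acl D)" by (rule acl_base[OF A])
 show "acl (acl D) \<subseteq> acl D"
 proof
  fix z assume "z \<in> acl (acl D)"
  then obtain p where p: "p \<in> polys (acl D)" "p \<noteq> 0" "poly p z = 0" by (auto simp: acl_def algebraic_over_def)
  have "\<exists>c\<in>D. c \<noteq> 0 \<and> integral_over D (c * coeff p i)" for i
   using polysD[OF p(1), of i] algebraic_over_iff[OF D] by (auto simp: acl_def)
  then obtain c where c: "c \<in> D" "c \<noteq> 0" "\<And>i. i \<in> {..degree p} \<Longrightarrow> integral_over D (c * coeff p i)"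
   using common_denominator[OF D, of "{..degree p}" "integral_over D" "coeff p"]
    sr_mult[OF integral_closure_subring[OF D]] integral_over_base[OF D] by blast
  define p' where "p' = smult c p"
  have p': "degree p' = degree p" "p' \<noteq> 0" "poly p' z = 0" using c p by (auto simp: p'_def)
  have co: "integral_over D (coeff p' i)" for i
   using c(3)[of i] by (cases "i \<le> degree p") (auto simp: p'_def coeff_eq_0 intro: integral_over_base D sr_closed)
  then have "degree p' > 0" using p' by (cases "degree p' = 0") (auto elim!: degree_eq_zeroE)
  then have "integral_over {z. integral_over D z} (lead_coeff p' * z)"
   using co p' by (intro integral_lead_coeff_mult integral_closure_subring D polysI) auto
  then have "integral_over D (lead_coeff p' * z)" by (rule integral_over_trans[OF D, rotated]) auto
  then have "lead_coeff p' * z \<in> acl D" "lead_coeff p' \<in> acl D"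
   using co by (auto simp: acl_def intro: integral_imp_algebraic)
  then have "(lead_coeff p' * z) / lead_coeff p' \<in> acl D" by (rule sf_divide[OF acl_subfield[OF D]])
  moreover have "lead_coeff p' \<noteq> 0" using p'(2) leading_coeff_0_iff by blast
  ultimately show "z \<in> acl D" by simp
 qed
qed

lemma acl_subset: "subring_set D \<Longrightarrow> E \<subseteq> acl D \<Longrightarrow> acl E \<subseteq> acl (D :: 'a::field set)"
 using acl_mono[of E "acl D"] acl_trans[of D] by simp

section \<open>Algebraic dependence as a closure operator with exchange\<close>

definition alg_cl :: "'a::comm_ring_1 set \<Rightarrow> 'a set \<Rightarrow> 'a set" where "alg_cl K X = acl (gen_alg K X)"

lemma cl_subfield: "subring_set K \<Longrightarrow> subfield_set (alg_cl K (X :: 'a::field set))"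
 unfolding alg_cl_def by (intro acl_subfield ga_subring)

lemma cl_base: "subring_set K \<Longrightarrow> gen_alg K X \<subseteq> alg_cl K (X :: 'a::idom set)"
 unfolding alg_cl_def by (intro acl_base ga_subring)

lemma cl_mono: "X \<subseteq> Y \<Longrightarrow> alg_cl K X \<subseteq> alg_cl K Y"
 unfolding alg_cl_def by (intro acl_mono ga_mono) auto

lemma cl_least:
 assumes K: "subring_set K" and "X \<subseteq> alg_cl K (Y :: 'a::field set)"
 shows "alg_cl K X \<subseteq> alg_cl K Y"
proof -
 have "gen_alg K X \<subseteq> alg_cl K Y"
  using assms cl_base[OF K, of Y] ga_base(1)[of K Y] by (intro ga_least sf_sr[OF cl_subfield]) auto
 then show ?thesis unfolding alg_cl_def by (intro acl_subset ga_subring K)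
qed

text \<open>The coefficients of the relation for \<open>z\<close> are polynomials in
  \<open>x\<close>. Regrouped by powers of \<open>x\<close> it becomes a relation \<open>q\<close>
  for \<open>x\<close> whose coefficients involve \<open>z\<close>. If \<open>q\<close> vanished
  identically, the part belonging to one power of \<open>x\<close> would make \<open>z\<close>
  algebraic over \<open>K[X]\<close>.\<close>

lemma cl_exchange:
 fixes K :: "'a::field set"
 assumes K: "subring_set K" and z: "z \<in> alg_cl K (insert x X)" "z \<notin> alg_cl K X"
 shows "x \<in> alg_cl K (insert z X)"
proof -
 let ?D = "gen_alg K X"
 have D: "subring_set ?D" by (rule ga_subring[OF K])
 obtain p where p: "p \<in> polys (gen_alg K (insert x X))" "p \<noteq> 0" "poly p z = 0"
  using z by (auto simp: alg_cl_def acl_def algebraic_over_def)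
 have "\<exists>h\<in>polys ?D. coeff p i = poly h x" for i
  using polysD[OF p(1), of i] ga_insert[OF K] by auto
 then obtain h where h: "\<And>i. h i \<in> polys ?D" "\<And>i. coeff p i = poly (h i) x" by metis
 define q where "q = (\<Sum>i\<le>degree p. smult (z ^ i) (h i))"
 have "poly q x = poly p z" by (simp add: q_def poly_sum poly_altdef[of p] h(2) mult.commute)
 moreover have "q \<in> polys (gen_alg K (insert z X))"
  unfolding q_def
 proof (intro po_closed ga_subring K sr_power)
  show "z \<in> gen_alg K (insert z X)" by (simp add: gen_alg.base_S)
  show "h i \<in> polys (gen_alg K (insert z X))" for i
   using h(1)[of i] polys_mono[OF ga_mono[of K K X "insert z X"]] by blast
 qed
 moreover have "q \<noteq> 0"
 proof
  assume "q = 0"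
  obtain j where j: "coeff (h (degree p)) j \<noteq> 0"
   using h(2)[of "degree p"] p(2) by (metis leading_coeff_0_iff poly_0 poly_eqI coeff_0)
  define r where "r = (\<Sum>i\<le>degree p. monom (coeff (h i) j) i)"
  have "poly r z = coeff q j" by (simp add: r_def poly_sum q_def coeff_sum poly_monom mult.commute)
  moreover have "coeff r (degree p) = coeff (h (degree p)) j" by (simp add: r_def coeff_sum)
  moreover have "r \<in> polys ?D" unfolding r_def
   using h by (intro po_closed[OF D]) (auto dest: polysD)
  ultimately have "algebraic_over ?D z" unfolding algebraic_over_def
   using j \<open>q = 0\<close> by (intro bexI[of _ r]) auto
  then show False using z by (simp add: alg_cl_def acl_def)
 qed
 ultimately show ?thesis using p unfolding alg_cl_def acl_def algebraic_over_def by auto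
qed

definition indep :: "'a::comm_ring_1 set \<Rightarrow> 'a set \<Rightarrow> bool" where
 "indep K X \<longleftrightarrow> finite X \<and> (\<forall>x\<in>X. x \<notin> alg_cl K (X - {x}))"

lemma indep_finite: "indep K X \<Longrightarrow> finite X"
 by (simp add: indep_def)

lemma indep_subset: "indep K X \<Longrightarrow> Y \<subseteq> X \<Longrightarrow> indep K Y"
 unfolding indep_def using cl_mono[of "Y - {_}" "X - {_}" K] by (meson Diff_mono finite_subset in_mono order_refl)

context
 fixes K :: "'a::field set"
 assumes K: "subring_set K"
begin

lemma indep_insert:
 assumes X: "indep K X" and y: "y \<notin> alg_cl K X"
 shows "indep K (insert y X)"
 unfolding indep_def
proof (intro conjI ballI)
 show "finite (insert y X)" using X by (simp add: indep_def)
 have yX: "y \<notin> X" using y cl_base[OF K, of X] ga_base(2)[of X K] by blast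
 fix x assume x: "x \<in> insert y X"
 show "x \<notin> alg_cl K (insert y X - {x})"
 proof (cases "x = y")
  case True
  then show ?thesis using y yX by simp
 next
  case False
  then have "insert y X - {x} = insert y (X - {x})" "insert x (X - {x}) = X" "x \<notin> alg_cl K (X - {x})"
   using x X by (auto simp: indep_def)
  then show ?thesis using cl_exchange[OF K, of x y "X - {x}"] y by auto
 qed
qed

lemma indep_insertD: "indep K (insert y X) \<Longrightarrow> y \<notin> X \<Longrightarrow> y \<notin> alg_cl K X"
 by (auto simp: indep_def)

text \<open>Steinitz exchange: an element of \<open>X\<close> outside \<open>Y\<close> is replaced
  by an element of \<open>Y\<close>, which keeps the size and lowers
  \<open>card (X - Y)\<close>.\<close>

lemma indep_card_le:
 assumes "indep K X" "finite Y" "X \<subseteq> alg_cl K Y"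
 shows "card X \<le> card Y"
 using assms
proof (induction "card (X - Y)" arbitrary: X rule: less_induct)
 case less
 show ?case
 proof (cases "X \<subseteq> Y")
  case True
  then show ?thesis using less by (intro card_mono)
 next
  case False
  then obtain x where x: "x \<in> X" "x \<notin> Y" by blast
  have fX: "finite X" using less.prems by (simp add: indep_def)
  have "\<not> Y \<subseteq> alg_cl K (X - {x})"
   using cl_least[OF K, of Y "X - {x}"] less.prems x by (auto simp: indep_def)
  then obtain y where y: "y \<in> Y" "y \<notin> alg_cl K (X - {x})" by blast
  have yX: "y \<notin> X" using y x cl_base[OF K, of "X - {x}"] ga_base(2)[of "X - {x}" K] by blast
  let ?X' = "insert y (X - {x})"
  have i: "indep K ?X'" by (intro indep_insert y indep_subset[OF less.prems(1)]) auto
  have "?X' - Y = (X - Y) - {x}" using y by auto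
  then have "card (?X' - Y) < card (X - Y)" using x fX card_Diff1_less[of "X - Y" x] by auto
  moreover have "?X' \<subseteq> alg_cl K Y" using less.prems y cl_base[OF K, of Y] ga_base(2)[of Y K] by auto
  ultimately have "card ?X' \<le> card Y" using less.hyps i less.prems by blast
  moreover have "card ?X' = card X" using yX card_Suc_Diff1[OF fX x(1)] fX by simp
  ultimately show ?thesis by simp
 qed
qed

lemma indep_extend:
 assumes "indep K X" "X \<subseteq> E" "finite Z" "E \<subseteq> alg_cl K Z"
 obtains Y where "X \<subseteq> Y" "Y \<subseteq> E" "indep K Y" "E \<subseteq> alg_cl K Y"
proof -
 let ?P = "\<lambda>Y. X \<subseteq> Y \<and> Y \<subseteq> E \<and> indep K Y"
 have "?P X" using assms by simp
 have bd: "card Y \<le> card Z" if "?P Y" for Y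
  using that assms(4) by (intro indep_card_le[OF _ assms(3)]) auto
 define Y where "Y = arg_max card ?P"
 have Y: "?P Y" "\<And>Y'. ?P Y' \<Longrightarrow> card Y' \<le> card Y"
  using arg_max_nat_lemma[of ?P X card "Suc (card Z)"] \<open>?P X\<close> bd unfolding Y_def by (simp_all add: less_Suc_eq_le)
 have "e \<in> alg_cl K Y" if "e \<in> E" for e
 proof (rule ccontr)
  assume e: "e \<notin> alg_cl K Y"
  then have "e \<notin> Y" using cl_base[OF K, of Y] ga_base(2)[of Y K] by blast
  moreover have "card (insert e Y) \<le> card Y" using Y(1) e that by (intro Y(2)) (auto intro: indep_insert)
  ultimately show False using Y(1) by (simp add: indep_def)
 qed
 then show thesis using that Y(1) by blast
qed

text \<open>Counting replaces a direct check of independence: this is how new coordinate systems are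
  recognized as independent after a change of variables.\<close>

lemma indep_if_spanning:
 assumes X: "indep K X" and Y: "finite Y" "X \<subseteq> alg_cl K Y" "card Y \<le> card X"
 shows "indep K Y" "card Y = card X"
proof -
 show c: "card Y = card X" using indep_card_le[OF X Y(1,2)] Y(3) by simp
 show "indep K Y" unfolding indep_def
 proof (intro conjI ballI notI Y(1))
  fix y assume y: "y \<in> Y" "y \<in> alg_cl K (Y - {y})"
  then have "Y \<subseteq> alg_cl K (Y - {y})" using cl_base[OF K, of "Y - {y}"] ga_base(2)[of "Y - {y}" K] by blast
  then have "X \<subseteq> alg_cl K (Y - {y})" using cl_least[OF K] Y(2) by blast
  then have "card X \<le> card (Y - {y})" using indep_card_le[OF X] Y(1) by blast
  then show False using c y Y(1) by (metis card_Diff1_less linorder_not_less)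
 qed
qed

end

section \<open>Homomorphisms\<close>

definition rhom :: "'a::comm_ring_1 set \<Rightarrow> ('a \<Rightarrow> 'b::comm_ring_1) \<Rightarrow> bool" where
 "rhom D f \<longleftrightarrow> f 1 = 1 \<and> (\<forall>x\<in>D. \<forall>y\<in>D. f (x + y) = f x + f y \<and> f (x * y) = f x * f y)"

lemma rhomI:
 assumes "f 1 = 1" "\<And>x y. x \<in> D \<Longrightarrow> y \<in> D \<Longrightarrow> f (x + y) = f x + f y" "\<And>x y. x \<in> D \<Longrightarrow> y \<in> D \<Longrightarrow> f (x * y) = f x * f y"
 shows "rhom D f"
 using assms by (auto simp: rhom_def)

lemma rhom_subset: "rhom D f \<Longrightarrow> E \<subseteq> D \<Longrightarrow> rhom E f"
 by (auto simp: rhom_def)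

context
 fixes D :: "'a::comm_ring_1 set" and f :: "'a \<Rightarrow> 'b::comm_ring_1"
 assumes D: "subring_set D" and f: "rhom D f"
begin

lemma rhom_one: "f 1 = 1" and rhom_add: "x \<in> D \<Longrightarrow> y \<in> D \<Longrightarrow> f (x + y) = f x + f y"
 and rhom_mult: "x \<in> D \<Longrightarrow> y \<in> D \<Longrightarrow> f (x * y) = f x * f y"
 using f by (auto simp: rhom_def)

lemma rhom_zero: "f 0 = 0"
 using rhom_add[OF sr_zero[OF D] sr_zero[OF D]] by simp

lemma rhom_uminus: "x \<in> D \<Longrightarrow> f (- x) = - f x"
 using rhom_add[of x "- x"] sr_uminus[OF D] rhom_zero by (simp add: eq_neg_iff_add_eq_0 add.commute)

lemma rhom_diff: "x \<in> D \<Longrightarrow> y \<in> D \<Longrightarrow> f (x - y) = f x - f y"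
 using rhom_add[of x "- y"] sr_uminus[OF D] rhom_uminus by simp

lemma rhom_power: "x \<in> D \<Longrightarrow> f (x ^ n) = f x ^ n"
 by (induction n) (auto simp: rhom_one rhom_mult sr_power[OF D])

lemma rhom_sum: "(\<And>i. i \<in> I \<Longrightarrow> g i \<in> D) \<Longrightarrow> f (sum g I) = (\<Sum>i\<in>I. f (g i))"
 by (induction I rule: infinite_finite_induct) (auto simp: rhom_zero rhom_add sr_sum[OF D])

lemma rhom_prod: "(\<And>i. i \<in> I \<Longrightarrow> g i \<in> D) \<Longrightarrow> f (prod g I) = (\<Prod>i\<in>I. f (g i))"
 by (induction I rule: infinite_finite_induct) (auto simp: rhom_one rhom_mult sr_prod[OF D])

lemma rhom_of_nat: "f (of_nat n) = of_nat n"
 by (induction n) (auto simp: rhom_zero rhom_one rhom_add sr_of_nat[OF D] sr_one[OF D])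

lemma rhom_image: "subring_set (f ` D)"
proof (rule subring_setI)
 show "1 \<in> f ` D" using rhom_one sr_one[OF D] by (metis imageI)
qed (auto simp flip: rhom_diff rhom_mult intro!: imageI sr_closed[OF D])

lemma rhom_map_coeff [simp]: "coeff (map_poly f p) i = f (coeff p i)"
 by (simp add: coeff_map_poly rhom_zero)

lemma rhom_ga: "x \<in> gen_alg C S \<Longrightarrow> C \<subseteq> D \<Longrightarrow> S \<subseteq> D \<Longrightarrow> f x \<in> gen_alg (f ` C) (f ` S)"
proof (induction rule: gen_alg.induct)
 case (add x y)
 then have "x \<in> D" "y \<in> D" using ga_least[OF D, of C S] by auto
 then show ?case using add by (auto simp: rhom_add intro: gen_alg.add)
next
 case (mult x y)
 then have "x \<in> D" "y \<in> D" using ga_least[OF D, of C S] by auto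
 then show ?case using mult by (auto simp: rhom_mult intro: gen_alg.mult)
next
 case (neg x)
 then have "x \<in> D" using ga_least[OF D, of C S] by auto
 then show ?case using neg by (auto simp: rhom_uminus intro: gen_alg.neg)
qed (auto intro: gen_alg.intros)

end

context
 fixes D :: "'a::idom set" and f :: "'a \<Rightarrow> 'b::idom"
 assumes D: "subring_set D" and f: "rhom D f"
begin

lemma mp_add: "p \<in> polys D \<Longrightarrow> q \<in> polys D \<Longrightarrow> map_poly f (p + q) = map_poly f p + map_poly f q"
 by (rule poly_eqI) (simp add: rhom_map_coeff[OF D f] rhom_add[OF D f] polysD)

lemma mp_mult: "p \<in> polys D \<Longrightarrow> q \<in> polys D \<Longrightarrow> map_poly f (p * q) = map_poly f p * map_poly f q"
proof (rule poly_eqI)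
 fix n assume "p \<in> polys D" "q \<in> polys D"
 then have "f (\<Sum>i\<le>n. coeff p i * coeff q (n - i)) = (\<Sum>i\<le>n. f (coeff p i) * f (coeff q (n - i)))"
  by (subst rhom_sum[OF D f]) (auto simp: rhom_mult[OF D f] polysD intro!: sr_mult[OF D])
 then show "coeff (map_poly f (p * q)) n = coeff (map_poly f p * map_poly f q) n"
  by (simp add: rhom_map_coeff[OF D f] coeff_mult)
qed

lemma mp_smult: "c \<in> D \<Longrightarrow> p \<in> polys D \<Longrightarrow> map_poly f (smult c p) = smult (f c) (map_poly f p)"
 by (rule poly_eqI) (simp add: rhom_map_coeff[OF D f] rhom_mult[OF D f] polysD)

lemma mp_pderiv: "p \<in> polys D \<Longrightarrow> map_poly f (pderiv p) = pderiv (map_poly f p)"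
proof (rule poly_eqI)
 fix n assume "p \<in> polys D"
 then have "f (of_nat (Suc n) * coeff p (Suc n)) = of_nat (Suc n) * f (coeff p (Suc n))"
  using rhom_mult[OF D f] rhom_of_nat[OF D f] sr_of_nat[OF D] polysD by metis
 then show "coeff (map_poly f (pderiv p)) n = coeff (pderiv (map_poly f p)) n"
  by (simp add: rhom_map_coeff[OF D f] coeff_pderiv)
qed

lemma mp_eval: "p \<in> polys D \<Longrightarrow> x \<in> D \<Longrightarrow> f (poly p x) = poly (map_poly f p) (f x)"
proof -
 assume p: "p \<in> polys D" and x: "x \<in> D"
 have z: "f 0 = 0" by (rule rhom_zero[OF D f])
 show ?thesis using p
 proof (induction p)
  case (pCons a p)
  have "a \<in> D" using polysD[OF pCons.prems, of 0] by simp
  moreover have p: "p \<in> polys D"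
   by (rule polysI) (use polysD[OF pCons.prems, of "Suc _"] in simp)
  ultimately show ?case using pCons.IH[OF p] x
   by (simp add: map_poly_pCons[OF pCons.hyps(1)] rhom_add[OF D f] rhom_mult[OF D f] sr_mult[OF D] po_eval[OF D p])
 qed (simp add: z)
qed

lemma mp_over: "p \<in> polys D \<Longrightarrow> f ` D \<subseteq> E \<Longrightarrow> map_poly f p \<in> polys E"
 by (rule polysI) (auto simp: rhom_map_coeff[OF D f] dest: polysD)

lemma mp_const: "map_poly f [:c:] = [:f c:]"
 by (rule poly_eqI) (simp add: rhom_map_coeff[OF D f] coeff_pCons rhom_zero[OF D f] split: nat.splits)

lemma mp_X: "map_poly f [:0,1:] = [:0,1:]"
 by (rule poly_eqI) (simp add: rhom_map_coeff[OF D f] coeff_pCons rhom_zero[OF D f] rhom_one[OF D f] split: nat.splits)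

lemma mp_diff: "p \<in> polys D \<Longrightarrow> q \<in> polys D \<Longrightarrow> map_poly f (p - q) = map_poly f p - map_poly f q"
 by (rule poly_eqI) (simp add: rhom_map_coeff[OF D f] rhom_diff[OF D f] polysD)

lemma mp_degree: "f (lead_coeff p) \<noteq> 0 \<Longrightarrow> degree (map_poly f p) = degree p"
 using map_poly_degree_eq by blast

text \<open>Assumption \<open>wd\<close> makes the value independent of the polynomial chosen to
  represent an element of \<open>D[z]\<close>.\<close>

lemma rhom_adjoin:
 assumes wd: "\<And>h. h \<in> polys D \<Longrightarrow> poly h z = 0 \<Longrightarrow> poly (map_poly f h) w = 0"
 obtains g where "rhom (gen_alg D {z}) g" "\<And>d. d \<in> D \<Longrightarrow> g d = f d" "g z = w"
  "\<And>h. h \<in> polys D \<Longrightarrow> g (poly h z) = poly (map_poly f h) w"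
proof -
 define g where "g x = poly (map_poly f (SOME h. h \<in> polys D \<and> poly h z = x)) w" for x
 have eval: "g (poly h z) = poly (map_poly f h) w" if h: "h \<in> polys D" for h
 proof -
  define h' where "h' = (SOME h'. h' \<in> polys D \<and> poly h' z = poly h z)"
  have h': "h' \<in> polys D" "poly h' z = poly h z"
   using someI[of "\<lambda>h'. h' \<in> polys D \<and> poly h' z = poly h z" h] h by (auto simp: h'_def)
  have "poly (map_poly f (h' - h)) w = 0"
   using h h' by (intro wd) (auto intro: po_closed[OF D])
  then show ?thesis unfolding g_def h'_def[symmetric] using h h' by (simp add: mp_diff)
 qed
 have c: "g d = f d" if "d \<in> D" for d
  using eval[of "[:d:]"] that by (auto simp: mp_const po_closed[OF D])
 have "g z = w" using eval[of "[:0,1:]"] by (auto simp: mp_X intro!: po_closed[OF D] sr_closed[OF D])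
 moreover have "rhom (gen_alg D {z}) g"
  unfolding ga_singleton[OF D]
 proof (rule rhomI)
  show "g 1 = 1" using c[OF sr_one[OF D]] rhom_one[OF D f] by simp
  fix x y assume "x \<in> (\<lambda>h. poly h z) ` polys D" "y \<in> (\<lambda>h. poly h z) ` polys D"
  then obtain p q where pq: "p \<in> polys D" "q \<in> polys D" "x = poly p z" "y = poly q z" by blast
  show "g (x + y) = g x + g y" using eval[of "p + q"] eval[of p] eval[of q] pq
   by (simp add: mp_add po_closed[OF D])
  show "g (x * y) = g x * g y" using eval[of "p * q"] eval[of p] eval[of q] pq
   by (simp add: mp_mult po_closed[OF D])
 qed
 ultimately show thesis using that c eval by blast
qed

end

lemma rhom_eq_on_ga:
 fixes f g :: "'a::comm_ring_1 \<Rightarrow> 'b::comm_ring_1"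
 assumes K: "subring_set K" and f: "rhom (gen_alg K S) f" and g: "rhom (gen_alg K S) g"
  and "\<And>x. x \<in> K \<union> S \<Longrightarrow> f x = g x" and "x \<in> gen_alg K S"
 shows "f x = g x"
 using assms(5)
proof induction
 case (add x y)
 then show ?case using rhom_add[OF ga_subring[OF K] f] rhom_add[OF ga_subring[OF K] g] by simp
next
 case (mult x y)
 then show ?case using rhom_mult[OF ga_subring[OF K] f] rhom_mult[OF ga_subring[OF K] g] by simp
next
 case (neg x)
 then show ?case using rhom_uminus[OF ga_subring[OF K] f] rhom_uminus[OF ga_subring[OF K] g] by simp
qed (use assms(4) in auto)

lemma transc_poly_eq:
 assumes "x \<notin> acl D" "p \<in> polys D" "poly p x = 0"
 shows "p = 0"
 using assms by (auto simp: acl_def algebraic_over_def)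

text \<open>The universal property of a polynomial ring: a variable satisfies no relation over the
  preceding ones, so its image is free.\<close>

lemma rhom_extend_indep:
 fixes K :: "'a::field set" and f :: "'a \<Rightarrow> 'b::idom"
 assumes K: "subring_set K" and X: "indep K X" and f: "rhom K f"
 obtains g where "rhom (gen_alg K X) g" "\<And>c. c \<in> K \<Longrightarrow> g c = f c" "\<And>x. x \<in> X \<Longrightarrow> g x = u x"
proof -
 have "\<exists>g. rhom (gen_alg K X) g \<and> (\<forall>c\<in>K. g c = f c) \<and> (\<forall>x\<in>X. g x = u x)"
  using indep_finite[OF X] X
 proof (induction X)
  case empty
  show ?case using f by (simp add: ga_empty[OF K]) blast
 next
  case (insert x X)
  then obtain g where g: "rhom (gen_alg K X) g" "\<forall>c\<in>K. g c = f c" "\<forall>x\<in>X. g x = u x"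
   using indep_subset[of K "insert x X" X] by blast
  have D: "subring_set (gen_alg K X)" by (rule ga_subring[OF K])
  have x: "x \<notin> acl (gen_alg K X)" using indep_insertD[OF K insert.prems insert.hyps(2)] by (simp add: alg_cl_def)
  obtain g' where g': "rhom (gen_alg (gen_alg K X) {x}) g'" "\<And>d. d \<in> gen_alg K X \<Longrightarrow> g' d = g d" "g' x = u x"
   by (rule rhom_adjoin[OF D g(1), of x "u x"]) (use transc_poly_eq[OF x] in force)+
  have "gen_alg (gen_alg K X) {x} = gen_alg K (insert x X)" using ga_un[OF K, of X "{x}"] by simp
  then show ?case using g g' ga_base(1)[of K X] ga_base(2)[of X K] by (intro exI[of _ g']) auto
 qed
 then show thesis using that by blast
qed

text \<open>\<open>z\<close> is sent to a root of the image of \<open>q\<close>. Pseudo-division by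
  \<open>q\<close> replaces any \<open>h\<close> with \<open>h(z)\<close> in \<open>I\<close> by a
  remainder of smaller degree with the same property, and \<open>kill\<close> disposes of the
  remainder. With \<open>I = {0}\<close> this extends to an algebraic element; with a prime
  \<open>I\<close> it builds a homomorphism that factors through the quotient.\<close>

lemma alg_hom_step:
 fixes D :: "'a::idom set" and f :: "'a \<Rightarrow> 'b::alg_closed_field"
 assumes D: "subring_set D" and f: "rhom D f" and q: "q \<in> polys D" "degree q > 0" "f (lead_coeff q) \<noteq> 0"
 and I: "is_ideal I" "poly q z \<in> I"
 and kill: "\<And>h i. h \<in> polys D \<Longrightarrow> poly h z \<in> I \<Longrightarrow> degree h < degree q \<Longrightarrow> f (coeff h i) = 0"
 obtains g where "rhom (gen_alg D {z}) g" "\<And>d. d \<in> D \<Longrightarrow> g d = f d" "\<And>x. x \<in> gen_alg D {z} \<Longrightarrow> x \<in> I \<Longrightarrow> g x = 0"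
  "poly (map_poly f q) (g z) = 0"
proof -
 have "degree (map_poly f q) > 0" using mp_degree[OF D f q(3)] q(2) by simp
 then obtain w where w: "poly (map_poly f q) w = 0" using alg_closed_imp_poly_has_root by blast
 have kill': "poly (map_poly f h) w = 0" if h: "h \<in> polys D" "poly h z \<in> I" for h
 proof -
  obtain k u r where kur: "u \<in> polys D" "r \<in> polys D"
   "smult (lead_coeff q ^ k) h = q * u + r" "degree r < degree q"
   using po_pseudo_div[OF D q(1) h(1) q(2)] by metis
  have lc: "lead_coeff q ^ k \<in> D" using q by (intro sr_power[OF D]) (auto dest: polysD)
  have "poly r z = lead_coeff q ^ k * poly h z + (- poly u z) * poly q z"
   using arg_cong[OF kur(3), of "\<lambda>p. poly p z"] by (simp add: algebra_simps)
  then have "poly r z \<in> I" using h I unfolding is_ideal_def by (metis mult.commute)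
  then have "f (coeff r i) = 0" for i using kill kur by blast
  then have "map_poly f r = 0" by (intro poly_eqI) (simp add: rhom_map_coeff[OF D f])
  moreover have "smult (f (lead_coeff q ^ k)) (map_poly f h) = map_poly f (q * u + r)"
   unfolding kur(3)[symmetric] using mp_smult[OF D f lc h(1)] by simp
  moreover have "map_poly f (q * u + r) = map_poly f q * map_poly f u + map_poly f r"
   using kur q by (simp add: mp_add[OF D f] mp_mult[OF D f] po_closed[OF D])
  ultimately have "smult (f (lead_coeff q ^ k)) (map_poly f h) = map_poly f q * map_poly f u" by simp
  from arg_cong[OF this, of "\<lambda>p. poly p w"] have "f (lead_coeff q ^ k) * poly (map_poly f h) w = 0"
   using w by simp
  moreover have "f (lead_coeff q ^ k) \<noteq> 0"
   using rhom_power[OF D f, of "lead_coeff q" k] q by (simp add: polysD)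
  ultimately show ?thesis by simp
 qed
 have "0 \<in> I" using I(1) by (simp add: is_ideal_def)
 then obtain g where g: "rhom (gen_alg D {z}) g" "\<And>d. d \<in> D \<Longrightarrow> g d = f d" "g z = w"
  "\<And>h. h \<in> polys D \<Longrightarrow> g (poly h z) = poly (map_poly f h) w"
  using rhom_adjoin[OF D f, of z w] kill' by metis
 have "g x = 0" if "x \<in> gen_alg D {z}" "x \<in> I" for x
  using that g(4) kill' unfolding ga_singleton[OF D] by auto
 then show thesis using that[of g] g w by auto
qed

section \<open>Normal rings\<close>

definition fracs :: "'a::field set \<Rightarrow> 'a set" where "fracs R = {x / y | x y. x \<in> R \<and> y \<in> R}"

lemma fracsE:
 assumes "z \<in> fracs R" "subring_set R"
 obtains x y where "x \<in> R" "y \<in> R" "y \<noteq> 0" "z = x / y"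
proof -
 obtain x y where xy: "x \<in> R" "y \<in> R" "z = x / y" using assms by (auto simp: fracs_def)
 \<comment> \<open>For \<open>y = 0\<close> the quotient is 0 by the convention on division, and
   \<open>0 / 1\<close> represents it.\<close>
 then show thesis using that[of x y] that[of 0 1] sr_zero[OF assms(2)] sr_one[OF assms(2)] by (cases "y = 0") auto
qed

lemma fracs_base: "subring_set R \<Longrightarrow> R \<subseteq> fracs R"
proof
 fix x assume "subring_set R" "x \<in> R"
 then show "x \<in> fracs R" unfolding fracs_def using sr_one[of R] by (intro CollectI exI[of _ x] exI[of _ 1]) auto
qed

lemma fracs_subfield:
 assumes R: "subring_set R"
 shows "subfield_set (fracs R)"
 unfolding subfield_set_def
proof (intro conjI ballI subring_setI)
 show "1 \<in> fracs R" using fracs_base[OF R] sr_one[OF R] by blast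
 fix x assume "x \<in> fracs R"
 then obtain a b where ab: "a \<in> R" "b \<in> R" "b \<noteq> 0" "x = a / b" using fracsE R by metis
 show "inverse x \<in> fracs R" unfolding fracs_def using ab by (intro CollectI exI[of _ b] exI[of _ a]) auto
 fix y assume "y \<in> fracs R"
 then obtain c d where cd: "c \<in> R" "d \<in> R" "d \<noteq> 0" "y = c / d" using fracsE R by metis
 show "x - y \<in> fracs R" unfolding fracs_def using ab cd
  by (intro CollectI exI[of _ "a * d - c * b"] exI[of _ "b * d"]) (auto simp: field_simps intro!: sr_closed[OF R])
 show "x * y \<in> fracs R" unfolding fracs_def using ab cd
  by (intro CollectI exI[of _ "a * c"] exI[of _ "b * d"]) (auto intro!: sr_closed[OF R])
qed

lemma fracs_least: "subfield_set F \<Longrightarrow> R \<subseteq> F \<Longrightarrow> fracs R \<subseteq> F"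
 unfolding fracs_def using sf_divide[of F] by blast

lemma fracs_acl: "subring_set R \<Longrightarrow> fracs R \<subseteq> acl R"
 by (intro fracs_least acl_subfield acl_base)

lemma acl_fracs: "subring_set R \<Longrightarrow> acl (fracs R) = acl R"
 using acl_subset[of R "fracs R"] fracs_acl acl_mono[OF fracs_base] by blast

definition minpoly :: "'a::field set \<Rightarrow> 'a \<Rightarrow> 'a poly \<Rightarrow> bool" where
 "minpoly F y p \<longleftrightarrow> p \<in> polys F \<and> lead_coeff p = 1 \<and> poly p y = 0 \<and>
   (\<forall>h\<in>polys F. poly h y = 0 \<longrightarrow> h = 0 \<or> degree p \<le> degree h)"

lemma minpoly_ex:
 assumes F: "subfield_set F" and y: "y \<in> acl F"
 obtains p where "minpoly F y p"
proof -
 let ?P = "\<lambda>p. p \<in> polys F \<and> p \<noteq> 0 \<and> poly p y = 0"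
 obtain p0 where "?P p0" using y by (auto simp: acl_def algebraic_over_def)
 then obtain p where p: "?P p" "\<And>h. ?P h \<Longrightarrow> degree p \<le> degree h"
  using ex_has_least_nat[of ?P p0 degree] by blast
 let ?q = "smult (inverse (lead_coeff p)) p"
 have "minpoly F y ?q" unfolding minpoly_def
  using p by (auto intro!: po_smult[OF sf_sr[OF F]] sf_inverse[OF F] dest: polysD)
 then show thesis by (rule that)
qed

lemma minpolyD:
 assumes "minpoly F y p"
 shows "p \<in> polys F" "lead_coeff p = 1" "poly p y = 0" "p \<noteq> 0" "degree p > 0"
  "\<And>h. h \<in> polys F \<Longrightarrow> poly h y = 0 \<Longrightarrow> degree h < degree p \<Longrightarrow> h = 0"
proof -
 show *: "p \<in> polys F" "lead_coeff p = 1" "poly p y = 0" "p \<noteq> 0" using assms by (auto simp: minpoly_def)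
 show "degree p > 0" using * by (cases "degree p = 0") (auto elim!: degree_eq_zeroE)
 show "\<And>h. h \<in> polys F \<Longrightarrow> poly h y = 0 \<Longrightarrow> degree h < degree p \<Longrightarrow> h = 0"
  using assms by (auto simp: minpoly_def)
qed

lemma minpoly_dvd:
 assumes p: "minpoly F y p" and D: "subring_set D" "D \<subseteq> F" "p \<in> polys D" and h: "h \<in> polys D" "poly h y = 0"
 obtains u where "u \<in> polys D" "h = p * u"
proof -
 obtain u r where ur: "u \<in> polys D" "r \<in> polys D" "h = p * u + r" "degree r < degree p"
  using po_monic_div[OF D(1,3) h(1)] minpolyD[OF p] by metis
 have "r = 0" using minpolyD(6)[OF p, of r] ur h minpolyD(3)[OF p] polys_mono[OF D(2)] by auto
 then show thesis using that ur by simp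
qed

text \<open>Over an algebraically closed field \<open>p\<close> is a product of linear factors, so
  its coefficients are polynomials in its roots.\<close>

lemma monic_integral_coeffs:
 fixes p :: "'b::alg_closed_field poly"
 assumes I: "subring_set I" and p: "lead_coeff p = 1" and r: "\<And>x. poly p x = 0 \<Longrightarrow> x \<in> I"
 shows "p \<in> polys I"
proof -
 obtain A where A: "size A = degree p" "p = smult (lead_coeff p) (\<Prod>x\<in>#A. [:-x, 1:])"
  using alg_closed_imp_factorization[of p] p by (metis leading_coeff_0_iff zero_neq_one)
 have "x \<in> I" if "x \<in># A" for x
 proof (rule r)
  have "p = (\<Prod>x\<in>#A. [:-x, 1:])" using A p by simp
  then show "poly p x = 0" using that by (auto simp: poly_prod_mset)
 qed
 then have "(\<Prod>x\<in>#A. [:-x, 1:]) \<in> polys I"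
  by (induction A) (auto intro!: po_closed[OF I] sr_closed[OF I])
 then show ?thesis using A p by simp
qed

definition normal_ring :: "'a::field set \<Rightarrow> bool" where
 "normal_ring R \<longleftrightarrow> subring_set R \<and> (\<forall>z\<in>fracs R. integral_over R z \<longrightarrow> z \<in> R)"

lemma normal_sr: "normal_ring R \<Longrightarrow> subring_set R"
 by (simp add: normal_ring_def)

text \<open>This takes the place of the Gauss lemma: roots of a factor are roots of
  \<open>h\<close>, hence integral; so are the coefficients of the factor, and normality puts them
  back into \<open>R\<close>.\<close>

lemma normal_monic_factor:
 fixes R :: "'b::alg_closed_field set"
 assumes R: "normal_ring R" and h: "h \<in> polys R" "lead_coeff h = 1"
  and p: "p \<in> polys (fracs R)" "lead_coeff p = 1" "p dvd h"
 shows "p \<in> polys R"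
proof -
 have "p \<in> polys {z. integral_over R z}"
 proof (rule monic_integral_coeffs[OF integral_closure_subring[OF normal_sr[OF R]] p(2)])
  fix x assume "poly p x = 0"
  then have "poly h x = 0" using p(3) by (auto elim!: dvdE)
  then show "x \<in> {z. integral_over R z}" using h by (auto simp: integral_over_def)
 qed
 then show ?thesis using p(1) R by (auto simp: polys_def normal_ring_def)
qed

lemma normal_minpoly:
 fixes R :: "'b::alg_closed_field set"
 assumes R: "normal_ring R" and y: "integral_over R y" and p: "minpoly (fracs R) y p"
 shows "p \<in> polys R"
proof -
 obtain h where h: "h \<in> polys R" "lead_coeff h = 1" "poly h y = 0" using y by (auto simp: integral_over_def)
 have "h \<in> polys (fracs R)" using h polys_mono[OF fracs_base[OF normal_sr[OF R]]] by blast
 then obtain u where "h = p * u"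
  using minpoly_dvd[OF p sf_sr[OF fracs_subfield[OF normal_sr[OF R]]] order_refl minpolyD(1)[OF p]] h by metis
 then show ?thesis using normal_monic_factor[OF R h(1,2) minpolyD(1,2)[OF p]] by simp
qed

section \<open>Normality of polynomial rings\<close>

text \<open>Complete integral closedness, stated without division; unlike normality it passes to
polynomial rings by comparing leading coefficients.\<close>

definition compl_int_closed :: "'a::idom set \<Rightarrow> bool" where
 "compl_int_closed R \<longleftrightarrow> (\<forall>u\<in>R. \<forall>v\<in>R. \<forall>s\<in>R. v \<noteq> 0 \<longrightarrow> s \<noteq> 0 \<longrightarrow>
   (\<forall>k. \<exists>g\<in>R. s * u ^ k = v ^ k * g) \<longrightarrow> (\<exists>g\<in>R. u = v * g))"

text \<open>Induction on the degree of \<open>U\<close>: its leading term is cancelled by a multiple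
  of \<open>V\<close>, and the difference satisfies the hypothesis again.\<close>

lemma compl_int_closed_poly:
 fixes R :: "'a::idom set"
 assumes R: "subring_set R" and c: "compl_int_closed R"
 shows "compl_int_closed (polys R)"
 unfolding compl_int_closed_def
proof (intro ballI impI)
 fix U V S assume U: "U \<in> polys R" and V: "V \<in> polys R" "V \<noteq> 0" and S: "S \<in> polys R" "S \<noteq> 0"
  and all: "\<forall>k. \<exists>G\<in>polys R. S * U ^ k = V ^ k * G"
 show "\<exists>G\<in>polys R. U = V * G" using U all
 proof (induction "degree U" arbitrary: U rule: less_induct)
  case less
  show ?case
  proof (cases "U = 0")
   case True
   then show ?thesis by (intro bexI[of _ 0]) (auto intro: po_closed[OF R])
  next
   case False
   have deg: "degree V \<le> degree U"
   proof (rule ccontr)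
    assume "\<not> degree V \<le> degree U"
    \<comment> \<open>One power more than \<open>degree S\<close> is enough: each power of
      \<open>V\<close> would exceed the corresponding power of \<open>U\<close> by at least one
      degree, which \<open>S\<close> cannot make up.\<close>
    define k where "k = Suc (degree S)"
    obtain G where G: "S * U ^ k = V ^ k * G" using less.prems by blast
    have "V ^ k * G \<noteq> 0" unfolding G[symmetric] using S False by simp
    then have "degree (V ^ k * G) = k * degree V + degree G"
     using V by (auto simp: degree_mult_eq degree_power_eq)
    moreover have "degree (S * U ^ k) = degree S + k * degree U" using S False
     by (simp add: degree_mult_eq degree_power_eq)
    ultimately have "k * degree V \<le> degree S + k * degree U" using G by simp
    moreover have "k * Suc (degree U) \<le> k * degree V" using \<open>\<not> degree V \<le> degree U\<close> by (intro mult_le_mono2) simp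
    ultimately show False by (simp add: k_def)
   qed
   have "\<exists>g\<in>R. lead_coeff S * lead_coeff U ^ k = lead_coeff V ^ k * g" for k
   proof -
    obtain G where "G \<in> polys R" "S * U ^ k = V ^ k * G" using less.prems by blast
    then show ?thesis using arg_cong[of "S * U ^ k" "V ^ k * G" lead_coeff]
     unfolding lead_coeff_mult lead_coeff_power
     by (intro bexI[of _ "lead_coeff G"]) (auto dest: polysD)
   qed
   then obtain l where l: "l \<in> R" "lead_coeff U = lead_coeff V * l"
    using c less.prems(1) V S unfolding compl_int_closed_def by (metis leading_coeff_0_iff polysD)
   define M where "M = monom l (degree U - degree V)"
   have M: "M \<in> polys R" unfolding M_def using l by (intro po_closed[OF R])
   define U' where "U' = U - V * M"
   have U': "U' \<in> polys R" unfolding U'_def using less.prems V M by (intro po_closed[OF R])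
   \<comment> \<open>In the binomial expansion of \<open>(U - V * M)^k\<close> every term
     \<open>S * U^i * (V * M)^(k-i)\<close> is divisible by \<open>V^k\<close>.\<close>
   have "\<exists>G\<in>polys R. S * U' ^ k = V ^ k * G" for k
   proof -
    have "\<forall>i. \<exists>G\<in>polys R. S * U ^ i = V ^ i * G" using less.prems by blast
    then obtain G where G: "\<And>i. G i \<in> polys R" "\<And>i. S * U ^ i = V ^ i * G i" by metis
    have "S * U' ^ k = S * (U + - (V * M)) ^ k" by (simp add: U'_def)
    also have "\<dots> = (\<Sum>i\<le>k. of_nat (k choose i) * (S * U ^ i) * (- (V * M)) ^ (k - i))"
     unfolding binomial_ring[of U "- (V * M)"] sum_distrib_left by (simp only: mult_ac)
    also have "\<dots> = (\<Sum>i\<le>k. V ^ k * (of_nat (k choose i) * G i * (- M) ^ (k - i)))"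
    proof (rule sum.cong)
     fix i assume "i \<in> {..k}"
     then have "V ^ k = V ^ i * V ^ (k - i)" by (simp flip: power_add)
     then show "of_nat (k choose i) * (S * U ^ i) * (- (V * M)) ^ (k - i) = V ^ k * (of_nat (k choose i) * G i * (- M) ^ (k - i))"
      unfolding G(2) mult_minus_right[symmetric] power_mult_distrib by (simp only: mult_ac)
    qed auto
    also have "\<dots> = V ^ k * (\<Sum>i\<le>k. of_nat (k choose i) * G i * (- M) ^ (k - i))"
     by (simp add: sum_distrib_left)
    finally show ?thesis by (rule bexI) (intro sr_closed[OF po_subring[OF R]] G(1) M)
   qed
   moreover have "degree U' < degree U \<or> U' = 0"
   proof -
    have "degree (V * M) \<le> degree U" unfolding M_def
     using degree_mult_le[of V "monom l (degree U - degree V)"] degree_monom_le[of l "degree U - degree V"] deg by linarith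
    then have "degree U' \<le> degree U" unfolding U'_def by (intro degree_diff_le) auto
    moreover have "coeff (V * M) (degree U) = lead_coeff U"
     using deg l unfolding M_def mult.commute[of V] coeff_monom_mult by (simp add: mult.commute)
    then have "coeff U' (degree U) = 0" by (simp add: U'_def)
    ultimately show ?thesis by (metis coeff_0 leading_coeff_0_iff le_neq_implies_less)
   qed
   ultimately have "\<exists>G\<in>polys R. U' = V * G"
    using less.hyps U' by (metis mult_zero_right po_closed(2)[OF R])
   then obtain G where "G \<in> polys R" "U' = V * G" by blast
   then show ?thesis using M by (intro bexI[of _ "G + M"]) (auto simp: U'_def algebra_simps intro: po_closed[OF R])
  qed
 qed
qed

lemma compl_int_closed_adjoin:
 fixes R :: "'a::field set"
 assumes R: "subring_set R" and c: "compl_int_closed R" and x: "x \<notin> acl R"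
 shows "compl_int_closed (gen_alg R {x})"
 unfolding compl_int_closed_def ga_singleton[OF R]
proof (intro ballI impI)
 let ?E = "\<lambda>h. poly h x"
 fix u v s assume "u \<in> ?E ` polys R" "v \<in> ?E ` polys R" "s \<in> ?E ` polys R" and nz: "v \<noteq> 0" "s \<noteq> 0"
  and all: "\<forall>k. \<exists>g\<in>?E ` polys R. s * u ^ k = v ^ k * g"
 then obtain U V S where UVS: "U \<in> polys R" "V \<in> polys R" "S \<in> polys R" "u = ?E U" "v = ?E V" "s = ?E S" by blast
 have "\<exists>G\<in>polys R. S * U ^ k = V ^ k * G" for k
 proof -
  obtain G where G: "G \<in> polys R" "s * u ^ k = v ^ k * ?E G" using all by blast
  have "S * U ^ k - V ^ k * G = 0"
   using G UVS by (intro transc_poly_eq[OF x]) (auto simp: poly_power intro!: po_closed[OF R])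
  then show ?thesis using G by auto
 qed
 moreover have "V \<noteq> 0" "S \<noteq> 0" using nz UVS by auto
 ultimately obtain G where "G \<in> polys R" "U = V * G"
  using compl_int_closed_poly[OF R c] UVS unfolding compl_int_closed_def by metis
 then show "\<exists>g\<in>?E ` polys R. u = v * g" using UVS by auto
qed

text \<open>All powers of \<open>z = u / v\<close> are combinations over \<open>R\<close> of the
  powers below the degree \<open>n\<close> of a monic equation, so \<open>v^n\<close> is a common
  denominator for all of them.\<close>

lemma compl_int_closed_normal:
 fixes R :: "'a::field set"
 assumes R: "subring_set R" and c: "compl_int_closed R"
 shows "normal_ring R"
 unfolding normal_ring_def
proof (intro conjI ballI impI R)
 fix z assume "z \<in> fracs R" and int: "integral_over R z"
 then obtain u v where uv: "u \<in> R" "v \<in> R" "v \<noteq> 0" "z = u / v" using fracsE R by metis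
 obtain p where p: "p \<in> polys R" "lead_coeff p = 1" "poly p z = 0" using int by (auto simp: integral_over_def)
 have n: "degree p > 0" using p by (cases "degree p = 0") (auto elim!: degree_eq_zeroE)
 let ?n = "degree p"
 have "\<exists>g\<in>R. v ^ ?n * u ^ k = v ^ k * g" for k
 proof -
  obtain w r where r: "r \<in> polys R" "monom 1 k = p * w + r" "degree r < degree p"
   using po_monic_div[OF R p(1) po_monom[OF R sr_one[OF R]] n p(2), of k] by metis
  have "z ^ k = poly r z" using arg_cong[OF r(2), of "\<lambda>p. poly p z"] p by (simp add: poly_monom)
  then have "v ^ ?n * z ^ k = (\<Sum>i\<le>degree r. coeff r i * (v ^ ?n * z ^ i))"
   by (simp add: poly_altdef sum_distrib_left mult_ac)
  also have "\<dots> = (\<Sum>i\<le>degree r. coeff r i * (v ^ (?n - i) * u ^ i))"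
  proof (intro sum.cong refl)
   fix i assume "i \<in> {..degree r}"
   then have "v ^ ?n = v ^ (?n - i) * v ^ i" using r(3) by (simp flip: power_add)
   then show "coeff r i * (v ^ ?n * z ^ i) = coeff r i * (v ^ (?n - i) * u ^ i)"
    using uv by (simp add: power_divide)
  qed
  also have "\<dots> \<in> R" using r(1) uv by (intro sr_closed[OF R]) (auto dest: polysD)
  finally have "v ^ ?n * z ^ k \<in> R" .
  moreover have "v ^ ?n * u ^ k = v ^ k * (v ^ ?n * z ^ k)" using uv by (simp add: power_divide)
  ultimately show ?thesis by blast
 qed
 then obtain g where "g \<in> R" "u = v * g"
  using c uv sr_power[OF R uv(2)] unfolding compl_int_closed_def by (metis power_not_zero)
 then show "z \<in> R" using uv by simp
qed

lemma polynomial_ring_normal: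
 fixes K :: "'a::field set"
 assumes K: "subfield_set K" and X: "indep K X"
 shows "normal_ring (gen_alg K X)"
proof -
 note Ks = sf_sr[OF K]
 have "compl_int_closed (gen_alg K X)" using indep_finite[OF X] X
 proof (induction X)
  case empty
  show ?case unfolding ga_empty[OF Ks] compl_int_closed_def
  proof (intro ballI impI)
   fix u v assume "u \<in> K" "v \<in> K" "v \<noteq> 0"
   then show "\<exists>g\<in>K. u = v * g" by (intro bexI[of _ "u / v"]) (auto intro: sf_divide[OF K])
  qed
 next
  case (insert x X)
  have "x \<notin> acl (gen_alg K X)" using indep_insertD[OF Ks insert.prems insert.hyps(2)] by (simp add: alg_cl_def)
  then have "compl_int_closed (gen_alg (gen_alg K X) {x})"
   using insert indep_subset[of K "insert x X" X] by (intro compl_int_closed_adjoin ga_subring Ks) auto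
  then show ?case using ga_un[OF Ks, of X "{x}"] by simp
 qed
 then show ?thesis by (intro compl_int_closed_normal ga_subring Ks)
qed

section \<open>Degrees and Noether normalization\<close>

text \<open>Elements of total degree at most \<open>n\<close>. The definition by spans of monomials
  also covers dependent generators, as in the image of \<open>K[X]\<close> modulo a prime, where an
  element has no well-defined degree.\<close>

definition filt :: "'a::comm_ring_1 set \<Rightarrow> 'a set \<Rightarrow> nat \<Rightarrow> 'a set" where
 "filt K X n = dspan K {prod_list xs | xs. set xs \<subseteq> X \<and> length xs \<le> n}"

lemma finite_monomials: "finite X \<Longrightarrow> finite {prod_list xs | xs. set xs \<subseteq> X \<and> length xs \<le> n}"
 using finite_lists_length_le[of X n] by (simp add: setcompr_eq_image)

lemma filt_mono: "m \<le> n \<Longrightarrow> x \<in> filt K X m \<Longrightarrow> x \<in> filt K X n"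
 unfolding filt_def by (erule dspan_mono) auto

lemma filt_add: "x \<in> filt K X n \<Longrightarrow> y \<in> filt K X n \<Longrightarrow> x + y \<in> filt K X n"
 unfolding filt_def by (rule dspan_add)

lemma filt_zero: "0 \<in> filt K X n"
 unfolding filt_def by (rule dspan.zero)

lemma filt_sum: "(\<And>i. i \<in> I \<Longrightarrow> f i \<in> filt K X n) \<Longrightarrow> sum f I \<in> filt K X n"
 unfolding filt_def by (rule dspan_sum)

context
 fixes K :: "'a::comm_ring_1 set"
 assumes K: "subring_set K"
begin

lemma filt_const: "c \<in> K \<Longrightarrow> c \<in> filt K X n"
proof -
 assume c: "c \<in> K"
 have "1 \<in> {prod_list xs | xs. set xs \<subseteq> X \<and> length xs \<le> n}" by (intro CollectI exI[of _ "[]"]) simp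
 from dspan_base[OF c this] show ?thesis by (simp add: filt_def)
qed

lemma filt_gen: "x \<in> X \<Longrightarrow> n > 0 \<Longrightarrow> x \<in> filt K X n"
proof -
 assume "x \<in> X" "n > 0"
 then have "x \<in> {prod_list xs | xs. set xs \<subseteq> X \<and> length xs \<le> n}" by (intro CollectI exI[of _ "[x]"]) simp
 from dspan_base[OF sr_one[OF K] this] show ?thesis by (simp add: filt_def)
qed

lemma filt_mult:
 assumes "x \<in> filt K X m" "y \<in> filt K X n"
 shows "x * y \<in> filt K X (m + n)"
proof -
 let ?M = "\<lambda>n. {prod_list xs | xs. set xs \<subseteq> X \<and> length xs \<le> n}"
 have *: "c * p * y \<in> filt K X (m + n)" if c: "c \<in> K" and p: "p \<in> ?M m" for c p
  using assms(2) unfolding filt_def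
 proof induction
  case zero
  show ?case by (simp add: dspan.zero)
 next
  case (add d q z)
  obtain xs ys where "p = prod_list xs" "set xs \<subseteq> X" "length xs \<le> m" "q = prod_list ys" "set ys \<subseteq> X" "length ys \<le> n"
   using p add by blast
  then have "p * q \<in> ?M (m + n)" by (intro CollectI exI[of _ "xs @ ys"]) auto
  then have "(c * d) * (p * q) + c * p * z \<in> dspan K (?M (m + n))"
   using c add by (intro dspan.add sr_mult[OF K]) auto
  then show ?case by (simp add: algebra_simps)
 qed
 show ?thesis using assms(1) unfolding filt_def[of K X m]
 proof induction
  case zero
  show ?case by (simp add: filt_zero)
 next
  case (add c p x)
  then show ?case using filt_add[OF *[of c p] add.IH] by (simp add: algebra_simps)
 qed
qed

lemma filt_cmult: "c \<in> K \<Longrightarrow> x \<in> filt K X n \<Longrightarrow> c * x \<in> filt K X n"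
 using filt_mult[OF filt_const[of c X 0], of x n] by simp

lemma filt_diff: "x \<in> filt K X n \<Longrightarrow> y \<in> filt K X n \<Longrightarrow> x - y \<in> filt K X n"
 using filt_add[of x K X n "(-1) * y"] filt_cmult[of "-1" y X n] sr_uminus[OF K sr_one[OF K]] by simp

text \<open>Multiplication by one generator is the only rule that raises the degree, which fits the
  recursion of \<open>grading\<close> and of the substitutions used below.\<close>

lemma filt_induct [consumes 1, case_names const add gen]:
 assumes "x \<in> filt K X n"
  and const: "\<And>c n. c \<in> K \<Longrightarrow> P n c" and add: "\<And>x y n. x \<in> filt K X n \<Longrightarrow> y \<in> filt K X n \<Longrightarrow> P n x \<Longrightarrow> P n y \<Longrightarrow> P n (x + y)"
  and gen: "\<And>x y n. x \<in> X \<Longrightarrow> y \<in> filt K X n \<Longrightarrow> P n y \<Longrightarrow> P (Suc n) (x * y)"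
 shows "P n x"
proof -
 have *: "c * prod_list xs \<in> filt K X n \<and> P n (c * prod_list xs)" if "c \<in> K" "set xs \<subseteq> X" "length xs \<le> n" for c xs n
  using that
 proof (induction xs arbitrary: n)
  case Nil
  then show ?case using const filt_const by simp
 next
  case (Cons x xs)
  then obtain m where m: "n = Suc m" by (cases n) auto
  then have "c * prod_list xs \<in> filt K X m \<and> P m (c * prod_list xs)" using Cons by simp
  then have "x * (c * prod_list xs) \<in> filt K X n \<and> P n (x * (c * prod_list xs))"
   using gen[of x "c * prod_list xs" m] filt_mult[of x X 1 "c * prod_list xs" m] filt_gen[of x X 1] Cons m by simp
  then show ?case by (simp add: mult_ac)
 qed
 have "x \<in> filt K X n \<and> P n x" using assms(1)[unfolded filt_def[of K X n]]
 proof induction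
  case zero
  show ?case using const[OF sr_zero[OF K]] filt_zero by blast
 next
  case (add c m x)
  then show ?case using *[of c _ n] assms(3) filt_add by blast
 qed
 then show ?thesis by simp
qed

lemma filt_subset_ga: "filt K X n \<subseteq> gen_alg K X"
proof
 fix x assume "x \<in> filt K X n"
 then show "x \<in> gen_alg K X"
  by (induction rule: filt_induct) (auto intro: gen_alg.intros)
qed

lemma filt_0: "filt K X 0 = K"
proof
 show "K \<subseteq> filt K X 0" using filt_const by blast
 show "filt K X 0 \<subseteq> K"
 proof
  fix x assume "x \<in> filt K X 0"
  then show "x \<in> K" unfolding filt_def by induction (auto intro: sr_closed[OF K])
 qed
qed

lemma ga_filt: "x \<in> gen_alg K X \<Longrightarrow> \<exists>n. x \<in> filt K X n"
proof (induction rule: gen_alg.induct)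
 case (add x y)
 then obtain m n where "x \<in> filt K X m" "y \<in> filt K X n" by blast
 then show ?case using filt_mono[of m "max m n"] filt_mono[of n "max m n"] filt_add by (meson max.cobounded1 max.cobounded2)
next
 case (neg x)
 then obtain n where "x \<in> filt K X n" by blast
 then show ?case using filt_diff[OF filt_zero, of x X n] by auto
qed (use filt_const filt_gen filt_mult in blast)+

lemma filt_image:
 assumes f: "rhom (gen_alg K X) f" "\<And>c. c \<in> K \<Longrightarrow> f c = c" and "x \<in> filt K X n"
 shows "f x \<in> filt K (f ` X) n"
 using assms(3)
proof (induction rule: filt_induct)
 case (const c)
 then show ?case using f filt_const by simp
next
 case (add x y n)
 then have "f (x + y) = f x + f y" using rhom_add[OF ga_subring[OF K] f(1)] filt_subset_ga by blast
 then show ?case using add by (simp add: filt_add)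
next
 case (gen x y n)
 then have "f (x * y) = f x * f y" using rhom_mult[OF ga_subring[OF K] f(1)] filt_subset_ga gen_alg.base_S by blast
 then show ?case using gen filt_mult[of "f x" "f ` X" 1 "f y" n] filt_gen[of "f x" "f ` X" 1] by simp
qed

text \<open>A degree bound in a quotient can be realized by a representative with the same
  bound.\<close>

lemma filt_image_lift:
 assumes f: "rhom (gen_alg K X) f" "\<And>c. c \<in> K \<Longrightarrow> f c = c" and "x \<in> filt K (f ` X) n"
 shows "x \<in> f ` filt K X n"
 using assms(3)
proof (induction rule: filt_induct)
 case (const c)
 then show ?case using f(2)[of c] filt_const[of c X] by (metis imageI)
next
 case (add x y n)
 then obtain a b where ab: "a \<in> filt K X n" "b \<in> filt K X n" "x = f a" "y = f b" by blast
 then have "f (a + b) = x + y" using rhom_add[OF ga_subring[OF K] f(1)] filt_subset_ga by blast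
 then show ?case using ab filt_add by (metis imageI)
next
 case (gen x y n)
 then obtain a b where ab: "a \<in> X" "b \<in> filt K X n" "x = f a" "y = f b" by blast
 then have "f (a * b) = x * y" using rhom_mult[OF ga_subring[OF K] f(1)] filt_subset_ga gen_alg.base_S by blast
 moreover have "a * b \<in> filt K X (Suc n)" using ab filt_mult[of a X 1 b n] filt_gen[of a X 1] by simp
 ultimately show ?case by (metis imageI)
qed

end

section \<open>Total degree and good directions\<close>

lemma rhom_id: "rhom D (\<lambda>x. x)"
 by (rule rhomI) auto

lemma rhom_const: "rhom K (\<lambda>c. [:c:])"
 by (rule rhomI) (auto simp: one_pCons)

text \<open>The grading \<open>x \<mapsto> x t\<close> of the polynomial ring \<open>K[X]\<close>, with values in polynomials in \<open>t\<close>.\<close>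

definition grading :: "'a::field set \<Rightarrow> 'a set \<Rightarrow> 'a \<Rightarrow> 'a poly" where
 "grading K X = (SOME g. rhom (gen_alg K X) g \<and> (\<forall>c\<in>K. g c = [:c:]) \<and> (\<forall>x\<in>X. g x = [:0, x:]))"

definition tdeg :: "'a::field set \<Rightarrow> 'a set \<Rightarrow> 'a \<Rightarrow> nat" where
 "tdeg K X r = degree (grading K X r)"

definition topform :: "'a::field set \<Rightarrow> 'a set \<Rightarrow> 'a \<Rightarrow> 'a" where
 "topform K X r = lead_coeff (grading K X r)"

definition eval_hom :: "'a::field set \<Rightarrow> 'a set \<Rightarrow> ('a \<Rightarrow> 'a) \<Rightarrow> ('a \<Rightarrow> 'a) \<Rightarrow> bool" where
 "eval_hom K X v g \<longleftrightarrow> rhom (gen_alg K X) g \<and> (\<forall>c\<in>K. g c = c) \<and> (\<forall>x\<in>X. g x = v x)"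

text \<open>The highest form of \<open>r\<close> does not vanish at the rational point
  \<open>v\<close>, so \<open>r\<close> keeps its full degree along lines in direction
  \<open>v\<close>. The maps \<open>g\<close> quantified over all agree on
  \<open>gen_alg K X\<close>.\<close>

definition good_direction :: "'a::field set \<Rightarrow> 'a set \<Rightarrow> 'a \<Rightarrow> ('a \<Rightarrow> 'a) \<Rightarrow> bool" where
 "good_direction K X r v \<longleftrightarrow> v ` X \<subseteq> K \<and> (\<forall>g. eval_hom K X v g \<longrightarrow> g (topform K X r) \<noteq> 0)"

context
 fixes K X :: "'a::field set"
 assumes K: "subfield_set K" and X: "indep K X"
begin

private lemma Ks: "subring_set K" using K by (rule sf_sr)

lemma R_sr: "subring_set (gen_alg K X)" by (rule ga_subring[OF Ks])

lemma eval_hom_ex: obtains g where "eval_hom K X v g"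
proof -
 obtain g where "rhom (gen_alg K X) g" "\<And>c. c \<in> K \<Longrightarrow> g c = c" "\<And>x. x \<in> X \<Longrightarrow> g x = v x"
  by (rule rhom_extend_indep[OF Ks X rhom_id, of v]) (rule that)
 then show thesis using that[of g] by (simp add: eval_hom_def)
qed

lemma grading: "rhom (gen_alg K X) (grading K X)" "c \<in> K \<Longrightarrow> grading K X c = [:c:]" "x \<in> X \<Longrightarrow> grading K X x = [:0, x:]"
proof -
 have "\<exists>g. rhom (gen_alg K X) g \<and> (\<forall>c\<in>K. g c = [:c:]) \<and> (\<forall>x\<in>X. g x = [:0, x:])"
  by (rule rhom_extend_indep[OF Ks X rhom_const, of "\<lambda>x. [:0, x:]"]) (intro exI conjI ballI)
 from someI_ex[OF this] show "rhom (gen_alg K X) (grading K X)"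
  "c \<in> K \<Longrightarrow> grading K X c = [:c:]" "x \<in> X \<Longrightarrow> grading K X x = [:0, x:]"
  unfolding grading_def by blast+
qed

lemma grading_eval: "r \<in> gen_alg K X \<Longrightarrow> poly (grading K X r) 1 = r"
proof -
 assume r: "r \<in> gen_alg K X"
 have e: "rhom (gen_alg K X) (\<lambda>r. poly (grading K X r) 1)"
  using grading(1) by (auto simp: rhom_def)
 show ?thesis
  by (rule rhom_eq_on_ga[OF Ks e _ _ r, of "\<lambda>x. x"]) (use grading(2,3) in \<open>auto simp: rhom_def\<close>)
qed

lemma grading_nz: "r \<in> gen_alg K X \<Longrightarrow> r \<noteq> 0 \<Longrightarrow> grading K X r \<noteq> 0"
 using grading_eval by force

lemma filt_tdeg: "r \<in> filt K X n \<Longrightarrow> tdeg K X r \<le> n"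
proof (induction rule: filt_induct[OF Ks, consumes 1, case_names const add gen])
 case (const c n)
 then show ?case by (simp add: tdeg_def grading)
next
 case (add x y n)
 then have "grading K X (x + y) = grading K X x + grading K X y"
  using rhom_add[OF R_sr grading(1)] filt_subset_ga[OF Ks] by blast
 then show ?case using add degree_add_le unfolding tdeg_def by metis
next
 case (gen x y n)
 then have "grading K X (x * y) = [:0,x:] * grading K X y"
  using rhom_mult[OF R_sr grading(1), of x y] filt_subset_ga[OF Ks] grading(3) gen_alg.base_S[of x X K] by (metis subsetD)
 then show ?case using gen degree_mult_le[of "[:0,x:]" "grading K X y"] unfolding tdeg_def
  by (metis add.commute add_le_cancel_right degree_pCons_le degree_pCons_0 le_trans plus_1_eq_Suc Suc_le_mono One_nat_def add_mono)
qed

lemma grading_coeff: "r \<in> filt K X n \<Longrightarrow> coeff (grading K X r) j \<in> filt K X j"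
proof (induction arbitrary: j rule: filt_induct[OF Ks, consumes 1, case_names const add gen])
 case (const c n)
 then show ?case by (cases j) (auto simp: grading filt_zero filt_const[OF Ks])
next
 case (add x y n)
 then have "grading K X (x + y) = grading K X x + grading K X y"
  using rhom_add[OF R_sr grading(1)] filt_subset_ga[OF Ks] by blast
 then show ?case using add by (simp add: filt_add)
next
 case (gen x y n)
 then have *: "grading K X (x * y) = [:0,x:] * grading K X y"
  using rhom_mult[OF R_sr grading(1), of x y] filt_subset_ga[OF Ks] grading(3) gen_alg.base_S[of x X K] by (metis subsetD)
 show ?case
 proof (cases j)
  case (Suc i)
  then show ?thesis using gen filt_mult[OF Ks, of x X 1 _ i] filt_gen[OF Ks, of x X 1] by (simp add: *)
 qed (simp add: * filt_zero)
qed

lemma filt_iff_tdeg: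
 assumes "r \<in> gen_alg K X"
 shows "r \<in> filt K X n \<longleftrightarrow> tdeg K X r \<le> n"
proof
 assume n: "tdeg K X r \<le> n"
 obtain m where "r \<in> filt K X m" using ga_filt[OF Ks assms] by blast
 then have "(\<Sum>i\<le>tdeg K X r. coeff (grading K X r) i * 1 ^ i) \<in> filt K X n"
  using filt_mono[OF order_trans[OF _ n] grading_coeff[OF \<open>r \<in> filt K X m\<close>]] by (intro filt_sum) simp
 then show "r \<in> filt K X n" using grading_eval[OF assms] unfolding poly_altdef tdeg_def by simp
qed (rule filt_tdeg)

lemma tdeg_mult: "r \<in> gen_alg K X \<Longrightarrow> s \<in> gen_alg K X \<Longrightarrow> r \<noteq> 0 \<Longrightarrow> s \<noteq> 0 \<Longrightarrow> tdeg K X (r * s) = tdeg K X r + tdeg K X s"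
 unfolding tdeg_def by (simp add: rhom_mult[OF R_sr grading(1)] degree_mult_eq grading_nz)

lemma tdeg_0_const: "r \<in> gen_alg K X \<Longrightarrow> tdeg K X r = 0 \<Longrightarrow> r \<in> K"
 using filt_iff_tdeg[of r 0] filt_0[OF Ks] by auto

lemma topform_in: "r \<in> gen_alg K X \<Longrightarrow> topform K X r \<in> gen_alg K X"
 using ga_filt[OF Ks] grading_coeff filt_subset_ga[OF Ks] unfolding topform_def by blast

lemma topform_nz: "r \<in> gen_alg K X \<Longrightarrow> r \<noteq> 0 \<Longrightarrow> topform K X r \<noteq> 0"
 unfolding topform_def by (simp add: grading_nz)

end

text \<open>Induction on the variables: first a point where the leading coefficient in the last
  variable survives, then a value in the infinite field \<open>K\<close> that avoids finitely many
  roots.\<close>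

lemma nonvanishing_point:
 fixes K :: "'a::field set"
 assumes K: "subfield_set K" and inf: "infinite K" and X: "indep K X" and H: "H \<in> gen_alg K X" "H \<noteq> 0"
 obtains v where "\<And>x. x \<in> X \<Longrightarrow> v x \<in> K" "\<And>g. eval_hom K X v g \<Longrightarrow> g H \<noteq> 0"
proof -
 note Ks = sf_sr[OF K]
 have "\<exists>v. (\<forall>x\<in>X. v x \<in> K) \<and> (\<forall>g. eval_hom K X v g \<longrightarrow> g H \<noteq> 0)"
  using indep_finite[OF X] X H
 proof (induction X arbitrary: H)
  case empty
  then show ?case by (auto simp: ga_empty[OF Ks] eval_hom_def)
 next
  case (insert x X)
  have iX: "indep K X" using insert.prems(1) indep_subset by blast
  let ?R = "gen_alg K X"
  have R: "subring_set ?R" by (rule ga_subring[OF Ks])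
  obtain h where h: "h \<in> polys ?R" "H = poly h x" using insert.prems(2) ga_insert[OF Ks] by auto
  have "lead_coeff h \<in> ?R" "lead_coeff h \<noteq> 0" using h insert.prems(3) by (auto dest: polysD)
  then obtain v where v: "\<forall>x\<in>X. v x \<in> K" "\<And>g. eval_hom K X v g \<Longrightarrow> g (lead_coeff h) \<noteq> 0"
   using insert.IH[OF iX] by blast
  obtain g0 where g0: "eval_hom K X v g0" using eval_hom_ex[OF K iX] by blast
  then have rg0: "rhom ?R g0" by (simp add: eval_hom_def)
  have "coeff (map_poly g0 h) (degree h) \<noteq> 0" using v(2)[OF g0] by (simp add: rhom_map_coeff[OF R rg0])
  then have "map_poly g0 h \<noteq> 0" by auto
  then have "finite {c. poly (map_poly g0 h) c = 0}" by (rule poly_roots_finite)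
  then obtain c where c: "c \<in> K" "poly (map_poly g0 h) c \<noteq> 0" using inf
   by (metis (mono_tags, lifting) finite_subset mem_Collect_eq subsetI)
  let ?v = "v(x := c)"
  have "g H \<noteq> 0" if g: "eval_hom K (insert x X) ?v g" for g
  proof -
   have rg: "rhom (gen_alg K (insert x X)) g" using g by (simp add: eval_hom_def)
   have sub: "?R \<subseteq> gen_alg K (insert x X)" by (rule ga_mono) auto
   have eq: "g r = g0 r" if "r \<in> ?R" for r
    by (rule rhom_eq_on_ga[OF Ks rhom_subset[OF rg sub] rg0 _ that])
     (use g g0 insert.hyps in \<open>auto simp: eval_hom_def\<close>)
   have "g H = poly (map_poly g h) (g x)" unfolding h(2)
    by (rule mp_eval[OF ga_subring[OF Ks] rg]) (use h polys_mono[OF sub] gen_alg.base_S[of x "insert x X" K] in auto)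
   also have "map_poly g h = map_poly g0 h"
    using h(1) eq by (intro poly_eqI) (auto simp: rhom_map_coeff[OF R rg0] rhom_map_coeff[OF ga_subring[OF Ks] rg] dest: polysD)
   also have "g x = c" using g by (simp add: eval_hom_def)
   finally show ?thesis using c by simp
  qed
  then have "\<forall>g. eval_hom K (insert x X) ?v g \<longrightarrow> g H \<noteq> 0" by blast
  moreover have "\<forall>y\<in>insert x X. ?v y \<in> K" using v c by auto
  ultimately show ?case by blast
 qed
 then show thesis using that by blast
qed

lemma good_direction_ex:
 fixes K :: "'a::field set"
 assumes "subfield_set K" "infinite K" "indep K X" "r \<in> gen_alg K X" "r \<noteq> 0"
 obtains v where "good_direction K X r v"
  using nonvanishing_point[OF assms(1-3) topform_in topform_nz] assms
 unfolding good_direction_def by (metis image_subsetI)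

text \<open>The linear change of coordinates adapted to the direction \<open>v\<close>.\<close>

definition dcoord :: "('a::field \<Rightarrow> 'a) \<Rightarrow> 'a \<Rightarrow> 'a" where "dcoord v x0 = x0 / v x0"

definition dbase :: "'a::field set \<Rightarrow> ('a \<Rightarrow> 'a) \<Rightarrow> 'a \<Rightarrow> 'a set" where
 "dbase X v x0 = (\<lambda>x. x - v x * dcoord v x0) ` (X - {x0})"

context
 fixes K X :: "'a::field set" and v :: "'a \<Rightarrow> 'a" and x0 :: 'a
 assumes K: "subfield_set K" and X: "indep K X" and v: "v ` X \<subseteq> K" and x0: "x0 \<in> X" "v x0 \<noteq> 0"
begin

private abbreviation "t \<equiv> dcoord v x0"
private abbreviation "Y \<equiv> dbase X v x0"

private lemma Kr: "subring_set K" using K by (rule sf_sr)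

private lemma vK: "x \<in> X \<Longrightarrow> v x \<in> K" using v by blast

lemma dcoord_filt: "t \<in> filt K X 1"
proof -
 have "inverse (v x0) * x0 \<in> filt K X 1"
  using x0 vK[of x0] by (intro filt_cmult[OF Kr] filt_gen[OF Kr] sf_inverse[OF K]) auto
 then show ?thesis by (simp add: dcoord_def field_simps)
qed

lemma dbase_filt: "Y \<subseteq> filt K X 1"
proof
 fix y assume "y \<in> Y"
 then obtain x where x: "x \<in> X" "y = x - v x * t" by (auto simp: dbase_def)
 show "y \<in> filt K X 1" unfolding x(2)
  using x(1) by (intro filt_diff[OF Kr] filt_cmult[OF Kr vK dcoord_filt] filt_gen[OF Kr]) auto
qed

lemma X_in_dbase: "x \<in> X \<Longrightarrow> \<exists>y\<in>insert 0 Y. x = y + v x * t"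
proof (cases "x = x0")
 case True
 then show ?thesis using x0 by (intro bexI[of _ 0]) (auto simp: dcoord_def)
next
 case False
 then show "x \<in> X \<Longrightarrow> ?thesis" by (intro bexI[of _ "x - v x * t"]) (auto simp: dbase_def)
qed

lemma dbase_finite: "finite Y"
 using indep_finite[OF X] by (simp add: dbase_def)

lemma dbase_ga: "gen_alg K (insert t Y) = gen_alg K X"
proof
 show "gen_alg K (insert t Y) \<subseteq> gen_alg K X"
  using dcoord_filt dbase_filt filt_subset_ga[OF Kr, of X 1] ga_base(1)[of K X] by (intro ga_least ga_subring Kr) auto
 have "x \<in> gen_alg K (insert t Y)" if "x \<in> X" for x
 proof -
  obtain y where "y \<in> insert 0 Y" "x = y + v x * t" using X_in_dbase \<open>x \<in> X\<close> by blast
  moreover have "y \<in> gen_alg K (insert t Y)" using \<open>y \<in> insert 0 Y\<close> sr_zero[OF ga_subring[OF Kr]] by (auto intro: gen_alg.base_S)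
  moreover have "v x * t \<in> gen_alg K (insert t Y)" using vK[OF that] by (intro gen_alg.mult) (auto intro: gen_alg.intros)
  ultimately show ?thesis using gen_alg.add by metis
 qed
 then show "gen_alg K X \<subseteq> gen_alg K (insert t Y)"
  using ga_base(1)[of K "insert t Y"] by (intro ga_least ga_subring Kr) auto
qed

lemma dbase_card: "card Y \<le> card X - 1"
 using card_image_le[of "X - {x0}"] indep_finite[OF X] x0 by (simp add: dbase_def)

lemma dbase_indep: "indep K (insert t Y)" "t \<notin> Y" "card Y = card X - 1"
proof -
 have sp: "X \<subseteq> alg_cl K (insert t Y)"
  using dbase_ga ga_base(2)[of X K] cl_base[OF Kr, of "insert t Y"] by simp
 have pos: "card X > 0" using x0 indep_finite[OF X] by (auto simp: card_gt_0_iff)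
 have le: "card (insert t Y) \<le> card X"
  using card_insert_le_m1[OF pos, of Y t] dbase_card by simp
 show "indep K (insert t Y)" using indep_if_spanning[OF Kr X _ sp le] dbase_finite by simp
 have c: "card (insert t Y) = card X" using indep_if_spanning[OF Kr X _ sp le] dbase_finite by simp
 then show "t \<notin> Y" using dbase_card pos by (metis card_insert_disjoint dbase_finite diff_less insert_absorb leD less_numeral_extra(1) )
 then show "card Y = card X - 1" using c dbase_finite by simp
qed

text \<open>Substituting \<open>x = y + v x * t\<close> makes \<open>r\<close> a polynomial in
  \<open>t\<close> over the base coordinates. The coefficient of \<open>t^N\<close> is the part of
  \<open>r\<close> of degree \<open>N\<close> evaluated at \<open>v\<close>, hence a
  constant.\<close>

lemma direction:
 assumes r: "r \<in> filt K X N"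
 obtains h where "h \<in> polys (gen_alg K Y)" "poly h t = r" "degree h \<le> N"
  "\<And>j. j \<le> N \<Longrightarrow> coeff h j \<in> filt K Y (N - j)"
  "\<And>g. eval_hom K X v g \<Longrightarrow> coeff h N = g (coeff (grading K X r) N)"
proof -
 note R = ga_subring[OF Kr, of X]
 define y where "y x = x - v x * t" for x
 have y: "y x \<in> insert 0 Y" if "x \<in> X" for x
  using that x0 by (auto simp: y_def dbase_def dcoord_def)
 \<comment> \<open>\<open>\<psi>\<close> is the substitution \<open>x = y x + v x * t\<close>, with
   values in polynomials in \<open>t\<close>.\<close>
 obtain \<psi> where \<psi>: "rhom (gen_alg K X) \<psi>" "\<And>c. c \<in> K \<Longrightarrow> \<psi> c = [:c:]" "\<And>x. x \<in> X \<Longrightarrow> \<psi> x = [:y x, v x:]"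
  by (rule rhom_extend_indep[OF Kr X rhom_const, of "\<lambda>x. [:y x, v x:]"]) (rule that)
 have sub: "filt K X n \<subseteq> gen_alg K X" for n by (rule filt_subset_ga[OF Kr])
 have add: "\<psi> (a + b) = \<psi> a + \<psi> b" if "a \<in> filt K X n" "b \<in> filt K X n" for a b n
  using that sub rhom_add[OF R \<psi>(1)] by blast
 have mult: "\<psi> (a * b) = [:y a, v a:] * \<psi> b" if "a \<in> X" "b \<in> filt K X n" for a b n
  using that sub rhom_mult[OF R \<psi>(1), of a b] \<psi>(3) gen_alg.base_S[of a X K] by (metis subsetD)
 have coeff_mult: "coeff ([:a, b:] * p) (Suc j) = a * coeff p (Suc j) + b * coeff p j" for a b :: 'a and p j
  by (simp add: coeff_pCons)
 have inv: "degree (\<psi> r) \<le> n \<and> (\<forall>j\<le>n. coeff (\<psi> r) j \<in> filt K Y (n - j))" if "r \<in> filt K X n" for r n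
  using that
 proof (induction rule: filt_induct[OF Kr, consumes 1, case_names const add gen])
  case (const c n)
  then show ?case by (auto simp: \<psi> coeff_pCons filt_zero filt_const[OF Kr] split: nat.splits)
 next
  case (add a b n)
  then show ?case by (simp add: \<open>\<And>a b n. a \<in> filt K X n \<Longrightarrow> b \<in> filt K X n \<Longrightarrow> \<psi> (a + b) = \<psi> a + \<psi> b\<close> degree_add_le filt_add)
 next
  case (gen a b n)
  have y1: "y a \<in> filt K Y 1" using y[OF gen(1)] by (auto intro: filt_gen[OF Kr] filt_zero)
  have "degree (\<psi> (a * b)) \<le> Suc n"
   unfolding mult[OF gen(1,2)] using degree_mult_le[of "[:y a, v a:]" "\<psi> b"] gen degree_pCons_le[of "y a" "[:v a:]"] by simp
  moreover have "coeff (\<psi> (a * b)) j \<in> filt K Y (Suc n - j)" if "j \<le> Suc n" for j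
  proof (cases j)
   case 0
   then show ?thesis using mult[OF gen(1,2)] filt_mult[OF Kr y1, of "coeff (\<psi> b) 0" n] gen(3)[THEN conjunct2, THEN spec, of 0] by simp
  next
   case (Suc i)
   have "y a * coeff (\<psi> b) (Suc i) \<in> filt K Y (n - i)"
   proof (cases "Suc i \<le> n")
    case True
    then have "y a * coeff (\<psi> b) (Suc i) \<in> filt K Y (1 + (n - Suc i))" using gen(3) by (intro filt_mult[OF Kr y1]) auto
    then show ?thesis using True by (simp add: Suc_diff_Suc)
   next
    case False
    then show ?thesis using gen(3) by (simp add: coeff_eq_0 filt_zero)
   qed
   moreover have "v a * coeff (\<psi> b) i \<in> filt K Y (n - i)"
    using gen(3) Suc that vK[OF gen(1)] by (intro filt_cmult[OF Kr]) auto
   ultimately show ?thesis unfolding mult[OF gen(1,2)] Suc coeff_mult by (simp add: filt_add)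
  qed
  ultimately show ?case by blast
 qed
 have gc: "coeff (grading K X a) j \<in> gen_alg K X" if "a \<in> filt K X n" for a n j
  using grading_coeff[OF K X that] sub by blast
 \<comment> \<open>In a monomial of degree \<open>n\<close> the power \<open>t^n\<close> arises only
   when every factor contributes its \<open>v x\<close>, which is evaluation at
   \<open>v\<close>.\<close>
 have ev: "coeff (\<psi> r) n = g (coeff (grading K X r) n)" if r: "r \<in> filt K X n" and g: "eval_hom K X v g" for r n g
  using r
 proof (induction rule: filt_induct[OF Kr, consumes 1, case_names const add gen])
  case (const c n)
  have "g c = c" "g 0 = 0" using g const rhom_zero[OF R] by (auto simp: eval_hom_def)
  then show ?case using const by (simp add: \<psi> grading[OF K X] coeff_pCons split: nat.splits)
 next
  case (add a b n)
  have "grading K X (a + b) = grading K X a + grading K X b"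
   using add sub rhom_add[OF R grading(1)[OF K X]] by blast
  moreover have "g (coeff (grading K X a) n + coeff (grading K X b) n) = g (coeff (grading K X a) n) + g (coeff (grading K X b) n)"
   using g gc add(1,2) by (intro rhom_add[OF R]) (auto simp: eval_hom_def)
  ultimately show ?case using add by (simp add: \<open>\<And>a b n. a \<in> filt K X n \<Longrightarrow> b \<in> filt K X n \<Longrightarrow> \<psi> (a + b) = \<psi> a + \<psi> b\<close>)
 next
  case (gen a b n)
  have "grading K X (a * b) = [:0, a:] * grading K X b"
   using gen sub rhom_mult[OF R grading(1)[OF K X], of a b] grading(3)[OF K X] gen_alg.base_S[of a X K] by (metis subsetD)
  moreover have "g (a * coeff (grading K X b) n) = g a * g (coeff (grading K X b) n)"
   using g gc gen(1,2) by (intro rhom_mult[OF R]) (auto simp: eval_hom_def intro: gen_alg.base_S)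
  moreover have "coeff (\<psi> b) (Suc n) = 0" using inv[OF gen(2)] by (simp add: coeff_eq_0)
  moreover have "g a = v a" using g gen by (simp add: eval_hom_def)
  ultimately show ?case unfolding mult[OF gen(1,2)] coeff_mult using gen by simp
 qed
 have e: "rhom (gen_alg K X) (\<lambda>r. poly (\<psi> r) t)" using \<psi>(1) by (auto simp: rhom_def)
 have "poly (\<psi> r) t = r" if "r \<in> gen_alg K X" for r
  by (rule rhom_eq_on_ga[OF Kr e _ _ that, of "\<lambda>x. x"]) (use \<psi>(2,3) in \<open>auto simp: rhom_def y_def mult.commute\<close>)
 moreover have "\<psi> r \<in> polys (gen_alg K Y)"
 proof (rule polysI)
  fix i
  show "coeff (\<psi> r) i \<in> gen_alg K Y" using inv[OF r] filt_subset_ga[OF Kr, of Y "N - i"] sr_zero[OF ga_subring[OF Kr]]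
   by (cases "i \<le> N") (auto simp: coeff_eq_0)
 qed
 ultimately show thesis using that[of "\<psi> r"] r sub inv[OF r] ev[OF r] by auto
qed

lemma good_direction_monic:
 assumes r: "r \<in> gen_alg K X" "r \<noteq> 0" and gd: "good_direction K X r v"
 obtains h where "h \<in> polys (gen_alg K Y)" "poly h t = r" "degree h = tdeg K X r"
  "\<And>j. j \<le> degree h \<Longrightarrow> coeff h j \<in> filt K Y (degree h - j)" "lead_coeff h \<in> K" "lead_coeff h \<noteq> 0"
proof -
 let ?N = "tdeg K X r"
 have "r \<in> filt K X ?N" using filt_iff_tdeg[OF K X r(1)] by simp
 then obtain h where h: "h \<in> polys (gen_alg K Y)" "poly h t = r" "degree h \<le> ?N"
  "\<And>j. j \<le> ?N \<Longrightarrow> coeff h j \<in> filt K Y (?N - j)"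
  "\<And>g. eval_hom K X v g \<Longrightarrow> coeff h ?N = g (coeff (grading K X r) ?N)"
  using direction by blast
 obtain g where g: "eval_hom K X v g" using eval_hom_ex[OF K X] by blast
 have "coeff h ?N \<noteq> 0" using h(5)[OF g] gd g by (auto simp: good_direction_def topform_def tdeg_def)
 then have d: "degree h = ?N" using h(3) by (simp add: le_antisym le_degree)
 show thesis using that[OF h(1,2) d] h(4)[of ?N] h(4) \<open>coeff h ?N \<noteq> 0\<close> d filt_0[OF Kr, of Y] by auto
qed

end

text \<open>A form of positive degree vanishes at the origin, so a good direction has a nonzero
  coordinate.\<close>

lemma good_direction_nz:
 assumes K: "subfield_set K" and X: "indep K X" and r: "r \<in> gen_alg K X" and pos: "tdeg K X r > 0" and gd: "good_direction K X r v"
 obtains x0 where "x0 \<in> X" "v x0 \<noteq> (0::'a::field)"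
proof (rule ccontr)
 note Ks = sf_sr[OF K]
 note R = ga_subring[OF Ks, of X]
 assume "\<not> thesis"
 then have v0: "\<forall>x\<in>X. v x = 0" using that by blast
 obtain g where g: "eval_hom K X v g" using eval_hom_ex[OF K X] by blast
 then have rg: "rhom (gen_alg K X) g" by (simp add: eval_hom_def)
 obtain n where "r \<in> filt K X n" using ga_filt[OF Ks r] by blast
 then have "j > 0 \<longrightarrow> g (coeff (grading K X r) j) = 0" for j
 proof (induction arbitrary: j rule: filt_induct[OF Ks, consumes 1, case_names const add gen])
  case (const c n)
  then show ?case using rhom_zero[OF R rg] by (auto simp: grading[OF K X] coeff_pCons split: nat.splits)
 next
  case (add x y n)
  then have "grading K X (x + y) = grading K X x + grading K X y"
   using rhom_add[OF R grading(1)[OF K X]] filt_subset_ga[OF Ks] by blast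
  moreover have "g (coeff (grading K X x) j + coeff (grading K X y) j) = g (coeff (grading K X x) j) + g (coeff (grading K X y) j)"
   using add grading_coeff[OF K X] filt_subset_ga[OF Ks] by (intro rhom_add[OF R rg]) blast+
  ultimately show ?case using add by simp
 next
  case (gen x y n)
  then have *: "grading K X (x * y) = [:0,x:] * grading K X y"
   using rhom_mult[OF R grading(1)[OF K X], of x y] filt_subset_ga[OF Ks] grading(3)[OF K X] gen_alg.base_S[of x X K] by (metis subsetD)
  have "g (x * coeff (grading K X y) i) = g x * g (coeff (grading K X y) i)" for i
   using gen grading_coeff[OF K X] filt_subset_ga[OF Ks] gen_alg.base_S by (intro rhom_mult[OF R rg]) blast+
  moreover have "g x = 0" using g gen v0 by (simp add: eval_hom_def)
  ultimately show ?case by (cases j) (auto simp: *)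
 qed
 then have "g (topform K X r) = 0" using pos unfolding topform_def tdeg_def by simp
 then show False using gd g by (auto simp: good_direction_def)
qed

text \<open>Along a good direction \<open>r\<close> has a constant nonzero leading coefficient in
  \<open>t\<close>; the image of \<open>r = 0\<close> is therefore, up to that constant, a monic
  equation for \<open>f t\<close>. Every \<open>x\<close> is a base coordinate plus a multiple of
  \<open>t\<close>.\<close>

lemma direction_integral:
 fixes K :: "'a::field set"
 assumes K: "subfield_set K" and X: "indep K X" and v: "v ` X \<subseteq> K" and x0: "x0 \<in> X" "v x0 \<noteq> 0"
  and r: "r \<in> gen_alg K X" "r \<noteq> 0" "good_direction K X r v"
  and f: "rhom (gen_alg K X) f" "\<And>c. c \<in> K \<Longrightarrow> f c = c" "f r = 0"
 shows "integral_over (gen_alg K (f ` dbase X v x0)) (f (dcoord v x0))"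
  and "x \<in> X \<Longrightarrow> integral_over (gen_alg K (f ` dbase X v x0)) (f x)"
proof -
 note Ks = sf_sr[OF K]
 let ?t = "dcoord v x0" and ?Y = "dbase X v x0"
 let ?R = "gen_alg K X" and ?S = "gen_alg K (f ` ?Y)"
 have R: "subring_set ?R" and S: "subring_set ?S" by (auto intro: ga_subring Ks)
 have YR: "?Y \<subseteq> ?R" "?t \<in> ?R" using dbase_filt[OF K X v x0] dcoord_filt[OF K X v x0] filt_subset_ga[OF Ks] by blast+
 have fS: "f ` gen_alg K ?Y \<subseteq> ?S"
 proof clarify
  fix x assume "x \<in> gen_alg K ?Y"
  from rhom_ga[OF R f(1) this] have "f x \<in> gen_alg (f ` K) (f ` ?Y)" using YR ga_base(1)[of K X] by auto
  moreover have "f ` K = K" using f(2) by force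
  ultimately show "f x \<in> ?S" by simp
 qed
 have YR': "gen_alg K ?Y \<subseteq> ?R" using YR ga_base(1)[of K X] by (intro ga_least R) auto
 obtain h where h: "h \<in> polys (gen_alg K ?Y)" "poly h ?t = r" "lead_coeff h \<in> K" "lead_coeff h \<noteq> 0"
  using good_direction_monic[OF K X v x0 r] by metis
 define c where "c = lead_coeff h"
 have hR: "h \<in> polys ?R" using h polys_mono[OF YR'] by blast
 have hS: "map_poly f h \<in> polys ?S"
  using h(1) fS by (intro polysI) (auto simp: rhom_map_coeff[OF R f(1)] dest: polysD)
 have c: "coeff (map_poly f h) (degree h) = c" "c \<in> K" "c \<noteq> 0" using h f(2) by (auto simp: rhom_map_coeff[OF R f(1)] c_def)
 then have "degree h \<le> degree (map_poly f h)" by (intro le_degree) simp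
 then have deg: "degree (map_poly f h) = degree h" using degree_map_poly_le[of f h] by simp
 have "poly (map_poly f h) (f ?t) = 0" using mp_eval[OF R f(1) hR YR(2)] h f by simp
 then show it: "integral_over ?S (f ?t)"
  using c hS deg sf_inverse[OF K c(2)]
  by (intro integral_overI[of "smult (inverse c) (map_poly f h)"]) (auto intro!: po_smult[OF S] gen_alg.base_K)
 assume x: "x \<in> X"
 then have vx: "v x \<in> K" using v by blast
 obtain y where y: "y \<in> insert 0 ?Y" "x = y + v x * ?t" using X_in_dbase[OF K X v x0 x] by blast
 have yR: "y \<in> ?R" "v x \<in> ?R" using y YR sr_zero[OF R] vx by (auto intro: gen_alg.base_K)
 then have "f x = f y + v x * f ?t"
  using y(2) rhom_add[OF R f(1)] rhom_mult[OF R f(1)] YR(2) f(2)[OF vx] sr_mult[OF R] by metis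
 moreover have "f y \<in> ?S" using y rhom_zero[OF R f(1)] sr_zero[OF S] by (auto intro: gen_alg.base_S)
 moreover have "v x \<in> ?S" using vx by (rule gen_alg.base_K)
 ultimately show "integral_over ?S (f x)"
  using it integral_over_base[OF S] sr_add[OF integral_closure_subring[OF S]] sr_mult[OF integral_closure_subring[OF S]] by auto
qed

section \<open>Noether normalization\<close>

lemma integral_in_cl: "subring_set K \<Longrightarrow> integral_over (gen_alg K X) z \<Longrightarrow> z \<in> alg_cl K X"
 unfolding alg_cl_def acl_def using integral_imp_algebraic by blast

text \<open>Induction on the generators. A generator \<open>z\<close> that is algebraic over the
  present coordinates is handled by a linear change of the coordinates \<open>X\<close> and
  \<open>T\<close>, where \<open>T\<close> stands for \<open>z\<close> in a genuine polynomial
  ring.\<close>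

lemma noether_normalization:
 fixes K :: "'a::field set"
 assumes K: "subfield_set K" "infinite K" and S: "finite S" and T: "T \<notin> alg_cl K S"
 obtains X where "X \<subseteq> gen_alg K S" "indep K X" "\<And>s. s \<in> S \<Longrightarrow> integral_over (gen_alg K X) s"
proof -
 note Ks = sf_sr[OF K(1)]
 have "\<exists>X. X \<subseteq> gen_alg K S \<and> indep K X \<and> (\<forall>s\<in>S. integral_over (gen_alg K X) s)"
  using S T
 proof (induction S)
  case empty
  show ?case by (intro exI[of _ "{}"]) (auto simp: indep_def)
 next
  case (insert z S)
  then obtain X where X: "X \<subseteq> gen_alg K S" "indep K X" "\<forall>s\<in>S. integral_over (gen_alg K X) s"
   using cl_mono[of S "insert z S" K] by blast
  have Xz: "gen_alg K X \<subseteq> gen_alg K (insert z S)"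
   using X ga_mono[of K K S "insert z S"] ga_base(1)[of K "insert z S"] by (intro ga_least ga_subring Ks) auto
  show ?case
  proof (cases "z \<in> alg_cl K X")
   case False
   have "indep K (insert z X)" using indep_insert[OF Ks X(2) False] .
   moreover have "integral_over (gen_alg K (insert z X)) s" if "s \<in> insert z S" for s
    using that X(3) integral_over_base[OF ga_subring[OF Ks], of z "insert z X"]
     integral_over_mono[OF _ ga_mono[of K K X "insert z X"], of s] by (auto intro: gen_alg.base_S)
   moreover have "insert z X \<subseteq> gen_alg K (insert z S)" using Xz ga_base(2)[of X K] by (auto intro: gen_alg.base_S)
   ultimately show ?thesis by blast
  next
   case True
   then obtain p where p: "p \<in> polys (gen_alg K X)" "p \<noteq> 0" "poly p z = 0"
    by (auto simp: alg_cl_def acl_def algebraic_over_def)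
   have XS: "alg_cl K X \<subseteq> alg_cl K (insert z S)"
    using X(1) cl_mono[of S "insert z S" K] cl_base[OF Ks, of S] by (intro cl_least Ks) auto
   then have T': "T \<notin> alg_cl K X" using insert.prems by blast
   then have TX: "T \<notin> X" using cl_base[OF Ks, of X] ga_base(2)[of X K] by blast
   let ?X = "insert T X" and ?R = "gen_alg K X"
   have R: "subring_set ?R" by (rule ga_subring[OF Ks])
   have iX: "indep K ?X" by (rule indep_insert[OF Ks X(2) T'])
   \<comment> \<open>The relation \<open>p(z) = 0\<close> read as an element of the polynomial ring
     \<open>K[X, T]\<close>; sending \<open>T\<close> to \<open>z\<close> kills it.\<close>
   define G where "G = poly p T"
   have G: "G \<in> gen_alg K ?X" using p ga_insert[OF Ks] by (auto simp: G_def)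
   have Tt: "T \<notin> acl ?R" using T' by (simp add: alg_cl_def)
   have G0: "G \<noteq> 0" using transc_poly_eq[OF Tt p(1)] p(2) by (auto simp: G_def)
   have pos: "tdeg K ?X G > 0"
   proof (rule ccontr)
    assume "\<not> tdeg K ?X G > 0"
    then have GK: "G \<in> K" using tdeg_0_const[OF K(1) iX G] by simp
    then have "p - [:G:] = 0" using p
     by (intro transc_poly_eq[OF Tt]) (auto simp: G_def intro!: po_closed[OF R] gen_alg.base_K)
    then show False using p G0 by simp
   qed
   obtain v where v: "good_direction K ?X G v" using good_direction_ex[OF K iX G G0] by blast
   then have vK: "v ` ?X \<subseteq> K" by (simp add: good_direction_def)
   obtain x0 where x0: "x0 \<in> ?X" "v x0 \<noteq> 0" using good_direction_nz[OF K(1) iX G pos v] by blast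
   obtain f where f: "rhom (gen_alg K ?X) f" "\<And>c. c \<in> K \<Longrightarrow> f c = c" "\<And>x. x \<in> ?X \<Longrightarrow> f x = (if x = T then z else x)"
    by (rule rhom_extend_indep[OF Ks iX rhom_id, of "\<lambda>x. if x = T then z else x"]) (rule that)
   have sub: "?R \<subseteq> gen_alg K ?X" by (rule ga_mono) auto
   have fid: "f r = r" if "r \<in> ?R" for r
    by (rule rhom_eq_on_ga[OF Ks rhom_subset[OF f(1) sub] _ _ that]) (use f TX in \<open>auto simp: rhom_def\<close>)
   have "f G = poly (map_poly f p) (f T)" unfolding G_def using p polys_mono[OF sub]
    by (intro mp_eval[OF ga_subring[OF Ks] f(1)]) (auto intro: gen_alg.base_S)
   also have "map_poly f p = p"
    using p fid by (intro poly_eqI) (auto simp: rhom_map_coeff[OF ga_subring[OF Ks] f(1)] dest: polysD)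
   finally have fG: "f G = 0" using p f by simp
   let ?Y = "f ` dbase ?X v x0"
   have int: "integral_over (gen_alg K ?Y) (f x)" if "x \<in> ?X" for x
    using direction_integral(2)[OF K(1) iX vK x0 G G0 v f(1,2) fG that] .
   have intX: "integral_over (gen_alg K ?Y) x" if "x \<in> insert z X" for x
   proof (cases "x = z")
    case True
    then show ?thesis using int[of T] f(3)[of T] by simp
   next
    case False
    then have "x \<in> X" "x \<noteq> T" using that TX by auto
    then show ?thesis using int[of x] f(3)[of x] by simp
   qed
   have Yf: "finite ?Y" using dbase_finite[OF K(1) iX vK x0] by simp
   have Ysub: "?Y \<subseteq> gen_alg K (insert z S)"
   proof -
    have "f ` gen_alg K ?X \<subseteq> gen_alg (f ` K) (f ` ?X)"
     using rhom_ga[OF ga_subring[OF Ks] f(1)] ga_base[of K ?X] ga_base(2)[of ?X K] by blast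
    moreover have "f ` K \<subseteq> gen_alg K (insert z S)" "f ` ?X \<subseteq> gen_alg K (insert z S)"
     using f Xz ga_base(2)[of X K] by (auto intro: gen_alg.intros)
    then have "gen_alg (f ` K) (f ` ?X) \<subseteq> gen_alg K (insert z S)" by (intro ga_least ga_subring Ks)
    moreover have "dbase ?X v x0 \<subseteq> gen_alg K ?X" using dbase_filt[OF K(1) iX vK x0] filt_subset_ga[OF Ks] by blast
    ultimately show ?thesis by blast
   qed
   \<comment> \<open>The base coordinates of \<open>K[X, T]\<close> are no more numerous than
     \<open>X\<close>, and \<open>X\<close> is algebraic over their images, so the images are
     independent.\<close>
   have "X \<subseteq> alg_cl K ?Y" using intX integral_in_cl[OF Ks] by blast
   moreover have "card ?Y \<le> card X"
    using card_image_le[OF dbase_finite[OF K(1) iX vK x0], of f] dbase_card[OF K(1) iX vK x0] TX indep_finite[OF X(2)] by simp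
   ultimately have "indep K ?Y" using indep_if_spanning[OF Ks X(2) Yf] by blast
   moreover have "integral_over (gen_alg K ?Y) s" if "s \<in> insert z S" for s
   proof (cases "s = z")
    case False
    have "integral_over (gen_alg K ?Y) e" if "e \<in> gen_alg K X" for e
     using that integral_over_gen_alg[OF ga_subring[OF Ks], of "insert z X" ?Y e] intX
      ga_mono[of K "gen_alg K ?Y" X "insert z X"] ga_base(1)[of K ?Y] by blast
    then show ?thesis using integral_over_trans[OF ga_subring[OF Ks]] X(3) that False by blast
   qed (use intX in simp)
   ultimately show ?thesis using Ysub by blast
  qed
 qed
 then show thesis using that by blast
qed

text \<open>In a relation of least degree the constant term is nonzero, since otherwise
  \<open>z\<close> could be cancelled. Hence the ideal generated by \<open>z\<close> meets
  \<open>E\<close> in a nonzero element, and a homomorphism that kills \<open>z\<close> kills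
  \<open>c\<close>.\<close>

lemma algebraic_nonzero_const:
 assumes E: "subring_set (E :: 'a::field set)" and z: "z \<in> acl E" "z \<noteq> 0"
 obtains c p where "c \<in> E" "c \<noteq> 0" "p \<in> polys E" "c + z * poly p z = 0"
proof -
 let ?P = "\<lambda>q. q \<in> polys E \<and> q \<noteq> 0 \<and> poly q z = 0"
 obtain q0 where "?P q0" using z by (auto simp: acl_def algebraic_over_def)
 then obtain q where q: "?P q" "\<And>h. ?P h \<Longrightarrow> degree q \<le> degree h"
  using ex_has_least_nat[of ?P q0 degree] by blast
 obtain c p where cp: "q = pCons c p" by (cases q)
 have c: "c \<in> E" using q(1) polysD[of q E 0] cp by simp
 have p: "p \<in> polys E" by (rule polysI) (use q(1) polysD[of q E "Suc _"] cp in simp)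
 have "c \<noteq> 0"
 proof
  assume "c = 0"
  then have "?P p" using q(1) cp z p by auto
  moreover have "degree p < degree q" using cp \<open>?P p\<close> by simp
  ultimately show False using q(2)[of p] by simp
 qed
 then show thesis using that c p q(1) cp by auto
qed

section \<open>Transcendence degree and points of the spectrum\<close>

definition tbasis :: "'a::field set \<Rightarrow> 'a set \<Rightarrow> 'a set \<Rightarrow> bool" where
 "tbasis K X E \<longleftrightarrow> X \<subseteq> E \<and> indep K X \<and> E \<subseteq> alg_cl K X"

definition trdeg :: "'a::field set \<Rightarrow> 'a set \<Rightarrow> nat" where
 "trdeg K E = card (SOME X. tbasis K X E)"

context
 fixes K :: "'a::field set"
 assumes K: "subring_set K"
begin

lemma tbasis_card: "tbasis K X E \<Longrightarrow> tbasis K Y E \<Longrightarrow> card X = card Y"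
proof -
 have "card X \<le> card Y" if "tbasis K X E" "tbasis K Y E" for X Y
  by (rule indep_card_le[OF K]) (use that in \<open>auto simp: tbasis_def indep_finite\<close>)
 then show "tbasis K X E \<Longrightarrow> tbasis K Y E \<Longrightarrow> card X = card Y" by (simp add: le_antisym)
qed

lemma trdeg_eq: "tbasis K X E \<Longrightarrow> trdeg K E = card X"
proof -
 assume X: "tbasis K X E"
 have "tbasis K (SOME X. tbasis K X E) E" by (rule someI[of "\<lambda>X. tbasis K X E", OF X])
 from tbasis_card[OF this X] show ?thesis by (simp add: trdeg_def)
qed

lemma tbasis_extend:
 assumes "indep K X" "X \<subseteq> E" "finite Z" "E \<subseteq> alg_cl K Z"
 obtains Y where "X \<subseteq> Y" "tbasis K Y E"
proof -
 obtain Y where "X \<subseteq> Y" "Y \<subseteq> E" "indep K Y" "E \<subseteq> alg_cl K Y" using indep_extend[OF K assms] .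
 then show thesis using that[of Y] by (simp add: tbasis_def)
qed

lemma indep_empty: "indep K {}"
 by (simp add: indep_def)

lemma trdeg_basis:
 assumes "finite Z" "E \<subseteq> alg_cl K Z"
 obtains Y where "tbasis K Y E" "card Y = trdeg K E"
proof -
 obtain Y where "tbasis K Y E" using tbasis_extend[OF indep_empty empty_subsetI assms] .
 then show thesis using that[of Y] trdeg_eq by simp
qed

lemma indep_le_trdeg:
 assumes "indep K X" "X \<subseteq> E" "finite Z" "E \<subseteq> alg_cl K Z"
 shows "card X \<le> trdeg K E"
proof -
 obtain Y where Y: "tbasis K Y E" "card Y = trdeg K E" using trdeg_basis[OF assms(3,4)] .
 then show ?thesis using indep_card_le[OF K assms(1), of Y] assms(2) unfolding tbasis_def indep_def by auto
qed

lemma indep_tbasis: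
 assumes "indep K X" "X \<subseteq> E" "finite Z" "E \<subseteq> alg_cl K Z" "trdeg K E \<le> card X"
 shows "tbasis K X E"
proof -
 obtain Y where Y: "X \<subseteq> Y" "tbasis K Y E" using tbasis_extend[OF assms(1-4)] .
 then have "card Y \<le> card X" using trdeg_eq assms(5) by simp
 then have "X = Y" using Y by (intro card_seteq) (auto simp: tbasis_def indep_def)
 then show ?thesis using Y by simp
qed

text \<open>Since the images are independent, a homomorphism back to \<open>Z\<close> exists, and it
  inverts \<open>f\<close> on generators.\<close>

lemma hom_inj_on_indep:
 assumes E: "subring_set E" "K \<subseteq> E" and f: "rhom E f" "\<And>c. c \<in> K \<Longrightarrow> f c = c"
  and Z: "Z \<subseteq> E" "inj_on f Z" "indep K (f ` Z)"
 shows "gen_alg K Z \<subseteq> E" "\<And>z. z \<in> gen_alg K Z \<Longrightarrow> f z = 0 \<Longrightarrow> z = 0"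
proof -
 show sub: "gen_alg K Z \<subseteq> E" using E Z by (intro ga_least) auto
 obtain g where g: "rhom (gen_alg K (f ` Z)) g" "\<And>c. c \<in> K \<Longrightarrow> g c = c" "\<And>y. y \<in> f ` Z \<Longrightarrow> g y = inv_into Z f y"
  by (rule rhom_extend_indep[OF K Z(3) rhom_id]) (rule that)
 have im: "f x \<in> gen_alg K (f ` Z)" if "x \<in> gen_alg K Z" for x
 proof -
  have "f ` K = K" using f(2) by force
  then show ?thesis using rhom_ga[OF E(1) f(1) that E(2) Z(1)] by simp
 qed
 have "rhom (gen_alg K Z) (\<lambda>x. g (f x))"
  using rhom_subset[OF f(1) sub] im g(1) unfolding rhom_def by auto
 then have gf: "g (f z) = z" if "z \<in> gen_alg K Z" for z
  by (rule rhom_eq_on_ga[OF K _ rhom_id]) (use that f g Z(2) in auto)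
 show "z = 0" if "z \<in> gen_alg K Z" "f z = 0" for z
  using gf[OF that(1)] that(2) rhom_zero[OF ga_subring[OF K] g(1)] by simp
qed

text \<open>A relation among the lifts is carried to a relation among the images. It stays
  nontrivial because its leading coefficient lies in a polynomial ring on which \<open>f\<close> is
  injective.\<close>

lemma indep_lift:
 assumes E: "subring_set E" "K \<subseteq> E" and f: "rhom E f" "\<And>c. c \<in> K \<Longrightarrow> f c = c"
  and Z: "Z \<subseteq> E" "inj_on f Z" "indep K (f ` Z)"
 shows "indep K Z"
 unfolding indep_def
proof (intro conjI ballI notI)
 show "finite Z" using Z(2,3) finite_imageD by (auto simp: indep_def)
 fix z assume z: "z \<in> Z" "z \<in> alg_cl K (Z - {z})"
 let ?W = "Z - {z}"
 have fW: "f ` ?W = f ` Z - {f z}" using Z(2) z by (auto simp: inj_on_def)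
 have W: "?W \<subseteq> E" "inj_on f ?W" "indep K (f ` ?W)"
  using Z indep_subset[OF Z(3), of "f ` ?W"] by (auto intro: inj_on_subset)
 obtain p where p: "p \<in> polys (gen_alg K ?W)" "p \<noteq> 0" "poly p z = 0"
  using z(2) by (auto simp: alg_cl_def acl_def algebraic_over_def)
 note sub = hom_inj_on_indep(1)[OF E f W] and inj = hom_inj_on_indep(2)[OF E f W]
 have pE: "p \<in> polys E" using p polys_mono[OF sub] by blast
 have "f ` K = K" using f(2) by force
 then have "map_poly f p \<in> polys (gen_alg K (f ` ?W))"
  using rhom_ga[OF E(1) f(1) polysD[OF p(1)] E(2) W(1)] by (intro polysI) (simp add: rhom_map_coeff[OF E(1) f(1)])
 moreover have "poly (map_poly f p) (f z) = 0"
  using mp_eval[OF E(1) f(1) pE, of z] z Z p rhom_zero[OF E(1) f(1)] by auto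
 moreover have "coeff (map_poly f p) (degree p) \<noteq> 0"
  using inj[of "lead_coeff p"] p by (auto simp: rhom_map_coeff[OF E(1) f(1)] dest: polysD)
 then have "map_poly f p \<noteq> 0" by auto
 ultimately have "f z \<in> alg_cl K (f ` Z - {f z})" unfolding alg_cl_def acl_def algebraic_over_def fW[symmetric] by blast
 then show False using Z(3) z by (auto simp: indep_def)
qed

lemma indep_image:
 assumes X: "indep K X" and f: "rhom (gen_alg K X) f" "\<And>c. c \<in> K \<Longrightarrow> f c = c"
  and inj: "\<And>z. z \<in> gen_alg K X \<Longrightarrow> f z = 0 \<Longrightarrow> z = 0"
 shows "indep K (f ` X)" "inj_on f (gen_alg K X)"
proof -
 let ?R = "gen_alg K X"
 have R: "subring_set ?R" by (rule ga_subring[OF K])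
 show inj': "inj_on f ?R"
 proof (rule inj_onI)
  fix x y assume "x \<in> ?R" "y \<in> ?R" "f x = f y"
  then show "x = y" using inj[of "x - y"] rhom_diff[OF R f(1), of x y] sr_diff[OF R] by auto
 qed
 let ?g = "inv_into ?R f"
 have g: "?g (f x) = x" if "x \<in> ?R" for x using inj' that by simp
 have KR: "K \<subseteq> ?R" "X \<subseteq> ?R" by (rule ga_base)+
 have "rhom (f ` ?R) ?g"
 proof (rule rhomI)
  show "?g 1 = 1" using g[OF sr_one[OF R]] rhom_one[OF R f(1)] by simp
  fix x y assume "x \<in> f ` ?R" "y \<in> f ` ?R"
  then obtain a b where "a \<in> ?R" "b \<in> ?R" "x = f a" "y = f b" by blast
  then show "?g (x + y) = ?g x + ?g y" "?g (x * y) = ?g x * ?g y"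
   using g rhom_add[OF R f(1)] rhom_mult[OF R f(1)] sr_add[OF R] sr_mult[OF R] by metis+
 qed
 moreover have "?g c = c" if "c \<in> K" for c using g[of c] f(2)[OF that] KR that by auto
 moreover have "K \<subseteq> f ` ?R" using f(2) KR by force
 moreover have "?g ` f ` X = X" using g KR by force
 moreover have "inj_on ?g (f ` X)" using KR by (intro inj_on_subset[OF inj_on_inv_into]) auto
 ultimately show "indep K (f ` X)"
  using indep_lift[OF rhom_image[OF R f(1)], of ?g "f ` X"] X image_mono[OF KR(2), of f] by simp
qed

end

section \<open>Primes of an affine domain as points in an algebraically closed field\<close>

lemma prime_idealD:
 assumes "prime_ideal P"
 shows "0 \<in> P" "1 \<notin> P" "a \<in> P \<Longrightarrow> b \<in> P \<Longrightarrow> a + b \<in> P" "a \<in> P \<Longrightarrow> c * a \<in> P" "a \<in> P \<Longrightarrow> a * c \<in> P"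
  "a * b \<in> P \<Longrightarrow> a \<in> P \<or> b \<in> P"
proof -
 show "0 \<in> P" "a \<in> P \<Longrightarrow> b \<in> P \<Longrightarrow> a + b \<in> P" "a \<in> P \<Longrightarrow> c * a \<in> P" "a * b \<in> P \<Longrightarrow> a \<in> P \<or> b \<in> P"
  using assms by (auto simp: prime_ideal_def is_ideal_def)
 then show "a \<in> P \<Longrightarrow> a * c \<in> P" using assms by (auto simp: prime_ideal_def is_ideal_def mult.commute)
 show "1 \<notin> P"
 proof
  assume "1 \<in> P"
  then have "x * 1 \<in> P" for x using assms unfolding prime_ideal_def is_ideal_def by blast
  then show False using assms by (auto simp: prime_ideal_def)
 qed
qed

lemma prime_ideal_uminus: "prime_ideal P \<Longrightarrow> a \<in> P \<Longrightarrow> - a \<in> P"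
 using prime_idealD(4)[of P a "-1"] by simp

lemma prime_ideal_diff: "prime_ideal P \<Longrightarrow> a \<in> P \<Longrightarrow> b \<in> P \<Longrightarrow> a - b \<in> P"
 using prime_idealD(3)[of P a "-b"] prime_ideal_uminus by auto

lemma prime_ideal_power: "prime_ideal P \<Longrightarrow> a ^ n \<in> P \<Longrightarrow> a \<in> P"
 by (induction n) (auto dest: prime_idealD)

text \<open>\<open>\<iota>\<close> embeds \<open>A\<close> into an algebraically closed field that
  also receives every residue ring. \<open>T\<close> is a variable transcendental over
  \<open>A\<close>.\<close>

locale affine_domain =
 fixes K :: "'a::idom set" and \<iota> :: "'a \<Rightarrow> 'b::alg_closed_field" and T :: 'b and S :: "'a set"
 assumes K: "subfield K" and inf: "infinite K" and gen: "finite S" "gen_alg K S = UNIV"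
  and \<iota>: "rhom UNIV \<iota>" "\<And>x. \<iota> x = 0 \<Longrightarrow> x = 0" and T: "T \<notin> acl (range \<iota>)"
begin

abbreviation k :: "'b set" where "k \<equiv> \<iota> ` K"

lemma UNIV_sr: "subring_set (UNIV :: 'c::comm_ring_1 set)"
 by (simp add: subring_set_def)

lemma K_sr: "subring_set K"
 using K by (auto simp: subfield_def subring_set_def)

lemma \<iota>_inj: "\<iota> x = \<iota> y \<Longrightarrow> x = y"
 using rhom_diff[OF UNIV_sr \<iota>(1), of x y] \<iota>(2)[of "x - y"] by simp

lemma k_sf: "subfield_set k"
 unfolding subfield_set_def
proof (intro conjI ballI)
 show "subring_set k" by (rule rhom_image[OF K_sr rhom_subset[OF \<iota>(1)]]) simp
 fix x assume "x \<in> k"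
 then obtain a where a: "a \<in> K" "x = \<iota> a" by blast
 show "inverse x \<in> k"
 proof (cases "a = 0")
  case False
  then obtain b where b: "b \<in> K" "a * b = 1" using K a by (auto simp: subfield_def)
  then have "\<iota> a * \<iota> b = 1" using rhom_mult[OF UNIV_sr \<iota>(1), of a b] rhom_one[OF UNIV_sr \<iota>(1)] by simp
  then show ?thesis using a b by (auto simp: inverse_unique)
 qed (use a rhom_zero[OF UNIV_sr \<iota>(1)] in auto)
qed

lemma k_sr: "subring_set k" by (rule sf_sr[OF k_sf])

lemma k_inf: "infinite k"
 using inf finite_imageD[OF _ inj_onI[OF \<iota>_inj]] by blast

text \<open>A realization of \<open>A/P\<close> over \<open>K\<close> as the subring
  \<open>range \<phi>\<close> of the field; quotients of values of \<open>\<phi>\<close> realize the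
  fraction field of \<open>A/P\<close>.\<close>

definition point :: "('a \<Rightarrow> 'b) \<Rightarrow> 'a set \<Rightarrow> bool" where
 "point \<phi> P \<longleftrightarrow> rhom UNIV \<phi> \<and> (\<forall>c\<in>K. \<phi> c = \<iota> c) \<and> (\<forall>x. \<phi> x = 0 \<longleftrightarrow> x \<in> P)"

lemma prime_inter_K: "prime_ideal P \<Longrightarrow> K \<inter> P = {0}"
proof -
 assume P: "prime_ideal P"
 have "x = 0" if "x \<in> K" "x \<in> P" for x
 proof (rule ccontr)
  assume "x \<noteq> 0"
  then obtain y where "x * y = 1" using K \<open>x \<in> K\<close> by (auto simp: subfield_def)
  then show False using prime_idealD(2,5)[OF P] that by metis
 qed
 then show ?thesis using prime_idealD(1)[OF P] sr_zero[OF K_sr] by auto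
qed

text \<open>A maximal subring \<open>D\<close> meeting \<open>P\<close> trivially: \<open>A/P\<close> is algebraic over \<open>D\<close>, so \<open>\<iota>\<close> on \<open>D\<close>
extends step by step to a homomorphism with kernel \<open>P\<close>.\<close>

lemma point_ex:
 assumes P: "prime_ideal P"
 obtains \<phi> where "point \<phi> P" "range \<phi> \<subseteq> acl (range \<iota>)"
proof -
 let ?D = "{D. subring_set D \<and> K \<subseteq> D \<and> D \<inter> P = {0}}"
 have "\<exists>D\<in>?D. \<forall>E\<in>?D. D \<subseteq> E \<longrightarrow> E = D"
 proof (rule subset_Zorn_nonempty)
  show "?D \<noteq> {}" using K_sr prime_inter_K[OF P] by blast
  fix C assume C: "C \<noteq> {}" "subset.chain ?D C"
  have "subring_set (\<Union>C)"
  proof (rule subring_setI)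
   obtain D where "D \<in> C" using C(1) by blast
   then show "1 \<in> \<Union>C" using C(2) sr_one[of D] unfolding subset.chain_def by blast
   fix x y assume "x \<in> \<Union>C" "y \<in> \<Union>C"
   then obtain D E where "D \<in> C" "x \<in> D" "E \<in> C" "y \<in> E" by blast
   then obtain D where D: "D \<in> C" "x \<in> D" "y \<in> D" using C(2) unfolding subset.chain_def by blast
   then have "subring_set D" using C(2) by (auto simp: subset.chain_def)
   then show "x - y \<in> \<Union>C" "x * y \<in> \<Union>C" using D by (auto intro: sr_diff sr_mult)
  qed
  moreover have "\<Union>C \<inter> P = {0}" "K \<subseteq> \<Union>C" using C unfolding subset.chain_def by blast+
  ultimately show "\<Union>C \<in> ?D" by blast
 qed
 then obtain D where "D \<in> ?D" and m: "\<forall>E\<in>?D. D \<subseteq> E \<longrightarrow> E = D" ..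
 then have D: "subring_set D" "K \<subseteq> D" "D \<inter> P = {0}" by auto
 have max: "E = D" if "subring_set E" "D \<subseteq> E" "E \<inter> P = {0}" for E
  using m that D(2) by blast
 have D0: "x = 0" if "x \<in> D" "x \<in> P" for x using D(3) that by blast
 have alg: "\<exists>q. q \<in> polys D \<and> q \<noteq> 0 \<and> poly q z \<in> P" for z
 proof (cases "z \<in> D")
  case True
  then show ?thesis using prime_idealD(1)[OF P]
   by (intro exI[of _ "[:- z, 1:]"]) (auto intro!: po_closed[OF D(1)] sr_closed[OF D(1)])
 next
  case False
  have "gen_alg D {z} \<noteq> D" using False gen_alg.base_S[of z "{z}" D] by auto
  then have "gen_alg D {z} \<inter> P \<noteq> {0}" using max[OF ga_subring[OF D(1)] ga_base(1)] by blast
  then obtain x where "x \<in> gen_alg D {z}" "x \<in> P" "x \<noteq> 0"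
   using prime_idealD(1)[OF P] sr_zero[OF ga_subring[OF D(1), of "{z}"]] by blast
  then show ?thesis unfolding ga_singleton[OF D(1)] by auto
 qed
 \<comment> \<open>An \<open>x\<close> outside \<open>P\<close> divides, modulo \<open>P\<close>, a
   nonzero constant \<open>c\<close> of \<open>D\<close>, namely the constant term of a relation of
   least degree. Since \<open>f c = \<iota> c\<close> is nonzero, so is \<open>f x\<close>.\<close>
 have ker: "x \<in> P" if E: "subring_set E" "D \<subseteq> E" and f: "rhom E f" "\<And>d. d \<in> D \<Longrightarrow> f d = \<iota> d"
  "\<And>y. y \<in> E \<Longrightarrow> y \<in> P \<Longrightarrow> f y = 0" and x: "x \<in> E" "f x = 0" for E f x
 proof (rule ccontr)
  assume xP: "x \<notin> P"
  let ?P = "\<lambda>q. q \<in> polys D \<and> q \<noteq> 0 \<and> poly q x \<in> P"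
  obtain q0 where "?P q0" using alg by blast
  then obtain q where q: "?P q" "\<And>h. ?P h \<Longrightarrow> degree q \<le> degree h"
   using ex_has_least_nat[of ?P q0 degree] by blast
  obtain c p where cp: "q = pCons c p" by (cases q)
  have c: "c \<in> D" using q(1) polysD[of q D 0] cp by simp
  have p: "p \<in> polys D" by (rule polysI) (use q(1) polysD[of q D "Suc _"] cp in simp)
  have px: "poly p x \<in> E" using p polys_mono[OF E(2)] x by (intro po_eval[OF E(1)]) auto
  have "c \<noteq> 0"
  proof
   assume "c = 0"
   then have "?P p" using q(1) cp p prime_idealD(6)[OF P, of x "poly p x"] xP by auto
   moreover have "degree p < degree q" using cp \<open>?P p\<close> by simp
   ultimately show False using q(2)[of p] by simp
  qed
  have "c + x * poly p x \<in> P" using q cp by simp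
  moreover have "c + x * poly p x \<in> E" using c px x E by (intro sr_add[OF E(1)] sr_mult[OF E(1)]) auto
  ultimately have "f (c + x * poly p x) = 0" by (intro f(3))
  then have "f c = 0" using rhom_add[OF E(1) f(1), of c "x * poly p x"] rhom_mult[OF E(1) f(1), of x "poly p x"] c px x E sr_mult[OF E(1)] by auto
  then show False using f(2)[OF c] \<iota>(2) \<open>c \<noteq> 0\<close> by metis
 qed
 have "\<exists>f. rhom (gen_alg D S') f \<and> (\<forall>d\<in>D. f d = \<iota> d) \<and> (\<forall>y\<in>gen_alg D S'. f y = 0 \<longleftrightarrow> y \<in> P)" if "finite S'" for S'
  using that
 proof (induction S')
  case empty
  have "\<iota> y = 0 \<longleftrightarrow> y \<in> P" if "y \<in> D" for y
   using D0[OF that] \<iota>(2)[of y] rhom_zero[OF UNIV_sr \<iota>(1)] prime_idealD(1)[OF P] by metis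
  then show ?case by (intro exI[of _ \<iota>]) (auto simp: ga_empty[OF D(1)] intro: rhom_subset[OF \<iota>(1)])
 next
  case (insert z S')
  then obtain f where f: "rhom (gen_alg D S') f" "\<forall>d\<in>D. f d = \<iota> d" "\<forall>y\<in>gen_alg D S'. f y = 0 \<longleftrightarrow> y \<in> P" by blast
  let ?E = "gen_alg D S'"
  have E: "subring_set ?E" by (rule ga_subring[OF D(1)])
  have DE: "D \<subseteq> ?E" by (rule ga_base)
  let ?P = "\<lambda>q. q \<in> polys ?E \<and> lead_coeff q \<notin> P \<and> poly q z \<in> P"
  obtain q0 where q0: "q0 \<in> polys D" "q0 \<noteq> 0" "poly q0 z \<in> P" using alg by blast
  have "?P q0" using q0 D0[of "lead_coeff q0"] polys_mono[OF DE] polysD[OF q0(1)] by auto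
  then obtain q where q: "?P q" "\<And>h. ?P h \<Longrightarrow> degree q \<le> degree h"
   using ex_has_least_nat[of ?P q0 degree] by blast
  have qd: "degree q > 0" using q(1) by (cases "degree q = 0") (auto elim!: degree_eq_zeroE)
  \<comment> \<open>\<open>q\<close> has least degree among the relations modulo \<open>P\<close>
    whose leading coefficient is outside \<open>P\<close>. A relation of smaller degree thus has its
    leading coefficient in \<open>P\<close>; stripping leading terms puts all its coefficients into
    \<open>P\<close>.\<close>
  have small: "coeff h i \<in> P" if "h \<in> polys ?E" "poly h z \<in> P" "degree h < degree q" for h i
   using that
  proof (induction "degree h" arbitrary: h rule: less_induct)
   case less
   have lc: "lead_coeff h \<in> P" using q(2)[of h] less.prems by auto
   define h' where "h' = h - monom (lead_coeff h) (degree h)"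
   show ?case
   proof (cases "degree h = 0")
    case True
    then show ?thesis using lc prime_idealD(1)[OF P] by (cases "i = 0") (auto simp: coeff_eq_0)
   next
    case False
    have h': "h' \<in> polys ?E" unfolding h'_def using less.prems by (intro po_closed[OF E]) (auto dest: polysD)
    have "degree h' \<le> degree h" unfolding h'_def by (intro degree_diff_le) (auto simp: degree_monom_le)
    moreover have "coeff h' (degree h) = 0" by (simp add: h'_def)
    ultimately have deg: "degree h' < degree h" using False
     by (metis le_neq_implies_less leading_coeff_0_iff degree_0)
    have "poly h' z \<in> P" unfolding h'_def poly_diff poly_monom
     using less.prems lc by (intro prime_ideal_diff[OF P] prime_idealD(5)[OF P]) auto
    then have "coeff h' i \<in> P" using less.hyps[OF deg h'] less.prems deg by simp
    then show ?thesis using lc by (cases "i = degree h") (auto simp: h'_def)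
   qed
  qed
  obtain g where g: "rhom (gen_alg ?E {z}) g" "\<And>d. d \<in> ?E \<Longrightarrow> g d = f d"
   "\<And>x. x \<in> gen_alg ?E {z} \<Longrightarrow> x \<in> P \<Longrightarrow> g x = 0"
  proof (rule alg_hom_step[OF E f(1), of q P z])
   show "q \<in> polys ?E" "degree q > 0" "is_ideal P" "poly q z \<in> P" using q qd P by (auto simp: prime_ideal_def)
   show "f (lead_coeff q) \<noteq> 0" using f(3) q(1) by (auto dest: polysD)
   show "f (coeff h i) = 0" if "h \<in> polys ?E" "poly h z \<in> P" "degree h < degree q" for h i
    using f(3) small[OF that] that(1) by (auto dest: polysD)
  qed (use that in blast)
  have eq: "gen_alg ?E {z} = gen_alg D (insert z S')" using ga_un[OF D(1), of S' "{z}"] by simp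
  have gD: "g d = \<iota> d" if "d \<in> D" for d using that g(2) f(2) DE by auto
  have "g y = 0 \<longleftrightarrow> y \<in> P" if y: "y \<in> gen_alg ?E {z}" for y
   using ker[OF ga_subring[OF E] _ g(1) gD g(3) y] g(3)[OF y] DE ga_base(1)[of ?E "{z}"] by blast
  then show ?case using g gD unfolding eq by blast
 qed
 from this[OF gen(1)] obtain \<phi> where \<phi>: "rhom (gen_alg D S) \<phi>" "\<forall>d\<in>D. \<phi> d = \<iota> d" "\<forall>y\<in>gen_alg D S. \<phi> y = 0 \<longleftrightarrow> y \<in> P" by blast
 have U: "gen_alg D S = UNIV" using gen(2) ga_mono[OF D(2), of S S] by auto
 \<comment> \<open>All residue rings stay algebraic over \<open>range \<iota>\<close>, so
   \<open>T\<close> remains transcendental over each of them.\<close>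
 have al: "\<phi> x \<in> acl (range \<iota>)" for x
 proof -
  obtain q where q: "q \<in> polys D" "q \<noteq> 0" "poly q x \<in> P" using alg by blast
  have "map_poly \<phi> q = map_poly \<iota> q" using q(1) \<phi>(1,2) U
   by (intro poly_eqI) (auto simp: rhom_map_coeff[OF UNIV_sr \<iota>(1)] rhom_map_coeff[OF UNIV_sr, of \<phi>] dest: polysD)
  moreover have "\<phi> (poly q x) = 0" using \<phi>(3) U q(3) by auto
  then have "poly (map_poly \<phi> q) (\<phi> x) = 0" using mp_eval[OF UNIV_sr, of \<phi> q x] \<phi>(1) U by simp
  moreover have "coeff (map_poly \<iota> q) (degree q) \<noteq> 0" using q(2) \<iota>(2)[of "lead_coeff q"] by (auto simp: rhom_map_coeff[OF UNIV_sr \<iota>(1)])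
  moreover have "map_poly \<iota> q \<in> polys (range \<iota>)" by (rule polysI) (auto simp: rhom_map_coeff[OF UNIV_sr \<iota>(1)])
  ultimately show ?thesis unfolding acl_def algebraic_over_def by (auto intro!: bexI[of _ "map_poly \<iota> q"])
 qed
 have "point \<phi> P" unfolding point_def using \<phi> U D(2) by auto
 then show thesis by (rule that) (use al in blast)
qed

lemma pointD:
 assumes "point \<phi> P"
 shows "rhom UNIV \<phi>" "\<And>c. c \<in> K \<Longrightarrow> \<phi> c = \<iota> c" "\<And>x. \<phi> x = 0 \<longleftrightarrow> x \<in> P" "\<phi> 1 = 1" "subring_set (range \<phi>)"
  "k \<subseteq> range \<phi>" "range \<phi> = gen_alg k (\<phi> ` S)" "prime_ideal P"
proof -
 show *: "rhom UNIV \<phi>" "\<And>c. c \<in> K \<Longrightarrow> \<phi> c = \<iota> c" "\<And>x. \<phi> x = 0 \<longleftrightarrow> x \<in> P" "\<phi> 1 = 1"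
  using assms by (auto simp: point_def rhom_def)
 show sr: "subring_set (range \<phi>)" by (rule rhom_image[OF UNIV_sr *(1)])
 have k: "\<phi> ` K = k" using *(2) by force
 then show kr: "k \<subseteq> range \<phi>" by blast
 show "range \<phi> = gen_alg k (\<phi> ` S)"
 proof
  show "range \<phi> \<subseteq> gen_alg k (\<phi> ` S)" using rhom_ga[OF UNIV_sr *(1), of _ K S] gen(2) k by auto
  show "gen_alg k (\<phi> ` S) \<subseteq> range \<phi>" using kr by (intro ga_least sr) auto
 qed
 note h = UNIV_sr *(1)
 show "prime_ideal P" unfolding prime_ideal_def is_ideal_def
 proof (intro conjI allI ballI impI)
  show "0 \<in> P" using *(3)[of 0] rhom_zero[OF h] by simp
  show "P \<noteq> UNIV" using *(3)[of 1] rhom_one[OF h] by auto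
  show "x + y \<in> P" if "x \<in> P" "y \<in> P" for x y using *(3) that rhom_add[OF h, of x y] by (metis UNIV_I add_0)
  show "a * x \<in> P" if "x \<in> P" for x a using *(3) that rhom_mult[OF h, of a x] by (metis UNIV_I mult_zero_right)
  show "a \<in> P \<or> b \<in> P" if "a * b \<in> P" for a b using *(3) that rhom_mult[OF h, of a b] by (metis UNIV_I mult_eq_0_iff)
 qed
qed

lemma point_diff: "point \<phi> P \<Longrightarrow> \<phi> x = \<phi> y \<longleftrightarrow> x - y \<in> P"
 using rhom_diff[OF UNIV_sr pointD(1), of \<phi> P x y] pointD(3)[of \<phi> P "x - y"] by auto

lemma point_factor:
 assumes \<phi>: "point \<phi> P" and \<phi>': "point \<phi>' Q" and "P \<subseteq> Q"
 obtains \<pi> where "rhom (range \<phi>) \<pi>" "\<And>a. \<pi> (\<phi> a) = \<phi>' a" "\<And>c. c \<in> k \<Longrightarrow> \<pi> c = c"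
proof -
 define \<pi> where "\<pi> x = \<phi>' (inv_into UNIV \<phi> x)" for x
 have e: "\<pi> (\<phi> a) = \<phi>' a" for a
 proof -
  have "\<phi> (inv_into UNIV \<phi> (\<phi> a)) = \<phi> a" by (simp add: f_inv_into_f)
  then have "inv_into UNIV \<phi> (\<phi> a) - a \<in> Q" using point_diff[OF \<phi>] assms(3) by blast
  then show ?thesis unfolding \<pi>_def using point_diff[OF \<phi>'] by blast
 qed
 have "rhom (range \<phi>) \<pi>"
 proof (rule rhomI)
  show "\<pi> 1 = 1" using e[of 1] rhom_one[OF UNIV_sr pointD(1)[OF \<phi>]] rhom_one[OF UNIV_sr pointD(1)[OF \<phi>']] by simp
  fix x y assume "x \<in> range \<phi>" "y \<in> range \<phi>"
  then obtain a b where "x = \<phi> a" "y = \<phi> b" by blast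
  then show "\<pi> (x + y) = \<pi> x + \<pi> y" "\<pi> (x * y) = \<pi> x * \<pi> y"
   using e[of "a + b"] e[of "a * b"] e rhom_add[OF UNIV_sr pointD(1)[OF \<phi>], of a b] rhom_add[OF UNIV_sr pointD(1)[OF \<phi>'], of a b]
    rhom_mult[OF UNIV_sr pointD(1)[OF \<phi>], of a b] rhom_mult[OF UNIV_sr pointD(1)[OF \<phi>'], of a b] by auto
 qed
 moreover have "\<pi> c = c" if c: "c \<in> k" for c
 proof -
  obtain d where "d \<in> K" "c = \<iota> d" using c by blast
  then show ?thesis using e[of d] pointD(2)[OF \<phi>, of d] pointD(2)[OF \<phi>', of d] by simp
 qed
 ultimately show thesis using that e by blast
qed

lemma point_fin:
 assumes "point \<phi> P"
 shows "finite (\<phi> ` S)" "range \<phi> \<subseteq> alg_cl k (\<phi> ` S)"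
 using gen(1) pointD(7)[OF assms] cl_base[OF k_sr] by auto

text \<open>A transcendence basis of \<open>A/Q\<close> lifts to independent elements of
  \<open>A/P\<close>. If the lifts were a basis there, an element of \<open>Q\<close> outside
  \<open>P\<close> would divide a nonzero polynomial \<open>c\<close> in the lifts, and
  \<open>c\<close> would vanish modulo \<open>Q\<close>.\<close>

lemma point_dim_le:
 assumes \<phi>: "point \<phi> P" and \<phi>': "point \<phi>' Q" and PQ: "P \<subseteq> Q"
 shows "trdeg k (range \<phi>') \<le> trdeg k (range \<phi>)" "P \<noteq> Q \<Longrightarrow> trdeg k (range \<phi>') < trdeg k (range \<phi>)"
proof -
 obtain \<pi> where \<pi>: "rhom (range \<phi>) \<pi>" "\<And>a. \<pi> (\<phi> a) = \<phi>' a" "\<And>c. c \<in> k \<Longrightarrow> \<pi> c = c" by (rule point_factor[OF assms]) (rule that)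
 obtain X' where X': "tbasis k X' (range \<phi>')" "card X' = trdeg k (range \<phi>')" using trdeg_basis[OF k_sr point_fin[OF \<phi>']] .
 define Z where "Z = (\<lambda>x. inv_into UNIV \<phi>' x) ` X'"
 have Z: "\<phi>' ` Z = X'" using X'(1) unfolding Z_def tbasis_def by (force simp: f_inv_into_f image_image)
 define X where "X = \<phi> ` Z"
 have \<pi>X: "\<pi> ` X = X'" using Z \<pi>(2) by (simp add: X_def image_image)
 have fin: "finite X" using X'(1) by (simp add: X_def Z_def tbasis_def indep_def)
 have "card Z \<le> card X'" unfolding Z_def by (rule card_image_le) (use X' in \<open>simp add: tbasis_def indep_def\<close>)
 then have c: "card X \<le> card X'" using card_image_le[of Z \<phi>] X'(1) unfolding X_def Z_def by (force simp: tbasis_def indep_def)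
 then have cX: "card X = card X'" using card_image_le[OF fin, of \<pi>] \<pi>X by simp
 have inj: "inj_on \<pi> X" using eq_card_imp_inj_on[OF fin, of \<pi>] \<pi>X cX by simp
 have XE: "X \<subseteq> range \<phi>" by (auto simp: X_def)
 note E = pointD(5,6)[OF \<phi>]
 have iX: "indep k X" using indep_lift[OF k_sr E \<pi>(1,3) XE inj] \<pi>X X' by (auto simp: tbasis_def)
 show le: "trdeg k (range \<phi>') \<le> trdeg k (range \<phi>)"
  using indep_le_trdeg[OF k_sr iX XE point_fin[OF \<phi>]] cX X' by simp
 assume "P \<noteq> Q"
 then obtain x where x: "x \<in> Q" "x \<notin> P" using PQ by blast
 show "trdeg k (range \<phi>') < trdeg k (range \<phi>)"
 proof (rule ccontr)
  assume "\<not> ?thesis"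
  then have "tbasis k X (range \<phi>)" using X' cX by (intro indep_tbasis[OF k_sr iX XE point_fin[OF \<phi>]]) simp
  then have "\<phi> x \<in> acl (gen_alg k X)" by (auto simp: tbasis_def alg_cl_def)
  moreover have "\<phi> x \<noteq> 0" using x pointD(3)[OF \<phi>] by simp
  ultimately obtain c p where cp: "c \<in> gen_alg k X" "c \<noteq> 0" "p \<in> polys (gen_alg k X)" "c + \<phi> x * poly p (\<phi> x) = 0"
   using algebraic_nonzero_const[OF ga_subring[OF k_sr]] by metis
  have iX': "indep k (\<pi> ` X)" using X' \<pi>X by (simp add: tbasis_def)
  note sub = hom_inj_on_indep(1)[OF k_sr E \<pi>(1,3) XE inj iX'] and inj' = hom_inj_on_indep(2)[OF k_sr E \<pi>(1,3) XE inj iX']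
  have pe: "poly p (\<phi> x) \<in> range \<phi>" using cp polys_mono[OF sub] by (intro po_eval[OF E(1)]) auto
  have "\<pi> (\<phi> x) = 0" using \<pi>(2) x pointD(3)[OF \<phi>'] by simp
  then have "\<pi> (c + \<phi> x * poly p (\<phi> x)) = \<pi> c"
   using cp sub pe by (subst rhom_add[OF E(1) \<pi>(1)]) (auto simp: rhom_mult[OF E(1) \<pi>(1)] intro!: sr_mult[OF E(1)])
  then have "\<pi> c = 0" using cp rhom_zero[OF E(1) \<pi>(1)] by simp
  then show False using inj' cp by blast
 qed
qed

text \<open>The dimension of \<open>A/P\<close>, measured by transcendence degree so that heights
  become computable.\<close>

definition pdim :: "'a set \<Rightarrow> nat" where "pdim P = trdeg k (range (SOME \<phi>. point \<phi> P))"

lemma pdim: "point \<phi> P \<Longrightarrow> pdim P = trdeg k (range \<phi>)"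
 unfolding pdim_def using point_dim_le(1)[of \<phi> P] point_dim_le(1)[of _ P \<phi>] someI[of "\<lambda>\<phi>. point \<phi> P" \<phi>]
 by (meson le_antisym order_refl)

lemma pdim_less: "prime_ideal P \<Longrightarrow> prime_ideal Q \<Longrightarrow> P \<subset> Q \<Longrightarrow> pdim Q < pdim P"
 using point_ex[of P] point_ex[of Q] point_dim_le(2) pdim by (metis psubset_eq)

end

section \<open>Going down and heights\<close>

text \<open>An ideal maximal among those that contain \<open>I\<close> and miss the multiplicative
  set \<open>M\<close> is prime.\<close>

lemma prime_avoiding:
 fixes I M :: "'a::comm_ring_1 set"
 assumes I: "is_ideal I" and M: "1 \<in> M" "\<And>x y. x \<in> M \<Longrightarrow> y \<in> M \<Longrightarrow> x * y \<in> M" and IM: "I \<inter> M = {}"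
 obtains P where "prime_ideal P" "I \<subseteq> P" "P \<inter> M = {}"
proof -
 let ?D = "{J. is_ideal J \<and> I \<subseteq> J \<and> J \<inter> M = {}}"
 have "\<exists>J\<in>?D. \<forall>J'\<in>?D. J \<subseteq> J' \<longrightarrow> J' = J"
 proof (rule subset_Zorn_nonempty)
  show "?D \<noteq> {}" using I IM by blast
  fix C assume C: "C \<noteq> {}" "subset.chain ?D C"
  have mem: "is_ideal J" "I \<subseteq> J" "J \<inter> M = {}" if "J \<in> C" for J
   using C(2) that unfolding subset.chain_def by auto
  obtain J0 where J0: "J0 \<in> C" using C(1) by blast
  have "is_ideal (\<Union>C)" unfolding is_ideal_def
  proof (intro conjI ballI allI)
   show "0 \<in> \<Union>C" using J0 mem(1)[OF J0] by (auto simp: is_ideal_def)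
   fix x assume x: "x \<in> \<Union>C"
   then obtain J where J: "J \<in> C" "x \<in> J" by blast
   show "a * x \<in> \<Union>C" for a using J mem(1)[OF J(1)] unfolding is_ideal_def by blast
   fix y assume "y \<in> \<Union>C"
   then obtain J' where "J' \<in> C" "y \<in> J'" by blast
   then have "J \<subseteq> J' \<or> J' \<subseteq> J" using J C(2) unfolding subset.chain_def by blast
   then obtain J where J: "J \<in> C" "x \<in> J" "y \<in> J" using J \<open>J' \<in> C\<close> \<open>y \<in> J'\<close> by auto
   then show "x + y \<in> \<Union>C" using mem(1)[OF J(1)] unfolding is_ideal_def by blast
  qed
  moreover have "I \<subseteq> \<Union>C" using J0 mem(2)[OF J0] by blast
  moreover have "\<Union>C \<inter> M = {}" using mem(3) by auto
  ultimately show "\<Union>C \<in> ?D" by blast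
 qed
 then obtain J where "J \<in> ?D" and max: "\<forall>J'\<in>?D. J \<subseteq> J' \<longrightarrow> J' = J" ..
 then have J: "is_ideal J" "I \<subseteq> J" "J \<inter> M = {}" by auto
 have meet: "\<exists>j\<in>J. \<exists>r. j + r * a \<in> M" if a: "a \<notin> J" for a
 proof -
  let ?J = "{j + r * a | j r. j \<in> J}"
  have J0: "0 \<in> J" using J(1) by (simp add: is_ideal_def)
  have "is_ideal ?J" unfolding is_ideal_def
  proof (intro conjI ballI allI)
   show "0 \<in> ?J" using J0 by (intro CollectI exI[of _ 0]) simp
   fix x assume "x \<in> ?J"
   then obtain j r where x: "x = j + r * a" "j \<in> J" by blast
   show "c * x \<in> ?J" for c using x J(1) unfolding is_ideal_def
    by (intro CollectI exI[of _ "c * j"] exI[of _ "c * r"]) (auto simp: algebra_simps)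
   fix y assume "y \<in> ?J"
   then obtain j' r' where y: "y = j' + r' * a" "j' \<in> J" by blast
   show "x + y \<in> ?J" using x y J(1) unfolding is_ideal_def
    by (intro CollectI exI[of _ "j + j'"] exI[of _ "r + r'"]) (auto simp: algebra_simps)
  qed
  moreover have "x \<in> ?J" if "x \<in> J" for x using that by (intro CollectI exI[of _ x] exI[of _ 0]) simp
  then have sub: "J \<subseteq> ?J" by blast
  moreover have aJ: "a \<in> ?J" using J0 by (intro CollectI exI[of _ 0] exI[of _ 1]) simp
  ultimately have max': "?J \<inter> M = {} \<Longrightarrow> ?J = J" using max[rule_format, of ?J] J(2) by simp
  have "\<exists>x. x \<in> ?J \<and> x \<in> M"
  proof (rule ccontr)
   assume "\<not> ?thesis"
   then have "?J \<inter> M = {}" by (intro equals0I) (erule IntE, blast)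
   from max'[OF this] aJ a show False by simp
  qed
  then show ?thesis by auto
 qed
 have "a \<in> J \<or> b \<in> J" if ab: "a * b \<in> J" for a b
 proof (rule ccontr)
  assume "\<not> ?thesis"
  then obtain i r j s where ij: "i \<in> J" "i + r * a \<in> M" "j \<in> J" "j + s * b \<in> M" using meet by blast
  have "(i + r * a) * (j + s * b) = (j + s * b) * i + (r * a) * j + (r * s) * (a * b)" by (simp add: algebra_simps)
  also have "\<dots> \<in> J" using J(1) ij ab unfolding is_ideal_def by blast
  finally show False using M(2)[OF ij(2,4)] J(3) by blast
 qed
 moreover have "J \<noteq> UNIV" using J(3) M(1) by blast
 ultimately have "prime_ideal J" using J(1) unfolding prime_ideal_def by auto
 then show thesis using J(2,3) by (rule that)
qed

text \<open>Divisibility with the quotient in \<open>R\<close>. The rings considered lie in a field,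
  where plain \<open>dvd\<close> carries no information.\<close>

definition dvd_in :: "'a::comm_ring_1 set \<Rightarrow> 'a \<Rightarrow> 'a \<Rightarrow> bool" where
 "dvd_in R p a \<longleftrightarrow> (\<exists>c\<in>R. a = p * c)"

definition prime_elt :: "'a::comm_ring_1 set \<Rightarrow> 'a \<Rightarrow> bool" where
 "prime_elt R p \<longleftrightarrow> p \<in> R \<and> p \<noteq> 0 \<and> \<not> dvd_in R p 1 \<and>
  (\<forall>a\<in>R. \<forall>b\<in>R. dvd_in R p (a * b) \<longrightarrow> dvd_in R p a \<or> dvd_in R p b)"

lemma prime_elt_power:
 assumes p: "prime_elt R p" and R: "subring_set R" and a: "a \<in> R" "dvd_in R p (a ^ n)"
 shows "dvd_in R p a"
 using a(2)
proof (induction n)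
 case 0
 then show ?case using p by (simp add: prime_elt_def)
next
 case (Suc n)
 then have "dvd_in R p a \<or> dvd_in R p (a ^ n)" using p a sr_power[OF R a(1)] by (simp add: prime_elt_def)
 then show ?case using Suc.IH by blast
qed

text \<open>A monic polynomial of minimal degree among those vanishing under \<open>f\<close> is prime: its factors
over the fraction field have coefficients in the normal ring \<open>K[Y]\<close>.\<close>

lemma monic_prime_elt:
 fixes K X :: "'b::alg_closed_field set"
 assumes K: "subfield_set K" "infinite K" and X: "indep K X"
  and f: "rhom (gen_alg K X) f" "\<And>c. c \<in> K \<Longrightarrow> f c = c" and r0: "r0 \<in> gen_alg K X" "r0 \<noteq> 0" "f r0 = 0"
 obtains p v x0 where "prime_elt (gen_alg K X) p" "f p = 0" "v ` X \<subseteq> K" "x0 \<in> X" "v x0 \<noteq> 0"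
  "\<And>a. a \<in> gen_alg K (dbase X v x0) \<Longrightarrow> dvd_in (gen_alg K X) p a \<Longrightarrow> a = 0"
proof -
 note Ks = sf_sr[OF K(1)]
 have pos: "tdeg K X r0 > 0"
  using tdeg_0_const[OF K(1) X r0(1)] f(2)[of r0] r0 by (cases "tdeg K X r0 = 0") auto
 obtain v where v: "good_direction K X r0 v" using good_direction_ex[OF K X r0(1,2)] .
 then have vK: "v ` X \<subseteq> K" by (simp add: good_direction_def)
 obtain x0 where x0: "x0 \<in> X" "v x0 \<noteq> 0" using good_direction_nz[OF K(1) X r0(1) pos v] .
 let ?Y = "dbase X v x0" and ?t = "dcoord v x0"
 let ?R = "gen_alg K X" and ?D = "gen_alg K ?Y"
 have R: "subring_set ?R" and D: "subring_set ?D" by (auto intro: ga_subring Ks)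
 have iY: "indep K ?Y" "?t \<notin> ?Y" "indep K (insert ?t ?Y)"
  using dbase_indep[OF K(1) X vK x0] indep_subset[of K "insert ?t ?Y" ?Y] by auto
 have tt: "?t \<notin> acl ?D" using indep_insertD[OF Ks iY(3,2)] by (simp add: alg_cl_def)
 have Req: "?R = (\<lambda>h. poly h ?t) ` polys ?D" using dbase_ga[OF K(1) X vK x0] ga_insert[OF Ks, of ?t ?Y] by simp
 have inR: "poly h ?t \<in> ?R" if "h \<in> polys ?D" for h using that Req by blast
 have N: "normal_ring ?D" by (rule polynomial_ring_normal[OF K(1) iY(1)])
 let ?P = "\<lambda>h. h \<in> polys ?D \<and> lead_coeff h = 1 \<and> f (poly h ?t) = 0"
 obtain h0 where h0: "h0 \<in> polys ?D" "poly h0 ?t = r0" "lead_coeff h0 \<in> K" "lead_coeff h0 \<noteq> 0"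
  using good_direction_monic[OF K(1) X vK x0 r0(1,2) v] by metis
 let ?i = "inverse (lead_coeff h0)"
 have iK: "?i \<in> K" by (rule sf_inverse[OF K(1) h0(3)])
 have iR: "?i \<in> ?R" "?i \<in> ?D" using iK ga_base(1)[of K X] ga_base(1)[of K ?Y] by blast+
 have "f (?i * r0) = 0" using rhom_mult[OF R f(1) iR(1) r0(1)] r0 by simp
 then have "?P (smult ?i h0)" using h0 iR by (auto intro!: po_smult[OF D])
 then obtain h where h: "?P h" "\<And>g. ?P g \<Longrightarrow> degree h \<le> degree g"
  using ex_has_least_nat[of ?P "smult ?i h0" degree] by blast
 have hd: "degree h > 0" using h(1) rhom_one[OF R f(1)] by (cases "degree h = 0") (auto elim!: degree_eq_zeroE)
 \<comment> \<open>Any root will do: its minimal polynomial \<open>m\<close> divides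
   \<open>h\<close> over \<open>?D\<close>, and the minimality of \<open>h\<close> among the monic
   polynomials killed by \<open>f\<close> forces \<open>h = m\<close>.\<close>
 obtain w where w: "poly h w = 0" using alg_closed_imp_poly_has_root[OF hd] by blast
 have wD: "integral_over ?D w" using h(1) w by (auto simp: integral_over_def)
 then have "w \<in> acl (fracs ?D)" unfolding acl_fracs[OF D] using integral_imp_algebraic[OF wD] by (simp add: acl_def)
 then obtain m where m: "minpoly (fracs ?D) w m" using minpoly_ex[OF fracs_subfield[OF D]] by blast
 have mD: "m \<in> polys ?D" by (rule normal_minpoly[OF N wD m])
 obtain u where u: "u \<in> polys ?D" "h = m * u"
  using minpoly_dvd[OF m D fracs_base[OF D] mD _ w] h(1) by blast
 have hm: "h = m"
 proof -
  have lu: "lead_coeff u = 1" using h(1) minpolyD(2)[OF m] unfolding u(2) lead_coeff_mult by simp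
  have nz: "m \<noteq> 0" "u \<noteq> 0" using h(1) u(2) by auto
  then have dh: "degree h = degree m + degree u" unfolding u(2) by (rule degree_mult_eq)
  have "f (poly m ?t) * f (poly u ?t) = 0"
   using h(1) u rhom_mult[OF R f(1) inR[OF mD] inR[OF u(1)]] by simp
  then have "?P m \<or> ?P u" using mD u lu minpolyD(2)[OF m] by auto
  then show ?thesis
  proof
   assume "?P m"
   then have "degree u = 0" using h(2) dh by fastforce
   then have "u = 1" using lu by (auto elim!: degree_eq_zeroE simp: one_pCons)
   then show ?thesis using u by simp
  next
   assume "?P u"
   then have "degree m = 0" using h(2) dh by fastforce
   then show ?thesis using minpolyD(5)[OF m] by simp
  qed
 qed
 define p where "p = poly h ?t"
 \<comment> \<open>Divisibility by \<open>p\<close> becomes vanishing at \<open>w\<close>. This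
   shows that \<open>p\<close> is prime and that it divides no nonzero element free of
   \<open>t\<close>.\<close>
 have dvd: "dvd_in ?R p (poly a ?t) \<longleftrightarrow> poly a w = 0" if a: "a \<in> polys ?D" for a
 proof
  assume "dvd_in ?R p (poly a ?t)"
  then obtain c where c: "c \<in> polys ?D" "poly a ?t = p * poly c ?t" using Req by (auto simp: dvd_in_def)
  then have "a - h * c = 0" using a h(1) by (intro transc_poly_eq[OF tt]) (auto simp: p_def intro!: po_closed[OF D])
  then show "poly a w = 0" using w by simp
 next
  assume "poly a w = 0"
  then obtain c where "c \<in> polys ?D" "a = h * c" using minpoly_dvd[OF m D fracs_base[OF D] mD a] hm by blast
  then show "dvd_in ?R p (poly a ?t)" unfolding dvd_in_def p_def using inR by auto
 qed
 have "prime_elt ?R p" unfolding prime_elt_def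
 proof (intro conjI ballI impI)
  show "p \<in> ?R" using inR h(1) by (simp add: p_def)
  show "p \<noteq> 0" using transc_poly_eq[OF tt, of h] h(1) by (auto simp: p_def)
  show "\<not> dvd_in ?R p 1" using dvd[of 1] by (simp add: po_closed[OF D])
  fix a b assume "a \<in> ?R" "b \<in> ?R" "dvd_in ?R p (a * b)"
  moreover obtain a' b' where "a' \<in> polys ?D" "b' \<in> polys ?D" "a = poly a' ?t" "b = poly b' ?t"
   using \<open>a \<in> ?R\<close> \<open>b \<in> ?R\<close> Req by blast
  ultimately show "dvd_in ?R p a \<or> dvd_in ?R p b"
   using dvd[of "a' * b'"] dvd[of a'] dvd[of b'] by (auto simp: po_closed[OF D])
 qed
 moreover have "a = 0" if "a \<in> ?D" "dvd_in ?R p a" for a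
  using dvd[of "[:a:]"] that by (auto simp: po_closed[OF D])
 ultimately show thesis using that[of p v x0] h(1) vK x0 by (auto simp: p_def)
qed

context affine_domain
begin

lemma point_normalization:
 assumes \<phi>: "point \<phi> P" "range \<phi> \<subseteq> acl (range \<iota>)"
 obtains X where "X \<subseteq> range \<phi>" "indep k X" "\<And>b. integral_over (gen_alg k X) (\<phi> b)" "tbasis k X (range \<phi>)"
proof -
 have "alg_cl k (\<phi> ` S) \<subseteq> acl (range \<iota>)"
  unfolding alg_cl_def using \<phi> pointD(7)[OF \<phi>(1)] by (intro acl_subset rhom_image[OF UNIV_sr \<iota>(1)]) auto
 then have "T \<notin> alg_cl k (\<phi> ` S)" using T by blast
 then obtain X where X: "X \<subseteq> gen_alg k (\<phi> ` S)" "indep k X" "\<And>s. s \<in> \<phi> ` S \<Longrightarrow> integral_over (gen_alg k X) s"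
  using noether_normalization[OF k_sf k_inf, of "\<phi> ` S" T] gen(1) by blast
 have int: "integral_over (gen_alg k X) (\<phi> b)" for b
 proof (rule integral_over_gen_alg[OF ga_subring[OF k_sr]])
  show "\<phi> b \<in> gen_alg (gen_alg k X) (\<phi> ` S)"
   using pointD(7)[OF \<phi>(1)] ga_mono[OF ga_base(1)[of k X] order_refl, of "\<phi> ` S"] by blast
 qed (use X in auto)
 have XR: "X \<subseteq> range \<phi>" using X(1) pointD(7)[OF \<phi>(1)] by simp
 have "tbasis k X (range \<phi>)" unfolding tbasis_def using XR X(2) int integral_in_cl[OF k_sr] by blast
 then show thesis using that[OF XR X(2) int] by simp
qed

text \<open>Going down to the principal prime \<open>(p)\<close>. The ideal of multiples of
  \<open>p\<close> has to miss the products \<open>r * b\<close> with \<open>r\<close> outside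
  \<open>(p)\<close> and \<open>b\<close> outside \<open>P\<close>. If \<open>r * b = p * c\<close>,
  comparing the minimal polynomials of \<open>b\<close> and of \<open>c = (r / p) * b\<close>, both
  over the normal ring \<open>K[X]\<close>, shows that a power of \<open>b\<close> is a multiple of
  \<open>p\<close>, hence lies in \<open>P\<close>.\<close>

lemma going_down:
 assumes \<phi>: "point \<phi> P0" and X: "indep k X" "X \<subseteq> range \<phi>" and int: "\<And>b. integral_over (gen_alg k X) (\<phi> b)"
  and p: "prime_elt (gen_alg k X) p" and P: "prime_ideal P" "P0 \<subseteq> P" and ph: "\<phi> ph = p" "ph \<in> P"
 obtains P1 where "prime_ideal P1" "P0 \<subseteq> P1" "P1 \<subseteq> P" "ph \<in> P1"
  "\<And>a. \<phi> a \<in> gen_alg k X \<Longrightarrow> a \<in> P1 \<longleftrightarrow> dvd_in (gen_alg k X) p (\<phi> a)"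
proof -
 let ?R = "gen_alg k X"
 have R: "subring_set ?R" by (rule ga_subring[OF k_sr])
 have N: "normal_ring ?R" by (rule polynomial_ring_normal[OF k_sf X(1)])
 note h = UNIV_sr pointD(1)[OF \<phi>]
 have RB: "?R \<subseteq> range \<phi>" using X(2) pointD(5,6)[OF \<phi>] by (intro ga_least) auto
 have pR: "p \<in> ?R" "p \<noteq> 0" using p by (auto simp: prime_elt_def)
 let ?M = "{r * b | r b. \<phi> r \<in> ?R \<and> \<not> dvd_in ?R p (\<phi> r) \<and> b \<notin> P}"
 let ?I = "{a. \<exists>c. \<phi> a = p * \<phi> c}"
 have P0: "x \<in> P" if "\<phi> x = 0" for x using that pointD(3)[OF \<phi>] P(2) by blast
 have disj: "?I \<inter> ?M = {}"
 proof (rule ccontr)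
  assume "?I \<inter> ?M \<noteq> {}"
  then obtain r b c where rb: "\<phi> r \<in> ?R" "\<not> dvd_in ?R p (\<phi> r)" "b \<notin> P" "\<phi> (r * b) = p * \<phi> c" by blast
  define r' b' c' where rbc: "r' = \<phi> r" "b' = \<phi> b" "c' = \<phi> c"
  have eq: "r' * b' = p * c'" using rb(4) rhom_mult[OF h, of r b] rbc by simp
  have r0: "r' \<noteq> 0" using rb(2) sr_zero[OF R] by (auto simp: dvd_in_def rbc)
  let ?F = "fracs ?R"
  have F: "subfield_set ?F" by (rule fracs_subfield[OF R])
  have RF: "?R \<subseteq> ?F" by (rule fracs_base[OF R])
  define z where "z = r' / p"
  have z: "z \<in> ?F" "z \<noteq> 0" "z * b' = c'"
   using sf_divide[OF F, of r' p] RF pR rb(1) r0 eq by (auto simp: z_def rbc field_simps)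
  have ib: "integral_over ?R b'" "integral_over ?R c'" using int by (auto simp: rbc)
  then have "b' \<in> acl ?F" using acl_fracs[OF R] integral_imp_algebraic by (auto simp: acl_def)
  then obtain m where m: "minpoly ?F b' m" using minpoly_ex[OF F] by blast
  have mR: "m \<in> polys ?R" by (rule normal_minpoly[OF N ib(1) m])
  define n where "n = degree m"
  \<comment> \<open>The minimal polynomial of \<open>z * b'\<close>: coefficient \<open>i\<close> of
    \<open>m\<close> is multiplied by \<open>z^(n-i)\<close>.\<close>
  define m' where "m' = smult (z ^ n) (pcompose m [:0, inverse z:])"
  have co: "coeff m' i = z ^ (n - i) * coeff m i" if "i \<le> n" for i
  proof -
   have "z ^ n = z ^ (n - i) * z ^ i" using that by (simp flip: power_add)
   then show ?thesis using z by (simp add: m'_def coeff_pcompose_linear power_inverse field_simps)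
  qed
  have dm': "degree m' = n" using z by (simp add: m'_def n_def)
  have m'F: "m' \<in> polys ?F"
   unfolding m'_def using minpolyD(1)[OF m] z F
   by (intro po_closed[OF sf_sr[OF F]] sr_closed[OF sf_sr[OF F]] sf_inverse[OF F]) auto
  have "minpoly ?F c' m'" unfolding minpoly_def
  proof (intro conjI ballI impI m'F)
   show "lead_coeff m' = 1" using co[of n] minpolyD(2)[OF m] by (simp add: dm' n_def)
   show "poly m' c' = 0" using z minpolyD(3)[OF m] by (auto simp: m'_def poly_pcompose field_simps)
   fix g assume g: "g \<in> polys ?F" "poly g c' = 0"
   have g': "pcompose g [:0, z:] \<in> polys ?F"
    using g z by (intro po_closed[OF sf_sr[OF F]] sr_closed[OF sf_sr[OF F]]) auto
   have "poly (pcompose g [:0, z:]) b' = 0" using g z by (simp add: poly_pcompose mult.commute)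
   then have "pcompose g [:0, z:] = 0 \<or> degree m \<le> degree (pcompose g [:0, z:])"
    using m g' by (auto simp: minpoly_def)
   then show "g = 0 \<or> degree m' \<le> degree g" using z pcompose_eq_0[of g "[:0,z:]"] by (auto simp: dm' n_def)
  qed
  then have m'R: "m' \<in> polys ?R" by (rule normal_minpoly[OF N ib(2)])
  \<comment> \<open>\<open>r'^(n-i) * coeff m i = p^(n-i) * coeff m' i\<close>, and \<open>p\<close>
    is prime and does not divide \<open>r'\<close>.\<close>
  have dv: "dvd_in ?R p (coeff m i)" if i: "i < n" for i
  proof -
   have "r' ^ (n - i) * coeff m i = p ^ (n - i) * coeff m' i"
    using co[of i] i pR by (simp add: z_def power_divide field_simps)
   also have "\<dots> = p * (p ^ (n - i - 1) * coeff m' i)" using i by (simp add: power_eq_if)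
   finally have "dvd_in ?R p (r' ^ (n - i) * coeff m i)" unfolding dvd_in_def
    using pR polysD[OF m'R] by (intro bexI[of _ "p ^ (n - i - 1) * coeff m' i"]) (auto intro!: sr_closed[OF R])
   then have "dvd_in ?R p (r' ^ (n - i)) \<or> dvd_in ?R p (coeff m i)"
    using p rb(1) polysD[OF mR] sr_power[OF R] by (auto simp: prime_elt_def rbc)
   then show ?thesis using prime_elt_power[OF p R] rb(1,2) by (auto simp: rbc)
  qed
  have "\<exists>d. \<forall>i<n. d i \<in> ?R \<and> coeff m i = p * d i" using dv unfolding dvd_in_def by metis
  then obtain d where d: "\<And>i. i < n \<Longrightarrow> d i \<in> ?R" "\<And>i. i < n \<Longrightarrow> coeff m i = p * d i" by blast
  have "0 = (\<Sum>i\<le>n. coeff m i * b' ^ i)" using minpolyD(3)[OF m] by (simp add: poly_altdef n_def)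
  also have "\<dots> = b' ^ n + (\<Sum>i<n. p * (d i * b' ^ i))"
   using minpolyD(2)[OF m] d(2) by (simp add: lessThan_Suc_atMost[symmetric] n_def mult.assoc)
  finally have "b' ^ n = p * (- (\<Sum>i<n. d i * b' ^ i))" by (simp add: sum_distrib_left eq_neg_iff_add_eq_0)
  moreover have "- (\<Sum>i<n. d i * b' ^ i) \<in> range \<phi>"
   using d(1) RB rbc by (intro sr_closed[OF pointD(5)[OF \<phi>]]) auto
  then obtain e where "- (\<Sum>i<n. d i * b' ^ i) = \<phi> e" by blast
  ultimately have "b' ^ n = p * \<phi> e" by simp
  then have "\<phi> (b ^ n - ph * e) = 0"
   using rhom_diff[OF h] rhom_power[OF h] rhom_mult[OF h] ph by (simp add: rbc)
  then have "b ^ n - ph * e \<in> P" by (rule P0)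
  then have "(b ^ n - ph * e) + ph * e \<in> P" using ph by (intro prime_idealD(3,5)[OF P(1)])
  then show False using prime_ideal_power[OF P(1), of b n] rb(3) by simp
 qed
 have M1: "r \<in> ?M" if "\<phi> r \<in> ?R" "\<not> dvd_in ?R p (\<phi> r)" for r
  using that prime_idealD(2)[OF P(1)] by (intro CollectI exI[of _ r] exI[of _ 1]) auto
 have one: "\<phi> 1 = 1" "\<not> dvd_in ?R p 1" using p rhom_one[OF h] by (auto simp: prime_elt_def)
 have idl: "is_ideal ?I" unfolding is_ideal_def
 proof (intro conjI ballI allI)
  show "0 \<in> ?I" using rhom_zero[OF h] by (intro CollectI exI[of _ 0]) simp
  fix x assume "x \<in> ?I"
  then obtain c where x: "\<phi> x = p * \<phi> c" by blast
  show "a * x \<in> ?I" for a using x rhom_mult[OF h] by (intro CollectI exI[of _ "a * c"]) (simp add: mult_ac)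
  fix y assume "y \<in> ?I"
  then obtain d where "\<phi> y = p * \<phi> d" by blast
  then show "x + y \<in> ?I" using x rhom_add[OF h] by (intro CollectI exI[of _ "c + d"]) (simp add: algebra_simps)
 qed
 have "1 \<in> ?M" using M1[of 1] one sr_one[OF R] by simp
 moreover have "x * y \<in> ?M" if xy: "x \<in> ?M" "y \<in> ?M" for x y
 proof -
  obtain r b where "\<phi> r \<in> ?R" "\<not> dvd_in ?R p (\<phi> r)" "b \<notin> P" "x = r * b" using xy(1) by blast
  moreover obtain s d where "\<phi> s \<in> ?R" "\<not> dvd_in ?R p (\<phi> s)" "d \<notin> P" "y = s * d" using xy(2) by blast
  ultimately show ?thesis using p rhom_mult[OF h, of r s] prime_idealD(6)[OF P(1), of b d] sr_mult[OF R]
   by (intro CollectI exI[of _ "r * s"] exI[of _ "b * d"]) (auto simp: prime_elt_def mult_ac)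
 qed
 ultimately obtain P1 where P1: "prime_ideal P1" "?I \<subseteq> P1" "P1 \<inter> ?M = {}"
  using prime_avoiding[OF idl _ _ disj] by blast
 have "P0 \<subseteq> P1"
 proof
  fix x assume "x \<in> P0"
  then have "\<phi> x = 0" using pointD(3)[OF \<phi>] by simp
  then have "x \<in> ?I" using rhom_zero[OF h] by (intro CollectI exI[of _ 0]) simp
  then show "x \<in> P1" using P1(2) by blast
 qed
 moreover have "P1 \<subseteq> P"
 proof
  fix x assume x: "x \<in> P1"
  show "x \<in> P"
  proof (rule ccontr)
   assume "x \<notin> P"
   then have "x \<in> ?M" using one sr_one[OF R] by (intro CollectI exI[of _ 1] exI[of _ x]) auto
   then show False using x P1(3) by blast
  qed
 qed
 moreover have "ph \<in> P1" using P1(2) ph(1) one by (auto intro!: exI[of _ 1])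
 moreover have "a \<in> P1 \<longleftrightarrow> dvd_in ?R p (\<phi> a)" if "\<phi> a \<in> ?R" for a
 proof
  assume "a \<in> P1"
  then show "dvd_in ?R p (\<phi> a)" using M1[OF that] P1(3) by blast
 next
  assume "dvd_in ?R p (\<phi> a)"
  then obtain c where "c \<in> ?R" "\<phi> a = p * c" by (auto simp: dvd_in_def)
  then show "a \<in> P1" using P1(2) RB by blast
 qed
 ultimately show thesis by (intro that[OF P1(1)])
qed

text \<open>The kernel already meets \<open>R\<close>: the constant term of a relation of least
  degree for \<open>z\<close> is nonzero and is killed together with \<open>z\<close>.\<close>

lemma integral_restrict_nonzero:
 assumes E: "subring_set E" and f: "rhom E f" and R: "subring_set R" "R \<subseteq> E"
  and z: "integral_over R z" "z \<in> E" "z \<noteq> 0" "f z = 0"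
 obtains r where "r \<in> R" "r \<noteq> (0::'b)" "f r = 0"
proof -
 have "z \<in> acl R" using z integral_imp_algebraic by (auto simp: acl_def)
 then obtain c p where cp: "c \<in> R" "c \<noteq> 0" "p \<in> polys R" "c + z * poly p z = 0"
  using algebraic_nonzero_const[OF R(1) _ z(3)] by blast
 have pe: "poly p z \<in> E" using cp polys_mono[OF R(2)] z by (intro po_eval[OF E]) auto
 have "f (c + z * poly p z) = f c" using cp R(2) pe z rhom_add[OF E f, of c "z * poly p z"] rhom_mult[OF E f, of z "poly p z"] sr_mult[OF E] by auto
 then show thesis using that[of c] cp rhom_zero[OF E f] by simp
qed

text \<open>\<open>P1\<close> contracts to a principal prime \<open>(p)\<close> of the Noether
  normalization of \<open>A/P0\<close>, and all but one of the coordinates remain independent modulo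
  it.\<close>

lemma chain_step:
 assumes P0: "prime_ideal P0" and P: "prime_ideal P" "P0 \<subset> P"
 obtains P1 where "prime_ideal P1" "P0 \<subset> P1" "P1 \<subseteq> P" "pdim P0 \<le> pdim P1 + 1"
proof -
 obtain \<phi> where \<phi>: "point \<phi> P0" "range \<phi> \<subseteq> acl (range \<iota>)" using point_ex[OF P0] .
 obtain X where X: "X \<subseteq> range \<phi>" "indep k X" "\<And>b. integral_over (gen_alg k X) (\<phi> b)" "tbasis k X (range \<phi>)"
  by (rule point_normalization[OF \<phi>]) (rule that)
 let ?R = "gen_alg k X"
 have R: "subring_set ?R" by (rule ga_subring[OF k_sr])
 have RB: "?R \<subseteq> range \<phi>" using X(1) pointD(5,6)[OF \<phi>(1)] by (intro ga_least) auto
 obtain \<psi> where \<psi>: "point \<psi> P" "range \<psi> \<subseteq> acl (range \<iota>)" using point_ex[OF P(1)] .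
 obtain \<pi> where \<pi>: "rhom (range \<phi>) \<pi>" "\<And>a. \<pi> (\<phi> a) = \<psi> a" "\<And>c. c \<in> k \<Longrightarrow> \<pi> c = c"
  by (rule point_factor[OF \<phi>(1) \<psi>(1)]) (use P that in auto)
 obtain x where x: "x \<in> P" "x \<notin> P0" using P(2) by blast
 obtain r0 where r0: "r0 \<in> ?R" "r0 \<noteq> 0" "\<pi> r0 = 0"
  by (rule integral_restrict_nonzero[OF pointD(5)[OF \<phi>(1)] \<pi>(1) R RB X(3)[of x]])
   (use x pointD(3)[OF \<phi>(1)] pointD(3)[OF \<psi>(1)] \<pi>(2) that in auto)
 obtain p v x0 where p: "prime_elt ?R p" "\<pi> p = 0" "v ` X \<subseteq> k" "x0 \<in> X" "v x0 \<noteq> 0"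
  "\<And>a. a \<in> gen_alg k (dbase X v x0) \<Longrightarrow> dvd_in ?R p a \<Longrightarrow> a = 0"
  using monic_prime_elt[OF k_sf k_inf X(2) rhom_subset[OF \<pi>(1) RB] \<pi>(3) r0] by metis
 obtain ph where ph: "\<phi> ph = p" using p(1) RB by (auto simp: prime_elt_def)
 have phP: "ph \<in> P" using p(2) ph \<pi>(2) pointD(3)[OF \<psi>(1)] by metis
 obtain P1 where P1: "prime_ideal P1" "P0 \<subseteq> P1" "P1 \<subseteq> P" "ph \<in> P1" "\<And>a. \<phi> a \<in> ?R \<Longrightarrow> a \<in> P1 \<longleftrightarrow> dvd_in ?R p (\<phi> a)"
  using going_down[OF \<phi>(1) X(2,1,3) p(1) P(1) _ ph phP] P(2) by blast
 have "ph \<notin> P0" using pointD(3)[OF \<phi>(1), of ph] ph p(1) by (auto simp: prime_elt_def)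
 then have ne: "P0 \<subset> P1" using P1 by blast
 obtain \<phi>1 where \<phi>1: "point \<phi>1 P1" "range \<phi>1 \<subseteq> acl (range \<iota>)" using point_ex[OF P1(1)] .
 obtain \<pi>1 where \<pi>1: "rhom (range \<phi>) \<pi>1" "\<And>a. \<pi>1 (\<phi> a) = \<phi>1 a" "\<And>c. c \<in> k \<Longrightarrow> \<pi>1 c = c"
  by (rule point_factor[OF \<phi>(1) \<phi>1(1) P1(2)]) (rule that)
 let ?Y = "dbase X v x0"
 have Y: "indep k ?Y" "card ?Y = card X - 1"
  using dbase_indep[OF k_sf X(2) p(3-5)] indep_subset[of k "insert (dcoord v x0) ?Y" ?Y] by auto
 have YR: "gen_alg k ?Y \<subseteq> ?R"
  using dbase_filt[OF k_sf X(2) p(3-5)] filt_subset_ga[OF k_sr, of X 1] ga_base(1)[of k X] by (intro ga_least R) auto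
 \<comment> \<open>The base coordinates survive in \<open>A/P1\<close>, since \<open>p\<close>
   divides no nonzero polynomial in them.\<close>
 have inj: "z = 0" if z: "z \<in> gen_alg k ?Y" "\<pi>1 z = 0" for z
 proof -
  obtain a where a: "z = \<phi> a" using z YR RB by blast
  then have "a \<in> P1" using z(2) \<pi>1(2) pointD(3)[OF \<phi>1(1)] by simp
  moreover have "\<phi> a \<in> ?R" using a z(1) YR by auto
  ultimately have "dvd_in ?R p z" using P1(5)[of a] a by simp
  then show ?thesis using p(6)[OF z(1)] by simp
 qed
 have sub: "gen_alg k ?Y \<subseteq> range \<phi>" using YR RB by blast
 note im = indep_image[OF k_sr Y(1) rhom_subset[OF \<pi>1(1) sub] \<pi>1(3) inj]
 have c: "card (\<pi>1 ` ?Y) = card ?Y" by (rule card_image, rule inj_on_subset[OF im(2) ga_base(2)])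
 have sub1: "\<pi>1 ` ?Y \<subseteq> range \<phi>1"
 proof clarify
  fix y assume "y \<in> ?Y"
  then obtain a where "y = \<phi> a" using sub ga_base(2)[of ?Y k] by blast
  then show "\<pi>1 y \<in> range \<phi>1" using \<pi>1(2) by simp
 qed
 have "card X - 1 \<le> trdeg k (range \<phi>1)"
  using indep_le_trdeg[OF k_sr im(1) sub1 point_fin[OF \<phi>1(1)]] unfolding c Y(2) .
 then have "pdim P0 \<le> pdim P1 + 1" unfolding pdim[OF \<phi>1(1)] pdim[OF \<phi>(1)] trdeg_eq[OF k_sr X(4)] by linarith
 then show thesis by (rule that[OF P1(1) ne P1(3)])
qed

lemma chain_ex:
 assumes "prime_ideal P0" "prime_ideal P" "P0 \<subseteq> P"
 shows "\<exists>m f. (\<forall>i\<le>m. prime_ideal (f i)) \<and> (\<forall>i<m. f i \<subset> f (Suc i)) \<and> f 0 = P0 \<and> f m = P \<and> pdim P0 \<le> pdim P + m"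
 using assms
proof (induction "pdim P0" arbitrary: P0 rule: less_induct)
 case less
 show ?case
 proof (cases "P0 = P")
  case True
  then show ?thesis using less.prems by (intro exI[of _ 0] exI[of _ "\<lambda>_. P"]) auto
 next
  case False
  then obtain P1 where P1: "prime_ideal P1" "P0 \<subset> P1" "P1 \<subseteq> P" "pdim P0 \<le> pdim P1 + 1"
   using chain_step[OF less.prems(1,2)] less.prems(3) by blast
  obtain m f where f: "\<forall>i\<le>m. prime_ideal (f i)" "\<forall>i<m. f i \<subset> f (Suc i)" "f 0 = P1" "f m = P" "pdim P1 \<le> pdim P + m"
   using less.hyps[OF pdim_less[OF less.prems(1) P1(1,2)] P1(1) less.prems(2) P1(3)] by blast
  let ?f = "\<lambda>i. case i of 0 \<Rightarrow> P0 | Suc j \<Rightarrow> f j"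
  have "\<forall>i\<le>Suc m. prime_ideal (?f i)" using f(1) less.prems(1) by (auto split: nat.splits)
  moreover have "\<forall>i<Suc m. ?f i \<subset> ?f (Suc i)" using f(2,3) P1(2) by (auto split: nat.splits)
  ultimately show ?thesis using f P1(4) by (intro exI[of _ "Suc m"] exI[of _ ?f]) auto
 qed
qed

lemma prime_zero: "prime_ideal {0::'a}"
proof -
 have "(UNIV :: 'a set) \<noteq> {0}" by (metis UNIV_I singletonD zero_neq_one)
 then show ?thesis unfolding prime_ideal_def is_ideal_def by auto
qed

text \<open>Each strict inclusion of primes lowers the dimension, which bounds the length of chains;
  chains whose steps lower it by at most one attain the bound. Height conditions can then be read as
  conditions on \<open>pdim\<close>.\<close>

lemma height_pdim:
 assumes P: "prime_ideal P"
 shows "height P = enat (pdim {0} - pdim P)" "pdim P \<le> pdim {0}"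
proof -
 have le: "pdim P \<le> pdim {0}" if "prime_ideal P" for P
 proof (cases "P = {0}")
  case False
  then have "{0} \<subset> P" using prime_idealD(1)[OF that] by blast
  then show ?thesis using pdim_less[OF prime_zero that] by simp
 qed simp
 have up: "n \<le> pdim {0} - pdim P" if f: "\<forall>i\<le>n. prime_ideal (f i)" "\<forall>i<n. f i \<subset> f (Suc i)" "f n = P" for n f
 proof -
  have "pdim (f i) + i \<le> pdim {0}" if "i \<le> n" for i using that
  proof (induction i)
   case 0
   then show ?case using f le by simp
  next
   case (Suc i)
   then have "pdim (f (Suc i)) < pdim (f i)" using f by (intro pdim_less) auto
   then show ?case using Suc by simp
  qed
  from this[of n] show ?thesis using f(3) by simp
 qed
 show "height P = enat (pdim {0} - pdim P)"
 proof (rule antisym)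
  show "height P \<le> enat (pdim {0} - pdim P)" unfolding height_def using up by (auto intro!: Sup_least)
  obtain m f where f: "\<forall>i\<le>m. prime_ideal (f i)" "\<forall>i<m. f i \<subset> f (Suc i)" "f m = P" "pdim {0} \<le> pdim P + m"
   using chain_ex[OF prime_zero P] prime_idealD(1)[OF P] by blast
  then have "enat m \<le> height P" unfolding height_def by (intro Sup_upper) blast
  moreover have "pdim {0} - pdim P \<le> m" using f(4) by simp
  ultimately show "enat (pdim {0} - pdim P) \<le> height P" by (meson enat_ord_simps(1) order_trans)
 qed
 show "pdim P \<le> pdim {0}" by (rule le[OF P])
qed

lemma height_succ:
 assumes "prime_ideal P" "prime_ideal Q" "P \<subseteq> Q"
 shows "height Q = height P + 1 \<longleftrightarrow> pdim P = pdim Q + 1"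
 using height_pdim[OF assms(1)] height_pdim[OF assms(2)] pdim_less[OF assms(1,2)] assms(3)
 by (cases "P = Q") (auto simp: one_enat_def)

end

lemma zero_ideal: "is_ideal {0::'a::comm_ring_1}"
 by (simp add: is_ideal_def)

text \<open>Homomorphisms extend along algebraic elements outside the zero set of one nonzero
  \<open>c\<close>. Each \<open>z\<close> contributes a factor that keeps the leading coefficient of
  its relation from vanishing.\<close>

lemma generic_extension:
 fixes D Z :: "'b::alg_closed_field set"
 assumes D: "subring_set D" and Z: "finite Z" "Z \<subseteq> acl D"
 shows "\<exists>c\<in>D. c \<noteq> 0 \<and> (\<forall>f :: 'b \<Rightarrow> 'b. rhom D f \<longrightarrow> f c \<noteq> 0 \<longrightarrow> (\<exists>g. rhom (gen_alg D Z) g \<and> (\<forall>d\<in>D. g d = f d)))"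
 using Z
proof (induction Z)
 case empty
 show ?case by (intro bexI[of _ 1]) (auto simp: ga_empty[OF D] intro: sr_one[OF D])
next
 case (insert z Z)
 then obtain c1 where c1: "c1 \<in> D" "c1 \<noteq> 0"
  "\<And>f :: 'b \<Rightarrow> 'b. rhom D f \<Longrightarrow> f c1 \<noteq> 0 \<Longrightarrow> \<exists>g. rhom (gen_alg D Z) g \<and> (\<forall>d\<in>D. g d = f d)" by auto
 let ?E = "gen_alg D Z"
 have E: "subring_set ?E" by (rule ga_subring[OF D])
 have DE: "D \<subseteq> ?E" by (rule ga_base)
 have EA: "?E \<subseteq> acl D" using insert.prems acl_base[OF D] by (intro ga_least sf_sr[OF acl_subfield[OF D]]) auto
 let ?P = "\<lambda>q. q \<in> polys ?E \<and> q \<noteq> 0 \<and> poly q z = 0"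
 obtain q0 where "q0 \<in> polys D" "q0 \<noteq> 0" "poly q0 z = 0"
  using insert.prems by (auto simp: acl_def algebraic_over_def)
 then have "?P q0" using polys_mono[OF DE] by blast
 then obtain q where q: "?P q" "\<And>h. ?P h \<Longrightarrow> degree q \<le> degree h"
  using ex_has_least_nat[of ?P q0 degree] by blast
 have qd: "degree q > 0" using q(1) by (cases "degree q = 0") (auto elim!: degree_eq_zeroE)
 define e where "e = lead_coeff q"
 have e: "e \<in> ?E" "e \<noteq> 0" using q(1) by (auto simp: e_def dest: polysD)
 \<comment> \<open>\<open>e\<close> lies only in the extended ring. Its relation over
   \<open>D\<close> has the nonzero constant term \<open>c2\<close>, and
   \<open>f c2 \<noteq> 0\<close> prevents the image of \<open>e\<close> from being 0.\<close>
 then obtain c2 p where c2: "c2 \<in> D" "c2 \<noteq> 0" "p \<in> polys D" "c2 + e * poly p e = 0"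
  using algebraic_nonzero_const[OF D, of e] EA by blast
 have "\<exists>g. rhom (gen_alg D (insert z Z)) g \<and> (\<forall>d\<in>D. g d = f d)" if f: "rhom D f" "f (c1 * c2) \<noteq> 0" for f :: "'b \<Rightarrow> 'b"
 proof -
  have f12: "f c1 \<noteq> 0" "f c2 \<noteq> 0" using f(2) rhom_mult[OF D f(1) c1(1) c2(1)] by auto
  obtain g where g: "rhom ?E g" "\<forall>d\<in>D. g d = f d" using c1(3)[OF f(1) f12(1)] by blast
  have pe: "poly p e \<in> ?E" using c2 polys_mono[OF DE] e by (intro po_eval[OF E]) auto
  have "g (c2 + e * poly p e) = g c2 + g e * g (poly p e)"
   using c2 DE e pe rhom_add[OF E g(1), of c2 "e * poly p e"] rhom_mult[OF E g(1), of e "poly p e"] sr_mult[OF E] by auto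
  then have "g e \<noteq> 0" using c2 f12 g(2) rhom_zero[OF E g(1)] by auto
  then obtain g' where g': "rhom (gen_alg ?E {z}) g'" "\<And>d. d \<in> ?E \<Longrightarrow> g' d = g d"
  proof (rule alg_hom_step[OF E g(1), of q "{0}" z, folded e_def, rotated 2])
   show "g (coeff h i) = 0" if "h \<in> polys ?E" "poly h z \<in> {0}" "degree h < degree q" for h i
    using q(2)[of h] that rhom_zero[OF E g(1)] by (cases "h = 0") auto
  qed (use q qd zero_ideal that in auto)
  moreover have "gen_alg ?E {z} = gen_alg D (insert z Z)" using ga_un[OF D, of Z "{z}"] by simp
  ultimately show ?thesis using g(2) DE by (intro exI[of _ g']) auto
 qed
 then show ?case using c1 c2 by (intro bexI[of _ "c1 * c2"]) (auto intro: sr_mult[OF D])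
qed

section \<open>Poisson primes of codimension one\<close>

definition derivation :: "('a::comm_ring_1 \<Rightarrow> 'a) \<Rightarrow> bool" where
 "derivation d \<longleftrightarrow> (\<forall>x y. d (x + y) = d x + d y \<and> d (x * y) = x * d y + d x * y)"

lemma derivation_add: "derivation d \<Longrightarrow> d (x + y) = d x + d y"
 and derivation_mult: "derivation d \<Longrightarrow> d (x * y) = x * d y + d x * y"
 by (auto simp: derivation_def)

lemma derivation_zero: "derivation d \<Longrightarrow> d 0 = 0"
 using derivation_add[of d 0 0] by simp

lemma derivation_one: "derivation d \<Longrightarrow> d 1 = 0"
 using derivation_mult[of d 1 1] by simp

lemma derivation_funpow_add: "derivation d \<Longrightarrow> (d ^^ n) (x + y) = (d ^^ n) x + (d ^^ n) y"
 by (induction n) (auto simp: derivation_add)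

text \<open>In the Leibniz expansion of order \<open>m + n\<close>, every term but the one with
  \<open>d^m x * d^n y\<close> has a factor in \<open>Q\<close>; in lower orders every term has
  one.\<close>

lemma leibniz_mod_prime:
 fixes d :: "'a::comm_ring_1 \<Rightarrow> 'a"
 assumes d: "derivation d" and Q: "prime_ideal Q"
  and x: "\<And>i. i < m \<Longrightarrow> (d ^^ i) x \<in> Q" and y: "\<And>j. j < n \<Longrightarrow> (d ^^ j) y \<in> Q"
 shows "(\<forall>s<m+n. (d ^^ s) (x * y) \<in> Q) \<and>
  (d ^^ (m + n)) (x * y) - of_nat ((m + n) choose m) * ((d ^^ m) x * (d ^^ n) y) \<in> Q"
 using x y
proof (induction "m + n" arbitrary: m n x y)
 case 0
 then show ?case using prime_idealD(1)[OF Q] by simp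
next
 case (Suc M)
 have step: "(d ^^ Suc s) (x * y) = (d ^^ s) (d x * y) + (d ^^ s) (x * d y)" for s
  unfolding funpow_Suc_right comp_def derivation_mult[OF d] derivation_funpow_add[OF d] by (simp add: add.commute)
 \<comment> \<open>The summand in which \<open>x\<close> has been differentiated once, so
   \<open>m\<close> drops by one. For \<open>m = 0\<close> the coefficient must be 0, whereas
   truncated subtraction in \<open>M choose (m - 1)\<close> would give 1.\<close>
 have A: "(\<forall>s<M. (d ^^ s) (d x * y) \<in> Q) \<and>
  (d ^^ M) (d x * y) - of_nat (if m = 0 then 0 else M choose (m - 1)) * ((d ^^ m) x * (d ^^ n) y) \<in> Q"
  if mn: "Suc M = m + n" and x: "\<And>i. i < m \<Longrightarrow> (d ^^ i) x \<in> Q" and y: "\<And>j. j < n \<Longrightarrow> (d ^^ j) y \<in> Q" for m n x y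
 proof (cases m)
  case 0
  then have n: "M = 0 + (n - 1)" "n = Suc (n - 1)" using mn by auto
  have y': "(d ^^ (n - 1)) y \<in> Q" using y[of "n - 1"] n(2) by linarith
  have IH: "(\<forall>s<0 + (n - 1). (d ^^ s) (d x * y) \<in> Q) \<and>
   (d ^^ (0 + (n - 1))) (d x * y) - of_nat ((0 + (n - 1)) choose 0) * ((d ^^ 0) (d x) * (d ^^ (n - 1)) y) \<in> Q"
   by (rule Suc.hyps(1)) (use n y in auto)
  have "((d ^^ M) (d x * y) - d x * (d ^^ (n - 1)) y) + d x * (d ^^ (n - 1)) y \<in> Q"
   using IH n(1) y' by (intro prime_idealD(3,4)[OF Q]) auto
  then show ?thesis using IH 0 n by auto
 next
  case (Suc m')
  then have M: "M = m' + n" using mn by simp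
  have "(\<forall>s<m' + n. (d ^^ s) (d x * y) \<in> Q) \<and>
   (d ^^ (m' + n)) (d x * y) - of_nat ((m' + n) choose m') * ((d ^^ m') (d x) * (d ^^ n) y) \<in> Q"
  proof (rule Suc.hyps(1)[OF M])
   show "(d ^^ i) (d x) \<in> Q" if "i < m'" for i
    using x[of "Suc i"] that Suc by (simp add: funpow_swap1)
  qed (use y in auto)
  then show ?thesis using M Suc by (simp add: funpow_swap1)
 qed
 \<comment> \<open>The other summand follows from \<open>A\<close> with \<open>x\<close> and
   \<open>y\<close> exchanged; since \<open>m + (n - 1) = M\<close>, its binomial coefficient can be
   written with \<open>m\<close>.\<close>
 have c: "(if n = 0 then 0 else M choose (n - 1)) = (if n = 0 then 0 else M choose m)"
  using Suc.hyps(2) binomial_symmetric[of m M] by (cases n) auto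
 have B: "(\<forall>s<M. (d ^^ s) (x * d y) \<in> Q) \<and>
  (d ^^ M) (x * d y) - of_nat (if n = 0 then 0 else M choose m) * ((d ^^ m) x * (d ^^ n) y) \<in> Q"
  using A[of n m y x, unfolded c mult.commute[of "d y"] mult.commute[of "(d ^^ n) y"]] Suc.hyps(2) Suc.prems by simp
 note A = A[OF Suc.hyps(2) Suc.prems]
 have "(d ^^ s) (x * y) \<in> Q" if s: "s < m + n" for s
 proof (cases s)
  case 0
  have "x \<in> Q \<or> y \<in> Q" using Suc.prems(1)[of 0] Suc.prems(2)[of 0] Suc.hyps(2) by (cases m) auto
  then show ?thesis using 0 prime_idealD(4,5)[OF Q] by auto
 next
  case (Suc s')
  then have "s' < M" using s Suc.hyps(2) by simp
  then show ?thesis unfolding Suc step using A B by (intro prime_idealD(3)[OF Q]) auto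
 qed
 moreover have "(d ^^ (m + n)) (x * y) - of_nat ((m + n) choose m) * ((d ^^ m) x * (d ^^ n) y) \<in> Q"
 proof -
  define w where "w = (d ^^ m) x * (d ^^ n) y"
  have ch: "((m + n) choose m) = (if m = 0 then 0 else M choose (m - 1)) + (if n = 0 then 0 else M choose m)"
   using Suc.hyps(2) by (cases m; cases n) auto
  have "(d ^^ (m + n)) (x * y) = (d ^^ M) (d x * y) + (d ^^ M) (x * d y)" using step[of M] Suc.hyps(2) by simp
  then have "(d ^^ (m + n)) (x * y) - of_nat ((m + n) choose m) * w =
   ((d ^^ M) (d x * y) - of_nat (if m = 0 then 0 else M choose (m - 1)) * w) +
   ((d ^^ M) (x * d y) - of_nat (if n = 0 then 0 else M choose m) * w)"
   unfolding ch of_nat_add by (simp only: algebra_simps)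
  also have "\<dots> \<in> Q" using A B unfolding w_def by (intro prime_idealD(3)[OF Q]) blast+
  finally show ?thesis by (simp add: w_def)
 qed
 ultimately show ?case by blast
qed

text \<open>For \<open>a\<close>, \<open>b\<close> outside, take the least orders \<open>m\<close>,
  \<open>n\<close> of derivatives that leave \<open>Q\<close>. Modulo \<open>Q\<close> the
  derivative of \<open>a * b\<close> of order \<open>m + n\<close> is a positive binomial
  coefficient times a product outside \<open>Q\<close>.\<close>

lemma prime_stable_core:
 fixes d :: "'a::comm_ring_1 \<Rightarrow> 'a"
 assumes d: "derivation d" and Q: "prime_ideal Q" and ch: "\<And>n. n > 0 \<Longrightarrow> of_nat n \<notin> Q"
 shows "prime_ideal {x. \<forall>n. (d ^^ n) x \<in> Q}"
 unfolding prime_ideal_def is_ideal_def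
proof (intro conjI ballI allI impI)
 let ?J = "{x. \<forall>n. (d ^^ n) x \<in> Q}"
 have "(d ^^ n) 0 = 0" for n by (induction n) (auto simp: derivation_zero[OF d])
 then show "0 \<in> ?J" using prime_idealD(1)[OF Q] by simp
 show "x + y \<in> ?J" if "x \<in> ?J" "y \<in> ?J" for x y
  using that prime_idealD(3)[OF Q] by (simp add: derivation_funpow_add[OF d])
 show "a * x \<in> ?J" if x: "x \<in> ?J" for a x
 proof -
  have "(d ^^ n) (a * x) \<in> Q" for n
   using leibniz_mod_prime[OF d Q, of 0 a "Suc n" x] x by auto
  then show ?thesis by blast
 qed
 show "?J \<noteq> UNIV"
 proof
  assume "?J = UNIV"
  then have "(d ^^ 0) 1 \<in> Q" by blast
  then show False using prime_idealD(2)[OF Q] by simp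
 qed
 fix a b assume ab: "a * b \<in> ?J"
 show "a \<in> ?J \<or> b \<in> ?J"
 proof (rule ccontr)
  assume "\<not> ?thesis"
  then have ex: "\<exists>n. (d ^^ n) a \<notin> Q" "\<exists>n. (d ^^ n) b \<notin> Q" by auto
  define m n where "m = (LEAST n. (d ^^ n) a \<notin> Q)" and "n = (LEAST n. (d ^^ n) b \<notin> Q)"
  have mn: "(d ^^ m) a \<notin> Q" "(d ^^ n) b \<notin> Q" unfolding m_def n_def
   using LeastI_ex[OF ex(1)] LeastI_ex[OF ex(2)] by simp_all
  have "(d ^^ i) a \<in> Q" if "i < m" for i using not_less_Least[of i "\<lambda>n. (d ^^ n) a \<notin> Q"] that by (auto simp: m_def)
  moreover have "(d ^^ i) b \<in> Q" if "i < n" for i using not_less_Least[of i "\<lambda>n. (d ^^ n) b \<notin> Q"] that by (auto simp: n_def)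
  ultimately have "(d ^^ (m + n)) (a * b) - of_nat ((m + n) choose m) * ((d ^^ m) a * (d ^^ n) b) \<in> Q"
   using leibniz_mod_prime[OF d Q, of m a n b] by blast
  moreover have "(d ^^ (m + n)) (a * b) \<in> Q" using ab by blast
  ultimately have "of_nat ((m + n) choose m) * ((d ^^ m) a * (d ^^ n) b) \<in> Q"
   using prime_ideal_diff[OF Q, of "(d ^^ (m + n)) (a * b)"] by fastforce
  then show False using mn ch[of "(m + n) choose m"] prime_idealD(6)[OF Q] by (meson le_add1 zero_less_binomial)
 qed
qed

section \<open>Finiteness implies rationality\<close>

lemma poisson_derivation: "poisson_bracket K br \<Longrightarrow> derivation (\<lambda>x. br x y)"
 by (simp add: poisson_bracket_def derivation_def)

lemma poisson_skew:
 assumes "poisson_bracket K br"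
 shows "br y x = - br x y"
proof -
 have A: "\<And>x y z. br (x + y) z = br x z + br y z" "\<And>x y z. br x (y + z) = br x y + br x z" "\<And>x. br x x = 0"
  using assms by (simp_all add: poisson_bracket_def)
 have "br x y + br y x = 0" using A(3)[of "x + y", unfolded A(1,2)] A(3)[of x] A(3)[of y] by (simp add: add.commute)
 then show ?thesis by (simp add: eq_neg_iff_add_eq_0 add.commute)
qed

context affine_domain
begin

lemma of_nat_notin_prime:
 assumes "prime_ideal (P :: 'a set)" "of_nat n \<noteq> (0::'a)"
 shows "of_nat n \<notin> P"
 using prime_inter_K[OF assms(1)] sr_of_nat[OF K_sr, of n] assms(2) by blast

text \<open>\<open>loc\<close> says that \<open>u / b\<close> is central modulo \<open>P\<close>.
  For a Hamiltonian derivation \<open>d\<close>, the largest \<open>d\<close>-stable ideal inside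
  \<open>Q\<close> is a prime that contains \<open>P\<close> and \<open>u\<close>. By the
  codimension hypothesis it cannot be smaller than \<open>Q\<close>.\<close>

lemma minimal_imp_poisson:
 assumes br: "poisson_bracket K br" and ch: "\<And>n. n > 0 \<Longrightarrow> of_nat n \<noteq> (0::'a)"
  and P: "poisson_prime br P" and Q: "prime_ideal Q" "P \<subseteq> Q" "pdim P = pdim Q + 1"
  and b: "b \<notin> Q" and u: "u \<in> Q" "u \<notin> P" and loc: "\<And>y. b * br u y - u * br b y \<in> P"
 shows "poisson_prime br Q"
 unfolding poisson_prime_def
proof (intro conjI ballI allI Q(1))
 fix x y assume x: "x \<in> Q"
 define d where "d x = br x y" for x
 have d: "derivation d" unfolding d_def by (rule poisson_derivation[OF br])
 let ?J = "{x. \<forall>n. (d ^^ n) x \<in> Q}"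
 have J: "prime_ideal ?J" by (rule prime_stable_core[OF d Q(1)]) (use of_nat_notin_prime[OF Q(1)] ch in blast)
 have PP: "prime_ideal P" using P by (simp add: poisson_prime_def)
 have dP: "(d ^^ n) z \<in> P" if "z \<in> P" for z n
  using that P by (induction n) (auto simp: d_def poisson_prime_def)
 have JQ: "?J \<subseteq> Q"
 proof
  fix z assume "z \<in> ?J"
  then have "(d ^^ 0) z \<in> Q" by blast
  then show "z \<in> Q" by simp
 qed
 have PJ: "P \<subseteq> ?J" using dP Q(2) by blast
 text \<open>Modulo \<open>P\<close>, each \<open>b^n d^n u\<close> is a multiple of \<open>u\<close>.\<close>
 have "\<exists>e. b ^ n * (d ^^ n) u - u * e \<in> P" for n
 proof (induction n)
  case 0
  then show ?case using prime_idealD(1)[OF PP] by (intro exI[of _ 1]) simp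
 next
  case (Suc n)
  then obtain e where e: "b ^ n * (d ^^ n) u - u * e \<in> P" by blast
  define v where "v = (d ^^ n) u"
  have "\<exists>w. d (b ^ n) * b = b ^ n * w"
  proof (induction n)
   case 0
   then show ?case by (simp add: derivation_one[OF d])
  next
   case (Suc n)
   then obtain w where "d (b ^ n) * b = b ^ n * w" by blast
   then have "d (b ^ Suc n) * b = b ^ Suc n * (w + d b)"
    by (simp add: derivation_mult[OF d] distrib_left distrib_right)
   then show ?case by blast
  qed
  then obtain w where w: "d (b ^ n) * b = b ^ n * w" by blast
  have dm: "d (p - q) = d p - d q" for p q
   using derivation_add[OF d, of "p - q" q] by (simp add: algebra_simps)
  have p1: "d (b ^ n * v - u * e) \<in> P" using P e unfolding v_def d_def poisson_prime_def by blast
  have p2: "b * d u - u * d b \<in> P" using loc[of y] by (simp add: d_def)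
  have p3: "b ^ n * v - u * e \<in> P" using e by (simp add: v_def)
  have "b ^ Suc n * d v - u * (e * d b + b * d e - w * e) =
   b * d (b ^ n * v - u * e) - w * (b ^ n * v - u * e) + e * (b * d u - u * d b)"
  proof -
   have "w * b ^ n = b * d (b ^ n)" using w by (simp add: mult.commute)
   then show ?thesis unfolding dm derivation_mult[OF d] by (simp add: algebra_simps)
  qed
  also have "\<dots> \<in> P"
   by (rule prime_idealD(3)[OF PP prime_ideal_diff[OF PP prime_idealD(4)[OF PP p1] prime_idealD(4)[OF PP p3]] prime_idealD(4)[OF PP p2]])
  finally show ?case by (auto simp: v_def)
 qed
 then have "(d ^^ n) u \<in> Q" for n
 proof -
  obtain e where "b ^ n * (d ^^ n) u - u * e \<in> P" using \<open>\<And>n. \<exists>e. b ^ n * (d ^^ n) u - u * e \<in> P\<close> by blast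
  then have "(b ^ n * (d ^^ n) u - u * e) + u * e \<in> Q" using Q(2) u by (intro prime_idealD(3,5)[OF Q(1)]) auto
  then have "b ^ n * (d ^^ n) u \<in> Q" by simp
  then show ?thesis using prime_idealD(6)[OF Q(1)] prime_ideal_power[OF Q(1)] b by blast
 qed
 then have "u \<in> ?J" by blast
 then have "P \<subset> ?J" using PJ u by blast
 then have "pdim ?J < pdim P" by (rule pdim_less[OF PP J])
 then have "\<not> pdim Q < pdim ?J" using Q(3) by simp
 then have "\<not> ?J \<subset> Q" using pdim_less[OF J Q(1)] by blast
 then have "?J = Q" using JQ by blast
 then have "(d ^^ 1) x \<in> Q" using x by blast
 then show "br x y \<in> Q" by (simp add: d_def)
qed

text \<open>Extend \<open>\<phi> a / \<phi> b\<close> to a transcendence basis. Sending it to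
  \<open>l\<close> in \<open>K\<close> and fixing the rest of the basis extends to
  \<open>A/P\<close> outside a finite set of \<open>l\<close>, and the kernel has dimension one
  less. One \<open>Q\<close> serves at most one \<open>l\<close>, since two would put
  \<open>b\<close> into \<open>Q\<close>.\<close>

lemma infinitely_many_codim_one:
 assumes \<phi>: "point \<phi> P" and b: "b \<notin> P" and tr: "\<phi> a / \<phi> b \<notin> acl k"
 shows "infinite {Q. prime_ideal Q \<and> P \<subseteq> Q \<and> pdim P = pdim Q + 1 \<and> b \<notin> Q \<and> (\<exists>l\<in>K. a - l * b \<in> Q \<and> a - l * b \<notin> P)}"
  (is "infinite ?Q")
proof -
 note h = UNIV_sr pointD(1)[OF \<phi>]
 define f where "f = \<phi> a / \<phi> b"
 have fb: "\<phi> b \<noteq> 0" using b pointD(3)[OF \<phi>] by simp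
 let ?B = "range \<phi>"
 let ?E = "insert f ?B"
 have clB: "?B \<subseteq> alg_cl k (\<phi> ` S)" "finite (\<phi> ` S)" using point_fin[OF \<phi>] by auto
 have fcl: "f \<in> alg_cl k (\<phi> ` S)" unfolding f_def using clB by (intro sf_divide[OF cl_subfield[OF k_sr]]) auto
 have E: "?E \<subseteq> alg_cl k (\<phi> ` S)" using clB fcl by blast
 have if1: "indep k {f}" using tr by (simp add: indep_def alg_cl_def ga_empty[OF k_sr] f_def)
 obtain Y where Y: "{f} \<subseteq> Y" "tbasis k Y ?E"
  by (rule tbasis_extend[OF k_sr if1 _ clB(2) E]) (use that in auto)
 obtain X where X: "tbasis k X ?B" "card X = trdeg k ?B" using trdeg_basis[OF k_sr clB(2,1)] .
 have "tbasis k X ?E" unfolding tbasis_def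
 proof (intro conjI)
  have "alg_cl k X \<supseteq> alg_cl k (\<phi> ` S)" using X(1) by (intro cl_least[OF k_sr]) (auto simp: tbasis_def)
  then show "?E \<subseteq> alg_cl k X" using E by blast
 qed (use X(1) in \<open>auto simp: tbasis_def\<close>)
 then have cY: "card Y = pdim P" using tbasis_card[OF k_sr Y(2)] X(2) pdim[OF \<phi>] by simp
 have iY: "indep k Y" using Y(2) by (simp add: tbasis_def)
 define W where "W = Y - {f}"
 have W: "Y = insert f W" "f \<notin> W" "W \<subseteq> ?B" "finite W" using Y indep_finite[OF iY] by (auto simp: W_def tbasis_def)
 let ?D = "gen_alg k Y" and ?DW = "gen_alg k W"
 have D: "subring_set ?D" and D0: "subring_set ?DW" by (auto intro: ga_subring k_sr)
 \<comment> \<open>The inverse of \<open>\<phi> b\<close> is included so that the extended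
   homomorphism cannot kill \<open>\<phi> b\<close>.\<close>
 let ?Z = "insert (inverse (\<phi> b)) (\<phi> ` S)"
 have ZA: "?Z \<subseteq> acl ?D"
 proof -
  have B: "?B \<subseteq> acl ?D" using Y(2) by (auto simp: tbasis_def alg_cl_def)
  then show ?thesis using sf_inverse[OF acl_subfield[OF D], of "\<phi> b"] by auto
 qed
 obtain c where c: "c \<in> ?D" "c \<noteq> 0"
  "\<And>g :: 'b \<Rightarrow> 'b. rhom ?D g \<Longrightarrow> g c \<noteq> 0 \<Longrightarrow> \<exists>g'. rhom (gen_alg ?D ?Z) g' \<and> (\<forall>d\<in>?D. g' d = g d)"
  using generic_extension[OF D _ ZA] clB(2) by auto
 obtain hc where hc: "hc \<in> polys ?DW" "c = poly hc f" using c(1) W(1) ga_insert[OF k_sr, of f W] by auto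
 have "hc \<noteq> 0" using c(2) hc by auto
 then have fin: "finite {l. poly hc l = 0}" by (rule poly_roots_finite)
 let ?L = "{l \<in> K. poly hc (\<iota> l) \<noteq> 0}"
 have "infinite ?L"
 proof
  assume "finite ?L"
  moreover have "k \<subseteq> \<iota> ` ?L \<union> {l. poly hc l = 0}" by auto
  ultimately show False using k_inf fin finite_subset by blast
 qed
 have "\<exists>Q. Q \<in> ?Q \<and> a - l * b \<in> Q" if l: "l \<in> ?L" for l
 proof -
  have lk: "\<iota> l \<in> k" using l by blast
  obtain g where g: "rhom ?D g" "\<And>c. c \<in> k \<Longrightarrow> g c = c" "\<And>y. y \<in> Y \<Longrightarrow> g y = (if y = f then \<iota> l else y)"
   by (rule rhom_extend_indep[OF k_sr iY rhom_id, of "\<lambda>y. if y = f then \<iota> l else y"]) (rule that)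
  have sub: "?DW \<subseteq> ?D" using W(1) by (intro ga_mono) auto
  have gid: "g x = x" if "x \<in> ?DW" for x
   by (rule rhom_eq_on_ga[OF k_sr rhom_subset[OF g(1) sub] rhom_id _ that]) (use g(2,3) W in auto)
  have "g c = poly (map_poly g hc) (g f)" unfolding hc(2)
   using hc(1) polys_mono[OF sub] W(1) gen_alg.base_S[of f Y k] by (intro mp_eval[OF D g(1)]) auto
  also have "map_poly g hc = hc" using hc(1) gid by (intro poly_eqI) (auto simp: rhom_map_coeff[OF D g(1)] dest: polysD)
  also have "g f = \<iota> l" using g(3) W(1) by auto
  finally have "g c \<noteq> 0" using l by simp
  then obtain g' where g': "rhom (gen_alg ?D ?Z) g'" "\<forall>d\<in>?D. g' d = g d" using c(3)[OF g(1)] by blast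
  let ?G = "gen_alg ?D ?Z"
  have G: "subring_set ?G" by (rule ga_subring[OF D])
  have DG: "?D \<subseteq> ?G" "?Z \<subseteq> ?G" by (rule ga_base)+
  have BG: "?B \<subseteq> ?G" unfolding pointD(7)[OF \<phi>] using DG ga_base(1)[of k Y] by (intro ga_least G) auto
  have g'k: "g' c = c" if "c \<in> k" for c using that g' g(2) ga_base(1)[of k Y] by auto
  define \<psi> where "\<psi> x = g' (\<phi> x)" for x
  define Q where "Q = {x. \<psi> x = 0}"
  have "rhom UNIV \<psi>"
  proof (rule rhomI)
   show "\<psi> 1 = 1" using rhom_one[OF h] rhom_one[OF G g'(1)] by (simp add: \<psi>_def)
   show "\<psi> (x + y) = \<psi> x + \<psi> y" "\<psi> (x * y) = \<psi> x * \<psi> y" for x y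
    using rhom_add[OF h, of x y] rhom_mult[OF h, of x y] BG rhom_add[OF G g'(1), of "\<phi> x" "\<phi> y"] rhom_mult[OF G g'(1), of "\<phi> x" "\<phi> y"]
    by (auto simp: \<psi>_def)
  qed
  then have \<psi>: "point \<psi> Q" unfolding point_def Q_def using pointD(2)[OF \<phi>] g'k by (auto simp: \<psi>_def)
  note Qp = pointD(8)[OF \<psi>]
  have PQ: "P \<subseteq> Q"
  proof
   fix x assume "x \<in> P"
   then have "\<phi> x = 0" using pointD(3)[OF \<phi>] by simp
   then show "x \<in> Q" using rhom_zero[OF G g'(1)] by (simp add: Q_def \<psi>_def)
  qed
  have "g' (\<phi> b) * g' (inverse (\<phi> b)) = 1"
   using rhom_mult[OF G g'(1), of "\<phi> b" "inverse (\<phi> b)"] BG DG fb rhom_one[OF G g'(1)] by auto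
  then have bQ: "b \<notin> Q" by (auto simp: Q_def \<psi>_def)
  have fG: "f \<in> ?G" using DG(1) gen_alg.base_S[of f Y k] W(1) by auto
  have "g' f = \<iota> l" using g'(2) g(3)[of f] W(1) gen_alg.base_S[of f Y k] by auto
  moreover have "\<phi> a = f * \<phi> b" using fb by (simp add: f_def)
  ultimately have "\<psi> a = \<iota> l * \<psi> b" using rhom_mult[OF G g'(1) fG, of "\<phi> b"] BG by (auto simp: \<psi>_def)
  moreover have "\<psi> (l * b) = \<iota> l * \<psi> b" using rhom_mult[OF UNIV_sr pointD(1)[OF \<psi>], of l b] pointD(2)[OF \<psi>, of l] l by simp
  ultimately have uQ: "a - l * b \<in> Q" using point_diff[OF \<psi>, of a "l * b"] by simp
  have uP: "a - l * b \<notin> P"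
  proof
   assume "a - l * b \<in> P"
   then have "\<phi> a = \<iota> l * \<phi> b" using point_diff[OF \<phi>, of a "l * b"] rhom_mult[OF h, of l b] pointD(2)[OF \<phi>, of l] l by auto
   then have "f = \<iota> l" using fb by (simp add: f_def)
   then show False using tr lk acl_base[OF k_sr] by (auto simp: f_def)
  qed
  have "W \<subseteq> range \<psi>"
  proof
   fix w assume w: "w \<in> W"
   then obtain x where "w = \<phi> x" using W(3) by blast
   moreover have "g' w = w" using g'(2) g(3)[of w] w W gen_alg.base_S[of w Y k] by auto
   ultimately show "w \<in> range \<psi>" unfolding \<psi>_def by (metis rangeI)
  qed
  moreover have "indep k W" using indep_subset[OF iY] W(1) by blast
  ultimately have "card W \<le> pdim Q" using indep_le_trdeg[OF k_sr _ _ point_fin[OF \<psi>]] pdim[OF \<psi>] by simp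
  moreover have "card Y = Suc (card W)" using W by simp
  moreover have "pdim Q < pdim P" using pdim_less[OF pointD(8)[OF \<phi>] Qp] PQ uQ uP by blast
  ultimately have "pdim P = pdim Q + 1" using cY by simp
  moreover have "\<exists>l\<in>K. a - l * b \<in> Q \<and> a - l * b \<notin> P" using uQ uP l by blast
  ultimately have "Q \<in> ?Q" using Qp PQ bQ by simp
  then show ?thesis using uQ by (intro exI conjI)
 qed
 then have Lex: "\<exists>Q. Q \<in> ?Q \<and> a - l * b \<in> Q" if "l \<in> ?L" for l using that .
 have LQ: "?L \<subseteq> (\<Union>Q\<in>?Q. {l \<in> K. a - l * b \<in> Q})"
 proof
  fix l assume l: "l \<in> ?L"
  from Lex[OF l] obtain Q where Q: "Q \<in> ?Q" "a - l * b \<in> Q" by (elim exE conjE)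
  show "l \<in> (\<Union>Q\<in>?Q. {l \<in> K. a - l * b \<in> Q})" by (rule UN_I[OF Q(1)]) (use Q(2) l in simp)
 qed
 have fQ: "finite {l \<in> K. a - l * b \<in> Q}" if "Q \<in> ?Q" for Q
 proof -
  have Q: "prime_ideal Q" "b \<notin> Q" using that by simp_all
  have eq: "l = m" if "l \<in> K" "m \<in> K" "a - l * b \<in> Q" "a - m * b \<in> Q" for l m
  proof -
   have "(l - m) * b \<in> Q" using prime_ideal_diff[OF Q(1) that(4,3)] by (simp add: algebra_simps)
   then have "l - m \<in> K \<inter> Q" using prime_idealD(6)[OF Q(1)] Q(2) sr_diff[OF K_sr that(1,2)] by blast
   then show ?thesis using prime_inter_K[OF Q(1)] by simp
  qed
  show ?thesis
  proof (cases "\<exists>m \<in> K. a - m * b \<in> Q")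
   case True
   then obtain m where "m \<in> K" "a - m * b \<in> Q" ..
   then have "{l \<in> K. a - l * b \<in> Q} \<subseteq> {m}" using eq[of _ m] by blast
   then show ?thesis by (rule finite_subset) simp
  next
   case False
   then have "{l \<in> K. a - l * b \<in> Q} = {}" by blast
   then show ?thesis by (simp only: finite.emptyI)
  qed
 qed
 show ?thesis
 proof
  assume "finite ?Q"
  then have "finite (\<Union>Q\<in>?Q. {l \<in> K. a - l * b \<in> Q})" by (rule finite_UN_I) (rule fQ)
  from finite_subset[OF LQ this] \<open>infinite ?L\<close> show False by (rule notE[rotated])
 qed
qed

lemma algebraic_imp_frac_algebraic:
 assumes \<phi>: "point \<phi> P" and b: "b \<notin> P" and al: "\<phi> a / \<phi> b \<in> acl k"
 shows "frac_algebraic K P (a, b)"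
proof -
 note h = UNIV_sr pointD(1)[OF \<phi>]
 have fb: "\<phi> b \<noteq> 0" using b pointD(3)[OF \<phi>] by simp
 obtain q where q: "q \<in> polys k" "q \<noteq> 0" "poly q (\<phi> a / \<phi> b) = 0" using al by (auto simp: acl_def algebraic_over_def)
 have inj: "inj \<iota>" using \<iota>_inj by (intro injI)
 define p where "p = map_poly (inv_into UNIV \<iota>) q"
 have i0: "inv_into UNIV \<iota> 0 = 0" using inv_into_f_f[OF inj, of 0] rhom_zero[OF UNIV_sr \<iota>(1)] by simp
 have co: "coeff p i \<in> K" "\<iota> (coeff p i) = coeff q i" for i
 proof -
  obtain c where "c \<in> K" "coeff q i = \<iota> c" using polysD[OF q(1)] by blast
  then show "coeff p i \<in> K" "\<iota> (coeff p i) = coeff q i" using inv_into_f_f[OF inj] by (simp_all add: p_def coeff_map_poly i0)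
 qed
 have deg: "degree p = degree q" unfolding p_def
  by (rule map_poly_degree_eq) (use co(2)[of "degree q"] q(2) in \<open>metis coeff_map_poly i0 leading_coeff_0_iff p_def rhom_zero[OF UNIV_sr \<iota>(1)]\<close>)
 have "\<phi> (\<Sum>i\<le>degree p. coeff p i * a ^ i * b ^ (degree p - i)) = (\<Sum>i\<le>degree p. coeff q i * \<phi> a ^ i * \<phi> b ^ (degree p - i))"
  using co pointD(2)[OF \<phi>] by (simp add: rhom_sum[OF h] rhom_mult[OF h] rhom_power[OF h])
 also have "\<dots> = (\<Sum>i\<le>degree p. \<phi> b ^ degree p * (coeff q i * (\<phi> a / \<phi> b) ^ i))"
 proof (intro sum.cong refl)
  fix i assume "i \<in> {..degree p}"
  then have "\<phi> b ^ degree p = \<phi> b ^ (degree p - i) * \<phi> b ^ i" by (simp flip: power_add)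
  then show "coeff q i * \<phi> a ^ i * \<phi> b ^ (degree p - i) = \<phi> b ^ degree p * (coeff q i * (\<phi> a / \<phi> b) ^ i)"
   using fb by (simp add: power_divide)
 qed
 also have "\<dots> = \<phi> b ^ degree p * poly q (\<phi> a / \<phi> b)" by (simp add: poly_altdef deg sum_distrib_left)
 finally have "(\<Sum>i\<le>degree p. coeff p i * a ^ i * b ^ (degree p - i)) \<in> P" using q(3) pointD(3)[OF \<phi>] by simp
 moreover have "p \<noteq> 0" using q(2) co(2)[of "degree q"] rhom_zero[OF UNIV_sr \<iota>(1)] by auto
 ultimately show ?thesis unfolding frac_algebraic_def
  using co(1) by (intro exI[of _ p]) (auto simp: frac_eq_def frac_poly_eval_def)
qed

lemma frac_algebraic_imp_algebraic:
 assumes \<phi>: "point \<phi> P" and b: "b \<notin> P" and al: "frac_algebraic K P (a, b)"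
 shows "\<phi> a / \<phi> b \<in> acl k"
proof -
 note h = UNIV_sr pointD(1)[OF \<phi>]
 have fb: "\<phi> b \<noteq> 0" using b pointD(3)[OF \<phi>] by simp
 obtain p where p: "p \<noteq> 0" "\<And>i. coeff p i \<in> K" "(\<Sum>i\<le>degree p. coeff p i * a ^ i * b ^ (degree p - i)) \<in> P"
  using al by (auto simp: frac_algebraic_def frac_eq_def frac_poly_eval_def)
 define q where "q = map_poly \<iota> p"
 have cq: "coeff q i = \<iota> (coeff p i)" for i by (simp add: q_def rhom_map_coeff[OF UNIV_sr \<iota>(1)])
 have dq: "degree q = degree p" unfolding q_def using p(1) \<iota>(2)[of "lead_coeff p"] by (intro map_poly_degree_eq) auto
 have "0 = \<phi> (\<Sum>i\<le>degree p. coeff p i * a ^ i * b ^ (degree p - i))" using p(3) pointD(3)[OF \<phi>] by simp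
 also have "\<dots> = (\<Sum>i\<le>degree p. coeff q i * \<phi> a ^ i * \<phi> b ^ (degree p - i))"
  using cq p(2) pointD(2)[OF \<phi>] by (simp add: rhom_sum[OF h] rhom_mult[OF h] rhom_power[OF h])
 also have "\<dots> = (\<Sum>i\<le>degree p. \<phi> b ^ degree p * (coeff q i * (\<phi> a / \<phi> b) ^ i))"
 proof (intro sum.cong refl)
  fix i assume "i \<in> {..degree p}"
  then have "\<phi> b ^ degree p = \<phi> b ^ (degree p - i) * \<phi> b ^ i" by (simp flip: power_add)
  then show "coeff q i * \<phi> a ^ i * \<phi> b ^ (degree p - i) = \<phi> b ^ degree p * (coeff q i * (\<phi> a / \<phi> b) ^ i)"
   using fb by (simp add: power_divide)
 qed
 also have "\<dots> = \<phi> b ^ degree p * poly q (\<phi> a / \<phi> b)" by (simp add: poly_altdef dq sum_distrib_left)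
 finally have "poly q (\<phi> a / \<phi> b) = 0" using fb by simp
 moreover have "q \<in> polys k" using p(2) cq by (intro polysI) auto
 moreover have "q \<noteq> 0" using p(1) cq[of "degree p"] \<iota>(2)[of "lead_coeff p"] by auto
 ultimately show ?thesis by (auto simp: acl_def algebraic_over_def)
qed

lemma finite_imp_rational:
 assumes br: "poisson_bracket K br" and ch: "\<And>n. n > 0 \<Longrightarrow> of_nat n \<noteq> (0::'a)"
  and P: "poisson_prime br P" and fin: "finite {Q. poisson_prime br Q \<and> P \<subseteq> Q \<and> height Q = height P + 1}"
 shows "poisson_rational K br P"
 unfolding poisson_rational_def
proof (rule ballI, rule ccontr)
 fix z assume z: "z \<in> frac_poisson_centre br P" "\<not> frac_algebraic K P z"
 obtain a b where ab: "z = (a, b)" by (cases z)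
 have PP: "prime_ideal P" using P by (simp add: poisson_prime_def)
 obtain \<phi> where \<phi>: "point \<phi> P" "range \<phi> \<subseteq> acl (range \<iota>)" using point_ex[OF PP] .
 have b: "b \<notin> P" using z(1) ab by (auto simp: frac_poisson_centre_def frac_elems_def)
 then have tr: "\<phi> a / \<phi> b \<notin> acl k" using algebraic_imp_frac_algebraic[OF \<phi>(1)] z(2) ab by blast
 have one: "br x 1 = 0" for x
  using derivation_one[OF poisson_derivation[OF br, of x]] poisson_skew[OF br, of x 1] by simp
 \<comment> \<open>The bracket of \<open>a / b\<close> with \<open>y / 1\<close> has this
   numerator.\<close>
 have central: "b * br a y - a * br b y \<in> P" for y
 proof -
  have "(y, 1) \<in> frac_elems P" using prime_idealD(2)[OF PP] by (simp add: frac_elems_def)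
  then have "frac_eq P (frac_br br (a, b) (y, 1)) (0, 1)" using z(1) ab unfolding frac_poisson_centre_def by blast
  then show ?thesis by (simp add: frac_eq_def frac_br_def one mult.commute)
 qed
 have "{Q. prime_ideal Q \<and> P \<subseteq> Q \<and> pdim P = pdim Q + 1 \<and> b \<notin> Q \<and> (\<exists>l\<in>K. a - l * b \<in> Q \<and> a - l * b \<notin> P)}
  \<subseteq> {Q. poisson_prime br Q \<and> P \<subseteq> Q \<and> height Q = height P + 1}"
 proof clarify
  fix Q l assume Q: "prime_ideal Q" "P \<subseteq> Q" "pdim P = pdim Q + 1" "b \<notin> Q" and l: "l \<in> K" "a - l * b \<in> Q" "a - l * b \<notin> P"
  \<comment> \<open>Brackets are linear over \<open>K\<close>, so replacing \<open>a\<close> by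
    \<open>a - l * b\<close> does not change the expression.\<close>
  have loc: "b * br (a - l * b) y - (a - l * b) * br b y \<in> P" for y
  proof -
   have "br ((a - l * b) + l * b) y = br (a - l * b) y + l * br b y"
    using br l(1) unfolding poisson_bracket_def by metis
   then have e: "br (a - l * b) y = br a y - l * br b y" by (simp add: algebra_simps)
   have "b * br (a - l * b) y - (a - l * b) * br b y = b * br a y - a * br b y"
    unfolding e by (simp add: right_diff_distrib left_diff_distrib mult_ac)
   then show ?thesis using central[of y] by simp
  qed
  have "poisson_prime br Q" by (rule minimal_imp_poisson[OF br ch P Q l(2,3) loc])
  then show "poisson_prime br Q \<and> P \<subseteq> Q \<and> height Q = height P + 1" using Q height_succ[OF PP Q(1,2)] by blast
 qed
 then show False using infinitely_many_codim_one[OF \<phi>(1) b tr] fin finite_subset by blast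
qed

end

section \<open>Derivations of fields\<close>

definition deriv_on :: "'a::comm_ring_1 set \<Rightarrow> ('a \<Rightarrow> 'a) \<Rightarrow> bool" where
 "deriv_on E d \<longleftrightarrow> (\<forall>x\<in>E. \<forall>y\<in>E. d (x + y) = d x + d y \<and> d (x * y) = x * d y + d x * y)"

lemma deriv_on_UNIV: "deriv_on UNIV d = derivation d"
 by (simp add: deriv_on_def derivation_def)

lemma chain_mem: "subset.chain A C \<Longrightarrow> G \<in> C \<Longrightarrow> G \<in> A"
 and chain_total: "subset.chain A C \<Longrightarrow> G \<in> C \<Longrightarrow> H \<in> C \<Longrightarrow> G \<subseteq> H \<or> H \<subseteq> G"
 by (auto simp: subset.chain_def)

text \<open>The value at \<open>(z, w)\<close> of the total differential of a polynomial.\<close>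

definition pdiff :: "('a::idom \<Rightarrow> 'a) \<Rightarrow> 'a \<Rightarrow> 'a \<Rightarrow> 'a poly \<Rightarrow> 'a" where
 "pdiff d z w h = poly (map_poly d h) z + poly (pderiv h) z * w"

context
 fixes E :: "'a::idom set" and d :: "'a \<Rightarrow> 'a"
 assumes E: "subring_set E" and d: "deriv_on E d"
begin

lemma don_add: "x \<in> E \<Longrightarrow> y \<in> E \<Longrightarrow> d (x + y) = d x + d y"
 and don_mult: "x \<in> E \<Longrightarrow> y \<in> E \<Longrightarrow> d (x * y) = x * d y + d x * y"
 using d by (auto simp: deriv_on_def)

lemma don_zero: "d 0 = 0"
proof -
 have "d 0 + 0 = d 0 + d 0" using don_add[OF sr_zero[OF E] sr_zero[OF E]] by (simp only: add_0_right)
 then show ?thesis by (metis add_left_imp_eq)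
qed

lemma don_sum: "(\<And>i. i \<in> I \<Longrightarrow> f i \<in> E) \<Longrightarrow> d (sum f I) = (\<Sum>i\<in>I. d (f i))"
 by (induction I rule: infinite_finite_induct) (auto simp: don_zero don_add sr_sum[OF E])

lemma pdiff_add: "p \<in> polys E \<Longrightarrow> q \<in> polys E \<Longrightarrow> pdiff d z w (p + q) = pdiff d z w p + pdiff d z w q"
proof -
 assume "p \<in> polys E" "q \<in> polys E"
 then have "map_poly d (p + q) = map_poly d p + map_poly d q"
  by (intro poly_eqI) (simp add: coeff_map_poly don_zero don_add polysD)
 then show ?thesis by (simp add: pdiff_def pderiv_add algebra_simps)
qed

lemma pdiff_mult: "p \<in> polys E \<Longrightarrow> q \<in> polys E \<Longrightarrow>
 pdiff d z w (p * q) = poly p z * pdiff d z w q + pdiff d z w p * poly q z"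
proof -
 assume p: "p \<in> polys E" and q: "q \<in> polys E"
 have "map_poly d (p * q) = p * map_poly d q + map_poly d p * q"
 proof (rule poly_eqI)
  fix n
  have "d (\<Sum>i\<le>n. coeff p i * coeff q (n - i)) = (\<Sum>i\<le>n. coeff p i * d (coeff q (n - i)) + d (coeff p i) * coeff q (n - i))"
   using p q by (subst don_sum) (auto simp: don_mult polysD intro!: sr_mult[OF E])
  then show "coeff (map_poly d (p * q)) n = coeff (p * map_poly d q + map_poly d p * q) n"
   by (simp add: coeff_map_poly don_zero coeff_mult sum.distrib)
 qed
 then show ?thesis by (simp add: pdiff_def pderiv_mult algebra_simps)
qed

lemma pdiff_const: "pdiff d z w [:c:] = d c"
proof -
 have "map_poly d [:c:] = [:d c:]"
  by (rule poly_eqI) (auto simp: coeff_map_poly don_zero coeff_pCons split: nat.splits)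
 then show ?thesis by (simp add: pdiff_def pderiv_pCons)
qed

lemma pdiff_X: "pdiff d z w [:0,1:] = w"
proof -
 have "d 1 + 0 = d 1 + d 1" using don_mult[OF sr_one[OF E] sr_one[OF E]] by (simp only: add_0_right mult_1_left mult_1_right)
 then have "d 1 = 0" by (metis add_left_imp_eq)
 then have "map_poly d [:0,1:] = 0"
  by (intro poly_eqI) (auto simp: coeff_map_poly don_zero coeff_pCons split: nat.splits)
 then show ?thesis by (simp add: pdiff_def pderiv_pCons)
qed

lemma deriv_adjoin:
 assumes wd: "\<And>h. h \<in> polys E \<Longrightarrow> poly h z = 0 \<Longrightarrow> pdiff d z w h = 0"
 obtains d' where "deriv_on (gen_alg E {z}) d'" "\<And>x. x \<in> E \<Longrightarrow> d' x = d x" "d' z = w"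
proof -
 define d' where "d' x = pdiff d z w (SOME h. h \<in> polys E \<and> poly h z = x)" for x
 have eval: "d' (poly h z) = pdiff d z w h" if h: "h \<in> polys E" for h
 proof -
  define h' where "h' = (SOME h'. h' \<in> polys E \<and> poly h' z = poly h z)"
  have h': "h' \<in> polys E" "poly h' z = poly h z"
   using someI[of "\<lambda>h'. h' \<in> polys E \<and> poly h' z = poly h z" h] h by (auto simp: h'_def)
  have hh: "h' - h \<in> polys E" using h h' by (auto intro: po_closed[OF E])
  have "pdiff d z w (h' - h) = 0" using h' hh by (intro wd) auto
  then have "pdiff d z w h' = pdiff d z w h" using pdiff_add[OF hh h, of z w] by simp
  then show ?thesis unfolding d'_def h'_def[symmetric] .
 qed
 have "d' x = d x" if "x \<in> E" for x
  using eval[of "[:x:]"] that by (auto simp: pdiff_const po_closed[OF E])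
 moreover have "d' z = w" using eval[of "[:0,1:]"] pdiff_X by (auto intro!: po_closed[OF E] sr_closed[OF E])
 moreover have "deriv_on (gen_alg E {z}) d'"
  unfolding ga_singleton[OF E] deriv_on_def
 proof (intro ballI conjI)
  fix x y assume "x \<in> (\<lambda>h. poly h z) ` polys E" "y \<in> (\<lambda>h. poly h z) ` polys E"
  then obtain p q where pq: "p \<in> polys E" "q \<in> polys E" "x = poly p z" "y = poly q z" by blast
  show "d' (x + y) = d' x + d' y" using eval[of "p + q"] eval[of p] eval[of q] pq
   by (simp add: pdiff_add po_closed[OF E])
  show "d' (x * y) = x * d' y + d' x * y" using eval[of "p * q"] eval[of p] eval[of q] pq
   by (simp add: pdiff_mult po_closed[OF E])
 qed
 ultimately show thesis by (intro that)
qed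

lemma deriv_poly:
 assumes d': "deriv_on E' d" "subring_set E'" "E \<subseteq> E'" and h: "h \<in> polys E" and z: "z \<in> E'"
 shows "d (poly h z) = pdiff d z (d z) h"
 using h
proof (induction h)
 case 0
 then show ?case by (simp add: pdiff_def don_zero)
next
 case (pCons a p)
 have a: "a \<in> E" using polysD[OF pCons.prems, of 0] by simp
 have p: "p \<in> polys E" by (rule polysI) (use polysD[OF pCons.prems, of "Suc _"] in simp)
 have pz: "poly p z \<in> E'" using p polys_mono[OF d'(3)] z by (intro po_eval[OF d'(2)]) auto
 have "pCons a p = [:a:] + [:0,1:] * p" by simp
 then have "pdiff d z (d z) (pCons a p) = pdiff d z (d z) [:a:] + pdiff d z (d z) ([:0,1:] * p)"
  using a p by (simp only: pdiff_add po_closed[OF E] sr_closed[OF E])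
 also have "\<dots> = d a + (z * pdiff d z (d z) p + d z * poly p z)"
  using p by (subst pdiff_mult) (auto simp: pdiff_const pdiff_X intro!: po_closed[OF E] sr_closed[OF E])
 also have "\<dots> = d (a + z * poly p z)"
  using d' a pz z pCons.IH[OF p] sr_mult[OF d'(2)] by (auto simp: deriv_on_def subset_iff)
 finally show ?case by simp
qed

end

context
 assumes ch: "\<And>n. n > 0 \<Longrightarrow> of_nat n \<noteq> (0::'b::alg_closed_field)"
begin

lemma pderiv_nz:
 assumes "degree (p :: 'b poly) > 0"
 shows "pderiv p \<noteq> 0" "degree (pderiv p) < degree p" "coeff (pderiv p) (degree p - 1) \<noteq> 0"
proof -
 have "coeff (pderiv p) (degree p - 1) = of_nat (degree p) * lead_coeff p"
  using assms by (simp add: coeff_pderiv)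
 then show "coeff (pderiv p) (degree p - 1) \<noteq> 0" using assms ch[of "degree p"] by auto
 then show "pderiv p \<noteq> 0" by auto
 have "coeff (pderiv p) i = 0" if "i \<ge> degree p" for i using that by (simp add: coeff_pderiv coeff_eq_0)
 then show "degree (pderiv p) < degree p" using \<open>pderiv p \<noteq> 0\<close>
  by (metis leading_coeff_0_iff not_le)
qed

text \<open>In characteristic zero the derivative of a relation of least degree is nonzero and of
  smaller degree, so it cannot vanish at \<open>z\<close>.\<close>

lemma minimal_relation:
 assumes E: "subring_set E" and z: "z \<in> acl (E :: 'b set)"
 obtains q where "q \<in> polys E" "q \<noteq> 0" "poly q z = 0" "degree q > 0" "poly (pderiv q) z \<noteq> 0"
  "\<And>h. h \<in> polys E \<Longrightarrow> poly h z = 0 \<Longrightarrow> degree h < degree q \<Longrightarrow> h = 0"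
proof -
 let ?P = "\<lambda>q. q \<in> polys E \<and> q \<noteq> 0 \<and> poly q z = 0"
 obtain q0 where "?P q0" using z by (auto simp: acl_def algebraic_over_def)
 then obtain q where q: "?P q" "\<And>h. ?P h \<Longrightarrow> degree q \<le> degree h"
  using ex_has_least_nat[of ?P q0 degree] by blast
 have d: "degree q > 0" using q(1) by (cases "degree q = 0") (auto elim!: degree_eq_zeroE)
 have m: "h = 0" if "h \<in> polys E" "poly h z = 0" "degree h < degree q" for h using q(2)[of h] that by auto
 have "poly (pderiv q) z \<noteq> 0" using m[of "pderiv q"] pderiv_nz[OF d] q(1) po_pderiv[OF E] by auto
 then show thesis using that[of q] q(1) d m by auto
qed

lemma deriv_algebraic_wd:
 assumes E: "subring_set E" and d: "deriv_on E d" and z: "z \<in> acl (E :: 'b set)"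
 obtains w where "\<And>h. h \<in> polys E \<Longrightarrow> poly h z = 0 \<Longrightarrow> pdiff d z w h = 0"
proof -
 obtain q where q: "q \<in> polys E" "q \<noteq> 0" "poly q z = 0" "degree q > 0" "poly (pderiv q) z \<noteq> 0"
  "\<And>h. h \<in> polys E \<Longrightarrow> poly h z = 0 \<Longrightarrow> degree h < degree q \<Longrightarrow> h = 0"
  by (rule minimal_relation[OF E z]) (rule that)
 \<comment> \<open>Implicit differentiation of \<open>q(z) = 0\<close> forces this value.\<close>
 define w where "w = - poly (map_poly d q) z / poly (pderiv q) z"
 have qw: "pdiff d z w q = 0" using q(5) by (simp add: pdiff_def w_def)
 show thesis
 proof (rule that[of w])
  fix h assume h: "h \<in> polys E" "poly h z = 0"
  obtain j u r where ur: "u \<in> polys E" "r \<in> polys E" "smult (lead_coeff q ^ j) h = q * u + r" "degree r < degree q"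
   using po_pseudo_div[OF E q(1) h(1) q(4)] by metis
  define c where "c = lead_coeff q ^ j"
  have c: "c \<in> E" "c \<noteq> 0" using q by (auto simp: c_def dest: polysD intro!: sr_power[OF E])
  have "poly r z = 0" using arg_cong[OF ur(3), of "\<lambda>p. poly p z"] q(3) h(2) by simp
  then have "r = 0" using q(6) ur by blast
  then have eq: "[:c:] * h = q * u" using ur(3) by (simp add: c_def)
  have cE: "[:c:] \<in> polys E" using c by (intro po_closed[OF E])
  have "pdiff d z w ([:c:] * h) = c * pdiff d z w h"
   using pdiff_mult[OF E d cE h(1), of z w] h(2) by simp
  moreover have "pdiff d z w (q * u) = 0" using pdiff_mult[OF E d q(1) ur(1), of z w] q(3) qw by simp
  ultimately show "pdiff d z w h = 0" using c eq by simp
 qed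
qed

text \<open>Zorn's lemma on graphs of derivations. The result lives on the whole field, so that
  later derivations are total maps that can be composed and combined freely.\<close>

lemma derivation_extend:
 fixes E0 :: "'b set"
 assumes E0: "subring_set E0" and d0: "deriv_on E0 d0"
 obtains d where "derivation d" "\<And>x. x \<in> E0 \<Longrightarrow> d x = d0 x"
proof -
 let ?G = "\<lambda>E d. {(x, d x) | x. x \<in> E}"
 let ?A = "{G. \<exists>E d. subring_set E \<and> deriv_on E d \<and> E0 \<subseteq> E \<and> (\<forall>x\<in>E0. d x = d0 x) \<and> G = ?G E (d :: 'b \<Rightarrow> 'b)}"
 have "\<exists>G\<in>?A. \<forall>H\<in>?A. G \<subseteq> H \<longrightarrow> H = G"
 proof (rule subset_Zorn_nonempty)
  have "?G E0 d0 \<in> ?A" unfolding mem_Collect_eq using E0 d0 by (intro exI[of _ E0] exI[of _ d0]) simp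
  then show "?A \<noteq> {}" by (metis empty_iff)
  fix C assume C: "C \<noteq> {}" "subset.chain ?A C"
  have mem: "\<exists>E d. subring_set E \<and> deriv_on E d \<and> E0 \<subseteq> E \<and> (\<forall>x\<in>E0. d x = d0 x) \<and> G = ?G E d" if "G \<in> C" for G
  proof -
   have "G \<in> ?A" by (rule chain_mem[OF C(2) that])
   then show ?thesis unfolding mem_Collect_eq .
  qed
  define E where "E = fst ` \<Union>C"
  define d where "d x = (THE y. (x, y) \<in> \<Union>C)" for x
  have common: "\<exists>G\<in>C. p \<in> G \<and> q \<in> G" if pq: "p \<in> \<Union>C" "q \<in> \<Union>C" for p q
  proof -
   obtain G H where GH: "G \<in> C" "p \<in> G" "H \<in> C" "q \<in> H" using pq by auto
   have "G \<subseteq> H \<or> H \<subseteq> G" by (rule chain_total[OF C(2) GH(1,3)])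
   then show ?thesis using GH by auto
  qed
  have uniq: "y = y'" if xy: "(x, y) \<in> \<Union>C" "(x, y') \<in> \<Union>C" for x y y'
  proof -
   obtain G where "G \<in> C" "(x, y) \<in> G" "(x, y') \<in> G" using common[OF xy] by auto
   then show ?thesis using mem[of G] by auto
  qed
  have d: "d x = y" if "(x, y) \<in> \<Union>C" for x y unfolding d_def using uniq that by (intro the_equality) auto
  have graph: "\<Union>C = ?G E d"
  proof (intro equalityI subsetI)
   fix p assume p: "p \<in> \<Union>C"
   then have "fst p \<in> E" by (auto simp: E_def)
   then show "p \<in> ?G E d" using p d[of "fst p" "snd p"] by (intro CollectI exI[of _ "fst p"]) auto
  next
   fix p assume "p \<in> ?G E d"
   then obtain x where x: "p = (x, d x)" "x \<in> E" by blast
   then obtain p' where "p' \<in> \<Union>C" "x = fst p'" unfolding E_def by blast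
   then have "(x, snd p') \<in> \<Union>C" by simp
   then show "p \<in> \<Union>C" using x(1) d by metis
  qed
  have pair: "\<exists>F e. subring_set F \<and> deriv_on F e \<and> x \<in> F \<and> y \<in> F \<and> (\<forall>z\<in>F. z \<in> E \<and> d z = e z)" if xy: "x \<in> E" "y \<in> E" for x y
  proof -
   have "(x, d x) \<in> \<Union>C" "(y, d y) \<in> \<Union>C" using xy graph by auto
   from common[OF this] obtain G where G: "G \<in> C" "(x, d x) \<in> G" "(y, d y) \<in> G" by (elim bexE conjE)
   obtain F e where F: "subring_set F" "deriv_on F e" "G = ?G F e" using mem[OF G(1)] by auto
   have "z \<in> E \<and> d z = e z" if "z \<in> F" for z
   proof -
    have "(z, e z) \<in> G" unfolding F(3) using that by auto
    then have "(z, e z) \<in> \<Union>C" by (rule UnionI[OF G(1)])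
    then show ?thesis using d by (force simp: E_def)
   qed
   then show ?thesis using F G by auto
  qed
  have "subring_set E"
  proof (rule subring_setI)
   obtain G where "G \<in> C" using C(1) by blast
   then obtain F e where F: "subring_set F" "G = ?G F e" using mem[OF \<open>G \<in> C\<close>] by auto
   then have "(1, e 1) \<in> G" using sr_one[OF F(1)] by auto
   then have "(1, e 1) \<in> \<Union>C" by (rule UnionI[OF \<open>G \<in> C\<close>])
   then show "1 \<in> E" by (force simp: E_def)
   fix x y assume "x \<in> E" "y \<in> E"
   from pair[OF this] obtain F where "subring_set F" "x \<in> F" "y \<in> F" "\<forall>z\<in>F. z \<in> E" by blast
   then show "x - y \<in> E" "x * y \<in> E" using sr_diff sr_mult by blast+
  qed
  moreover have "deriv_on E d" unfolding deriv_on_def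
  proof (intro ballI)
   fix x y assume "x \<in> E" "y \<in> E"
   from pair[OF this] obtain F e where F: "subring_set F" "deriv_on F e" "x \<in> F" "y \<in> F" "\<forall>z\<in>F. z \<in> E \<and> d z = e z" by blast
   then have "x + y \<in> F" "x * y \<in> F" using sr_add sr_mult by blast+
   then show "d (x + y) = d x + d y \<and> d (x * y) = x * d y + d x * y"
    using F by (simp add: deriv_on_def)
  qed
  moreover have "x \<in> E \<and> d x = d0 x" if x: "x \<in> E0" for x
  proof -
   obtain G where "G \<in> C" using C(1) by blast
   then obtain F e where "E0 \<subseteq> F" "\<forall>x\<in>E0. e x = d0 x" "G = ?G F e" using mem[OF \<open>G \<in> C\<close>] by auto
   then have "(x, d0 x) \<in> G" using x by force
   then have "(x, d0 x) \<in> \<Union>C" by (rule UnionI[OF \<open>G \<in> C\<close>])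
   then show ?thesis using d by (force simp: E_def)
  qed
  ultimately show "\<Union>C \<in> ?A" unfolding graph mem_Collect_eq by (intro exI[of _ E] exI[of _ d]) auto
 qed
 then obtain G where "G \<in> ?A" and max: "\<forall>H\<in>?A. G \<subseteq> H \<longrightarrow> H = G" ..
 from \<open>G \<in> ?A\<close> obtain E d where E: "subring_set E" "deriv_on E d" "E0 \<subseteq> E" "\<forall>x\<in>E0. d x = d0 x" "G = ?G E d"
  unfolding mem_Collect_eq by (elim exE conjE)
 have "z \<in> E" for z
 proof -
  have "\<exists>w. \<forall>h\<in>polys E. poly h z = 0 \<longrightarrow> pdiff d z w h = 0"
  proof (cases "z \<in> acl E")
   case True
   show ?thesis by (rule deriv_algebraic_wd[OF E(1,2) True]) blast
  next
   case False
   \<comment> \<open>A transcendental \<open>z\<close> may get any derivative; 0 is chosen.\<close>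
   have "pdiff d z 0 h = 0" if "h \<in> polys E" "poly h z = 0" for h
    using transc_poly_eq[OF False that] by (simp add: pdiff_def)
   then show ?thesis by (intro exI[of _ 0]) blast
  qed
  then obtain w where w: "\<And>h. h \<in> polys E \<Longrightarrow> poly h z = 0 \<Longrightarrow> pdiff d z w h = 0" by blast
  obtain d' where d': "deriv_on (gen_alg E {z}) d'" "\<And>x. x \<in> E \<Longrightarrow> d' x = d x"
   by (rule deriv_adjoin[OF E(1,2) w]) (auto intro: that)
  let ?E = "gen_alg E {z}"
  have sub: "E \<subseteq> ?E" by (rule ga_base)
  have "?G ?E d' \<in> ?A" using d' E ga_subring[OF E(1)] sub by (intro CollectI exI[of _ ?E] exI[of _ d']) auto
  moreover have "G \<subseteq> ?G ?E d'" unfolding E(5) using sub d'(2) by fastforce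
  ultimately have "?G ?E d' = G" using max[rule_format, of "?G ?E d'"] by simp
  then have "fst ` ?G ?E d' = fst ` ?G E d" using E(5) by simp
  moreover have "fst ` ?G F e = F" for F :: "'b set" and e :: "'b \<Rightarrow> 'b" by force
  ultimately have "?E = E" by simp
  then show "z \<in> E" using gen_alg.base_S[of z "{z}" E] by simp
 qed
 then have "E = UNIV" by blast
 then show thesis using that[of d] E by (simp add: deriv_on_UNIV)
qed

lemma derivation_zero_acl:
 assumes E: "subring_set (E :: 'b set)" and d: "derivation d" and z0: "\<And>x. x \<in> E \<Longrightarrow> d x = 0" and z: "z \<in> acl E"
 shows "d z = 0"
proof -
 obtain q where q: "q \<in> polys E" "poly q z = 0" "poly (pderiv q) z \<noteq> 0"
  by (rule minimal_relation[OF E z]) (rule that)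
 have dE: "deriv_on E d" "deriv_on UNIV d" using d by (auto simp: deriv_on_def derivation_def)
 have "d (poly q z) = pdiff d z (d z) q" by (rule deriv_poly[OF E dE _ _ q(1)]) (auto simp: subring_set_def)
 moreover have "map_poly d q = 0" using q(1) z0 by (intro poly_eqI) (auto simp: coeff_map_poly derivation_zero[OF d] dest: polysD)
 ultimately show ?thesis using q derivation_zero[OF d] by (simp add: pdiff_def)
qed

lemma partial_derivatives:
 assumes K: "subring_set K" and X: "indep K (X :: 'b set)"
 obtains pd where "\<And>x. x \<in> X \<Longrightarrow> derivation (pd x)" "\<And>x c. x \<in> X \<Longrightarrow> c \<in> K \<Longrightarrow> pd x c = 0"
  "\<And>x y. x \<in> X \<Longrightarrow> y \<in> X \<Longrightarrow> pd x y = (if y = x then 1 else 0)"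
proof -
 have "\<exists>d. derivation d \<and> (\<forall>c\<in>K. d c = 0) \<and> (\<forall>y\<in>X. d y = (if y = x then 1 else 0))" if x: "x \<in> X" for x
 proof -
  let ?E = "gen_alg K (X - {x})"
  have E: "subring_set ?E" by (rule ga_subring[OF K])
  have xt: "x \<notin> acl ?E" using X x by (auto simp: indep_def alg_cl_def)
  have z: "deriv_on ?E (\<lambda>_. 0)" by (simp add: deriv_on_def)
  obtain d' where d': "deriv_on (gen_alg ?E {x}) d'" "\<And>y. y \<in> ?E \<Longrightarrow> d' y = 0" "d' x = 1"
  proof (rule deriv_adjoin[OF E z, of x 1])
   fix h assume "h \<in> polys ?E" "poly h x = 0"
   then have "h = 0" using transc_poly_eq[OF xt] by blast
   then show "pdiff (\<lambda>_. 0) x 1 h = 0" by (simp add: pdiff_def)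
  qed (rule that)
  obtain d where d: "derivation d" "\<And>y. y \<in> gen_alg ?E {x} \<Longrightarrow> d y = d' y"
   by (rule derivation_extend[OF ga_subring[OF E] d'(1)]) (rule that)
  have "d y = 0" if "y \<in> ?E" for y using d(2)[of y] d'(2)[OF that] gen_alg.base_K[OF that] by auto
  moreover have "d x = 1" using d(2)[of x] d'(3) gen_alg.base_S[of x "{x}" ?E] by auto
  ultimately show ?thesis using d(1) by (intro exI[of _ d]) (auto intro: gen_alg.intros)
 qed
 then have "\<forall>x\<in>X. \<exists>d. derivation d \<and> (\<forall>c\<in>K. d c = 0) \<and> (\<forall>y\<in>X. d y = (if y = x then 1 else 0))" by blast
 from bchoice[OF this] obtain pd where
  pd: "\<forall>x\<in>X. derivation (pd x) \<and> (\<forall>c\<in>K. pd x c = 0) \<and> (\<forall>y\<in>X. pd x y = (if y = x then 1 else 0))" ..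
 show thesis by (rule that[of pd]) (use pd in auto)
qed

lemma derivation_comb:
 assumes "\<And>i. i \<in> I \<Longrightarrow> derivation (D i)"
 shows "derivation (\<lambda>x. \<Sum>i\<in>I. f i * D i x)"
 unfolding derivation_def using assms
 by (auto simp: derivation_add derivation_mult distrib_left sum.distrib sum_distrib_left sum_distrib_right mult_ac intro!: sum.cong)

lemma derivation_zero_cl:
 assumes K: "subring_set K" and d: "derivation d" "\<And>c. c \<in> K \<Longrightarrow> d c = 0" "\<And>x. x \<in> X \<Longrightarrow> d x = 0"
  and z: "z \<in> alg_cl K (X :: 'b set)"
 shows "d z = 0"
proof (rule derivation_zero_acl[OF ga_subring[OF K] d(1) _ z[unfolded alg_cl_def]])
 fix x assume "x \<in> gen_alg K X"
 then show "d x = 0"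
 proof induction
  case (neg x)
  then show ?case using derivation_add[OF d(1), of x "-x"] derivation_zero[OF d(1)] by simp
 qed (auto simp: d derivation_add derivation_mult)
qed

lemma derivation_minus: "derivation d1 \<Longrightarrow> derivation d2 \<Longrightarrow> derivation (\<lambda>x::'b. d1 x - d2 x)"
 by (auto simp: derivation_def algebra_simps)

lemma derivation_commutator: "derivation d1 \<Longrightarrow> derivation d2 \<Longrightarrow> derivation (\<lambda>x::'b. d1 (d2 x) - d2 (d1 x))"
 by (auto simp: derivation_def algebra_simps)

context
 fixes K X :: "'b set" and pd :: "'b \<Rightarrow> 'b \<Rightarrow> 'b"
 assumes K: "subring_set K" and fX: "finite X"
  and pd: "\<And>x. x \<in> X \<Longrightarrow> derivation (pd x)" "\<And>x c. x \<in> X \<Longrightarrow> c \<in> K \<Longrightarrow> pd x c = 0"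
  "\<And>x y. x \<in> X \<Longrightarrow> y \<in> X \<Longrightarrow> pd x y = (if y = x then 1 else 0)"
begin

text \<open>Both sides are derivations in \<open>z\<close> that kill \<open>K\<close> and agree on
  \<open>X\<close>, so they agree on everything algebraic over \<open>K[X]\<close>. The same
  argument, applied to a commutator, makes the partial derivatives commute.\<close>

lemma derivation_chain_rule:
 assumes d: "derivation d" "\<And>c. c \<in> K \<Longrightarrow> d c = 0" and z: "z \<in> alg_cl K X"
 shows "d z = (\<Sum>x\<in>X. d x * pd x z)"
proof -
 have "(\<lambda>z. d z - (\<Sum>x\<in>X. d x * pd x z)) z = 0"
 proof (rule derivation_zero_cl[OF K _ _ _ z])
  show "derivation (\<lambda>z. d z - (\<Sum>x\<in>X. d x * pd x z))" by (intro derivation_minus d derivation_comb pd)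
  fix x assume x: "x \<in> X"
  have "(\<Sum>y\<in>X. d y * pd y x) = (\<Sum>y\<in>X. if y = x then d x else 0)"
   using x pd(3) by (intro sum.cong) auto
  then show "d x - (\<Sum>y\<in>X. d y * pd y x) = 0" using fX x by simp
 qed (simp add: d pd)
 then show ?thesis by simp
qed

lemma pd_commute: "x \<in> X \<Longrightarrow> y \<in> X \<Longrightarrow> z \<in> alg_cl K X \<Longrightarrow> pd x (pd y z) = pd y (pd x z)"
proof -
 assume x: "x \<in> X" and y: "y \<in> X" and z: "z \<in> alg_cl K X"
 have "(\<lambda>z. pd x (pd y z) - pd y (pd x z)) z = 0"
  by (rule derivation_zero_cl[OF K derivation_commutator[OF pd(1)[OF x] pd(1)[OF y]] _ _ z])
   (use x y in \<open>auto simp: pd(2,3) derivation_zero[OF pd(1)] derivation_one[OF pd(1)]\<close>)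
 then show ?thesis by simp
qed

lemma pd_filt:
 assumes x: "x \<in> X" and z: "z \<in> filt K X n"
 shows "pd x z \<in> filt K X n" "n > 0 \<Longrightarrow> pd x z \<in> filt K X (n - 1)"
proof -
 \<comment> \<open>The clause for \<open>n = 0\<close> is needed in the induction because
   \<open>n - 1\<close> is truncated there.\<close>
 have "(n = 0 \<longrightarrow> pd x z = 0) \<and> pd x z \<in> filt K X (n - 1)" using z
 proof (induction rule: filt_induct[OF K, consumes 1, case_names const add gen])
  case (const c n)
  then show ?case by (simp add: pd(2)[OF x] filt_zero)
 next
  case (add a b n)
  then show ?case by (auto simp: derivation_add[OF pd(1)[OF x]] filt_add)
 next
  case (gen a b n)
  have "a * pd x b \<in> filt K X n"
  proof (cases n)
   case (Suc m)
   then show ?thesis using gen(3) filt_mult[OF K filt_gen[OF K gen(1), of 1], of "pd x b" m] by simp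
  qed (use gen(3) in \<open>simp add: filt_zero\<close>)
  moreover have "pd x a * b \<in> filt K X n" using gen(1,2) pd(3)[OF x gen(1)] by (auto simp: filt_zero)
  ultimately show ?case by (auto simp: derivation_mult[OF pd(1)[OF x]] filt_add)
 qed
 then show "n > 0 \<Longrightarrow> pd x z \<in> filt K X (n - 1)" "pd x z \<in> filt K X n" using filt_mono[of "n - 1" n] by auto
qed

end

section \<open>Primitive elements\<close>

lemma finite_ext_field:
 fixes F :: "'b set"
 assumes F: "subfield_set F" and a: "a \<in> acl F"
 shows "subfield_set (gen_alg F {a})"
 unfolding subfield_set_def
proof (intro conjI ballI)
 note Fs = sf_sr[OF F]
 show sr: "subring_set (gen_alg F {a})" by (rule ga_subring[OF Fs])
 fix x assume x: "x \<in> gen_alg F {a}"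
 show "inverse x \<in> gen_alg F {a}"
 proof (cases "x = 0")
  case False
  have "gen_alg F {a} \<subseteq> acl F" using a acl_base[OF Fs] by (intro ga_least sf_sr[OF acl_subfield[OF Fs]]) auto
  then obtain c p where cp: "c \<in> F" "c \<noteq> 0" "p \<in> polys F" "c + x * poly p x = 0"
   using algebraic_nonzero_const[OF Fs _ False] x by blast
  have "x * poly p x = - c" using cp(4) by (simp add: eq_neg_iff_add_eq_0 add.commute)
  then have "inverse x = - (poly p x * inverse c)" using cp(2) False by (simp add: field_simps)
  also have "\<dots> \<in> gen_alg F {a}"
   using cp x polys_mono[OF ga_base(1)[of F "{a}"]] sf_inverse[OF F cp(1)]
   by (intro sr_uminus[OF sr] sr_mult[OF sr] po_eval[OF sr]) (auto intro: gen_alg.base_K)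
  finally show ?thesis .
 qed (use sr_zero[OF sr] in simp)
qed

text \<open>If \<open>v\<close> had a conjugate \<open>v'\<close> over \<open>F(u + c v)\<close>, then \<open>c\<close> would be \<open>(u' - u)/(v - v')\<close> for conjugates
of \<open>u\<close> and \<open>v\<close>, which leaves finitely many bad \<open>c\<close>.\<close>

lemma primitive_pair:
 fixes F K :: "'b set"
 assumes F: "subfield_set F" and K: "K \<subseteq> F" "infinite K" and u: "u \<in> acl F" and v: "v \<in> acl F"
 obtains c where "c \<in> K" "u \<in> gen_alg F {u + c * v}" "v \<in> gen_alg F {u + c * v}"
proof -
 note Fs = sf_sr[OF F]
 obtain pu where pu: "minpoly F u pu" using minpoly_ex[OF F u] .
 obtain pv where pv: "minpoly F v pv" using minpoly_ex[OF F v] .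
 define bad where "bad = (\<lambda>(u', v'). (u' - u) / (v - v')) ` ({x. poly pu x = 0} \<times> {x. poly pv x = 0})"
 have "finite bad" unfolding bad_def using minpolyD(4)[OF pu] minpolyD(4)[OF pv] by (intro finite_imageI finite_cartesian_product poly_roots_finite)
 then have "\<not> K \<subseteq> bad" using K(2) finite_subset by metis
 then obtain c where c: "c \<in> K" "c \<notin> bad" by blast
 let ?a = "u + c * v"
 have aA: "?a \<in> acl F" using u v c K(1) acl_base[OF Fs]
  by (intro sr_add sr_mult sf_sr[OF acl_subfield[OF Fs]]) auto
 let ?L = "gen_alg F {?a}"
 have L: "subfield_set ?L" by (rule finite_ext_field[OF F aA])
 note Ls = sf_sr[OF L]
 have FL: "F \<subseteq> ?L" by (rule ga_base)
 have aL: "?a \<in> ?L" by (simp add: gen_alg.base_S)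
 have vL: "v \<in> acl ?L" using v acl_mono[OF FL] by blast
 obtain m where m: "minpoly ?L v m" using minpoly_ex[OF L vL] .
 have roots: "w = v" if w: "poly m w = 0" for w
 proof (rule ccontr)
  assume ne: "w \<noteq> v"
  obtain g where g: "rhom (gen_alg ?L {v}) g" "\<And>x. x \<in> ?L \<Longrightarrow> g x = x" "g v = w"
  proof (rule rhom_adjoin[OF Ls rhom_id, of v w])
   fix h assume "h \<in> polys ?L" "poly h v = 0"
   then obtain q where "h = m * q" using minpoly_dvd[OF m Ls order_refl minpolyD(1)[OF m]] by blast
   moreover have "map_poly (\<lambda>x. x) h = h" by (rule poly_eqI) (simp add: coeff_map_poly)
   ultimately show "poly (map_poly (\<lambda>x. x) h) w = 0" using w by simp
  qed (rule that)
  let ?M = "gen_alg ?L {v}"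
  have M: "subring_set ?M" by (rule ga_subring[OF Ls])
  have LM: "?L \<subseteq> ?M" "v \<in> ?M" by (auto intro: gen_alg.intros)
  have cM: "c \<in> ?M" "g c = c" using c K(1) FL LM g(2) by auto
  have "u = ?a - c * v" by simp
  then have uM: "u \<in> ?M" using LM aL cM sr_diff[OF M] sr_mult[OF M] by (metis subsetD)
  have "g ?a = ?a" using g(2) aL by simp
  moreover have "g ?a = g u + c * w" using rhom_add[OF M g(1) uM sr_mult[OF M cM(1) LM(2)]] rhom_mult[OF M g(1) cM(1) LM(2)] cM g(3) by simp
  ultimately have e: "g u - u = c * (v - w)" by (simp add: algebra_simps)
  have im: "poly p (g x) = 0" if p: "p \<in> polys F" "poly p x = 0" and x: "x \<in> ?M" for p x
  proof -
   have "map_poly g p = p" using p(1) g(2) FL by (intro poly_eqI) (auto simp: rhom_map_coeff[OF M g(1)] dest: polysD)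
   then show ?thesis using mp_eval[OF M g(1), of p x] p polys_mono[OF FL] polys_mono[OF LM(1)] x rhom_zero[OF M g(1)] by auto
  qed
  have "poly pu (g u) = 0" "poly pv w = 0"
   using im[OF minpolyD(1,3)[OF pu] uM] im[OF minpolyD(1,3)[OF pv] LM(2)] g(3) by auto
  moreover have "c = (g u - u) / (v - w)" using e ne by simp
  ultimately have "c \<in> bad" unfolding bad_def by force
  then show False using c by simp
 qed
 obtain A where A: "size A = degree m" "m = smult (lead_coeff m) (\<Prod>x\<in>#A. [:-x, 1:])"
  using alg_closed_imp_factorization[of m] minpolyD(4)[OF m] by blast
 have mA: "m = (\<Prod>x\<in>#A. [:-x, 1:])" using A(2) minpolyD(2)[OF m] by simp
 have "x = v" if "x \<in># A" for x using roots[of x] that mA by (auto simp: poly_prod_mset)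
 then have Av: "A = replicate_mset (degree m) v" using A(1) set_mset_subset_singletonD[of A v] by auto
 have m1: "m = [:-v, 1:] ^ degree m" using mA Av by (metis image_replicate_mset prod_mset_replicate_mset)
 \<comment> \<open>\<open>m\<close> is a power of \<open>Y - v\<close>. With an exponent above one,
   its derivative would be a nonzero relation for \<open>v\<close> of smaller degree.\<close>
 have "degree m = 1"
 proof (rule ccontr)
  assume "degree m \<noteq> 1"
  then obtain j where j: "degree m = Suc (Suc j)" using minpolyD(5)[OF m] by (cases "degree m"; cases "degree m - 1") auto
  define q where "q = [:-v, 1:]"
  have "m = q * (q * q ^ j)" using m1 unfolding j q_def by (simp only: power_Suc)
  moreover have "poly q v = 0" by (simp add: q_def)
  ultimately have "poly (pderiv m) v = 0" by (simp add: pderiv_mult)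
  then have "pderiv m = 0" using minpolyD(6)[OF m, of "pderiv m"] pderiv_nz(2)[OF minpolyD(5)[OF m]] po_pderiv[OF Ls minpolyD(1)[OF m]] by blast
  then show False using pderiv_nz(1)[OF minpolyD(5)[OF m]] by blast
 qed
 then have "m = [:-v, 1:]" using m1 by simp
 then have "- v \<in> ?L" using polysD[OF minpolyD(1)[OF m], of 0] by simp
 then have vL': "v \<in> ?L" using sr_uminus[OF Ls] by force
 have "u = ?a - c * v" by simp
 then have "u \<in> ?L" using aL vL' c K(1) FL sr_diff[OF Ls] sr_mult[OF Ls] by (metis subsetD)
 then show thesis using that[of c] c vL' by blast
qed

lemma primitive_element:
 fixes F K :: "'b set"
 assumes F: "subfield_set F" and K: "subring_set K" "K \<subseteq> F" "infinite K" and U: "finite U" "U \<subseteq> acl F"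
 obtains a where "a \<in> gen_alg K U" "U \<subseteq> gen_alg F {a}"
proof -
 note Fs = sf_sr[OF F]
 have "\<exists>a. a \<in> gen_alg K U \<and> U \<subseteq> gen_alg F {a}" using U
 proof (induction U)
  case empty
  show ?case using sr_zero[OF ga_subring[OF K(1)]] by auto
 next
  case (insert v U)
  then obtain u where u: "u \<in> gen_alg K U" "U \<subseteq> gen_alg F {u}" by blast
  have "gen_alg K U \<subseteq> acl F" using insert.prems K(2) acl_base[OF Fs] by (intro ga_least sf_sr[OF acl_subfield[OF Fs]]) auto
  then have uA: "u \<in> acl F" and vA: "v \<in> acl F" using u insert.prems by auto
  obtain c where c: "c \<in> K" "u \<in> gen_alg F {u + c * v}" "v \<in> gen_alg F {u + c * v}"
   by (rule primitive_pair[OF F K(2,3) uA vA]) (rule that)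
  have "gen_alg F {u} \<subseteq> gen_alg F {u + c * v}" using c by (intro ga_least ga_subring Fs ga_base) auto
  moreover have "u + c * v \<in> gen_alg K (insert v U)"
   using u(1) c(1) ga_mono[of K K U "insert v U"] by (intro gen_alg.add gen_alg.mult) (auto intro: gen_alg.intros)
  ultimately show ?case using u(2) c(3) by blast
 qed
 then show thesis using that by blast
qed

end

text \<open>Gaussian elimination with fewer equations than unknowns. The solution must lie in the
  subfield \<open>C\<close>, which later is the base field in one application and the function field
  in another.\<close>

lemma linear_relation:
 fixes C :: "'a::field set"
 assumes C: "subfield_set C" and I: "finite I" and J: "finite J" "card I < card J" and a: "\<And>i j. i \<in> I \<Longrightarrow> j \<in> J \<Longrightarrow> a i j \<in> C"
 obtains c where "\<And>j. j \<in> J \<Longrightarrow> c j \<in> C" "\<exists>j\<in>J. c j \<noteq> 0" "\<And>i. i \<in> I \<Longrightarrow> (\<Sum>j\<in>J. c j * a i j) = 0"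
proof -
 note Cs = sf_sr[OF C]
 have "\<exists>c. (\<forall>j\<in>J. c j \<in> C) \<and> (\<exists>j\<in>J. c j \<noteq> 0) \<and> (\<forall>i\<in>I. (\<Sum>j\<in>J. c j * a i j) = 0)"
  using I J a
 proof (induction I arbitrary: J a)
  case empty
  then obtain j where "j \<in> J" by fastforce
  then show ?case by (intro exI[of _ "\<lambda>_. 1"]) (auto intro: sr_one[OF Cs])
 next
  case (insert i I)
  show ?case
  proof (cases "\<forall>j\<in>J. a i j = 0")
   case True
   have "card I < card J" using insert by simp
   then obtain c where "(\<forall>j\<in>J. c j \<in> C) \<and> (\<exists>j\<in>J. c j \<noteq> 0) \<and> (\<forall>i\<in>I. (\<Sum>j\<in>J. c j * a i j) = 0)"
    using insert.IH[of J a] insert.prems by auto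
   then show ?thesis using True by (intro exI[of _ c]) auto
  next
   case False
   then obtain j0 where j0: "j0 \<in> J" "a i j0 \<noteq> 0" by blast
   let ?J = "J - {j0}"
   define a' where "a' i' j = a i' j - a i' j0 * (a i j / a i j0)" for i' j
   have "a' i' j \<in> C" if "i' \<in> I" "j \<in> ?J" for i' j unfolding a'_def
    using that j0 insert.prems(3) by (intro sr_diff[OF Cs] sr_mult[OF Cs] sf_divide[OF C]) auto
   moreover have "card I < card ?J" using insert j0 by simp
   ultimately obtain c where c: "\<forall>j\<in>?J. c j \<in> C" "\<exists>j\<in>?J. c j \<noteq> 0" "\<forall>i'\<in>I. (\<Sum>j\<in>?J. c j * a' i' j) = 0"
    using insert.IH[of ?J a'] insert.prems(1) by auto
   define s where "s = (\<Sum>j\<in>?J. c j * (a i j / a i j0))"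
   have sC: "s \<in> C" unfolding s_def using c(1) j0 insert.prems(3)
    by (intro sr_sum[OF Cs] sr_mult[OF Cs] sf_divide[OF C]) auto
   let ?c = "c(j0 := - s)"
   have split: "(\<Sum>j\<in>J. ?c j * f j) = - s * f j0 + (\<Sum>j\<in>?J. c j * f j)" for f
    using insert.prems(1) j0(1) by (subst sum.remove[of J j0]) (auto intro!: sum.cong)
   have "(\<Sum>j\<in>J. ?c j * a i' j) = 0" if "i' \<in> insert i I" for i'
   proof (cases "i' = i")
    case True
    have "s * a i j0 = (\<Sum>j\<in>?J. c j * a i j)" using j0(2) by (simp add: s_def sum_distrib_right)
    then show ?thesis unfolding split True by simp
   next
    case False
    then have "(\<Sum>j\<in>?J. c j * a' i' j) = 0" using c(3) that by blast
    moreover have "(\<Sum>j\<in>?J. c j * a' i' j) = (\<Sum>j\<in>?J. c j * a i' j) - s * a i' j0"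
     by (simp add: a'_def s_def right_diff_distrib sum_subtractf sum_distrib_left sum_distrib_right mult_ac)
    ultimately show ?thesis unfolding split by simp
   qed
   moreover have "\<forall>j\<in>J. ?c j \<in> C" using c(1) sC sr_uminus[OF Cs] by auto
   moreover have "\<exists>j\<in>J. ?c j \<noteq> 0" using c(2) by auto
   ultimately show ?thesis by blast
  qed
 qed
 then show thesis using that by blast
qed

section \<open>The conductor bound\<close>

lemma clear_denominators:
 assumes R: "subring_set (R :: 'a::field set)" and h: "h \<in> polys (fracs R)"
 obtains e where "e \<in> R" "e \<noteq> 0" "smult e h \<in> polys R"
proof -
 have "\<exists>c\<in>R. c \<noteq> 0 \<and> c * coeff h i \<in> R" for i
 proof -
  obtain x y where "x \<in> R" "y \<in> R" "y \<noteq> 0" "coeff h i = x / y" using fracsE[OF polysD[OF h] R] by metis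
  then show ?thesis by (intro bexI[of _ y]) auto
 qed
 then obtain e where e: "e \<in> R" "e \<noteq> 0" "\<And>i. i \<in> {..degree h} \<Longrightarrow> e * coeff h i \<in> R"
  using common_denominator[OF R, of "{..degree h}" "\<lambda>x. x \<in> R" "coeff h"] sr_mult[OF R] by blast
 have "e * coeff h i \<in> R" for i using e(3)[of i] sr_zero[OF R] by (cases "i \<le> degree h") (auto simp: coeff_eq_0)
 then have "smult e h \<in> polys R" by (intro polysI) simp
 then show thesis by (rule that[OF e(1,2)])
qed

context
 assumes ch: "\<And>n. n > 0 \<Longrightarrow> of_nat n \<noteq> (0::'b::alg_closed_field)"
begin

text \<open>A minimal polynomial is irreducible, so all its roots are conjugates with the same
  minimal polynomial.\<close>

lemma minpoly_root:
 assumes F: "subfield_set F" and f: "minpoly F y f" and r: "poly f r = (0::'b)"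
 shows "minpoly F r f"
 unfolding minpoly_def
proof (intro conjI ballI impI minpolyD(1,2)[OF f] r)
 note Fs = sf_sr[OF F]
 fix h assume h: "h \<in> polys F" "poly h r = 0"
 have "r \<in> acl F" using f r minpolyD(4)[OF f] by (auto simp: acl_def algebraic_over_def minpoly_def)
 then obtain g where g: "minpoly F r g" using minpoly_ex[OF F] by blast
 obtain u where u: "u \<in> polys F" "f = g * u"
  using minpoly_dvd[OF g Fs order_refl minpolyD(1)[OF g] minpolyD(1)[OF f] r] .
 have nz: "g \<noteq> 0" "u \<noteq> 0" using u minpolyD(4)[OF f] by auto
 then have d: "degree f = degree g + degree u" unfolding u(2) by (rule degree_mult_eq)
 have "poly g y = 0 \<or> poly u y = 0" using minpolyD(3)[OF f] u(2) by simp
 then have "degree g = degree f"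
 proof
  assume "poly g y = 0"
  then show ?thesis using minpolyD(6)[OF f minpolyD(1)[OF g]] nz d by force
 next
  assume "poly u y = 0"
  then show ?thesis using minpolyD(6)[OF f u(1)] nz d minpolyD(5)[OF g] by force
 qed
 then show "h = 0 \<or> degree f \<le> degree h" using g h by (auto simp: minpoly_def)
qed

lemma minpoly_separable:
 assumes F: "subfield_set F" and f: "minpoly F y f"
 shows "finite {r. poly f r = (0::'b)}" "card {r. poly f r = 0} = degree f" "f = (\<Prod>r | poly f r = 0. [:- r, 1:])"
  "\<And>r. poly f r = 0 \<Longrightarrow> poly (pderiv f) r \<noteq> 0"
proof -
 let ?A = "{r. poly f r = 0}"
 show fin: "finite ?A" using minpolyD(4)[OF f] by (rule poly_roots_finite)
 show sep: "poly (pderiv f) r \<noteq> 0" if "poly f r = 0" for r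
  using minpolyD(6)[OF minpoly_root[OF F f that], of "pderiv f"] pderiv_nz[OF ch minpolyD(5)[OF f]] po_pderiv[OF sf_sr[OF F] minpolyD(1)[OF f]] by blast
 obtain A where A: "size A = degree f" "f = smult (lead_coeff f) (\<Prod>x\<in>#A. [:-x, 1:])"
  using alg_closed_imp_factorization[of f] minpolyD(4)[OF f] by blast
 have fA: "f = (\<Prod>x\<in>#A. [:-x, 1:])" using A(2) minpolyD(2)[OF f] by simp
 have c1: "count A x \<le> 1" for x
 proof (rule ccontr)
  assume "\<not> count A x \<le> 1"
  then have "replicate_mset 2 x \<subseteq># A" using count_le_replicate_mset_subset_eq[of 2 A x] by simp
  then obtain B where B: "A = replicate_mset 2 x + B" by (metis subset_mset.add_diff_inverse)
  define q where "q = [:-x, 1:]"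
  have "f = q * (q * (\<Prod>x\<in>#B. [:-x, 1:]))" unfolding fA B q_def by (simp add: numeral_2_eq_2 del: mult_pCons_left)
  moreover have "poly q x = 0" by (simp add: q_def)
  ultimately have "poly f x = 0" "poly (pderiv f) x = 0" by (simp_all add: pderiv_mult)
  then show False using sep by blast
 qed
 have sA: "set_mset A = ?A" using fA by (auto simp: poly_prod_mset)
 have "A = mset_set ?A"
 proof (rule multiset_eqI)
  fix x show "count A x = count (mset_set ?A) x"
  proof (cases "x \<in># A")
   case True
   then have "x \<in> ?A" "count A x = 1" using sA c1[of x] count_greater_zero_iff[of A x] by (blast, linarith)
   then show ?thesis using fin by (simp only: count_mset_set)
  next
   case False
   have "count A x = 0" using False by (simp only: not_in_iff)
   moreover have "x \<notin> ?A" using False sA by blast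
   ultimately show ?thesis by (simp add: count_mset_set(3))
  qed
 qed
 then show "f = (\<Prod>r | poly f r = 0. [:- r, 1:])" "card ?A = degree f" using fA A(1)
  by (simp_all add: prod_unfold_prod_mset flip: size_mset_set)
qed

text \<open>The conductor of an order contains the derivative of the defining polynomial: the Lagrange
interpolation of \<open>\<tau> f'\<close> at the conjugates has integral coefficients.\<close>

lemma dedekind_conductor:
 assumes R: "normal_ring (R :: 'b set)" and f: "minpoly (fracs R) y f" "f \<in> polys R"
  and c: "c \<in> polys (fracs R)" "integral_over R (poly c y)"
 obtains G where "G \<in> polys R" "poly G y = poly (pderiv f) y * poly c y"
proof -
 let ?F = "fracs R"
 note Rs = normal_sr[OF R]
 have F: "subfield_set ?F" by (rule fracs_subfield[OF Rs])
 note Fs = sf_sr[OF F]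
 let ?A = "{r. poly f r = 0}"
 note sep = minpoly_separable[OF F f(1)]
 obtain u G where G: "u \<in> polys ?F" "G \<in> polys ?F" "c * pderiv f = f * u + G" "degree G < degree f"
  using po_monic_div[OF Fs minpolyD(1)[OF f(1)] _ minpolyD(5,2)[OF f(1)], of "c * pderiv f"]
   sr_mult[OF po_subring[OF Fs] c(1) po_pderiv[OF Fs minpolyD(1)[OF f(1)]]] by metis
 have Gr: "poly G r = poly c r * poly (pderiv f) r" if "poly f r = 0" for r
  using arg_cong[OF G(3), of "\<lambda>p. poly p r"] that by simp
 let ?I = "{z. integral_over R z}"
 have I: "subring_set ?I" by (rule integral_closure_subring[OF Rs])
 obtain q where q: "q \<in> polys R" "lead_coeff q = 1" "poly q (poly c y) = 0" using c(2) by (auto simp: integral_over_def)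
 have qF: "pcompose q c \<in> polys ?F"
  using q(1) polys_mono[OF fracs_base[OF Rs]] c(1) by (intro po_pcompose[OF Fs]) auto
 have "poly (pcompose q c) y = 0" using q by (simp add: poly_pcompose)
 then obtain v where "pcompose q c = f * v"
  using minpoly_dvd[OF f(1) Fs order_refl minpolyD(1)[OF f(1)] qF] by metis
 then have "poly (pcompose q c) r = 0" if "poly f r = 0" for r using that by simp
 then have cr: "poly c r \<in> ?I" if "poly f r = 0" for r
  using that q(1,2) by (auto simp: poly_pcompose integral_over_def)
 have ri: "r \<in> ?I" if "poly f r = 0" for r using that f(2) minpolyD(2)[OF f(1)] by (auto simp: integral_over_def)
 \<comment> \<open>At a root \<open>r\<close> all summands but the one of \<open>r\<close> vanish,
   and the remaining product is the derivative of \<open>f\<close> at \<open>r\<close>. Thus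
   \<open>G'\<close> and \<open>G\<close> agree at all roots.\<close>
 define G' where "G' = (\<Sum>r\<in>?A. smult (poly c r) (\<Prod>s\<in>?A - {r}. [:- s, 1:]))"
 have lin: "[:- s, 1:] \<in> polys ?I" if "poly f s = 0" for s
  by (intro po_pCons[OF I] sr_uminus[OF I ri[OF that]] sr_one[OF I] po_closed(2)[OF I])
 have G'I: "G' \<in> polys ?I" unfolding G'_def
 proof (intro sr_sum[OF po_subring[OF I]] po_smult[OF I] sr_prod[OF po_subring[OF I]])
  show "poly c r \<in> ?I" if "r \<in> ?A" for r using cr[of r] that by blast
  show "[:- s, 1:] \<in> polys ?I" if "s \<in> ?A - {r}" for r s using lin[of s] that by blast
 qed
 have pf: "pderiv f = (\<Sum>r\<in>?A. \<Prod>s\<in>?A - {r}. [:- s, 1:])"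
  by (subst sep(3)) (simp add: pderiv_prod pderiv_pCons)
 have G'r: "poly G' r = poly c r * poly (pderiv f) r" if r: "r \<in> ?A" for r
 proof -
  have z: "(\<Prod>s\<in>?A - {r'}. poly [:- s, 1:] r) = 0" if "r' \<in> ?A" "r' \<noteq> r" for r'
   using that r sep(1) by (auto intro!: prod_zero)
  have "poly G' r = poly c r * (\<Prod>s\<in>?A - {r}. poly [:- s, 1:] r)"
   unfolding G'_def poly_sum poly_smult poly_prod using z sep(1) r
   by (subst sum.remove[of _ r]) (auto intro!: sum.neutral)
  moreover have "poly (pderiv f) r = (\<Prod>s\<in>?A - {r}. poly [:- s, 1:] r)"
   unfolding pf poly_sum poly_prod using z sep(1) r by (subst sum.remove[of _ r]) (auto intro!: sum.neutral)
  ultimately show ?thesis by simp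
 qed
 have dG': "degree G' < degree f"
 proof -
  have "degree (smult (poly c r) (\<Prod>s\<in>?A - {r}. [:- s, 1:])) < degree f" if r: "r \<in> ?A" for r
  proof -
   have "degree (smult (poly c r) (\<Prod>s\<in>?A - {r}. [:- s, 1:])) \<le> degree (\<Prod>s\<in>?A - {r}. [:- s, 1:])" by (rule degree_smult_le)
   also have "\<dots> \<le> (\<Sum>s\<in>?A - {r}. degree [:- s, 1:])"
    using degree_prod_sum_le[of "?A - {r}" "\<lambda>s. [:- s, 1:]"] sep(1) by (simp add: o_def)
   also have "\<dots> = card (?A - {r})" by simp
   also have "\<dots> < card ?A" using sep(1) r by (intro card_Diff1_less)
   finally show ?thesis using sep(2) by simp
  qed
  then show ?thesis unfolding G'_def using minpolyD(5)[OF f(1)] by (intro degree_sum_less) auto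
 qed
 have "G = G'"
 proof (rule poly_eqI_degree[of ?A])
  show "poly G r = poly G' r" if "r \<in> ?A" for r using Gr[of r] G'r[OF that] that by simp
  show "degree G < card ?A" "degree G' < card ?A" using G(4) dG' sep(2) by auto
 qed
 \<comment> \<open>The coefficients are fractions because \<open>G\<close> is a remainder over the
   fraction field, and integral because they are those of \<open>G'\<close>; normality puts them
   into \<open>R\<close>.\<close>
 then have "G \<in> polys R" using G(2) G'I R by (auto simp: polys_def normal_ring_def)
 then show thesis using that[of G] Gr[OF minpolyD(3)[OF f(1)]] by (simp add: mult.commute)
qed

end

section \<open>Rees rings and degree bounds for the conductor\<close>

text \<open>Homogenization by a new variable \<open>T\<close>: the Rees ring of \<open>K[Y]\<close> records total degrees.\<close>

definition rees :: "'a::comm_ring_1 set \<Rightarrow> 'a set \<Rightarrow> 'a \<Rightarrow> 'a set" where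
 "rees K Y T = gen_alg K (insert T ((\<lambda>y. y * T) ` Y))"

lemma rees_sr: "subring_set K \<Longrightarrow> subring_set (rees K Y T)"
 unfolding rees_def by (rule ga_subring)

lemma rees_T: "T \<in> rees K Y T" and rees_K: "c \<in> K \<Longrightarrow> c \<in> rees K Y T" and rees_Y: "y \<in> Y \<Longrightarrow> y * T \<in> rees K Y T"
 unfolding rees_def by (auto intro: gen_alg.intros)

lemma filt_rees:
 assumes K: "subring_set K" and z: "z \<in> filt K Y n"
 shows "z * T ^ n \<in> rees K Y T"
 using z
proof (induction rule: filt_induct[OF K, consumes 1, case_names const add gen])
 case (const c n)
 then show ?case by (intro sr_mult[OF rees_sr[OF K]] sr_power[OF rees_sr[OF K]] rees_T rees_K)
next
 case (add x y n)
 then show ?case using sr_add[OF rees_sr[OF K]] by (simp add: distrib_right)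
next
 case (gen x y n)
 have "(x * T) * (y * T ^ n) \<in> rees K Y T" by (rule sr_mult[OF rees_sr[OF K] rees_Y[OF gen(1)] gen(3)])
 then show ?case by (simp add: mult_ac)
qed

lemma filt_rees_ge:
 assumes K: "subring_set K" and z: "z \<in> filt K Y m" "m \<le> n"
 shows "z * T ^ n \<in> rees K Y T"
 using filt_rees[OF K filt_mono[OF z(2,1)]] .

lemma rees_form:
 assumes K: "subring_set K" and z: "z \<in> rees K Y T"
 obtains H where "z = poly H T" "\<And>n. coeff H n \<in> filt K Y n"
proof -
 have "\<exists>H. z = poly H T \<and> (\<forall>n. coeff H n \<in> filt K Y n)" using z unfolding rees_def
 proof induction
  case (base_K c)
  then show ?case by (intro exI[of _ "[:c:]"]) (auto simp: coeff_pCons filt_const[OF K] filt_zero split: nat.splits)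
 next
  case (base_S s)
  then consider "s = T" | y where "y \<in> Y" "s = y * T" by blast
  then show ?case
  proof cases
   case 1
   then show ?thesis using filt_const[OF K sr_one[OF K]]
    by (intro exI[of _ "[:0,1:]"]) (auto simp: coeff_pCons filt_zero split: nat.splits)
  next
   case 2
   then show ?thesis using filt_gen[OF K, of y Y 1] filt_zero
    by (intro exI[of _ "[:0,y:]"]) (auto simp: coeff_pCons mult.commute split: nat.splits)
  qed
 next
  case (add x y)
  then obtain H G where "x = poly H T" "\<forall>n. coeff H n \<in> filt K Y n" "y = poly G T" "\<forall>n. coeff G n \<in> filt K Y n" by blast
  then show ?case by (intro exI[of _ "H + G"]) (simp add: filt_add)
 next
  case (mult x y)
  then obtain H G where HG: "x = poly H T" "\<forall>n. coeff H n \<in> filt K Y n" "y = poly G T" "\<forall>n. coeff G n \<in> filt K Y n" by blast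
  have "coeff (H * G) n \<in> filt K Y n" for n unfolding coeff_mult
  proof (intro filt_sum)
   fix i assume "i \<in> {..n}"
   then show "coeff H i * coeff G (n - i) \<in> filt K Y n"
    using filt_mult[OF K HG(2)[rule_format, of i] HG(4)[rule_format, of "n - i"]] by simp
  qed
  then show ?case using HG by (intro exI[of _ "H * G"]) simp
 next
  case (neg x)
  then obtain H where "x = poly H T" "\<forall>n. coeff H n \<in> filt K Y n" by blast
  then show ?case using filt_diff[OF K filt_zero] by (intro exI[of _ "- H"]) (simp add: diff_0[symmetric] del: diff_0)
 qed
 then show thesis using that by blast
qed

text \<open>An element of the Rees ring is a polynomial in \<open>T\<close> whose coefficient at
  \<open>T^n\<close> has degree at most \<open>n\<close>. As \<open>T\<close> is transcendental over
  \<open>D\<close>, the coefficient at \<open>T^m\<close> must be \<open>z\<close>.\<close>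

lemma rees_filt:
 assumes K: "subring_set K" and D: "subring_set (D :: 'a::field set)" "filt K Y m \<subseteq> D" "\<And>n. filt K Y n \<subseteq> D" "z \<in> D" "T \<notin> acl D"
  and z: "z * T ^ m \<in> rees K Y T"
 shows "z \<in> filt K Y m"
proof -
 obtain H where H: "z * T ^ m = poly H T" "\<And>n. coeff H n \<in> filt K Y n" by (rule rees_form[OF K z]) (rule that)
 have "monom z m - H \<in> polys D"
  using H(2) D(3,4) by (intro po_closed[OF D(1)]) (auto intro!: polysI)
 moreover have "poly (monom z m - H) T = 0" using H(1) by (simp add: poly_monom)
 ultimately have "monom z m - H = 0" using transc_poly_eq[OF D(5)] by blast
 then have "coeff H m = z" by (metis coeff_monom eq_iff_diff_eq_0)
 then show ?thesis using H(2)[of m] by simp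
qed

text \<open>Adjoining \<open>T\<close> creates no new relations for \<open>r\<close>: a relation
  over \<open>E[T]\<close> is expanded in powers of \<open>T\<close>, and each coefficient is a
  relation over \<open>E\<close>.\<close>

lemma transc_coeff_zero:
 assumes K: "subring_set (D :: 'a::field set)" and T: "T \<notin> acl D" and r: "r \<in> D"
  and E: "subring_set E" "E \<subseteq> D" and min: "\<And>h. h \<in> polys E \<Longrightarrow> poly h r = 0 \<Longrightarrow> degree h < N \<Longrightarrow> h = 0"
  and g: "g \<in> polys (gen_alg E {T})" "poly g r = 0" "degree g < N"
 shows "g = 0"
proof -
 have "\<exists>h\<in>polys E. coeff g i = poly h T" for i
  using polysD[OF g(1), of i] unfolding ga_singleton[OF E(1)] by blast
 then obtain H where H: "\<And>i. H i \<in> polys E" "\<And>i. coeff g i = poly (H i) T" by metis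
 define Q where "Q = (\<Sum>i\<le>degree g. smult (r ^ i) (H i))"
 have "Q \<in> polys D" unfolding Q_def
  using H(1) polys_mono[OF E(2)] r by (intro po_closed[OF K] sr_power[OF K]) auto
 moreover have "poly Q T = 0" using g(2) by (simp add: Q_def poly_sum poly_altdef[of g] H(2) mult.commute)
 ultimately have Q0: "Q = 0" using transc_poly_eq[OF T] by blast
 have "coeff (H i) j = 0" if i: "i \<le> degree g" for i j
 proof -
  define h where "h = (\<Sum>i\<le>degree g. monom (coeff (H i) j) i)"
  have "poly h r = coeff Q j" by (simp add: h_def poly_sum Q_def coeff_sum poly_monom mult.commute)
  moreover have "h \<in> polys E" unfolding h_def using H(1) by (intro po_closed[OF E(1)]) (auto dest: polysD)
  moreover have "degree h < N" unfolding h_def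
   using g(3) by (intro degree_sum_less) (auto intro: le_less_trans[OF degree_monom_le])
  ultimately have "h = 0" using min Q0 by simp
  moreover have "coeff h i = coeff (H i) j" using i by (simp add: h_def coeff_sum)
  ultimately show ?thesis by simp
 qed
 then have "coeff g i = 0" for i using H(2)[of i] by (cases "i \<le> degree g") (auto simp: poly_altdef coeff_eq_0)
 then show ?thesis by (intro poly_eqI) simp
qed

text \<open>\<open>y\<close> is recovered as \<open>(y * T) / T\<close>, so the new generators span
  as much as \<open>T\<close> and \<open>Y\<close> and are no more numerous.\<close>

lemma rees_indep:
 fixes K Y :: "'a::field set"
 assumes K: "subring_set K" and Y: "indep K Y" and T: "T \<notin> alg_cl K Y"
 shows "indep K (insert T ((\<lambda>y. y * T) ` Y))"
proof -
 let ?Z = "insert T ((\<lambda>y. y * T) ` Y)"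
 have T0: "T \<noteq> 0" using T sr_zero[OF sf_sr[OF cl_subfield[OF K]]] by metis
 have TY: "T \<notin> Y" using T cl_base[OF K, of Y] ga_base(2)[of Y K] by blast
 have i: "indep K (insert T Y)" by (rule indep_insert[OF K Y T])
 have Z: "?Z \<subseteq> alg_cl K ?Z" using cl_base[OF K, of ?Z] ga_base(2)[of ?Z K] by blast
 have "insert T Y \<subseteq> alg_cl K ?Z"
 proof
  fix y assume "y \<in> insert T Y"
  then show "y \<in> alg_cl K ?Z"
  proof
   assume "y \<in> Y"
   then have "(y * T) / T \<in> alg_cl K ?Z" using Z by (intro sf_divide[OF cl_subfield[OF K]]) auto
   then show ?thesis using T0 by simp
  qed (use Z in auto)
 qed
 moreover have "card ?Z \<le> card (insert T Y)"
  using card_image_le[OF indep_finite[OF Y], of "\<lambda>y. y * T"] indep_finite[OF Y] TY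
  by (simp add: card_insert_if)
 ultimately show ?thesis using indep_if_spanning(1)[OF K i] indep_finite[OF Y] by simp
qed

text \<open>Along a good direction \<open>v\<close> the image of \<open>K[X]\<close> modulo \<open>p\<close> is generated over a polynomial
ring by one root of \<open>p\<close>, whose different is the derivative of \<open>p\<close> along \<open>v\<close>; \<open>T\<close> keeps track of degrees.\<close>

lemma conductor:
 fixes K X :: "'b::alg_closed_field set"
 assumes ch: "\<And>n. n > 0 \<Longrightarrow> of_nat n \<noteq> (0::'b)" and K: "subfield_set K" and X: "indep K X"
  and \<pi>: "rhom (gen_alg K X) \<pi>" "\<And>c. c \<in> K \<Longrightarrow> \<pi> c = c"
  and ker: "\<And>r. r \<in> gen_alg K X \<Longrightarrow> \<pi> r = 0 \<longleftrightarrow> dvd_in (gen_alg K X) p r" and p: "prime_elt (gen_alg K X) p"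
  and T: "T \<notin> acl (\<pi> ` gen_alg K X)" and v: "good_direction K X p v"
  and d: "derivation d" "\<And>c. c \<in> K \<Longrightarrow> d c = 0" "\<And>x. x \<in> X \<Longrightarrow> d x = v x"
  and \<tau>: "\<tau> \<in> fracs (\<pi> ` gen_alg K X)" "integral_over (rees K (\<pi> ` X) T) (\<tau> * T ^ w)"
 shows "\<pi> (d p) * \<tau> \<in> \<pi> ` filt K X (tdeg K X p - 1 + w)"
proof -
 note Ks = sf_sr[OF K]
 let ?R = "gen_alg K X"
 have R: "subring_set ?R" by (rule ga_subring[OF Ks])
 have pR: "p \<in> ?R" "p \<noteq> 0" using p by (auto simp: prime_elt_def)
 define N where "N = tdeg K X p"
 have N0: "N > 0"
 proof (rule ccontr)
  assume "\<not> N > 0"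
  then have "p \<in> K" using tdeg_0_const[OF K X pR(1)] by (simp add: N_def)
  then have "dvd_in ?R p 1" unfolding dvd_in_def using sf_inverse[OF K] pR(2)
   by (intro bexI[of _ "inverse p"]) (auto intro: gen_alg.base_K)
  then show False using p by (simp add: prime_elt_def)
 qed
 obtain x0 where x0: "x0 \<in> X" "v x0 \<noteq> 0" using good_direction_nz[OF K X pR(1) N0[unfolded N_def] v] .
 have vK: "v ` X \<subseteq> K" using v by (simp add: good_direction_def)
 define Y t where "Y = dbase X v x0" and "t = dcoord v x0"
 obtain h where h: "h \<in> polys (gen_alg K Y)" "poly h t = p" "degree h = N"
  "\<And>j. j \<le> N \<Longrightarrow> coeff h j \<in> filt K Y (N - j)" "lead_coeff h \<in> K" "lead_coeff h \<noteq> 0"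
  using good_direction_monic[OF K X vK x0 pR v] unfolding Y_def t_def N_def by metis
 define c where "c = lead_coeff h"
 have c: "c \<in> K" "c \<noteq> 0" using h by (auto simp: c_def)
 let ?D = "gen_alg K Y"
 have D: "subring_set ?D" by (rule ga_subring[OF Ks])
 have iY: "indep K Y" "t \<notin> Y" "indep K (insert t Y)"
  using dbase_indep[OF K X vK x0] indep_subset[of K "insert t Y" Y] by (auto simp: Y_def t_def)
 have tt: "t \<notin> acl ?D" using indep_insertD[OF Ks iY(3,2)] by (simp add: alg_cl_def)
 have Rt: "?R = gen_alg K (insert t Y)" using dbase_ga[OF K X vK x0] by (simp add: Y_def t_def)
 then have Req: "?R = (\<lambda>h. poly h t) ` polys ?D" using ga_insert[OF Ks, of t Y] by simp
 have DR: "?D \<subseteq> ?R" "t \<in> ?R" unfolding Rt by (auto intro: gen_alg.base_S ga_mono[THEN subsetD, rotated 2])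
 \<comment> \<open>\<open>p = h(t)\<close> has degree \<open>N\<close> in \<open>t\<close>, so a
   nonzero multiple of \<open>p\<close> has degree at least \<open>N\<close> in
   \<open>t\<close>.\<close>
 have small: "g = 0" if g: "g \<in> polys ?D" "degree g < N" "\<pi> (poly g t) = 0" for g
 proof -
  have "poly g t \<in> ?R" using g(1) Req by blast
  then have "dvd_in ?R p (poly g t)" using ker g(3) by blast
  then obtain C where C: "C \<in> polys ?D" "poly g t = p * poly C t" using Req by (auto simp: dvd_in_def)
  have "g - h * C = 0" using g C h by (intro transc_poly_eq[OF tt]) (auto intro!: po_closed[OF D])
  then have gC: "g = h * C" by simp
  have "C = 0"
  proof (rule ccontr)
   assume "C \<noteq> 0"
   then have "degree g = N + degree C" using h(3,6) gC by (subst gC, subst degree_mult_eq) auto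
   then show False using g(2) by simp
  qed
  then show ?thesis using gC by simp
 qed
 have kerD: "a = 0" if "a \<in> ?D" "\<pi> a = 0" for a
  using small[of "[:a:]"] that N0 by (auto intro: po_closed[OF D])
 note im = indep_image[OF Ks iY(1) rhom_subset[OF \<pi>(1) DR(1)] \<pi>(2) kerD]
 define \<rho> where "\<rho> = \<pi> t"
 let ?Y = "\<pi> ` Y"
 let ?E = "gen_alg K ?Y"
 have E: "subring_set ?E" by (rule ga_subring[OF Ks])
 have \<pi>K: "\<pi> ` K = K" using \<pi>(2) by force
 have imga: "\<pi> ` gen_alg K Z = gen_alg K (\<pi> ` Z)" if Z: "gen_alg K Z \<subseteq> ?R" for Z
 proof
  have "Z \<subseteq> ?R" "K \<subseteq> ?R" using Z ga_base[of K Z] ga_base(2)[of Z K] by blast+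
  then show "\<pi> ` gen_alg K Z \<subseteq> gen_alg K (\<pi> ` Z)" using rhom_ga[OF R \<pi>(1), of _ K Z] \<pi>K by auto
  have "K \<subseteq> \<pi> ` gen_alg K Z" using \<pi>K ga_base(1)[of K Z] by blast
  then show "gen_alg K (\<pi> ` Z) \<subseteq> \<pi> ` gen_alg K Z" using ga_base(2)[of Z K]
   by (intro ga_least rhom_image[OF ga_subring[OF Ks] rhom_subset[OF \<pi>(1) Z]]) auto
 qed
 have DE: "\<pi> ` ?D = ?E" by (rule imga[OF DR(1)])
 let ?B = "\<pi> ` ?R"
 have B: "subring_set ?B" by (rule rhom_image[OF R \<pi>(1)])
 have EB: "?E \<subseteq> ?B" "\<rho> \<in> ?B" using DE DR by (auto simp: \<rho>_def)
 have min: "g = 0" if g: "g \<in> polys ?E" "poly g \<rho> = 0" "degree g < N" for g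
 proof -
  define i where "i = inv_into ?D \<pi>"
  have i: "i y \<in> ?D" "\<pi> (i y) = y" if "y \<in> ?E" for y
   using that DE unfolding i_def by (auto intro: inv_into_into f_inv_into_f)
  have i0: "i 0 = 0" using kerD i[OF sr_zero[OF E]] by blast
  define g' where "g' = map_poly i g"
  have g': "g' \<in> polys ?D" unfolding g'_def using i g(1) by (intro polysI) (auto simp: coeff_map_poly i0 dest: polysD)
  have mg: "map_poly \<pi> g' = g" using i(2) g(1) unfolding g'_def
   by (intro poly_eqI) (auto simp: coeff_map_poly i0 rhom_zero[OF R \<pi>(1)] dest: polysD)
  have "\<pi> (poly g' t) = poly (map_poly \<pi> g') \<rho>" unfolding \<rho>_def
   using g' polys_mono[OF DR(1)] by (intro mp_eval[OF R \<pi>(1) _ DR(2)]) auto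
  moreover have "degree g' < N" using g(3) degree_map_poly_le[of i g] by (simp add: g'_def)
  ultimately have "g' = 0" using small[OF g'] mg g(2) by simp
  then show ?thesis using mg by simp
 qed
 have TB: "T \<notin> acl ?E" using T acl_mono[OF EB(1)] by blast
 have T0: "T \<noteq> 0" using T acl_base[OF B] sr_zero[OF B] by blast
 let ?R2 = "rees K ?Y T"
 have R2: "subring_set ?R2" by (rule rees_sr[OF Ks])
 have TY: "T \<notin> alg_cl K ?Y" using TB unfolding alg_cl_def .
 have N2: "normal_ring ?R2" unfolding rees_def
  by (rule polynomial_ring_normal[OF K rees_indep[OF Ks im(1) TY]])
 let ?F2 = "fracs ?R2"
 have F2: "subfield_set ?F2" by (rule fracs_subfield[OF R2])
 note F2s = sf_sr[OF F2]
 have RF2: "?R2 \<subseteq> ?F2" by (rule fracs_base[OF R2])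
 have TF: "T \<in> ?F2" using rees_T[of T K ?Y] RF2 by blast
 define h\<pi> where "h\<pi> = map_poly \<pi> h"
 have ch\<pi>: "coeff h\<pi> j = \<pi> (coeff h j)" for j by (simp add: h\<pi>_def rhom_map_coeff[OF R \<pi>(1)])
 have hR: "h \<in> polys ?R" using h(1) polys_mono[OF DR(1)] by blast
 have h\<rho>: "poly h\<pi> \<rho> = 0"
  using mp_eval[OF R \<pi>(1) hR DR(2)] h(2) ker[OF pR(1)] sr_one[OF R] unfolding h\<pi>_def \<rho>_def dvd_in_def by force
 \<comment> \<open>The homogenized monic equation of \<open>\<rho> * T\<close>: coefficient
   \<open>j\<close> is multiplied by \<open>T^(N-j)\<close>, which its degree bound matches, so it
   lies in the Rees ring.\<close>
 define f where "f = smult (T ^ N / c) (pcompose h\<pi> [:0, 1 / T:])"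
 have cf: "coeff f j = T ^ N / c * (\<pi> (coeff h j) / T ^ j)" for j
  by (simp add: f_def coeff_pcompose_linear ch\<pi> power_divide)
 have fR: "f \<in> polys ?R2"
 proof (rule polysI)
  fix j show "coeff f j \<in> ?R2"
  proof (cases "j \<le> N")
   case True
   have "T ^ N = T ^ (N - j) * T ^ j" using True by (simp flip: power_add)
   then have "coeff f j = inverse c * (\<pi> (coeff h j) * T ^ (N - j))" using T0 by (simp add: cf divide_inverse mult_ac)
   moreover have "\<pi> (coeff h j) \<in> filt K ?Y (N - j)"
    by (rule filt_image[OF Ks rhom_subset[OF \<pi>(1) DR(1)] \<pi>(2) h(4)[OF True]])
   ultimately show ?thesis using filt_rees[OF Ks] rees_K[OF sf_inverse[OF K c(1)]] sr_mult[OF R2] by metis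
  next
   case False
   then show ?thesis using h(3) by (simp add: cf coeff_eq_0 rhom_zero[OF R \<pi>(1)] sr_zero[OF R2])
  qed
 qed
 have lead: "coeff f N = 1" using c T0 h(3) \<pi>(2)[OF c(1)] by (simp add: cf c_def)
 have degf: "degree f = N"
 proof (rule antisym)
  show "degree f \<le> N" by (rule degree_le) (use h(3) in \<open>auto simp: cf coeff_eq_0 rhom_zero[OF R \<pi>(1)]\<close>)
  show "N \<le> degree f" using lead by (intro le_degree) simp
 qed
 let ?r = "\<rho> * T"
 have froot: "poly f ?r = 0" using h\<rho> T0 by (simp add: f_def poly_pcompose)
 have mf: "minpoly ?F2 ?r f" unfolding minpoly_def
 proof (intro conjI ballI impI froot)
  show "f \<in> polys ?F2" using fR polys_mono[OF RF2] by blast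
  show "lead_coeff f = 1" using lead degf by simp
  fix g assume g: "g \<in> polys ?F2" "poly g ?r = 0"
  show "g = 0 \<or> degree f \<le> degree g"
  proof (rule ccontr)
   assume "\<not> ?thesis"
   then have gN: "g \<noteq> 0" "degree g < N" using degf by auto
   obtain e where e: "e \<in> ?R2" "e \<noteq> 0" "smult e g \<in> polys ?R2" using clear_denominators[OF R2 g(1)] .
   let ?ET = "gen_alg ?E {T}"
   have ET: "subring_set ?ET" by (rule ga_subring[OF E])
   have "?Y \<subseteq> ?ET" "K \<subseteq> ?ET" using ga_base(1)[of ?E "{T}"] ga_base(2)[of ?Y K] ga_base(1)[of K ?Y] by blast+
   moreover have TT: "T \<in> ?ET" by (simp add: gen_alg.base_S)
   moreover have "y * T \<in> ?ET" if "y \<in> ?Y" for y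
    by (rule sr_mult[OF ET subsetD[OF \<open>?Y \<subseteq> ?ET\<close> that] TT])
   ultimately have sub: "?R2 \<subseteq> ?ET" unfolding rees_def by (intro ga_least ET) auto
   \<comment> \<open>Replacing \<open>Y\<close> by \<open>T * Y\<close> turns a short relation for
     \<open>\<rho> * T\<close> into one for \<open>\<rho>\<close> over polynomials in
     \<open>T\<close>, which \<open>transc_coeff_zero\<close> excludes.\<close>
   define g1 where "g1 = pcompose (smult e g) [:0, T:]"
   have "smult e g \<in> polys ?ET" using e(3) polys_mono[OF sub] by blast
   then have "g1 \<in> polys ?ET" unfolding g1_def
    by (rule po_pcompose[OF ET _ po_pCons[OF ET sr_zero[OF ET] po_pCons[OF ET TT po_closed(2)[OF ET]]]])
   moreover have "poly g1 \<rho> = 0" using g(2) by (simp add: g1_def poly_pcompose mult.commute)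
   moreover have "degree g1 < N" using gN(2) T0 e(2) by (simp add: g1_def)
   ultimately have "g1 = 0" using transc_coeff_zero[OF B T EB(2) E EB(1) min] by blast
   then have "smult e g = 0" unfolding g1_def by (rule pcompose_eq_0) (use T0 in simp)
   then show False using e(2) gN(1) by simp
  qed
 qed
 have rA: "?r \<in> acl ?F2" using mf minpolyD(4)[OF mf] by (auto simp: acl_def algebraic_over_def minpoly_def)
 let ?L = "gen_alg ?F2 {?r}"
 have L: "subfield_set ?L" by (rule finite_ext_field[OF ch F2 rA])
 note Ls = sf_sr[OF L]
 have FL: "?F2 \<subseteq> ?L" by (rule ga_base)
 have TL: "T \<in> ?L" using TF FL by blast
 have rL: "?r \<in> ?L" by (simp add: gen_alg.base_S)
 have YL: "y \<in> ?L" if "y \<in> ?Y" for y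
 proof -
  have "(y * T) / T \<in> ?F2" using RF2 rees_Y[OF that, of T K] TF by (intro sf_divide[OF F2]) auto
  then show ?thesis using T0 FL by auto
 qed
 have \<rho>L: "\<rho> \<in> ?L" using sf_divide[OF L rL TL] T0 by simp
 have KL: "K \<subseteq> ?L" using FL RF2 rees_K[of _ K ?Y T] by blast
 have "?B \<subseteq> ?L"
 proof -
  have "?B = gen_alg K (\<pi> ` insert t Y)" unfolding Rt by (rule imga) (simp add: Rt)
  also have "\<dots> \<subseteq> ?L" using YL \<rho>L KL by (intro ga_least Ls) (auto simp: \<rho>_def)
  finally show ?thesis .
 qed
 then have "\<tau> \<in> ?L" using \<tau>(1) fracs_least[OF L] by blast
 then have "\<tau> * T ^ w \<in> ?L" by (intro sr_mult[OF Ls] sr_power[OF Ls] TL)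
 then obtain c2 where c2: "c2 \<in> polys ?F2" "\<tau> * T ^ w = poly c2 ?r" unfolding ga_singleton[OF F2s] by blast
 have ir: "integral_over ?R2 ?r" using fR lead degf froot by (auto simp: integral_over_def)
 note I = integral_closure_subring[OF R2]
 have genint: "integral_over ?R2 s" if s: "s \<in> insert T ((\<lambda>y. y * T) ` \<pi> ` X)" for s
 proof (cases "s = T")
  case True
  then show ?thesis using integral_over_base[OF R2 rees_T] by simp
 next
  case False
  then obtain x where x: "x \<in> X" "s = \<pi> x * T" using s by blast
  then have vx: "v x \<in> K" using vK by blast
  obtain y where y: "y \<in> insert 0 Y" "x = y + v x * t" using X_in_dbase[OF K X vK x0 x(1)] unfolding Y_def t_def by blast
  have yR: "y \<in> ?R" using y(1) DR(1) ga_base(2)[of Y K] sr_zero[OF R] by blast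
  have vR: "v x \<in> ?R" using vx by (rule gen_alg.base_K)
  have "\<pi> x = \<pi> y + v x * \<rho>"
   using y(2) rhom_add[OF R \<pi>(1) yR sr_mult[OF R vR DR(2)]] rhom_mult[OF R \<pi>(1) vR DR(2)] \<pi>(2)[OF vx] by (simp add: \<rho>_def)
  then have s: "s = \<pi> y * T + v x * ?r" using x(2) by (simp add: algebra_simps)
  have "\<pi> y * T \<in> ?R2"
   using y(1) rhom_zero[OF R \<pi>(1)] sr_zero[OF R2] by (auto intro: rees_Y)
  then have "integral_over ?R2 (\<pi> y * T)" by (rule integral_over_base[OF R2])
  moreover have "integral_over ?R2 (v x)" using vx by (intro integral_over_base[OF R2] rees_K)
  ultimately show ?thesis unfolding s using sr_add[OF I] sr_mult[OF I] ir by simp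
 qed
 have "integral_over ?R2 (\<tau> * T ^ w)"
 proof (rule integral_over_trans[OF R2 _ \<tau>(2)])
  fix e assume "e \<in> rees K (\<pi> ` X) T"
  then have "e \<in> gen_alg ?R2 (insert T ((\<lambda>y. y * T) ` \<pi> ` X))"
   unfolding rees_def[of K "\<pi> ` X"] using ga_mono[of K ?R2] rees_K[of _ K ?Y T] by blast
  then show "integral_over ?R2 e" using integral_over_gen_alg[OF R2 genint] by blast
 qed
 then obtain G where G: "G \<in> polys ?R2" "poly G ?r = poly (pderiv f) ?r * (\<tau> * T ^ w)"
  using dedekind_conductor[OF ch N2 mf fR c2(1)] c2(2) by metis
 have dK: "d (a * x) = a * d x" if "a \<in> K" for a x using derivation_mult[OF d(1), of a x] d(2)[OF that] by simp
 have dt: "d t = 1"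
 proof -
  have "t = inverse (v x0) * x0" by (simp add: t_def dcoord_def field_simps)
  moreover have "inverse (v x0) \<in> K" using vK x0 by (intro sf_inverse[OF K]) auto
  ultimately show ?thesis using dK d(3)[OF x0(1)] x0(2) by simp
 qed
 \<comment> \<open>\<open>d\<close> is differentiation along \<open>v\<close>: it is 0 on the base
   coordinates and 1 on \<open>t\<close>, hence \<open>d p = h'(t)\<close>.\<close>
 have dD: "d a = 0" if "a \<in> ?D" for a
 proof (rule derivation_zero_cl[OF ch Ks d(1,2), of Y])
  fix y assume "y \<in> Y"
  then obtain x where x: "x \<in> X" "y = x - v x * t" by (auto simp: Y_def dbase_def t_def)
  then have "v x \<in> K" using vK by blast
  then show "d y = 0" using x derivation_add[OF d(1), of y "v x * t"] dK[of "v x" t] dt d(3)[OF x(1)] by simp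
 qed (use that cl_base[OF Ks, of Y] in auto)
 have "d p = poly (pderiv h) t"
 proof -
  have dD': "deriv_on ?D d" "deriv_on UNIV d" using d(1) by (auto simp: deriv_on_def derivation_def)
  have "d (poly h t) = pdiff d t (d t) h" by (rule deriv_poly[OF D dD' _ _ h(1)]) (auto simp: subring_set_def)
  moreover have "map_poly d h = 0" using h(1) dD
   by (intro poly_eqI) (auto simp: coeff_map_poly derivation_zero[OF d(1)] dest: polysD)
  ultimately show ?thesis using h(2) dt by (simp add: pdiff_def)
 qed
 then have \<pi>d: "\<pi> (d p) = poly (pderiv h\<pi>) \<rho>"
  using mp_eval[OF R \<pi>(1) po_pderiv[OF R hR] DR(2)] mp_pderiv[OF R \<pi>(1) hR] by (simp add: h\<pi>_def \<rho>_def)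
 define z where "z = \<pi> (d p) * \<tau> / c"
 have "poly (pderiv f) ?r = T ^ N / c * (\<pi> (d p) / T)"
  using T0 by (simp add: f_def pderiv_smult pderiv_pcompose poly_pcompose \<pi>d pderiv_pCons)
 moreover have "T ^ N = T ^ (N - 1) * T" using N0 by (metis power_minus_mult)
 \<comment> \<open>The derivative of \<open>f\<close> contributes \<open>T^(N-1)\<close> and the
   weight of \<open>\<tau>\<close> contributes \<open>T^w\<close>. Membership of this product in the
   Rees ring is the bound \<open>N - 1 + w\<close> for the degree of \<open>z\<close>.\<close>
 ultimately have "poly G ?r = z * T ^ (N - 1 + w)" using G(2) T0 by (simp add: z_def power_add mult_ac)
 moreover have "poly G ?r \<in> rees K (\<pi> ` X) T"
 proof -
  let ?R3 = "rees K (\<pi> ` X) T"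
  have R3: "subring_set ?R3" by (rule rees_sr[OF Ks])
  have f1: "\<pi> y * T \<in> ?R3" if "y \<in> filt K X 1" for y
   using filt_rees[OF Ks filt_image[OF Ks \<pi> that], of T] by simp
  have "Y \<subseteq> filt K X 1" "t \<in> filt K X 1" using dbase_filt[OF K X vK x0] dcoord_filt[OF K X vK x0] by (auto simp: Y_def t_def)
  then have "(\<lambda>y. y * T) ` ?Y \<subseteq> ?R3" "?r \<in> ?R3" using f1 by (auto simp: \<rho>_def)
  moreover have "?R2 \<subseteq> ?R3" unfolding rees_def[of K ?Y]
   using calculation(1) rees_T[of T K "\<pi> ` X"] rees_K[of _ K "\<pi> ` X" T] by (intro ga_least R3) auto
  ultimately show ?thesis using G(1) polys_mono[of ?R2 ?R3] by (intro po_eval[OF R3]) auto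
 qed
 ultimately have zT: "z * T ^ (N - 1 + w) \<in> rees K (\<pi> ` X) T" by simp
 let ?A = "acl ?B"
 have A: "subfield_set ?A" by (rule acl_subfield[OF B])
 have KB: "K \<subseteq> ?B" using \<pi>K ga_base(1)[of K X] by blast
 have BX: "?B = gen_alg K (\<pi> ` X)" by (rule imga) simp
 have fA: "filt K (\<pi> ` X) n \<subseteq> ?A" for n
  using filt_subset_ga[OF Ks, of "\<pi> ` X" n] acl_base[OF B] BX by simp
 have "d p \<in> ?R" using \<open>d p = poly (pderiv h) t\<close> po_eval[OF R po_pderiv[OF R hR] DR(2)] by simp
 then have "\<pi> (d p) \<in> ?A" "\<tau> \<in> ?A" "c \<in> ?A" using acl_base[OF B] \<tau>(1) fracs_acl[OF B] c(1) KB by blast+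
 then have zA: "z \<in> ?A" unfolding z_def by (intro sf_divide[OF A] sr_mult[OF sf_sr[OF A]])
 have "T \<notin> acl ?A" using T acl_trans[OF B] by simp
 then have "z \<in> filt K (\<pi> ` X) (N - 1 + w)" using rees_filt[OF Ks sf_sr[OF A] fA fA zA _ zT] by blast
 then have "c * z \<in> filt K (\<pi> ` X) (N - 1 + w)" by (rule filt_cmult[OF Ks c(1)])
 moreover have "c * z = \<pi> (d p) * \<tau>" using c(2) by (simp add: z_def)
 ultimately show ?thesis using filt_image_lift[OF Ks \<pi>, of "\<pi> (d p) * \<tau>" "N - 1 + w"] by (simp add: N_def)
qed

section \<open>Logarithmic forms\<close>

lemma derivation_divide:
 assumes d: "derivation d" and b: "b \<noteq> (0::'a::field)"
 shows "d (a / b) = (d a * b - a * d b) / b ^ 2"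
proof -
 have "d a = d (a / b * b)" using b by simp
 also have "\<dots> = a / b * d b + d (a / b) * b" by (rule derivation_mult[OF d])
 finally show ?thesis using b by (simp add: field_simps power2_eq_square)
qed

text \<open>For nonzero \<open>f\<close> this is the localization of \<open>A\<close> at the powers
  of \<open>f\<close>, inside the field.\<close>

definition loc :: "'a::field set \<Rightarrow> 'a \<Rightarrow> 'a set" where "loc A f = {z. \<exists>m. f ^ m * z \<in> A}"

lemma locI: "f ^ m * z \<in> A \<Longrightarrow> z \<in> loc A f"
 by (auto simp: loc_def)

lemma loc_sr:
 assumes A: "subring_set A" and f: "f \<in> A"
 shows "subring_set (loc A f)"
proof (rule subring_setI)
 show "1 \<in> loc A f" using sr_one[OF A] by (intro locI[of f 0]) simp
 fix x y assume "x \<in> loc A f" "y \<in> loc A f"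
 then obtain m n where mn: "f ^ m * x \<in> A" "f ^ n * y \<in> A" by (auto simp: loc_def)
 have "f ^ (m + n) * (x - y) = f ^ n * (f ^ m * x) - f ^ m * (f ^ n * y)" by (simp add: power_add algebra_simps)
 then show "x - y \<in> loc A f" using mn by (intro locI[of f "m + n"]) (simp add: sr_closed[OF A] f)
 have eq: "f ^ (m + n) * (x * y) = (f ^ m * x) * (f ^ n * y)" by (simp add: power_add algebra_simps)
 show "x * y \<in> loc A f" by (rule locI[of f "m + n"]) (subst eq, rule sr_mult[OF A mn])
qed

lemma loc_base: "A \<subseteq> loc A f"
 by (auto intro: locI[of f 0])

lemma loc_cancel:
 assumes "f * z \<in> loc A f"
 shows "z \<in> loc A f"
proof -
 obtain m where "f ^ m * (f * z) \<in> A" using assms by (auto simp: loc_def)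
 then show ?thesis by (intro locI[of f "Suc m"]) (simp add: mult_ac)
qed

lemma loc_derivation:
 assumes A: "subring_set A" and f: "f \<in> A" and d: "derivation d" "\<And>a. a \<in> A \<Longrightarrow> d a \<in> loc A f" and z: "z \<in> loc A f"
 shows "d z \<in> loc A f"
proof -
 note L = loc_sr[OF A f]
 have "f ^ m * z \<in> A \<Longrightarrow> d z \<in> loc A f" for m and z
 proof (induction m arbitrary: z)
  case 0
  then show ?case using d(2) by simp
 next
  case (Suc m)
  then have "f ^ m * (f * z) \<in> A" by (simp add: mult_ac)
  then have "d (f * z) \<in> loc A f" by (rule Suc.IH)
  then have "f * d z + d f * z \<in> loc A f" by (simp add: derivation_mult[OF d(1)])
  moreover have "d f * z \<in> loc A f" by (rule sr_mult[OF L d(2)[OF f] locI[OF Suc.prems]])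
  ultimately have "f * d z \<in> loc A f" using sr_diff[OF L] by fastforce
  then show ?case by (rule loc_cancel)
 qed
 then show ?thesis using z by (auto simp: loc_def)
qed

text \<open>A form \<open>e dp/p\<close> whose coefficient \<open>e\<close> is idempotent modulo \<open>p\<close> is closed up to forms without
pole: differentiating \<open>e\<^sup>2 - e \<equiv> 0\<close> shows that \<open>de\<close> is proportional to \<open>dp\<close> modulo \<open>p\<close>.\<close>

lemma log_form_closed:
 fixes L :: "'a::field set"
 assumes L: "subring_set L" and d1: "derivation d1" "d1 ` L \<subseteq> L" and d2: "derivation d2" "d2 ` L \<subseteq> L"
  and p: "p \<in> L" "p \<noteq> 0" "d1 (d2 p) = d2 (d1 p)" and e: "e \<in> L" "z \<in> L" "e ^ 2 - e = p * z" and b: "b1 \<in> L" "b2 \<in> L"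
 shows "d1 (e * d2 p / p + b2) - d2 (e * d1 p / p + b1) \<in> L"
proof -
 \<comment> \<open>\<open>2 * e - 1\<close> has square \<open>1 + 4 * (p * z)\<close>, so it is its
   own inverse modulo \<open>p\<close>. This solves
   \<open>(2 * e - 1) * d e = z * d p + p * d z\<close> for \<open>d e\<close> up to multiples of
   \<open>p\<close>.\<close>
 have de: "d e = (2 * e - 1) * z * d p + p * ((2 * e - 1) * d z - 4 * z * d e)" if d: "derivation d" for d
 proof -
  have "d (e * e) = d (e + p * z)" using e(3) by (simp add: power2_eq_square algebra_simps)
  then have h: "(2 * e - 1) * d e = z * d p + p * d z"
   using derivation_add[OF d, of e "p * z"] derivation_mult[OF d, of e e] derivation_mult[OF d, of p z] by (simp add: algebra_simps)
  have "(2 * e - 1) * (2 * e - 1) = 1 + 4 * (p * z)" unfolding e(3)[symmetric] by (simp add: power2_eq_square algebra_simps)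
  then have "d e = (2 * e - 1) * ((2 * e - 1) * d e) - 4 * (p * z) * d e"
   by (simp add: mult.assoc[symmetric]) (simp add: algebra_simps)
  then show ?thesis unfolding h by (simp add: algebra_simps)
 qed
 define u1 u2 where "u1 = (2 * e - 1) * d1 z - 4 * z * d1 e" and "u2 = (2 * e - 1) * d2 z - 4 * z * d2 e"
 have q: "d (e * q / p) = (d e * q + e * d q) / p - e * q * d p / p ^ 2" if "derivation d" for d q
  using p(2) by (simp add: derivation_divide[OF that] derivation_mult[OF that] field_simps power2_eq_square)
 have "d1 (e * d2 p / p + b2) - d2 (e * d1 p / p + b1) = (d1 e * d2 p - d2 e * d1 p) / p + (d1 b2 - d2 b1)"
  unfolding derivation_add[OF d1(1)] derivation_add[OF d2(1)] q[OF d1(1)] q[OF d2(1)] p(3) using p(2) by (simp add: field_simps)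
 also have "(d1 e * d2 p - d2 e * d1 p) / p = u1 * d2 p - u2 * d1 p"
  unfolding de[OF d1(1), folded u1_def] de[OF d2(1), folded u2_def] using p(2) by (simp add: field_simps)
 finally have eq: "d1 (e * d2 p / p + b2) - d2 (e * d1 p / p + b1) = u1 * d2 p - u2 * d1 p + (d1 b2 - d2 b1)" .
 have m: "d1 x \<in> L" "d2 x \<in> L" if "x \<in> L" for x using d1(2) d2(2) that by blast+
 have n: "2 \<in> L" "4 \<in> L" using sr_of_nat[OF L, of 2] sr_of_nat[OF L, of 4] by simp_all
 show ?thesis unfolding eq u1_def u2_def using p e b by (intro sr_closed(1,3,4,5)[OF L] m n) auto
qed

text \<open>For \<open>z\<close> in \<open>B\<close> this would be multiplicativity, but
  \<open>z\<close> is only integral. Multiply its monic equation by the power of \<open>p\<close>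
  that makes it an equation for \<open>p * z\<close>: modulo the kernel only the top term is
  left.\<close>

lemma integral_times_kernel:
 assumes B: "subring_set B" and f: "rhom B f" and R: "R \<subseteq> B" and p: "p \<in> B" "f p = 0"
  and z: "integral_over R z" "p * z \<in> B"
 shows "f (p * z) = (0::'b::idom)"
proof -
 obtain q where q: "q \<in> polys R" "lead_coeff q = 1" "poly q z = 0" using z(1) by (auto simp: integral_over_def)
 let ?n = "degree q"
 define x where "x = p * z"
 have qB: "coeff q i \<in> B" for i using polysD[OF q(1)] R by blast
 have "0 = p ^ ?n * poly q z" using q(3) by simp
 also have "\<dots> = (\<Sum>i\<le>?n. coeff q i * (p ^ (?n - i) * x ^ i))"
  unfolding poly_altdef sum_distrib_left
 proof (rule sum.cong)
  fix i assume "i \<in> {..?n}"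
  then have "p ^ ?n = p ^ (?n - i) * p ^ i" by (simp flip: power_add)
  then show "p ^ ?n * (coeff q i * z ^ i) = coeff q i * (p ^ (?n - i) * x ^ i)"
   by (simp add: x_def power_mult_distrib mult_ac)
 qed simp
 finally have "(\<Sum>i\<le>?n. coeff q i * (p ^ (?n - i) * x ^ i)) = 0" by simp
 then have "f (\<Sum>i\<le>?n. coeff q i * (p ^ (?n - i) * x ^ i)) = 0" by (simp add: rhom_zero[OF B f])
 moreover have xB: "x \<in> B" using z(2) by (simp add: x_def)
 then have "f (\<Sum>i\<le>?n. coeff q i * (p ^ (?n - i) * x ^ i)) = (\<Sum>i\<le>?n. f (coeff q i * (p ^ (?n - i) * x ^ i)))"
  using qB p(1) by (intro rhom_sum[OF B f] sr_mult[OF B] sr_power[OF B])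
 moreover have "f (coeff q i * (p ^ (?n - i) * x ^ i)) = (if i = ?n then f x ^ ?n else 0)" if "i \<le> ?n" for i
 proof -
  have "f (coeff q i * (p ^ (?n - i) * x ^ i)) = f (coeff q i) * (f p ^ (?n - i) * f x ^ i)"
   using qB p(1) xB by (simp add: rhom_mult[OF B f] rhom_power[OF B f] sr_mult[OF B] sr_power[OF B])
  then show ?thesis using that p(2) q(2) rhom_one[OF B f] by (auto simp: power_0_left)
 qed
 ultimately have "f x ^ ?n = 0" by (simp add: sum.delta)
 then show ?thesis by (simp add: x_def)
qed

text \<open>In characteristic zero a vanishing derivative in one variable removes that variable; the
  variables are removed one after the other.\<close>

lemma partials_zero_const:
 fixes K X :: "'b::alg_closed_field set"
 assumes ch: "\<And>n. n > 0 \<Longrightarrow> of_nat n \<noteq> (0::'b)" and K: "subring_set K" and X: "indep K X"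
  and pd: "\<And>x. x \<in> X \<Longrightarrow> derivation (pd x)" "\<And>x c. x \<in> X \<Longrightarrow> c \<in> K \<Longrightarrow> pd x c = 0"
  "\<And>x y. x \<in> X \<Longrightarrow> y \<in> X \<Longrightarrow> pd x y = (if y = x then 1 else 0)"
  and p: "p \<in> gen_alg K X" "\<And>x. x \<in> X \<Longrightarrow> pd x p = 0"
 shows "p \<in> K"
proof -
 have "p \<in> gen_alg K (X - Y)" if "finite Y" for Y using that
 proof (induction Y)
  case empty
  then show ?case using p(1) by simp
 next
  case (insert x Y)
  show ?case
  proof (cases "x \<in> X - Y")
   case False
   then have "X - insert x Y = X - Y" by blast
   then show ?thesis using insert.IH by simp
  next
   case True
   let ?Z = "X - insert x Y"
   let ?E = "gen_alg K ?Z"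
   have E: "subring_set ?E" by (rule ga_subring[OF K])
   have XY: "X - Y = insert x ?Z" using True by blast
   obtain h where h: "h \<in> polys ?E" "p = poly h x" using insert.IH unfolding XY ga_insert[OF K] by blast
   have dx: "derivation (pd x)" using pd(1) True by blast
   have dE: "pd x a = 0" if "a \<in> ?E" for a
    by (rule derivation_zero_cl[OF ch K dx, of ?Z]) (use pd(2,3) True that cl_base[OF K, of ?Z] in auto)
   have dU: "deriv_on ?E (pd x)" "deriv_on UNIV (pd x)" using dx by (auto simp: deriv_on_def derivation_def)
   have "pd x p = pdiff (pd x) x (pd x x) h" unfolding h(2)
    by (rule deriv_poly[OF E dU _ _ h(1)]) (auto simp: subring_set_def)
   moreover have "map_poly (pd x) h = 0" using h(1) dE
    by (intro poly_eqI) (auto simp: coeff_map_poly derivation_zero[OF dx] dest: polysD)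
   ultimately have pz: "poly (pderiv h) x = 0" using p(2)[of x] pd(3)[of x x] True by (simp add: pdiff_def)
   have "indep K (insert x ?Z)" by (rule indep_subset[OF X]) (use True in blast)
   then have "x \<notin> acl ?E" using indep_insertD[OF K, of x ?Z] unfolding alg_cl_def by blast
   then have "pderiv h = 0" by (rule transc_poly_eq[OF _ po_pderiv[OF E h(1)] pz])
   then have "degree h = 0" using pderiv_nz(1)[OF ch, of h] by blast
   then obtain a where "h = [:a:]" by (rule degree_eq_zeroE)
   then show ?thesis using h polysD[OF h(1), of 0] by simp
  qed
 qed
 from this[OF indep_finite[OF X]] show ?thesis by (simp add: ga_empty[OF K])
qed

text \<open>Good directions form a Zariski-open set, so one coordinate can be changed alone. The
  difference of two such directional derivatives isolates a partial derivative.\<close>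

lemma good_direction_perturb:
 fixes K X :: "'b::field set"
 assumes K: "subfield_set K" "infinite K" and X: "indep K X" and r: "r \<in> gen_alg K X"
  and v: "good_direction K X r v" and x: "x \<in> X"
 obtains c where "c \<in> K" "c \<noteq> 0" "good_direction K X r (v(x := v x + c))"
proof -
 note Ks = sf_sr[OF K(1)]
 let ?t = "topform K X r"
 have tR: "?t \<in> gen_alg K X" by (rule topform_in[OF K(1) X r])
 have vK: "v ` X \<subseteq> K" using v by (simp add: good_direction_def)
 obtain G where G: "rhom (gen_alg K X) G" "\<And>c. c \<in> K \<Longrightarrow> G c = [:c:]" "\<And>y. y \<in> X \<Longrightarrow> G y = [:v y, if y = x then 1 else 0:]"
  using rhom_extend_indep[OF Ks X rhom_const, of "\<lambda>y. [:v y, if y = x then 1 else 0:]"] by metis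
 note Rs = ga_subring[OF Ks, of X]
 have ev: "eval_hom K X (v(x := v x + c)) (\<lambda>z. poly (G z) c)" for c
  unfolding eval_hom_def using G(2,3) by (intro conjI rhomI ballI) (auto simp: rhom_one[OF Rs G(1)] rhom_add[OF Rs G(1)] rhom_mult[OF Rs G(1)])
 have "poly (G ?t) 0 \<noteq> 0" using v ev[of 0] by (auto simp: good_direction_def)
 then have "G ?t \<noteq> 0" by auto
 then have "finite (insert 0 {c. poly (G ?t) c = 0})" using poly_roots_finite by blast
 then have "infinite (K - insert 0 {c. poly (G ?t) c = 0})" using K(2) by (rule Diff_infinite_finite)
 then have "K - insert 0 {c. poly (G ?t) c = 0} \<noteq> {}" by (rule infinite_imp_nonempty)
 then obtain c where c: "c \<in> K" "c \<noteq> 0" "poly (G ?t) c \<noteq> 0" by blast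
 have "good_direction K X r (v(x := v x + c))" unfolding good_direction_def
 proof (intro conjI allI impI)
  show "(v(x := v x + c)) ` X \<subseteq> K" using vK c(1) x sr_add[OF Ks] by auto
  fix g assume g: "eval_hom K X (v(x := v x + c)) g"
  have "g ?t = poly (G ?t) c"
   by (rule rhom_eq_on_ga[OF Ks _ _ _ tR]) (use g ev[of c] in \<open>auto simp: eval_hom_def\<close>)
  then show "g ?t \<noteq> 0" using c(3) by simp
 qed
 then show thesis by (rule that[OF c(1,2)])
qed

text \<open>The monic polynomial with roots \<open>r * u\<close> has the integral coefficients
  \<open>u^(n-j) * coeff q j\<close>; the single factor \<open>u^n\<close> then serves all
  coefficients of \<open>q\<close>.\<close>

lemma scaled_monic_integral:
 fixes q :: "'b::alg_closed_field poly"
 assumes I: "subring_set I" and u: "u \<in> I" "u \<noteq> 0" and q: "lead_coeff q = 1" "\<And>r. poly q r = 0 \<Longrightarrow> r * u \<in> I"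
 shows "smult (u ^ degree q) q \<in> polys I"
proof -
 let ?n = "degree q"
 define f where "f = smult (u ^ ?n) (pcompose q [:0, 1 / u:])"
 have cf: "coeff f j = u ^ ?n * (coeff q j / u ^ j)" for j
  by (simp add: f_def coeff_pcompose_linear power_divide)
 have df: "degree f = ?n"
  using u(2) by (simp add: f_def)
 have "f \<in> polys I"
 proof (rule monic_integral_coeffs[OF I])
  show "lead_coeff f = 1" unfolding df cf using u(2) q(1) by simp
  fix x assume "poly f x = 0"
  then have "poly q (x / u) = 0" using u(2) by (simp add: f_def poly_pcompose mult.commute)
  from q(2)[OF this] show "x \<in> I" using u(2) by simp
 qed
 have "u ^ ?n * coeff q j \<in> I" for j
 proof -
  have "coeff f j * u ^ j \<in> I" by (intro sr_mult[OF I] sr_power[OF I] polysD[OF \<open>f \<in> _\<close>] u(1))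
  then show ?thesis using u(2) by (simp add: cf)
 qed
 then show ?thesis by (intro polysI) simp
qed

section \<open>The free module generated by a primitive integral element\<close>

lemma poly_as_sum_le: "degree q \<le> c \<Longrightarrow> poly q x = (\<Sum>i\<le>c. coeff q i * x ^ i)" for x :: "'a::comm_ring_1"
 unfolding poly_altdef by (rule sum.mono_neutral_left) (auto simp: coeff_eq_0)

lemma coeff_sum_monom: "coeff (\<Sum>j\<le>n. monom (f j) j) i = (if i \<le> n then f i else 0)"
 by (simp add: coeff_sum)

text \<open>\<open>B\<close> plays the role of \<open>A/P\<close> and \<open>R = K[X]\<close> that
  of its Noether normalization. \<open>\<alpha>\<close> may generate less than the fraction field of
  \<open>B\<close>: in the application it is chosen to generate, over the fractions of
  \<open>R\<close>, the values on \<open>X\<close> of finitely many Hamiltonian derivations.\<close>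

locale primitive_integral =
 fixes K X B :: "'b::alg_closed_field set" and pd :: "'b \<Rightarrow> 'b \<Rightarrow> 'b" and \<alpha> T :: 'b and g :: "'b poly"
 assumes ch: "\<And>n. n > 0 \<Longrightarrow> of_nat n \<noteq> (0::'b)" and K: "subfield_set K" and inf: "infinite K" and X: "indep K X"
  and pd: "\<And>x. x \<in> X \<Longrightarrow> derivation (pd x)" "\<And>x c. x \<in> X \<Longrightarrow> c \<in> K \<Longrightarrow> pd x c = 0"
   "\<And>x y. x \<in> X \<Longrightarrow> y \<in> X \<Longrightarrow> pd x y = (if y = x then 1 else 0)"
  and B: "subring_set B" and RB: "gen_alg K X \<subseteq> B" and int: "\<And>b. b \<in> B \<Longrightarrow> integral_over (gen_alg K X) b"
  and \<alpha>B: "\<alpha> \<in> B" and g: "minpoly (fracs (gen_alg K X)) \<alpha> g"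
begin

abbreviation R where "R \<equiv> gen_alg K X"
abbreviation F where "F \<equiv> fracs R"
abbreviation A where "A \<equiv> gen_alg R {\<alpha>}"
abbreviation n where "n \<equiv> degree g"
abbreviation \<gamma> where "\<gamma> \<equiv> poly (pderiv g) \<alpha>"

lemma Ks: "subring_set K" and fX: "finite X"
 using sf_sr[OF K] indep_finite[OF X] by blast+

lemma Rs: "subring_set R"
 by (rule ga_subring[OF Ks])

lemma Fs: "subfield_set F"
 by (rule fracs_subfield[OF Rs])

lemma RF: "R \<subseteq> F"
 by (rule fracs_base[OF Rs])

lemma As: "subring_set A"
 by (rule ga_subring[OF Rs])

lemma RA: "R \<subseteq> A" and \<alpha>A: "\<alpha> \<in> A"
 by (rule ga_base) (simp add: gen_alg.base_S)

lemma AB: "A \<subseteq> B"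
 using \<alpha>B by (intro ga_least B RB) auto

lemma gR: "g \<in> polys R"
 by (rule normal_minpoly[OF polynomial_ring_normal[OF K X] int[OF \<alpha>B] g])

lemma polyA: "q \<in> polys R \<Longrightarrow> poly q \<alpha> \<in> A"
 unfolding ga_singleton[OF Rs] by blast

lemma \<gamma>A: "\<gamma> \<in> A"
 by (rule polyA[OF po_pderiv[OF Rs gR]])

lemma \<gamma>_nz: "\<gamma> \<noteq> 0"
 by (rule minpoly_separable(4)[OF ch Fs g minpolyD(3)[OF g]])

lemma A_unique:
 assumes "q \<in> polys R" "degree q < n" "poly q \<alpha> = 0"
 shows "q = 0"
 using minpolyD(6)[OF g _ assms(3,2)] assms(1) polys_mono[OF RF] by blast

lemma poly_reduce:
 assumes q: "q \<in> polys R"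
 obtains q' where "q' \<in> polys R" "degree q' < n" "poly q' \<alpha> = poly q \<alpha>"
proof -
 obtain u r where "u \<in> polys R" "r \<in> polys R" "q = g * u + r" "degree r < n"
  using po_monic_div[OF Rs gR q minpolyD(5,2)[OF g]] .
 then show thesis using that[of r] minpolyD(3)[OF g] by simp
qed

lemma A_repr:
 assumes "a \<in> A"
 obtains q where "q \<in> polys R" "degree q < n" "poly q \<alpha> = a"
proof -
 obtain q0 where q0: "q0 \<in> polys R" "a = poly q0 \<alpha>" using assms unfolding ga_singleton[OF Rs] by blast
 obtain q where q: "q \<in> polys R" "degree q < n" "poly q \<alpha> = poly q0 \<alpha>" using poly_reduce[OF q0(1)] .
 show thesis by (rule that[OF q(1,2)]) (simp add: q(3) q0(2))
qed

lemma R_cancel: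
 assumes r: "r \<in> R" "r \<noteq> 0" and q: "q1 \<in> polys R" "degree q1 < n" "q2 \<in> polys R" "degree q2 < n" and eq: "r * poly q1 \<alpha> = poly q2 \<alpha>"
 shows "r * coeff q1 i = coeff q2 i"
proof -
 have "smult r q1 - q2 = 0"
 proof (rule A_unique)
  show "smult r q1 - q2 \<in> polys R" using q r by (intro sr_diff[OF po_subring[OF Rs]] po_smult[OF Rs])
  show "degree (smult r q1 - q2) < n" using q by (intro degree_diff_less) (auto intro: le_less_trans[OF degree_smult_le])
  show "poly (smult r q1 - q2) \<alpha> = 0" using eq by simp
 qed
 then have "smult r q1 = q2" by simp
 from arg_cong[OF this, of "\<lambda>q. coeff q i"] show ?thesis by simp
qed

lemma p_dvd_coeffs:
 assumes p: "p \<noteq> 0" and d: "\<And>i. dvd_in R p (coeff q i)"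
 obtains a where "a \<in> A" "poly q \<alpha> = p * a"
proof -
 have "\<exists>c. c \<in> R \<and> coeff q i = p * c" for i using d[of i] by (auto simp: dvd_in_def)
 then obtain c where c: "\<And>i. c i \<in> R" "\<And>i. coeff q i = p * c i" by metis
 have c0: "c i = 0" if "i > degree q" for i using c(2)[of i] that p by (simp add: coeff_eq_0)
 define r where "r = (\<Sum>j\<le>degree q. monom (c j) j)"
 have cr: "coeff r i = c i" for i unfolding r_def coeff_sum_monom using c0[of i] by auto
 have "q = smult p r" by (rule poly_eqI) (simp add: cr c(2))
 then have "poly q \<alpha> = p * poly r \<alpha>" by simp
 moreover have "poly r \<alpha> \<in> A" using c(1) cr by (intro polyA polysI) simp
 ultimately show thesis by (rule that[rotated])
qed

text \<open>\<open>A\<close> is a free \<open>R\<close>-module on the powers of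
  \<open>\<alpha>\<close> below \<open>n\<close>, so the prime element \<open>p\<close> can be
  treated coefficient by coefficient.\<close>

lemma A_prime_cancel:
 assumes p: "prime_elt R p" and r: "r \<in> R" "\<not> dvd_in R p r" and z: "z \<in> A" "r * z = p * a" "a \<in> A"
 obtains a' where "a' \<in> A" "z = p * a'"
proof -
 have pR: "p \<in> R" "p \<noteq> 0" using p by (auto simp: prime_elt_def)
 obtain q where q: "q \<in> polys R" "degree q < n" "poly q \<alpha> = z" using A_repr[OF z(1)] .
 obtain q2 where q2: "q2 \<in> polys R" "degree q2 < n" "poly q2 \<alpha> = a" using A_repr[OF z(3)] .
 have "p * coeff q2 i = coeff (smult r q) i" for i
 proof (rule R_cancel[OF pR q2(1,2)])
  show "smult r q \<in> polys R" by (intro po_smult[OF Rs] r q)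
  show "degree (smult r q) < n" using q(2) by (rule le_less_trans[OF degree_smult_le])
  show "p * poly q2 \<alpha> = poly (smult r q) \<alpha>" using q q2 z by simp
 qed
 then have "dvd_in R p (r * coeff q i)" for i using polysD[OF q2(1), of i] by (auto simp: dvd_in_def intro!: bexI[of _ "coeff q2 i"])
 then have "dvd_in R p (coeff q i)" for i using p r polysD[OF q(1)] by (auto simp: prime_elt_def)
 then show thesis using p_dvd_coeffs[OF pR(2), of q] q(3) that by metis
qed

text \<open>The excess \<open>c\<close> absorbs all constants that do not depend on the specialization.\<close>

definition bd :: "nat \<Rightarrow> nat \<Rightarrow> 'b set" where
 "bd N c = {poly q \<alpha> | q. degree q \<le> c \<and> (\<forall>i. coeff q i \<in> filt K X (N + c))}"

lemma bdI: "degree q \<le> c \<Longrightarrow> (\<And>i. coeff q i \<in> filt K X (N + c)) \<Longrightarrow> poly q \<alpha> \<in> bd N c"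
 by (auto simp: bd_def)

lemma bdE:
 assumes "a \<in> bd N c"
 obtains q where "a = poly q \<alpha>" "degree q \<le> c" "\<And>i. coeff q i \<in> filt K X (N + c)" "q \<in> polys R"
proof -
 obtain q where q: "a = poly q \<alpha>" "degree q \<le> c" "\<And>i. coeff q i \<in> filt K X (N + c)" using assms by (auto simp: bd_def)
 show thesis by (rule that[OF q]) (use q(3) filt_subset_ga[OF Ks, of X] in \<open>auto intro: polysI\<close>)
qed

lemma bd_A: "bd N c \<subseteq> A"
proof
 fix a assume "a \<in> bd N c"
 then obtain q where "a = poly q \<alpha>" "q \<in> polys R" by (rule bdE)
 then show "a \<in> A" using polyA by simp
qed

lemma bd_mono:
 assumes "N \<le> N'" "c \<le> c'" "a \<in> bd N c"
 shows "a \<in> bd N' c'"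
proof -
 obtain q where q: "a = poly q \<alpha>" "degree q \<le> c" "\<And>i. coeff q i \<in> filt K X (N + c)" "q \<in> polys R" by (rule bdE[OF assms(3)]) (rule that)
 have "coeff q i \<in> filt K X (N' + c')" for i by (rule filt_mono[OF _ q(3)]) (use assms in simp)
 then show ?thesis unfolding q(1) using q(2) assms by (intro bdI) auto
qed

lemma bd_add: "a \<in> bd N c \<Longrightarrow> b \<in> bd N c \<Longrightarrow> a + b \<in> bd N c"
proof (elim bdE)
 fix q r assume *: "a = poly q \<alpha>" "degree q \<le> c" "\<And>i. coeff q i \<in> filt K X (N + c)"
  "b = poly r \<alpha>" "degree r \<le> c" "\<And>i. coeff r i \<in> filt K X (N + c)"
 have "poly (q + r) \<alpha> \<in> bd N c" using * by (intro bdI) (auto intro: degree_add_le filt_add)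
 then show "a + b \<in> bd N c" using * by simp
qed

lemma bd_mult:
 assumes "a \<in> bd N c" "b \<in> bd N' c'"
 shows "a * b \<in> bd (N + N') (c + c')"
proof -
 obtain q where q: "a = poly q \<alpha>" "degree q \<le> c" "\<And>i. coeff q i \<in> filt K X (N + c)" "q \<in> polys R" by (rule bdE[OF assms(1)]) (rule that)
 obtain r where r: "b = poly r \<alpha>" "degree r \<le> c'" "\<And>i. coeff r i \<in> filt K X (N' + c')" "r \<in> polys R" by (rule bdE[OF assms(2)]) (rule that)
 have "poly (q * r) \<alpha> \<in> bd (N + N') (c + c')"
 proof (rule bdI)
  show "degree (q * r) \<le> c + c'" using degree_mult_le[of q r] q(2) r(2) by simp
  fix i
  have "coeff q j * coeff r (i - j) \<in> filt K X (N + N' + (c + c'))" for j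
   using filt_mult[OF Ks q(3)[of j] r(3)[of "i - j"]] by (simp add: ac_simps)
  then show "coeff (q * r) i \<in> filt K X (N + N' + (c + c'))" unfolding coeff_mult by (rule filt_sum)
 qed
 then show ?thesis using q r by simp
qed

lemma filt_bd:
 assumes "r \<in> filt K X N"
 shows "r \<in> bd N 0"
 using bdI[of "[:r:]" 0 N] assms filt_zero[of K X N] by (simp add: coeff_pCons split: nat.split)

lemma poly_filt:
 assumes "q \<in> polys R"
 obtains N where "\<And>i. coeff q i \<in> filt K X N"
proof -
 have "\<exists>m. coeff q i \<in> filt K X m" for i using ga_filt[OF Ks polysD[OF assms]] .
 then obtain m where m: "\<And>i. coeff q i \<in> filt K X (m i)" by metis
 have "coeff q i \<in> filt K X (\<Sum>i\<le>degree q. m i)" for i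
 proof (cases "i \<le> degree q")
  case True
  then have "m i \<le> (\<Sum>i\<le>degree q. m i)" by (intro member_le_sum) auto
  then show ?thesis using m[of i] by (rule filt_mono)
 qed (simp add: coeff_eq_0 filt_zero)
 then show thesis by (rule that)
qed

lemma A_bd:
 assumes "a \<in> A"
 obtains c where "a \<in> bd 0 c"
proof -
 obtain q where q: "q \<in> polys R" "poly q \<alpha> = a" using A_repr[OF assms] by metis
 obtain N where N: "\<And>i. coeff q i \<in> filt K X N" by (rule poly_filt[OF q(1)]) (rule that)
 have "coeff q i \<in> filt K X (0 + (degree q + N))" for i by (rule filt_mono[OF _ N]) simp
 then have "poly q \<alpha> \<in> bd 0 (degree q + N)" by (intro bdI) simp_all
 then show thesis using q(2) that by simp
qed

lemma bd_uminus: "a \<in> bd N c \<Longrightarrow> - a \<in> bd N c"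
proof (elim bdE)
 fix q assume *: "a = poly q \<alpha>" "degree q \<le> c" "\<And>i. coeff q i \<in> filt K X (N + c)"
 have "poly (- q) \<alpha> \<in> bd N c" using * filt_diff[OF Ks filt_zero, of "coeff q _"] by (intro bdI) auto
 then show "- a \<in> bd N c" using * by simp
qed

lemma bd_diff: "a \<in> bd N c \<Longrightarrow> b \<in> bd N c \<Longrightarrow> a - b \<in> bd N c"
 using bd_add[OF _ bd_uminus] by fastforce

lemma bd_sum: "(\<And>i. i \<in> I \<Longrightarrow> f i \<in> bd N c) \<Longrightarrow> sum f I \<in> bd N c"
proof (induction I rule: infinite_finite_induct)
 case (insert i I)
 then show ?case by (simp add: bd_add)
qed (use filt_bd[OF filt_zero, of N] bd_mono[of N N 0 c] in auto)

lemma bd_span: obtains M where "finite M" "bd N c \<subseteq> dspan K M"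
proof -
 let ?M1 = "{prod_list xs | xs. set xs \<subseteq> X \<and> length xs \<le> N + c}"
 let ?M2 = "(\<lambda>i. \<alpha> ^ i) ` {..c}"
 let ?M = "{m * m' | m m'. m \<in> ?M1 \<and> m' \<in> ?M2}"
 have "?M = (\<lambda>(m, m'). m * m') ` (?M1 \<times> ?M2)" by auto
 moreover have "finite (?M1 \<times> ?M2)" using finite_monomials[OF fX, of "N + c"] by (intro finite_cartesian_product) auto
 ultimately have "finite ?M" by (metis (lifting) finite_imageI)
 moreover have "bd N c \<subseteq> dspan K ?M"
 proof
  fix a assume "a \<in> bd N c"
  then obtain q where q: "a = poly q \<alpha>" "degree q \<le> c" "\<And>i. coeff q i \<in> filt K X (N + c)" using bdE by metis
  have "a = (\<Sum>i\<le>c. coeff q i * \<alpha> ^ i)" unfolding q(1) by (rule poly_as_sum_le) (rule q(2))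
  also have "\<dots> \<in> dspan (filt K X (N + c)) ?M2" using q(3) by (intro dspan_sum dspan_base) auto
  also have "\<dots> \<subseteq> dspan K ?M" by (rule dspan_tower) (simp add: filt_def)
  finally show "a \<in> dspan K ?M" .
 qed
 ultimately show thesis by (rule that)
qed

text \<open>The bound \<open>c'\<close> is uniform in \<open>r\<close>: in the basis of powers of
  \<open>\<alpha>\<close> the coefficients of \<open>r * a\<close> are \<open>r\<close> times those
  of \<open>a\<close>, and total degrees add. Only the excess over the degree of \<open>r\<close>
  remains.\<close>

lemma bd_divide:
 obtains c' where "\<And>r a. r \<in> R \<Longrightarrow> r \<noteq> 0 \<Longrightarrow> a \<in> A \<Longrightarrow> r * a \<in> bd (tdeg K X r) c \<Longrightarrow> a \<in> bd 0 c'"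
proof -
 have "\<exists>\<rho>. \<rho> \<in> polys R \<and> degree \<rho> < n \<and> poly \<rho> \<alpha> = \<alpha> ^ i" for i
 proof -
  have "\<alpha> ^ i \<in> A" by (rule sr_power[OF As \<alpha>A])
  then show ?thesis using A_repr by metis
 qed
 then obtain \<rho> where \<rho>: "\<And>i. \<rho> i \<in> polys R" "\<And>i. degree (\<rho> i) < n" "\<And>i. poly (\<rho> i) \<alpha> = \<alpha> ^ i" by metis
 have "\<exists>m. coeff (\<rho> i) j \<in> filt K X m" for i j using ga_filt[OF Ks polysD[OF \<rho>(1)]] .
 then obtain m where m: "\<And>i j. coeff (\<rho> i) j \<in> filt K X (m i j)" by metis
 \<comment> \<open>The degree cost of rewriting \<open>\<alpha>^i\<close> for
   \<open>i \<le> c\<close> in the basis of powers below \<open>n\<close>; it depends on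
   \<open>c\<close> and \<open>g\<close> only.\<close>
 define w where "w = (\<Sum>i\<le>c. \<Sum>j<n. m i j)"
 have \<rho>w: "coeff (\<rho> i) j \<in> filt K X w" if "i \<le> c" for i j
 proof (cases "j < n")
  case True
  have "m i j \<le> (\<Sum>j<n. m i j)" using True by (intro member_le_sum) auto
  also have "\<dots> \<le> w" unfolding w_def using that by (intro member_le_sum[of i "{..c}" "\<lambda>i. \<Sum>j<n. m i j"]) auto
  finally show ?thesis using m by (rule filt_mono)
 next
  case False
  then show ?thesis using \<rho>(2)[of i] by (simp add: coeff_eq_0 filt_zero)
 qed
 show thesis
 proof (rule that[of "n + c + w"])
  fix r a assume r: "r \<in> R" "r \<noteq> 0" and a: "a \<in> A" "r * a \<in> bd (tdeg K X r) c"
  obtain q where q: "r * a = poly q \<alpha>" "degree q \<le> c" "\<And>i. coeff q i \<in> filt K X (tdeg K X r + c)" "q \<in> polys R" by (rule bdE[OF a(2)]) (rule that)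
  define q' where "q' = (\<Sum>i\<le>c. smult (coeff q i) (\<rho> i))"
  have q': "q' \<in> polys R" "degree q' < n" "poly q' \<alpha> = r * a"
  proof -
   show "q' \<in> polys R" unfolding q'_def by (intro sr_sum[OF po_subring[OF Rs]] po_smult[OF Rs] polysD[OF q(4)] \<rho>)
   show "degree q' < n" unfolding q'_def using minpolyD(5)[OF g]
    by (intro degree_sum_less) (auto intro: le_less_trans[OF degree_smult_le] \<rho>)
   show "poly q' \<alpha> = r * a" unfolding q'_def poly_sum poly_smult \<rho>(3) q(1) by (rule poly_as_sum_le[symmetric]) (rule q(2))
  qed
  have q'f: "coeff q' j \<in> filt K X (tdeg K X r + (c + w))" for j
   unfolding q'_def coeff_sum coeff_smult using filt_mult[OF Ks q(3) \<rho>w]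
   by (intro filt_sum) (simp add: add.assoc)
  obtain s where s: "s \<in> polys R" "degree s < n" "poly s \<alpha> = a" using A_repr[OF a(1)] .
  have cs: "r * coeff s j = coeff q' j" for j
   by (rule R_cancel[OF r s(1,2) q'(1,2)]) (simp add: s q')
  have sf: "coeff s j \<in> filt K X (c + w)" for j
  proof (cases "coeff s j = 0")
   case False
   have "tdeg K X (coeff q' j) \<le> tdeg K X r + (c + w)" by (rule filt_tdeg[OF K X q'f])
   then have "tdeg K X (coeff s j) \<le> c + w"
    using tdeg_mult[OF K X r(1) polysD[OF s(1)] r(2) False] by (simp add: cs)
   then show ?thesis using filt_iff_tdeg[OF K X polysD[OF s(1)]] by blast
  qed (simp add: filt_zero)
  have "coeff s j \<in> filt K X (0 + (n + c + w))" for j by (rule filt_mono[OF _ sf]) simp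
  then have "poly s \<alpha> \<in> bd 0 (n + c + w)" using s(2) by (intro bdI) auto
  then show "a \<in> bd 0 (n + c + w)" by (simp add: s(3))
 qed
qed

lemma map_poly_pd_filt: "x \<in> X \<Longrightarrow> coeff q i \<in> filt K X N \<Longrightarrow> coeff (map_poly (pd x) q) i \<in> filt K X N"
 using pd_filt(1)[OF ch Ks fX pd] by (simp add: coeff_map_poly derivation_zero[OF pd(1)])

lemma pd_R: "x \<in> X \<Longrightarrow> r \<in> R \<Longrightarrow> pd x r \<in> R"
 using ga_filt[OF Ks, of r X] pd_filt(1)[OF ch Ks fX pd, of x r] filt_subset_ga[OF Ks, of X] by blast

lemma pd_poly:
 assumes x: "x \<in> X" and q: "q \<in> polys R"
 shows "pd x (poly q \<alpha>) = poly (map_poly (pd x) q) \<alpha> + poly (pderiv q) \<alpha> * pd x \<alpha>"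
proof -
 have "deriv_on R (pd x)" "deriv_on UNIV (pd x)" using pd(1)[OF x] by (auto simp: deriv_on_def derivation_def)
 from deriv_poly[OF Rs this _ _ q] show ?thesis by (simp add: pdiff_def subring_set_def)
qed

lemma mp_pd_over: "x \<in> X \<Longrightarrow> q \<in> polys R \<Longrightarrow> map_poly (pd x) q \<in> polys R"
 using pd_R[OF _ polysD] by (intro polysI) (simp add: coeff_map_poly derivation_zero[OF pd(1)])

lemma \<gamma>_pd_\<alpha>:
 assumes x: "x \<in> X"
 shows "\<gamma> * pd x \<alpha> \<in> A"
proof -
 have "\<gamma> * pd x \<alpha> = - poly (map_poly (pd x) g) \<alpha>"
  using pd_poly[OF x gR] minpolyD(3)[OF g] derivation_zero[OF pd(1)[OF x]] by (simp add: eq_neg_iff_add_eq_0 add.commute)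
 then show ?thesis using polyA[OF mp_pd_over[OF x gR]] sr_uminus[OF As] by simp
qed

lemma \<gamma>_pd_A:
 assumes x: "x \<in> X" and a: "a \<in> A"
 shows "\<gamma> * pd x a \<in> A"
proof -
 obtain q where q: "q \<in> polys R" "poly q \<alpha> = a" using A_repr[OF a] by metis
 have "\<gamma> * pd x a = \<gamma> * poly (map_poly (pd x) q) \<alpha> + poly (pderiv q) \<alpha> * (\<gamma> * pd x \<alpha>)"
  unfolding q(2)[symmetric] pd_poly[OF x q(1)] by (simp add: algebra_simps)
 then show ?thesis using polyA[OF mp_pd_over[OF x q(1)]] polyA[OF po_pderiv[OF Rs q(1)]] \<gamma>_pd_\<alpha>[OF x] \<gamma>A
  by (simp add: sr_add[OF As] sr_mult[OF As])
qed

text \<open>Implicit differentiation of \<open>g(\<alpha>) = 0\<close> has denominator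
  \<open>\<gamma>\<close>. The constant depends only on \<open>\<gamma>\<close> and on the finitely
  many \<open>\<gamma> * pd x \<alpha>\<close>.\<close>

lemma bd_pd:
 obtains c0 where "\<And>N c a x. x \<in> X \<Longrightarrow> a \<in> bd N c \<Longrightarrow> \<gamma> * pd x a \<in> bd N (c + c0)"
proof -
 obtain c1 where c1: "\<gamma> \<in> bd 0 c1" using A_bd[OF \<gamma>A] .
 have "\<exists>c. \<gamma> * pd x \<alpha> \<in> bd 0 c" if "x \<in> X" for x using A_bd[OF \<gamma>_pd_\<alpha>[OF that]] by metis
 then obtain cx where cx: "\<And>x. x \<in> X \<Longrightarrow> \<gamma> * pd x \<alpha> \<in> bd 0 (cx x)" by metis
 define c2 where "c2 = sum cx X"
 have c2: "\<gamma> * pd x \<alpha> \<in> bd 0 c2" if "x \<in> X" for x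
  by (rule bd_mono[OF _ _ cx[OF that]]) (use fX that in \<open>auto simp: c2_def intro: member_le_sum\<close>)
 show thesis
 proof (rule that[of "c1 + c2"])
  fix N c a x assume x: "x \<in> X" and a: "a \<in> bd N c"
  obtain q where q: "a = poly q \<alpha>" "degree q \<le> c" "\<And>i. coeff q i \<in> filt K X (N + c)" "q \<in> polys R" by (rule bdE[OF a]) (rule that)
  have "poly (map_poly (pd x) q) \<alpha> \<in> bd N c"
  proof (rule bdI)
   show "degree (map_poly (pd x) q) \<le> c" using degree_map_poly_le[of "pd x" q] q(2) by simp
  qed (rule map_poly_pd_filt[OF x q(3)])
  from bd_mult[OF c1 this] have 1: "\<gamma> * poly (map_poly (pd x) q) \<alpha> \<in> bd N (c + (c1 + c2))"
   by (rule bd_mono[rotated 2]) auto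
  have "poly (pderiv q) \<alpha> \<in> bd N c"
  proof (rule bdI)
   show "degree (pderiv q) \<le> c" using q(2) by (simp add: degree_pderiv_le[THEN order_trans])
   show "coeff (pderiv q) i \<in> filt K X (N + c)" for i
    unfolding coeff_pderiv by (intro filt_cmult[OF Ks] sr_of_nat[OF Ks] q(3))
  qed
  from bd_mult[OF this c2[OF x]] have 2: "poly (pderiv q) \<alpha> * (\<gamma> * pd x \<alpha>) \<in> bd N (c + (c1 + c2))"
   by (rule bd_mono[rotated 2]) auto
  have "\<gamma> * pd x a = \<gamma> * poly (map_poly (pd x) q) \<alpha> + poly (pderiv q) \<alpha> * (\<gamma> * pd x \<alpha>)"
   unfolding q(1) pd_poly[OF x q(4)] by (simp add: algebra_simps)
  then show "\<gamma> * pd x a \<in> bd N (c + (c1 + c2))" using bd_add[OF 1 2] by simp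
 qed
qed

end

lemma prime_elt_tdeg_pos:
 assumes K: "subfield_set K" and X: "indep K X" and p: "prime_elt (gen_alg K X) p"
 shows "tdeg K X p > 0"
proof (rule ccontr)
 have pR: "p \<in> gen_alg K X" "p \<noteq> 0" using p by (auto simp: prime_elt_def)
 assume "\<not> tdeg K X p > 0"
 then have "p \<in> K" using tdeg_0_const[OF K X pR(1)] by simp
 then have "inverse p \<in> gen_alg K X" using sf_inverse[OF K] ga_base(1)[of K X] by blast
 then have "dvd_in (gen_alg K X) p 1" using pR(2) by (auto simp: dvd_in_def intro!: bexI[of _ "inverse p"])
 then show False using p by (simp add: prime_elt_def)
qed

lemma mp_sum:
 assumes "subring_set D" "rhom D f" "\<And>i. i \<in> I \<Longrightarrow> q i \<in> polys D"
 shows "map_poly f (\<Sum>i\<in>I. q i) = (\<Sum>i\<in>I. map_poly f (q i :: 'a::idom poly) :: 'b::idom poly)"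
 using assms by (intro poly_eqI) (simp add: rhom_map_coeff[OF assms(1,2)] coeff_sum rhom_sum[OF assms(1,2)] polysD)

text \<open>Roots of a monic polynomial with coefficients of degree at most \<open>w\<close> have
  weight at most \<open>w\<close>: after scaling the roots by \<open>T^w\<close>, each lower
  coefficient carries at least the factor \<open>T^w\<close> that its degree requires.\<close>

lemma rhom_roots_weighted:
 fixes q :: "'b::field poly" and T :: 'b
 assumes K: "subring_set K" and f: "rhom (gen_alg K X) f" "\<And>c. c \<in> K \<Longrightarrow> f c = c" and T0: "T \<noteq> 0"
  and q: "\<And>i. coeff q i \<in> filt K X w" "lead_coeff q = 1" and r: "poly (map_poly f q) r = 0"
 shows "integral_over (rees K (f ` X) T) (r * T ^ w)"
proof -
 let ?S = "rees K (f ` X) T" and ?n = "degree q" and ?u = "T ^ w"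
 have S: "subring_set ?S" by (rule rees_sr[OF K])
 have R: "subring_set (gen_alg K X)" by (rule ga_subring[OF K])
 have u0: "?u \<noteq> 0" using T0 by simp
 define h where "h = smult (?u ^ ?n) (pcompose (map_poly f q) [:0, 1 / ?u:])"
 have ch: "coeff h j = ?u ^ ?n * (f (coeff q j) / ?u ^ j)" for j
  by (simp add: h_def coeff_pcompose_linear power_divide rhom_map_coeff[OF R f(1)])
 have one: "coeff h ?n = 1" unfolding ch using q(2) u0 rhom_one[OF R f(1)] by simp
 have "coeff h j \<in> ?S" for j
 proof (cases j ?n rule: linorder_cases)
  case less
  then obtain d where d: "?n = j + Suc d" using less_imp_Suc_add[of j ?n] by auto
  have "f (coeff q j) * T ^ (w * Suc d) \<in> ?S"
  proof (rule filt_rees_ge[OF K filt_image[OF K f q(1)]])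
   show "w \<le> w * Suc d" unfolding mult_Suc_right by (rule le_add1)
  qed
  moreover have "coeff h j = f (coeff q j) * T ^ (w * Suc d)"
   unfolding ch d power_mult using u0 by (simp only: power_add) (simp add: field_simps)
  ultimately show ?thesis by simp
 next
  case equal
  then show ?thesis using one sr_one[OF S] by simp
 next
  case greater
  then show ?thesis unfolding ch by (simp add: coeff_eq_0 rhom_zero[OF R f(1)] sr_zero[OF S])
 qed
 then have hS: "h \<in> polys ?S" by (rule polysI)
 have "degree h = ?n"
 proof (rule antisym)
  show "degree h \<le> ?n" by (rule degree_le) (simp add: ch coeff_eq_0 rhom_zero[OF R f(1)])
  show "?n \<le> degree h" using one by (intro le_degree) simp
 qed
 moreover have "poly h (r * ?u) = 0" using r T0 by (simp add: h_def poly_pcompose)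
 ultimately show ?thesis using hS one by (intro integral_overI[of h]) simp_all
qed

section \<open>Forms attached to specializations\<close>

context primitive_integral
begin

text \<open>\<open>\<pi>\<close> is reduction modulo a prime of \<open>B\<close> over
  \<open>(p)\<close>. By the last clause \<open>\<gamma>\<close> has a multiple in \<open>R\<close>
  outside \<open>(p)\<close>, so that divisions by \<open>\<gamma>\<close> can be undone with
  \<open>A_prime_cancel\<close>.\<close>

definition spec :: "('b \<Rightarrow> 'b) \<Rightarrow> 'b \<Rightarrow> bool" where
 "spec \<pi> p \<longleftrightarrow> rhom B \<pi> \<and> (\<forall>c\<in>K. \<pi> c = c) \<and> prime_elt R p \<and> (\<forall>r\<in>R. \<pi> r = 0 \<longleftrightarrow> dvd_in R p r) \<and>
   T \<notin> acl (\<pi> ` R) \<and> (\<exists>c\<in>A. \<gamma> * c \<in> R \<and> \<pi> (\<gamma> * c) \<noteq> 0)"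

text \<open>\<open>m\<close> is the factor of \<open>g\<close> modulo \<open>p\<close> that belongs to the specialization \<open>\<pi>\<close>, so \<open>m' dm/dY\<close> equals
\<open>dg/dY\<close> at its own conjugates of \<open>\<alpha>\<close> and vanishes at the others. Hence \<open>h x / \<gamma>\<close> is \<open>e \<partial>p/\<partial>x\<close> modulo \<open>p\<close>,
with \<open>e\<close> an idempotent, and \<open>\<Sum> h x / (\<gamma> p) dx\<close> behaves like \<open>e dp/p\<close>.\<close>

definition is_form :: "nat \<Rightarrow> ('b \<Rightarrow> 'b) \<Rightarrow> 'b \<Rightarrow> ('b \<Rightarrow> 'b) \<Rightarrow> bool" where
 "is_form w \<pi> p h \<longleftrightarrow> (\<exists>H m m'. map_poly \<pi> g = m * m' \<and> minpoly (fracs (\<pi> ` R)) (\<pi> \<alpha>) m \<and>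
   (\<forall>x\<in>X. H x \<in> polys R \<and> degree (H x) \<le> n \<and> (\<forall>i. coeff (H x) i \<in> filt K X (tdeg K X p + w)) \<and>
    map_poly \<pi> (H x) = smult (\<pi> (pd x p)) (pderiv m * m') \<and> h x = poly (H x) \<alpha>))"

lemma specD:
 assumes "spec \<pi> p"
 shows "rhom B \<pi>" "rhom A \<pi>" "rhom R \<pi>" "\<And>c. c \<in> K \<Longrightarrow> \<pi> c = c" "prime_elt R p" "p \<in> R" "p \<noteq> 0"
  "\<And>r. r \<in> R \<Longrightarrow> \<pi> r = 0 \<longleftrightarrow> dvd_in R p r" "T \<notin> acl (\<pi> ` R)" "\<pi> \<gamma> \<noteq> 0" "\<pi> p = 0" "tdeg K X p > 0"
proof -
 show 1: "rhom B \<pi>" using assms by (simp add: spec_def)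
 show 2: "rhom A \<pi>" "rhom R \<pi>" by (rule rhom_subset[OF 1 AB], rule rhom_subset[OF 1 RB])
 show 3: "\<And>c. c \<in> K \<Longrightarrow> \<pi> c = c" and 4: "prime_elt R p" and 5: "\<And>r. r \<in> R \<Longrightarrow> \<pi> r = 0 \<longleftrightarrow> dvd_in R p r" and 6: "T \<notin> acl (\<pi> ` R)"
  using assms unfolding spec_def by blast+
 show pR: "p \<in> R" "p \<noteq> 0" using 4 by (auto simp: prime_elt_def)
 obtain c where c: "c \<in> A" "\<pi> (\<gamma> * c) \<noteq> 0" using assms unfolding spec_def by blast
 then show "\<pi> \<gamma> \<noteq> 0" using rhom_mult[OF As 2(1) \<gamma>A c(1)] by auto
 show "\<pi> p = 0" using 5[OF pR(1)] sr_one[OF Rs] by (force simp: dvd_in_def)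
 show "tdeg K X p > 0" by (rule prime_elt_tdeg_pos[OF K X 4])
qed

text \<open>\<open>conductor\<close> bounds derivatives along good directions. Changing such a
  direction at \<open>x\<close> alone changes the derivative by a constant multiple of
  \<open>pd x p\<close>, which is thus a difference of two bounded terms.\<close>

lemma spec_partial_filt:
 assumes s: "spec \<pi> p" and e: "e \<in> fracs (\<pi> ` R)" "integral_over (rees K (\<pi> ` X) T) (e * T ^ w)" and x: "x \<in> X"
 shows "\<pi> (pd x p) * e \<in> \<pi> ` filt K X (tdeg K X p - 1 + w)"
proof -
 note sD = specD[OF s]
 let ?M = "\<pi> ` filt K X (tdeg K X p - 1 + w)"
 define D where "D v z = (\<Sum>y\<in>X. v y * pd y z)" for v z
 have Dp: "\<pi> (D v p) * e \<in> ?M" if v: "good_direction K X p v" for v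
 proof (rule conductor[OF ch K X sD(3,4,8,5,9) v _ _ _ e])
  show "derivation (D v)" unfolding D_def by (rule derivation_comb[OF ch pd(1)])
  show "D v c = 0" if "c \<in> K" for c using pd(2) that by (simp add: D_def)
  show "D v y = v y" if "y \<in> X" for y
  proof -
   have "D v y = (\<Sum>z\<in>X. if z = y then v z else 0)" unfolding D_def using pd(3) that by (intro sum.cong) auto
   then show ?thesis using fX that by simp
  qed
 qed
 obtain v where v: "good_direction K X p v" using good_direction_ex[OF K inf X sD(6,7)] .
 obtain c where c: "c \<in> K" "c \<noteq> 0" "good_direction K X p (v(x := v x + c))" using good_direction_perturb[OF K inf X sD(6) v x] .
 have vK: "v y \<in> R" if "y \<in> X" for y using v that ga_base(1)[of K X] by (auto simp: good_direction_def)
 have DR: "D v p \<in> R" unfolding D_def by (intro sr_sum[OF Rs] sr_mult[OF Rs] vK pd_R sD(6))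
 have pR: "pd x p \<in> R" by (rule pd_R[OF x sD(6)])
 have cR: "c \<in> R" using c(1) ga_base(1)[of K X] by blast
 have "D (v(x := v x + c)) p = D v p + c * pd x p" unfolding D_def using fX x
  by (subst (1 2) sum.remove[of _ x]) (auto simp: algebra_simps intro!: sum.cong)
 then have "\<pi> (D (v(x := v x + c)) p) = \<pi> (D v p) + c * \<pi> (pd x p)"
  using rhom_add[OF Rs sD(3) DR sr_mult[OF Rs cR pR]] rhom_mult[OF Rs sD(3) cR pR] sD(4)[OF c(1)] by simp
 then have "\<pi> (pd x p) * e = inverse c * (\<pi> (D (v(x := v x + c)) p) * e - \<pi> (D v p) * e)"
  using c(2) by (simp add: algebra_simps)
 moreover obtain z1 z2 where z: "z1 \<in> filt K X (tdeg K X p - 1 + w)" "z2 \<in> filt K X (tdeg K X p - 1 + w)"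
   "\<pi> (D (v(x := v x + c)) p) * e = \<pi> z1" "\<pi> (D v p) * e = \<pi> z2" using Dp[OF v] Dp[OF c(3)] by blast
 moreover have iK: "inverse c \<in> K" by (rule sf_inverse[OF K c(1)])
 have zR: "z1 \<in> R" "z2 \<in> R" using z(1,2) filt_subset_ga[OF Ks, of X] by blast+
 have "inverse c \<in> R" using iK ga_base(1)[of K X] by blast
 then have "\<pi> (inverse c * (z1 - z2)) = inverse c * (\<pi> z1 - \<pi> z2)"
  using rhom_mult[OF Rs sD(3) _ sr_diff[OF Rs zR]] rhom_diff[OF Rs sD(3) zR] sD(4)[OF iK] by simp
 moreover have "inverse c * (z1 - z2) \<in> filt K X (tdeg K X p - 1 + w)"
  by (intro filt_cmult[OF Ks iK] filt_diff[OF Ks] z)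
 ultimately show ?thesis by (intro image_eqI[of _ \<pi> "inverse c * (z1 - z2)"]) simp_all
qed

lemma form_ex:
 obtains w where "\<And>\<pi> p. spec \<pi> p \<Longrightarrow> \<exists>h. is_form w \<pi> p h"
proof -
 obtain w0 where w0: "\<And>i. coeff g i \<in> filt K X w0" by (rule poly_filt[OF gR]) (rule that)
 have "\<exists>h. is_form (w0 * n) \<pi> p h" if s: "spec \<pi> p" for \<pi> p
 proof -
  note sD = specD[OF s]
  let ?R' = "\<pi> ` R"
  have R': "subring_set ?R'" by (rule rhom_image[OF Rs sD(3)])
  let ?F = "fracs ?R'"
  have F: "subfield_set ?F" by (rule fracs_subfield[OF R'])
  note F's = sf_sr[OF F]
  have RF': "?R' \<subseteq> ?F" by (rule fracs_base[OF R'])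
  let ?g = "map_poly \<pi> g"
  have gF: "?g \<in> polys ?F" by (rule mp_over[OF Rs sD(3) gR RF'])
  have g0: "poly ?g (\<pi> \<alpha>) = 0"
   using mp_eval[OF As sD(2) _ \<alpha>A, of g] gR polys_mono[OF RA] minpolyD(3)[OF g] rhom_zero[OF As sD(2)] by auto
  have dg: "degree ?g = n" using mp_degree[OF Rs sD(3), of g] minpolyD(2)[OF g] rhom_one[OF Rs sD(3)] by simp
  have lg: "lead_coeff ?g = 1" unfolding dg using minpolyD(2)[OF g] rhom_one[OF Rs sD(3)] by (simp add: rhom_map_coeff[OF Rs sD(3)])
  then have gnz: "?g \<noteq> 0" by auto
  have "\<pi> \<alpha> \<in> acl ?F" using gF g0 gnz by (auto simp: acl_def algebraic_over_def)
  then obtain m where m: "minpoly ?F (\<pi> \<alpha>) m" using minpoly_ex[OF F] by blast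
  obtain m' where m': "m' \<in> polys ?F" "?g = m * m'"
   using minpoly_dvd[OF m F's order_refl minpolyD(1)[OF m] gF g0] .
  have lm: "lead_coeff m = 1" "lead_coeff m' = 1"
   using lg minpolyD(2)[OF m] unfolding m'(2) lead_coeff_mult by simp_all
  have dm: "degree m + degree m' = n" using gnz dg unfolding m'(2) by (subst degree_mult_eq[symmetric]) auto
  let ?E = "pderiv m * m'"
  have T0: "T \<noteq> 0" using sD(9) acl_base[OF R'] sr_zero[OF R'] by blast
  let ?S = "rees K (\<pi> ` X) T"
  let ?I = "{z. integral_over ?S z}"
  have S: "subring_set ?S" by (rule rees_sr[OF Ks])
  have I: "subring_set ?I" by (rule integral_closure_subring[OF S])
  let ?u = "T ^ w0"
  have uI: "?u \<in> ?I" "?u \<noteq> 0" using integral_over_base[OF S sr_power[OF S rees_T]] T0 by auto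
  have root: "r * ?u \<in> ?I" if "poly ?g r = 0" for r
   using rhom_roots_weighted[OF Ks sD(3,4) T0 w0 minpolyD(2)[OF g] that] by simp
  have sm: "smult (?u ^ degree m) m \<in> polys ?I" by (rule scaled_monic_integral[OF I uI lm(1) root]) (simp add: m')
  have sm': "smult (?u ^ degree m') m' \<in> polys ?I" by (rule scaled_monic_integral[OF I uI lm(2) root]) (simp add: m')
  have "smult (?u ^ n) ?E = pderiv (smult (?u ^ degree m) m) * smult (?u ^ degree m') m'"
   unfolding dm[symmetric] by (simp add: pderiv_smult power_add mult.commute)
  also have "\<dots> \<in> polys ?I" by (intro sr_mult[OF po_subring[OF I]] po_pderiv[OF I] sm sm')
  finally have EI: "integral_over ?S (coeff ?E j * T ^ (w0 * n))" for j
   using polysD[of "smult (?u ^ n) ?E" ?I j] by (simp add: power_mult mult.commute)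
  have EF: "coeff ?E j \<in> ?F" for j
   by (rule polysD) (intro sr_mult[OF po_subring[OF F's]] po_pderiv[OF F's] minpolyD(1)[OF m] m'(1))
  have dE: "degree ?E \<le> n"
  proof -
   have "degree ?E \<le> degree (pderiv m) + degree m'" by (rule degree_mult_le)
   also have "\<dots> \<le> degree m + degree m'" by (simp add: degree_pderiv_le[THEN order_trans])
   finally show ?thesis using dm by simp
  qed
  have "\<exists>f. f \<in> filt K X (tdeg K X p - 1 + w0 * n) \<and> \<pi> f = \<pi> (pd x p) * coeff ?E j" if "x \<in> X" for x j
   using spec_partial_filt[OF s EF EI that, of j] by auto
  then obtain f where f: "\<And>x j. x \<in> X \<Longrightarrow> f x j \<in> filt K X (tdeg K X p - 1 + w0 * n)"
   "\<And>x j. x \<in> X \<Longrightarrow> \<pi> (f x j) = \<pi> (pd x p) * coeff ?E j" by metis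
  define H where "H x = (\<Sum>j\<le>n. monom (f x j) j)" for x
  have cH: "coeff (H x) i = (if i \<le> n then f x i else 0)" for x i unfolding H_def by (rule coeff_sum_monom)
  have Hf: "coeff (H x) i \<in> filt K X (tdeg K X p + w0 * n)" if "x \<in> X" for x i
   unfolding cH using filt_mono[OF _ f(1)[OF that, of i], of "tdeg K X p + w0 * n"] by (simp add: filt_zero)
  have "is_form (w0 * n) \<pi> p (\<lambda>x. poly (H x) \<alpha>)" unfolding is_form_def
  proof (rule exI[of _ H], rule exI[of _ m], rule exI[of _ m'], intro conjI ballI allI m m'(2) refl)
   fix x assume x: "x \<in> X"
   show "H x \<in> polys R" using Hf[OF x] filt_subset_ga[OF Ks, of X] by (intro polysI) blast
   show "degree (H x) \<le> n" by (rule degree_le) (simp add: cH)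
   show "coeff (H x) i \<in> filt K X (tdeg K X p + w0 * n)" for i by (rule Hf[OF x])
   show "map_poly \<pi> (H x) = smult (\<pi> (pd x p)) ?E"
   proof (rule poly_eqI)
    fix i show "coeff (map_poly \<pi> (H x)) i = coeff (smult (\<pi> (pd x p)) ?E) i"
    proof (cases "i \<le> n")
     case True
     then show ?thesis using f(2)[OF x, of i] by (simp add: rhom_map_coeff[OF Rs sD(3)] cH)
    next
     case False
     then have "coeff ?E i = 0" using dE by (intro coeff_eq_0) simp
     then show ?thesis using False by (simp add: rhom_map_coeff[OF Rs sD(3)] cH rhom_zero[OF Rs sD(3)])
    qed
   qed
  qed
  then show ?thesis by blast
 qed
 then show thesis by (rule that)
qed

text \<open>\<open>A / p A\<close> is the quotient of \<open>(R / p)[Y]\<close> by \<open>g\<close>: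
  the remainder of \<open>G\<close> modulo \<open>g\<close> reduces to 0, so \<open>p\<close>
  divides its coefficients.\<close>

lemma p_dvd_poly:
 assumes s: "spec \<pi> p" and G: "G \<in> polys R" "map_poly \<pi> g dvd map_poly \<pi> G"
 obtains a where "a \<in> A" "poly G \<alpha> = p * a"
proof -
 note sD = specD[OF s]
 obtain u r where ur: "u \<in> polys R" "r \<in> polys R" "G = g * u + r" "degree r < n"
  using po_monic_div[OF Rs gR G(1) minpolyD(5,2)[OF g]] .
 have "map_poly \<pi> G = map_poly \<pi> g * map_poly \<pi> u + map_poly \<pi> r"
  unfolding ur(3) using mp_add[OF Rs sD(3) sr_mult[OF po_subring[OF Rs] gR ur(1)] ur(2)] mp_mult[OF Rs sD(3) gR ur(1)] by simp
 then have d: "map_poly \<pi> g dvd map_poly \<pi> r" using G(2) by (metis dvd_add_right_iff dvd_triv_left)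
 have dg: "degree (map_poly \<pi> g) = n" using mp_degree[OF Rs sD(3), of g] minpolyD(2)[OF g] rhom_one[OF Rs sD(3)] by simp
 have "map_poly \<pi> r = 0"
 proof (rule ccontr)
  assume "map_poly \<pi> r \<noteq> 0"
  then have "n \<le> degree (map_poly \<pi> r)" using dvd_imp_degree_le[OF d] dg by simp
  then show False using degree_map_poly_le[of \<pi> r] ur(4) by simp
 qed
 then have "\<pi> (coeff r i) = 0" for i using rhom_map_coeff[OF Rs sD(3), of r i] by simp
 then have "dvd_in R p (coeff r i)" for i using sD(8)[OF polysD[OF ur(2)]] by blast
 then obtain a where "a \<in> A" "poly r \<alpha> = p * a" using p_dvd_coeffs[OF sD(7), of r] by metis
 then show thesis using that[of a] ur(3) minpolyD(3)[OF g] by simp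
qed

lemma spec_minpoly_dvd:
 assumes s: "spec \<pi> p" and m: "minpoly (fracs (\<pi> ` R)) (\<pi> \<alpha>) m" and G: "G \<in> polys R" "\<pi> (poly G \<alpha>) = 0"
 shows "m dvd map_poly \<pi> G"
proof -
 note sD = specD[OF s]
 have R': "subring_set (\<pi> ` R)" by (rule rhom_image[OF Rs sD(3)])
 note F' = sf_sr[OF fracs_subfield[OF R']]
 have "map_poly \<pi> G \<in> polys (fracs (\<pi> ` R))" by (rule mp_over[OF Rs sD(3) G(1) fracs_base[OF R']])
 moreover have "poly (map_poly \<pi> G) (\<pi> \<alpha>) = 0"
  using mp_eval[OF As sD(2) _ \<alpha>A, of G] G polys_mono[OF RA] by auto
 ultimately obtain u where "map_poly \<pi> G = m * u" using minpoly_dvd[OF m F' order_refl minpolyD(1)[OF m]] by metis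
 then show ?thesis by simp
qed

lemma is_form_bd: "is_form w \<pi> p h \<Longrightarrow> x \<in> X \<Longrightarrow> h x \<in> bd (tdeg K X p) (w + n)"
proof -
 assume "is_form w \<pi> p h" "x \<in> X"
 then obtain H where H: "degree H \<le> n" "\<And>i. coeff H i \<in> filt K X (tdeg K X p + w)" "h x = poly H \<alpha>" unfolding is_form_def by metis
 have "coeff H i \<in> filt K X (tdeg K X p + (w + n))" for i by (rule filt_mono[OF _ H(2)]) simp
 then show "h x \<in> bd (tdeg K X p) (w + n)" unfolding H(3) using H(1) by (intro bdI) auto
qed

text \<open>At the root \<open>\<pi> \<alpha>\<close> of \<open>m\<close> the derivatives of
  \<open>g\<close> and \<open>pderiv m * m'\<close> agree. Thus \<open>e\<close> is 1 on the chosen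
  prime, and the form has a pole there.\<close>

lemma form_restrict:
 assumes s: "spec \<pi> p" and h: "is_form w \<pi> p h" and x: "x \<in> X"
 shows "\<pi> (h x) = \<pi> (pd x p) * \<pi> \<gamma>"
proof -
 note sD = specD[OF s]
 obtain H m m' where H: "map_poly \<pi> g = m * m'" "minpoly (fracs (\<pi> ` R)) (\<pi> \<alpha>) m" "H x \<in> polys R"
  "map_poly \<pi> (H x) = smult (\<pi> (pd x p)) (pderiv m * m')" "h x = poly (H x) \<alpha>" using h x unfolding is_form_def by blast
 have ev: "\<pi> (poly q \<alpha>) = poly (map_poly \<pi> q) (\<pi> \<alpha>)" if "q \<in> polys R" for q
  using mp_eval[OF As sD(2) _ \<alpha>A, of q] that polys_mono[OF RA] by blast
 have "\<pi> \<gamma> = poly (pderiv m * m') (\<pi> \<alpha>)"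
  unfolding ev[OF po_pderiv[OF Rs gR]] mp_pderiv[OF Rs sD(3) gR] H(1) using minpolyD(3)[OF H(2)] by (simp add: pderiv_mult mult.commute)
 then show ?thesis unfolding H(5) ev[OF H(3)] H(4) by simp
qed

text \<open>If \<open>p\<close> divided all its partial derivatives, their smaller degree would make
  them vanish, and \<open>p\<close> would be constant.\<close>

lemma form_nonzero:
 assumes s: "spec \<pi> p"
 obtains x where "x \<in> X" "\<pi> (pd x p) \<noteq> 0"
proof (rule ccontr)
 assume "\<not> thesis"
 then have z: "\<pi> (pd x p) = 0" if x: "x \<in> X" for x using \<open>\<And>x. x \<in> X \<Longrightarrow> \<pi> (pd x p) \<noteq> 0 \<Longrightarrow> thesis\<close>[OF x] by argo
 note sD = specD[OF s]
 have "pd x p = 0" if x: "x \<in> X" for x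
 proof (rule ccontr)
  assume nz: "pd x p \<noteq> 0"
  have "dvd_in R p (pd x p)" using sD(8)[OF pd_R[OF x sD(6)]] z[OF x] by simp
  then obtain c where c: "c \<in> R" "pd x p = p * c" by (auto simp: dvd_in_def)
  then have "tdeg K X (pd x p) = tdeg K X p + tdeg K X c" using nz sD by (simp add: tdeg_mult[OF K X])
  moreover have "p \<in> filt K X (tdeg K X p)" using filt_iff_tdeg[OF K X sD(6)] by blast
  then have "pd x p \<in> filt K X (tdeg K X p - 1)" using pd_filt(2)[OF ch Ks fX pd x] sD(12) by blast
  then have "tdeg K X (pd x p) \<le> tdeg K X p - 1" by (rule filt_tdeg[OF K X])
  ultimately show False using sD(12) by simp
 qed
 then have "p \<in> K" using partials_zero_const[OF ch Ks X pd sD(6)] by blast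
 then have "p \<in> filt K X 0" by (simp add: filt_0[OF Ks])
 then show False using filt_tdeg[OF K X, of p 0] sD(12) by simp
qed

text \<open>The vector \<open>u\<close> is tangent to the chosen prime, so \<open>m\<close> divides
  the reduction of \<open>\<Sum> pd x p * U x\<close>. The contraction also carries the factor
  \<open>m'\<close>, hence it is divisible by \<open>m * m' = g\<close> modulo \<open>p\<close>, and
  the pole cancels with a bound uniform in \<open>p\<close>.\<close>

lemma form_contraction:
 assumes u: "\<And>x. x \<in> X \<Longrightarrow> u x \<in> A"
 obtains c where "\<And>\<pi> p h. spec \<pi> p \<Longrightarrow> is_form w \<pi> p h \<Longrightarrow> \<pi> (\<Sum>x\<in>X. pd x p * u x) = 0 \<Longrightarrow> (\<Sum>x\<in>X. h x * u x) / p \<in> bd 0 c"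
proof -
 have "\<exists>U. U \<in> polys R \<and> poly U \<alpha> = u x" if "x \<in> X" for x using A_repr[OF u[OF that]] by metis
 then obtain U where U: "\<And>x. x \<in> X \<Longrightarrow> U x \<in> polys R" "\<And>x. x \<in> X \<Longrightarrow> poly (U x) \<alpha> = u x" by metis
 have "\<exists>c. u x \<in> bd 0 c" if "x \<in> X" for x using A_bd[OF u[OF that]] by metis
 then obtain cx where cx: "\<And>x. x \<in> X \<Longrightarrow> u x \<in> bd 0 (cx x)" by metis
 define c1 where "c1 = (\<Sum>x\<in>X. cx x)"
 have c1: "u x \<in> bd 0 c1" if "x \<in> X" for x
 proof (rule bd_mono[OF _ _ cx[OF that]])
  show "cx x \<le> c1" unfolding c1_def using fX that by (intro member_le_sum) auto
 qed simp
 obtain c where c: "\<And>r a. r \<in> R \<Longrightarrow> r \<noteq> 0 \<Longrightarrow> a \<in> A \<Longrightarrow> r * a \<in> bd (tdeg K X r) (w + n + c1) \<Longrightarrow> a \<in> bd 0 c"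
  by (rule bd_divide) (rule that)
 have "(\<Sum>x\<in>X. h x * u x) / p \<in> bd 0 c" if s: "spec \<pi> p" and h: "is_form w \<pi> p h" and z: "\<pi> (\<Sum>x\<in>X. pd x p * u x) = 0" for \<pi> p h
 proof -
  note sD = specD[OF s]
  obtain H m m' where H: "map_poly \<pi> g = m * m'" "minpoly (fracs (\<pi> ` R)) (\<pi> \<alpha>) m" "\<And>x. x \<in> X \<Longrightarrow> H x \<in> polys R"
   "\<And>x. x \<in> X \<Longrightarrow> map_poly \<pi> (H x) = smult (\<pi> (pd x p)) (pderiv m * m')" "\<And>x. x \<in> X \<Longrightarrow> h x = poly (H x) \<alpha>"
   using h unfolding is_form_def by metis
  note P = po_subring[OF Rs]
  let ?G = "\<Sum>x\<in>X. H x * U x"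
  let ?V = "\<Sum>x\<in>X. smult (pd x p) (U x)"
  have VR: "?V \<in> polys R" by (intro sr_sum[OF P] po_smult[OF Rs] pd_R sD(6) U)
  have Vm: "map_poly \<pi> ?V = (\<Sum>x\<in>X. smult (\<pi> (pd x p)) (map_poly \<pi> (U x)))"
   by (subst mp_sum[OF Rs sD(3)]) (auto intro!: po_smult[OF Rs] pd_R sD(6) U sum.cong mp_smult[OF Rs sD(3)])
  have "poly ?V \<alpha> = (\<Sum>x\<in>X. pd x p * u x)" unfolding poly_sum by (rule sum.cong) (auto simp: U(2))
  then have mV: "m dvd map_poly \<pi> ?V" using z by (intro spec_minpoly_dvd[OF s H(2) VR]) simp
  have "map_poly \<pi> ?G = (\<Sum>x\<in>X. map_poly \<pi> (H x) * map_poly \<pi> (U x))"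
   by (subst mp_sum[OF Rs sD(3)]) (auto intro!: sr_mult[OF P] H U sum.cong mp_mult[OF Rs sD(3)])
  also have "\<dots> = pderiv m * m' * map_poly \<pi> ?V" unfolding Vm sum_distrib_left by (rule sum.cong) (auto simp: H(4))
  finally have "map_poly \<pi> g dvd map_poly \<pi> ?G" unfolding H(1) using mV by (auto simp: dvd_def mult_ac)
  moreover have "?G \<in> polys R" by (intro sr_sum[OF P] sr_mult[OF P] H U)
  ultimately obtain a where a: "a \<in> A" "poly ?G \<alpha> = p * a" using p_dvd_poly[OF s] by blast
  have G: "poly ?G \<alpha> = (\<Sum>x\<in>X. h x * u x)" unfolding poly_sum by (rule sum.cong) (auto simp: U(2) H(5))
  have "(\<Sum>x\<in>X. h x * u x) \<in> bd (tdeg K X p) (w + n + c1)"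
   using bd_mult[OF is_form_bd[OF h] c1] by (intro bd_sum) simp
  then have "a \<in> bd 0 c" using c[OF sD(6,7) a(1)] a(2) G by simp
  moreover have "(\<Sum>x\<in>X. h x * u x) / p = a" using a(2) G sD(7) by simp
  ultimately show ?thesis by simp
 qed
 then show thesis by (rule that)
qed

text \<open>The exterior derivative of the form has no pole along \<open>p\<close> by
  \<open>log_form_closed\<close>, applied after inverting an element outside \<open>(p)\<close>. The
  inverted factor is then cancelled, and dividing the explicit numerator by \<open>p * p\<close>
  leaves a bound independent of \<open>p\<close>.\<close>

lemma form_closed:
 obtains c where "\<And>\<pi> p h x y. spec \<pi> p \<Longrightarrow> is_form w \<pi> p h \<Longrightarrow> x \<in> X \<Longrightarrow> y \<in> X \<Longrightarrow>
  \<gamma> ^ 3 * (pd y (h x / (\<gamma> * p)) - pd x (h y / (\<gamma> * p))) \<in> bd 0 c"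
proof -
 obtain c0 where c0: "\<And>N c a x. x \<in> X \<Longrightarrow> a \<in> bd N c \<Longrightarrow> \<gamma> * pd x a \<in> bd N (c + c0)" by (rule bd_pd) (rule that)
 obtain c2 where c2: "\<gamma> \<in> bd 0 c2" by (rule A_bd[OF \<gamma>A])
 let ?c1 = "w + n"
 let ?c = "2 * c2 + ?c1 + c0"
 obtain c where c: "\<And>r a. r \<in> R \<Longrightarrow> r \<noteq> 0 \<Longrightarrow> a \<in> A \<Longrightarrow> r * a \<in> bd (tdeg K X r) ?c \<Longrightarrow> a \<in> bd 0 c"
  by (rule bd_divide) (rule that)
 have "\<gamma> ^ 3 * (pd y (h x / (\<gamma> * p)) - pd x (h y / (\<gamma> * p))) \<in> bd 0 c"
  if s: "spec \<pi> p" and h: "is_form w \<pi> p h" and x: "x \<in> X" and y: "y \<in> X" for \<pi> p h x y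
 proof -
  note sD = specD[OF s]
  let ?N = "tdeg K X p"
  define D where "D = pd y (h x / (\<gamma> * p)) - pd x (h y / (\<gamma> * p))"
  note dx = pd(1)[OF x] and dy = pd(1)[OF y]
  have hb: "h x \<in> bd ?N ?c1" "h y \<in> bd ?N ?c1" using is_form_bd[OF h] x y by blast+
  have pf: "p \<in> filt K X ?N" using filt_iff_tdeg[OF K X sD(6)] by blast
  have pb: "p \<in> bd ?N 0" "pd x p \<in> bd ?N 0" "pd y p \<in> bd ?N 0"
   using filt_bd[OF pf] filt_bd[OF pd_filt(1)[OF ch Ks fX pd x pf]] filt_bd[OF pd_filt(1)[OF ch Ks fX pd y pf]] by blast+
  define t1 where "t1 = \<gamma> * p * (\<gamma> * pd y (h x) - \<gamma> * pd x (h y))"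
  define t2 where "t2 = p * (h x * (\<gamma> * pd y \<gamma>) - h y * (\<gamma> * pd x \<gamma>))"
  define t3 where "t3 = \<gamma> * \<gamma> * (h x * pd y p - h y * pd x p)"
  \<comment> \<open>Two factors \<open>\<gamma>\<close> clear the squared denominator; the third
    makes the derivatives of elements of \<open>A\<close> return to \<open>A\<close>.\<close>
  have Z: "\<gamma> ^ 3 * D * (p * p) = t1 - t2 - t3"
  proof -
   have d: "d (a / (\<gamma> * p)) = (d a * (\<gamma> * p) - a * (\<gamma> * d p + d \<gamma> * p)) / (\<gamma> * p) ^ 2" if "derivation d" for d a
    using derivation_divide[OF that, of "\<gamma> * p" a] \<gamma>_nz sD(7) derivation_mult[OF that, of \<gamma> p] by simp
   show ?thesis unfolding D_def d[OF dx] d[OF dy] t1_def t2_def t3_def using \<gamma>_nz sD(7)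
    by (simp add: divide_simps power2_eq_square power3_eq_cube) (simp add: algebra_simps)
  qed
  have "t1 \<in> bd (?N + ?N) ?c" unfolding t1_def
   by (rule bd_mono[OF _ _ bd_mult[OF bd_mult[OF c2 pb(1)] bd_diff[OF c0[OF y hb(1)] c0[OF x hb(2)]]]]) auto
  moreover have "t2 \<in> bd (?N + ?N) ?c" unfolding t2_def
   by (rule bd_mono[OF _ _ bd_mult[OF pb(1) bd_diff[OF bd_mult[OF hb(1) c0[OF y c2]] bd_mult[OF hb(2) c0[OF x c2]]]]]) auto
  moreover have "t3 \<in> bd (?N + ?N) ?c" unfolding t3_def
   by (rule bd_mono[OF _ _ bd_mult[OF bd_mult[OF c2 c2] bd_diff[OF bd_mult[OF hb(1) pb(3)] bd_mult[OF hb(2) pb(2)]]]]) auto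
  ultimately have Zb: "\<gamma> ^ 3 * D * (p * p) \<in> bd (?N + ?N) ?c" unfolding Z by (intro bd_diff)
  then have ZA: "\<gamma> ^ 3 * D * (p * p) \<in> A" using bd_A by blast
  obtain x0 where x0: "x0 \<in> X" "\<pi> (pd x0 p) \<noteq> 0" by (rule form_nonzero[OF s])
  define \<sigma> where "\<sigma> = pd x0 p"
  have \<sigma>: "\<sigma> \<in> R" "\<pi> \<sigma> \<noteq> 0" using pd_R[OF x0(1) sD(6)] x0(2) by (auto simp: \<sigma>_def)
  then have \<sigma>A: "\<sigma> \<in> A" and \<sigma>nz: "\<sigma> \<noteq> 0" using RA rhom_zero[OF Rs sD(3)] by auto
  \<comment> \<open>Once \<open>\<sigma>\<close> and \<open>\<gamma>\<close> are inverted, the form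
    is \<open>e dp/p\<close> plus a regular form, with \<open>e = h x0 / f\<close>.\<close>
  define f where "f = \<sigma> * \<gamma>"
  have fA: "f \<in> A" unfolding f_def by (rule sr_mult[OF As \<sigma>A \<gamma>A])
  have fnz: "f \<noteq> 0" using \<sigma>nz \<gamma>_nz by (simp add: f_def)
  let ?L = "loc A f"
  have L: "subring_set ?L" by (rule loc_sr[OF As fA])
  have AL: "A \<subseteq> ?L" by (rule loc_base)
  have dL: "pd u ` ?L \<subseteq> ?L" if u: "u \<in> X" for u
  proof -
   have "pd u a \<in> ?L" if a: "a \<in> A" for a
   proof (rule loc_cancel)
    have "f * pd u a = \<sigma> * (\<gamma> * pd u a)" by (simp add: f_def)
    then show "f * pd u a \<in> ?L" using subsetD[OF AL sr_mult[OF As \<sigma>A \<gamma>_pd_A[OF u a]]] by (simp only:)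
   qed
   then show ?thesis using loc_derivation[OF As fA pd(1)[OF u]] by blast
  qed
  have fL: "a / f \<in> ?L" if "a \<in> A" for a
   by (rule loc_cancel) (use that AL fnz in auto)
  obtain H m m' where H: "map_poly \<pi> g = m * m'" "minpoly (fracs (\<pi> ` R)) (\<pi> \<alpha>) m" "\<And>x. x \<in> X \<Longrightarrow> H x \<in> polys R"
   "\<And>x. x \<in> X \<Longrightarrow> map_poly \<pi> (H x) = smult (\<pi> (pd x p)) (pderiv m * m')" "\<And>x. x \<in> X \<Longrightarrow> h x = poly (H x) \<alpha>"
   using h unfolding is_form_def by metis
  note P = po_subring[OF Rs]
  have hA: "h u \<in> A" if "u \<in> X" for u using H(3,5)[OF that] polyA by simp
  have hp: "\<exists>a\<in>A. \<sigma> * h u - pd u p * h x0 = p * a" if u: "u \<in> X" for u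
  proof -
   let ?G = "smult \<sigma> (H u) - smult (pd u p) (H x0)"
   have pu: "pd u p \<in> R" by (rule pd_R[OF u sD(6)])
   have "map_poly \<pi> ?G = smult (\<pi> \<sigma>) (map_poly \<pi> (H u)) - smult (\<pi> (pd u p)) (map_poly \<pi> (H x0))"
    using mp_diff[OF Rs sD(3) po_smult[OF Rs \<sigma>(1) H(3)[OF u]] po_smult[OF Rs pu H(3)[OF x0(1)]]]
     mp_smult[OF Rs sD(3) \<sigma>(1) H(3)[OF u]] mp_smult[OF Rs sD(3) pu H(3)[OF x0(1)]] by simp
   also have "\<dots> = 0" unfolding H(4)[OF u] H(4)[OF x0(1)] \<sigma>_def by (simp add: mult.commute)
   finally have "map_poly \<pi> g dvd map_poly \<pi> ?G" by simp
   moreover have "?G \<in> polys R" by (intro sr_diff[OF P] po_smult[OF Rs] \<sigma> H u x0 pu)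
   ultimately obtain a where "a \<in> A" "poly ?G \<alpha> = p * a" using p_dvd_poly[OF s] by blast
   then show ?thesis using H(5)[OF u] H(5)[OF x0(1)] by (intro bexI[of _ a]) simp_all
  qed
  obtain ax where ax: "ax \<in> A" "\<sigma> * h x - pd x p * h x0 = p * ax" using hp[OF x] by blast
  obtain ay where ay: "ay \<in> A" "\<sigma> * h y - pd y p * h x0 = p * ay" using hp[OF y] by blast
  \<comment> \<open>Idempotency of \<open>e\<close> modulo \<open>p\<close>: substituting
    \<open>\<sigma> * pderiv m * m'\<close> for \<open>H x0\<close> and \<open>m * m'\<close> for
    \<open>g\<close>, the difference is \<open>- \<sigma>^2 * m * m' * pderiv m * pderiv m'\<close>,
    a multiple of \<open>g\<close>.\<close>
  have "\<exists>a\<in>A. h x0 * h x0 - \<sigma> * (\<gamma> * h x0) = p * a"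
  proof -
   let ?G = "H x0 * H x0 - smult \<sigma> (pderiv g * H x0)"
   note H0 = H(3)[OF x0(1)] and g' = po_pderiv[OF Rs gR]
   have "map_poly \<pi> ?G = map_poly \<pi> (H x0) * map_poly \<pi> (H x0) - smult (\<pi> \<sigma>) (pderiv (m * m') * map_poly \<pi> (H x0))"
    using mp_diff[OF Rs sD(3) sr_mult[OF P H0 H0] po_smult[OF Rs \<sigma>(1) sr_mult[OF P g' H0]]]
     mp_smult[OF Rs sD(3) \<sigma>(1) sr_mult[OF P g' H0]] mp_mult[OF Rs sD(3) H0 H0] mp_mult[OF Rs sD(3) g' H0]
     mp_pderiv[OF Rs sD(3) gR] H(1) by simp
   also have "\<dots> = (m * m') * smult (- (\<pi> \<sigma> * \<pi> \<sigma>)) (pderiv m * pderiv m')"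
    unfolding H(4)[OF x0(1)] \<sigma>_def[symmetric] pderiv_mult by (simp add: algebra_simps smult_add_right)
   finally have "map_poly \<pi> g dvd map_poly \<pi> ?G" unfolding H(1) by (simp only: dvd_triv_left)
   moreover have "?G \<in> polys R" by (intro sr_diff[OF P] po_smult[OF Rs] sr_mult[OF P] \<sigma> H0 g')
   ultimately obtain a where "a \<in> A" "poly ?G \<alpha> = p * a" using p_dvd_poly[OF s] by blast
   then show ?thesis using H(5)[OF x0(1)] by (intro bexI[of _ a]) simp_all
  qed
  then obtain a0 where a0: "a0 \<in> A" "h x0 * h x0 - \<sigma> * (\<gamma> * h x0) = p * a0" by blast
  have om: "h u / (\<gamma> * p) = (h x0 / f) * pd u p / p + au / f" if "\<sigma> * h u - pd u p * h x0 = p * au" for u au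
  proof -
   have "\<sigma> * h u = pd u p * h x0 + p * au" using that by (simp add: algebra_simps)
   then have "h u = (pd u p * h x0 + p * au) / \<sigma>" using \<sigma>nz by (simp add: field_simps)
   then show ?thesis using \<sigma>nz \<gamma>_nz sD(7) by (simp add: f_def field_simps)
  qed
  have pcl: "p \<in> alg_cl K X" using sD(6) cl_base[OF Ks, of X] by blast
  have pL: "p \<in> ?L" using sD(6) RA AL by blast
  have zL: "a0 / (f * f) \<in> ?L" using loc_cancel[of f "a0 / (f * f)" A] fL[OF a0(1)] fnz by simp
  have idem: "(h x0 / f) ^ 2 - h x0 / f = p * (a0 / (f * f))"
  proof -
   have "(h x0 / f) ^ 2 - h x0 / f = (h x0 * h x0 - \<sigma> * (\<gamma> * h x0)) / (f * f)"
    using fnz by (simp add: power2_eq_square diff_divide_distrib) (simp add: f_def)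
   then show ?thesis using a0(2) by simp
  qed
  have "pd y ((h x0 / f) * pd x p / p + ax / f) - pd x ((h x0 / f) * pd y p / p + ay / f) \<in> ?L"
   by (rule log_form_closed[OF L dy dL[OF y] dx dL[OF x] pL sD(7) pd_commute[OF ch Ks fX pd y x pcl] fL[OF hA[OF x0(1)]] zL idem fL[OF ay(1)] fL[OF ax(1)]])
  then have "D \<in> ?L" unfolding D_def om[OF ax(2)] om[OF ay(2)] .
  then obtain k where k: "f ^ k * D \<in> A" by (auto simp: loc_def)
  obtain c' where c': "c' \<in> A" "\<gamma> * c' \<in> R" "\<pi> (\<gamma> * c') \<noteq> 0" using s unfolding spec_def by blast
  \<comment> \<open>A multiple of \<open>f^k\<close> that lies in \<open>R\<close> outside
    \<open>(p)\<close>; with it \<open>p\<close> can be cancelled twice.\<close>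
  define \<rho> where "\<rho> = (\<sigma> * (\<gamma> * c')) ^ k"
  have \<rho>R: "\<rho> \<in> R" unfolding \<rho>_def by (intro sr_power[OF Rs] sr_mult[OF Rs] \<sigma> c')
  have "\<pi> \<rho> = (\<pi> \<sigma> * \<pi> (\<gamma> * c')) ^ k" unfolding \<rho>_def
   using rhom_power[OF Rs sD(3) sr_mult[OF Rs \<sigma>(1) c'(2)]] rhom_mult[OF Rs sD(3) \<sigma>(1) c'(2)] by simp
  then have \<rho>p: "\<not> dvd_in R p \<rho>" using sD(8)[OF \<rho>R] \<sigma>(2) c'(3) by simp
  have \<rho>f: "\<rho> = c' ^ k * f ^ k" by (simp add: \<rho>_def f_def power_mult_distrib mult_ac)
  define b where "b = c' ^ k * (\<gamma> ^ 3 * (f ^ k * D))"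
  have bA: "b \<in> A" unfolding b_def by (intro sr_mult[OF As] sr_power[OF As] c' \<gamma>A k)
  have pA: "p \<in> A" using sD(6) RA by blast
  have e1: "\<rho> * (\<gamma> ^ 3 * D * (p * p)) = p * (p * b)" by (simp add: \<rho>f b_def mult_ac)
  obtain z1 where z1: "z1 \<in> A" "\<gamma> ^ 3 * D * (p * p) = p * z1" by (rule A_prime_cancel[OF sD(5) \<rho>R \<rho>p ZA e1 sr_mult[OF As pA bA]])
  have "p * (\<rho> * z1) = p * (p * b)" using e1 unfolding z1(2) by (simp only: mult.left_commute)
  then have e2: "\<rho> * z1 = p * b" using sD(7) by simp
  obtain z2 where z2: "z2 \<in> A" "z1 = p * z2" by (rule A_prime_cancel[OF sD(5) \<rho>R \<rho>p z1(1) e2 bA])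
  have DA: "\<gamma> ^ 3 * D = z2" using z1(2) z2(2) sD(7) by (simp add: mult_ac)
  have pp: "p * p \<in> R" "p * p \<noteq> 0" using sr_mult[OF Rs sD(6,6)] sD(7) by auto
  have "z2 \<in> bd 0 c"
  proof (rule c[OF pp z2(1)])
   have "p * p * z2 = \<gamma> ^ 3 * D * (p * p)" unfolding DA by (rule mult.commute)
   then show "p * p * z2 \<in> bd (tdeg K X (p * p)) ?c"
    using Zb tdeg_mult[OF K X sD(6,6,7,7)] by (simp only:)
  qed
  then show ?thesis using DA unfolding D_def by simp
 qed
 then show thesis by (rule that)
qed

end

section \<open>Linear dependence over constants\<close>

lemma derivation_sum: "derivation d \<Longrightarrow> d (\<Sum>i\<in>I. f i) = (\<Sum>i\<in>I. d (f i))"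
 by (induction I rule: infinite_finite_induct) (simp_all add: derivation_zero derivation_add)

text \<open>Normalize a relation of minimal support and differentiate it.\<close>

lemma constant_relation:
 fixes y :: "'j \<Rightarrow> 'x \<Rightarrow> 'a::field"
 assumes E: "subfield_set E" and \<Delta>: "\<And>\<delta>. \<delta> \<in> \<Delta> \<Longrightarrow> derivation \<delta>" "\<And>\<delta>. \<delta> \<in> \<Delta> \<Longrightarrow> \<delta> ` E \<subseteq> E"
  and ode: "\<And>\<delta> r x. \<delta> \<in> \<Delta> \<Longrightarrow> r \<in> J \<Longrightarrow> x \<in> X \<Longrightarrow> \<delta> (y r x) = (\<Sum>l\<in>X. M \<delta> x l * y r l)"
  and J: "finite J" and f0: "\<And>r. r \<in> J \<Longrightarrow> f0 r \<in> E" "\<exists>r\<in>J. f0 r \<noteq> 0" "\<And>x. x \<in> X \<Longrightarrow> (\<Sum>r\<in>J. f0 r * y r x) = 0"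
 obtains f where "\<And>r. r \<in> J \<Longrightarrow> f r \<in> E" "\<exists>r\<in>J. f r \<noteq> 0" "\<And>x. x \<in> X \<Longrightarrow> (\<Sum>r\<in>J. f r * y r x) = 0"
  "\<And>r \<delta>. r \<in> J \<Longrightarrow> \<delta> \<in> \<Delta> \<Longrightarrow> \<delta> (f r) = 0"
proof -
 define rel where "rel f \<longleftrightarrow> (\<forall>r\<in>J. f r \<in> E) \<and> (\<exists>r\<in>J. f r \<noteq> 0) \<and> (\<forall>x\<in>X. (\<Sum>r\<in>J. f r * y r x) = 0)" for f
 define supp where "supp f = card {r \<in> J. f r \<noteq> 0}" for f :: "'j \<Rightarrow> 'a"
 have "rel f0" unfolding rel_def using f0 by blast
 then obtain f where f: "rel f" "\<And>h. rel h \<Longrightarrow> supp f \<le> supp h"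
  using ex_has_least_nat[of rel f0 supp] by blast
 obtain r0 where r0: "r0 \<in> J" "f r0 \<noteq> 0" using f(1) by (auto simp: rel_def)
 define e where "e r = f r / f r0" for r
 have eE: "e r \<in> E" if "r \<in> J" for r unfolding e_def using f(1) that r0(1) by (intro sf_divide[OF E]) (auto simp: rel_def)
 have e0: "(\<Sum>r\<in>J. e r * y r x) = 0" if "x \<in> X" for x
 proof -
  have "(\<Sum>r\<in>J. e r * y r x) = (\<Sum>r\<in>J. f r * y r x) / f r0" by (simp add: e_def sum_divide_distrib)
  then show ?thesis using f(1) that by (simp add: rel_def)
 qed
 have "\<delta> (e r) = 0" if \<delta>: "\<delta> \<in> \<Delta>" and r: "r \<in> J" for \<delta> r
 proof (rule ccontr)
  assume nz: "\<delta> (e r) \<noteq> 0"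
  note d = \<Delta>(1)[OF \<delta>]
  have "(\<Sum>r\<in>J. \<delta> (e r) * y r x) = 0" if x: "x \<in> X" for x
  proof -
   have "(\<Sum>r\<in>J. e r * \<delta> (y r x)) = (\<Sum>r\<in>J. \<Sum>l\<in>X. M \<delta> x l * (e r * y r l))"
    by (rule sum.cong) (auto simp: ode[OF \<delta> _ x] sum_distrib_left mult_ac)
   also have "\<dots> = (\<Sum>l\<in>X. M \<delta> x l * (\<Sum>r\<in>J. e r * y r l))" by (subst sum.swap) (simp add: sum_distrib_left)
   also have "\<dots> = 0" using e0 by simp
   finally have "(\<Sum>r\<in>J. e r * \<delta> (y r x)) = 0" .
   moreover have "\<delta> (\<Sum>r\<in>J. e r * y r x) = 0" using e0[OF x] derivation_zero[OF d] by simp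
   then have "(\<Sum>r\<in>J. e r * \<delta> (y r x) + \<delta> (e r) * y r x) = 0" by (simp add: derivation_sum[OF d] derivation_mult[OF d])
   ultimately show ?thesis by (simp add: sum.distrib)
  qed
  then have "rel (\<lambda>r. \<delta> (e r))" unfolding rel_def using nz r \<Delta>(2)[OF \<delta>] eE by blast
  from f(2)[OF this] have "supp f \<le> supp (\<lambda>r. \<delta> (e r))" .
  moreover have "supp (\<lambda>r. \<delta> (e r)) < supp f" unfolding supp_def
  proof (rule psubset_card_mono)
   have "e r0 = 1" using r0 by (simp add: e_def)
   then have "\<delta> (e r0) = 0" using derivation_one[OF d] by simp
   moreover have "\<delta> (e r) = 0" if "f r = 0" for r using that derivation_zero[OF d] by (simp add: e_def)
   ultimately show "{r \<in> J. \<delta> (e r) \<noteq> 0} \<subset> {r \<in> J. f r \<noteq> 0}" using r0 by blast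
  qed (use J in simp)
  ultimately show False by simp
 qed
 moreover have "e r0 \<noteq> 0" using r0 by (simp add: e_def)
 ultimately show thesis using that[of e] eE e0 r0(1) by blast
qed

lemma algebraic_over_field_integral:
 assumes K: "subfield_set (K :: 'a::field set)" and z: "z \<in> acl K"
 shows "integral_over K z"
proof -
 obtain c where c: "c \<in> K" "c \<noteq> 0" "integral_over K (c * z)" using z algebraic_over_iff[OF sf_sr[OF K]] by (auto simp: acl_def)
 have "integral_over K (inverse c)" by (rule integral_over_base[OF sf_sr[OF K] sf_inverse[OF K c(1)]])
 then have "integral_over K (inverse c * (c * z))" using sr_mult[OF integral_closure_subring[OF sf_sr[OF K]]] c(3) by blast
 then show ?thesis using c(2) by (simp flip: mult.assoc)
qed

context primitive_integral
begin

lemma B_cl: "B \<subseteq> alg_cl K X"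
 using integral_in_cl[OF Ks int] by blast

text \<open>Clear all denominators except \<open>p j0\<close>. The term of \<open>j0\<close> is then
  minus a sum of integral elements, the constants being integral over \<open>K\<close>. So
  \<open>p j0\<close> times it is killed by \<open>\<pi> j0\<close>, although none of the factors of
  \<open>h j0 x * P\<close> is.\<close>

lemma form_independent:
 assumes J: "finite J" and s: "\<And>j. j \<in> J \<Longrightarrow> spec (\<pi> j) (p j)" and h: "\<And>j. j \<in> J \<Longrightarrow> is_form w (\<pi> j) (p j) (h j)"
  and dist: "\<And>j l. j \<in> J \<Longrightarrow> l \<in> J \<Longrightarrow> j \<noteq> l \<Longrightarrow> \<pi> j (p l) \<noteq> 0"
  and b: "\<And>j. j \<in> J \<Longrightarrow> b j \<in> acl K" "\<And>x. x \<in> X \<Longrightarrow> (\<Sum>j\<in>J. b j * (h j x / (\<gamma> * p j))) = 0" and j0: "j0 \<in> J"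
 shows "b j0 = 0"
proof (rule ccontr)
 assume b0: "b j0 \<noteq> 0"
 let ?J = "J - {j0}"
 note sD = specD[OF s]
 obtain x where x: "x \<in> X" "\<pi> j0 (pd x (p j0)) \<noteq> 0" by (rule form_nonzero[OF s[OF j0]])
 have hB: "h j x \<in> B" if "j \<in> J" for j using is_form_bd[OF h[OF that] x(1)] bd_A AB by blast
 have pB: "p j \<in> B" if "j \<in> J" for j using sD(6)[OF that] RB by blast
 define P where "P = (\<Prod>l\<in>?J. p l)"
 have PB: "P \<in> B" unfolding P_def by (intro sr_prod[OF B] pB) simp
 have "0 = \<gamma> * P * (\<Sum>j\<in>J. b j * (h j x / (\<gamma> * p j)))" using b(2)[OF x(1)] by simp
 also have "\<dots> = (\<Sum>j\<in>J. b j * (h j x * P / p j))" unfolding sum_distrib_left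
  using \<gamma>_nz by (intro sum.cong) auto
 also have "\<dots> = b j0 * (h j0 x * P / p j0) + (\<Sum>j\<in>?J. b j * (h j x * P / p j))" by (rule sum.remove[OF J j0])
 also have "(\<Sum>j\<in>?J. b j * (h j x * P / p j)) = (\<Sum>j\<in>?J. b j * (h j x * (\<Prod>l\<in>?J - {j}. p l)))"
 proof (rule sum.cong[OF refl])
  fix j assume j: "j \<in> ?J"
  have "P = p j * (\<Prod>l\<in>?J - {j}. p l)" unfolding P_def by (rule prod.remove) (use j J in auto)
  then show "b j * (h j x * P / p j) = b j * (h j x * (\<Prod>l\<in>?J - {j}. p l))" using sD(7)[of j] j by simp
 qed
 finally have "b j0 * (h j0 x * P / p j0) = - (\<Sum>j\<in>?J. b j * (h j x * (\<Prod>l\<in>?J - {j}. p l)))"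
  by (simp add: eq_neg_iff_add_eq_0)
 then have "h j0 x * P / p j0 = - (\<Sum>j\<in>?J. b j * (h j x * (\<Prod>l\<in>?J - {j}. p l))) / b j0"
  using b0 by (metis nonzero_mult_div_cancel_left)
 also have "\<dots> = - (\<Sum>j\<in>?J. (b j / b j0) * (h j x * (\<Prod>l\<in>?J - {j}. p l)))" by (simp add: sum_divide_distrib)
 finally have z: "h j0 x * P / p j0 = - (\<Sum>j\<in>?J. (b j / b j0) * (h j x * (\<Prod>l\<in>?J - {j}. p l)))" .
 let ?I = "{z. integral_over R z}"
 have I: "subring_set ?I" by (rule integral_closure_subring[OF Rs])
 have KI: "z \<in> ?I" if "z \<in> acl K" for z
  using integral_over_mono[OF algebraic_over_field_integral[OF K that] ga_base(1)] by simp
 have BI: "z \<in> ?I" if "z \<in> B" for z using int[OF that] by simp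
 have "h j0 x * P / p j0 \<in> ?I" unfolding z
 proof (intro sr_uminus[OF I] sr_sum[OF I] sr_mult[OF I])
  fix j assume j: "j \<in> ?J"
  show "b j / b j0 \<in> ?I" using b(1) j j0 by (intro KI sf_divide[OF acl_subfield[OF Ks]]) auto
  show "h j x \<in> ?I" using hB j by (intro BI) auto
  show "(\<Prod>l\<in>?J - {j}. p l) \<in> ?I" by (intro BI sr_prod[OF B] pB) auto
 qed
 then have iz: "integral_over R (h j0 x * P / p j0)" by simp
 have eq: "p j0 * (h j0 x * P / p j0) = h j0 x * P" using sD(7)[OF j0] by simp
 have "\<pi> j0 (h j0 x * P) = 0"
  using integral_times_kernel[OF B sD(1)[OF j0] RB pB[OF j0] sD(11)[OF j0] iz] unfolding eq using sr_mult[OF B hB[OF j0] PB] by simp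
 moreover have "\<pi> j0 (h j0 x * P) = \<pi> j0 (h j0 x) * (\<Prod>l\<in>?J. \<pi> j0 (p l))"
  using rhom_mult[OF B sD(1)[OF j0] hB[OF j0] PB] rhom_prod[OF B sD(1)[OF j0], of ?J p] pB by (simp add: P_def)
 moreover have "\<pi> j0 (h j0 x) \<noteq> 0" using form_restrict[OF s[OF j0] h[OF j0] x(1)] x(2) sD(10)[OF j0] by simp
 moreover have "(\<Prod>l\<in>?J. \<pi> j0 (p l)) \<noteq> 0" using dist j0 J by auto
 ultimately show False by simp
qed

text \<open>The index pairs split the work: for each \<open>r\<close>, enough forms
  \<open>(r, t)\<close> yield one combination \<open>y r\<close> that is closed and killed by all
  \<open>\<delta>\<close>; \<open>card X + 1\<close> values of \<open>r\<close> make these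
  combinations dependent.\<close>

lemma specializations_contradiction:
 fixes \<Delta> :: "('b \<Rightarrow> 'b) set" and \<pi> :: "nat \<times> nat \<Rightarrow> 'b \<Rightarrow> 'b"
 assumes \<Delta>: "finite \<Delta>" "\<And>\<delta>. \<delta> \<in> \<Delta> \<Longrightarrow> derivation \<delta>" "\<And>\<delta> c. \<delta> \<in> \<Delta> \<Longrightarrow> c \<in> K \<Longrightarrow> \<delta> c = 0" "\<And>\<delta>. \<delta> \<in> \<Delta> \<Longrightarrow> \<delta> ` B \<subseteq> B"
  and D: "D \<in> R" "D \<noteq> 0" "\<And>\<delta> x. \<delta> \<in> \<Delta> \<Longrightarrow> x \<in> X \<Longrightarrow> D * \<delta> x \<in> A"
  and C: "\<And>f. f \<in> fracs B \<Longrightarrow> (\<And>\<delta>. \<delta> \<in> \<Delta> \<Longrightarrow> \<delta> f = 0) \<Longrightarrow> f \<in> acl K"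
  and s: "\<And>j. spec (\<pi> j) (p j)" and dist: "\<And>j l. j \<noteq> l \<Longrightarrow> \<pi> j (p l) \<noteq> 0"
  and stable: "\<And>j b \<delta>. \<delta> \<in> \<Delta> \<Longrightarrow> b \<in> B \<Longrightarrow> \<pi> j b = 0 \<Longrightarrow> \<pi> j (\<delta> b) = 0"
 shows False
proof -
 note sD = specD[OF s]
 obtain w where w: "\<And>\<pi> p. spec \<pi> p \<Longrightarrow> \<exists>h. is_form w \<pi> p h" by (rule form_ex) (rule that)
 from w[OF s] obtain h where h: "\<And>j. is_form w (\<pi> j) (p j) (h j)" by metis
 define \<omega> where "\<omega> j x = h j x / (\<gamma> * p j)" for j x
 have RBs: "r \<in> B" if "r \<in> R" for r using RB that by blast
 have "\<exists>c. \<forall>j. (\<Sum>x\<in>X. h j x * (D * \<delta> x)) / p j \<in> bd 0 c" if \<delta>: "\<delta> \<in> \<Delta>" for \<delta>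
 proof -
  obtain c where c: "\<And>\<pi> p h. spec \<pi> p \<Longrightarrow> is_form w \<pi> p h \<Longrightarrow> \<pi> (\<Sum>x\<in>X. pd x p * (D * \<delta> x)) = 0 \<Longrightarrow> (\<Sum>x\<in>X. h x * (D * \<delta> x)) / p \<in> bd 0 c"
   by (rule form_contraction[of "\<lambda>x. D * \<delta> x" w]) (use D(3)[OF \<delta>] in blast)+
  have "(\<Sum>x\<in>X. h j x * (D * \<delta> x)) / p j \<in> bd 0 c" for j
  proof (rule c[OF s h])
   have pcl: "p j \<in> alg_cl K X" using RBs[OF sD(6)] B_cl by blast
   have "(\<Sum>x\<in>X. pd x (p j) * (D * \<delta> x)) = D * \<delta> (p j)"
   proof -
    have "\<delta> (p j) = (\<Sum>x\<in>X. \<delta> x * pd x (p j))" by (rule derivation_chain_rule[OF ch Ks fX pd \<Delta>(2,3)[OF \<delta>] pcl])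
    then have "D * \<delta> (p j) = (\<Sum>x\<in>X. D * (\<delta> x * pd x (p j)))" by (simp only: sum_distrib_left)
    then show ?thesis by (simp add: mult_ac)
   qed
   moreover have "\<delta> (p j) \<in> B" using \<Delta>(4)[OF \<delta>] RBs[OF sD(6)] by blast
   moreover have "\<pi> j (\<delta> (p j)) = 0" by (rule stable[OF \<delta> RBs[OF sD(6)] sD(11)])
   ultimately show "\<pi> j (\<Sum>x\<in>X. pd x (p j) * (D * \<delta> x)) = 0" using rhom_mult[OF B sD(1) RBs[OF D(1)]] by simp
  qed
  then show ?thesis by blast
 qed
 then obtain c1 where c1: "\<And>\<delta> j. \<delta> \<in> \<Delta> \<Longrightarrow> (\<Sum>x\<in>X. h j x * (D * \<delta> x)) / p j \<in> bd 0 (c1 \<delta>)" by metis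
 obtain c2 where c2: "\<And>\<pi> p h x y. spec \<pi> p \<Longrightarrow> is_form w \<pi> p h \<Longrightarrow> x \<in> X \<Longrightarrow> y \<in> X \<Longrightarrow>
  \<gamma> ^ 3 * (pd y (h x / (\<gamma> * p)) - pd x (h y / (\<gamma> * p))) \<in> bd 0 c2" by (rule form_closed[of w]) (rule that)
 \<comment> \<open>The obstructions to be removed: contractions with the derivations, and the
   coefficients of the exterior derivative.\<close>
 define L where "L i j = (case i of Inl \<delta> \<Rightarrow> \<gamma> * D * (\<Sum>x\<in>X. \<omega> j x * \<delta> x)
  | Inr (x, y) \<Rightarrow> \<gamma> ^ 3 * (pd y (\<omega> j x) - pd x (\<omega> j y)))" for i j
 define I0 where "I0 = Inl ` \<Delta> \<union> Inr ` (X \<times> X)"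
 have fI0: "finite I0" using \<Delta>(1) fX by (simp add: I0_def)
 have Lb: "\<exists>c. \<forall>j. L i j \<in> bd 0 c" if "i \<in> I0" for i
 proof (cases i)
  case (Inl \<delta>)
  have "L i j = (\<Sum>x\<in>X. h j x * (D * \<delta> x)) / p j" for j
   unfolding L_def Inl \<omega>_def using \<gamma>_nz by (simp add: sum_distrib_left sum_divide_distrib mult_ac)
  then show ?thesis using c1 that Inl by (intro exI[of _ "c1 \<delta>"]) (auto simp: I0_def)
 next
  case (Inr xy)
  then obtain x y where xy: "i = Inr (x, y)" "x \<in> X" "y \<in> X" using \<open>i \<in> I0\<close> by (cases xy) (auto simp: I0_def)
  have "L i j \<in> bd 0 c2" for j
   unfolding L_def xy(1) sum.case prod.case \<omega>_def by (rule c2[OF s h xy(2,3)])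
  then show ?thesis by blast
 qed
 have "\<exists>M. finite M \<and> (\<forall>j. L i j \<in> dspan K M)" if i: "i \<in> I0" for i
 proof -
  obtain c where c: "\<forall>j. L i j \<in> bd 0 c" using Lb[OF i] by blast
  obtain M where "finite M" "bd 0 c \<subseteq> dspan K M" by (rule bd_span[of 0 c])
  then show ?thesis using c by blast
 qed
 then obtain M where M: "\<And>i. i \<in> I0 \<Longrightarrow> finite (M i)" "\<And>i j. i \<in> I0 \<Longrightarrow> L i j \<in> dspan K (M i)" by metis
 have "\<exists>a. (\<forall>m. a m \<in> K) \<and> L i j = (\<Sum>m\<in>M i. a m * m)" if "i \<in> I0" for i j
  using dspan_sum_form[OF M(1)[OF that] M(2)[OF that, of j] Ks] by metis
 then obtain a where a: "\<And>i j m. i \<in> I0 \<Longrightarrow> a i j m \<in> K" "\<And>i j. i \<in> I0 \<Longrightarrow> L i j = (\<Sum>m\<in>M i. a i j m * m)" by metis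
 \<comment> \<open>The coordinates over \<open>K\<close> of all obstructions;
   \<open>card I + 1\<close> forms thus admit a nontrivial combination without obstruction.\<close>
 define I where "I = Sigma I0 M"
 have fI: "finite I" unfolding I_def using fI0 M(1) by blast
 have "\<exists>c. (\<forall>t\<in>{..card I}. c t \<in> K) \<and> (\<exists>t\<in>{..card I}. c t \<noteq> 0) \<and> (\<forall>i\<in>I0. (\<Sum>t\<le>card I. c t * L i (r, t)) = 0)" for r :: nat
 proof -
  have aK: "(\<lambda>(i, m) t. a i (r, t) m) im t \<in> K" if "im \<in> I" for im t using a(1) that by (auto simp: I_def)
  have cI: "card I < card {..card I}" by simp
  obtain c where c: "\<And>t. t \<in> {..card I} \<Longrightarrow> c t \<in> K" "\<exists>t\<in>{..card I}. c t \<noteq> 0"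
   "\<And>im. im \<in> I \<Longrightarrow> (\<Sum>t\<le>card I. c t * (\<lambda>(i, m) t. a i (r, t) m) im t) = 0"
   by (rule linear_relation[OF K fI finite_atMost cI aK]) (assumption | rule that)+
  have "(\<Sum>t\<le>card I. c t * L i (r, t)) = 0" if i: "i \<in> I0" for i
  proof -
   have "(\<Sum>t\<le>card I. c t * L i (r, t)) = (\<Sum>t\<le>card I. \<Sum>m\<in>M i. c t * a i (r, t) m * m)"
    by (simp add: a(2)[OF i] sum_distrib_left mult.assoc)
   also have "\<dots> = (\<Sum>m\<in>M i. (\<Sum>t\<le>card I. c t * a i (r, t) m) * m)" by (subst sum.swap) (simp add: sum_distrib_right)
   also have "\<dots> = 0" using c(3)[of "(i, _)"] i by (intro sum.neutral) (simp add: I_def)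
   finally show ?thesis .
  qed
  then show ?thesis using c(1,2) by (intro exI[of _ c]) simp
 qed
 then have "\<forall>r. \<exists>c. (\<forall>t\<in>{..card I}. c t \<in> K) \<and> (\<exists>t\<in>{..card I}. c t \<noteq> 0) \<and> (\<forall>i\<in>I0. (\<Sum>t\<le>card I. c t * L i (r, t)) = 0)" by (rule allI)
 from choice[OF this] obtain c where cc: "\<forall>r. (\<forall>t\<in>{..card I}. c r t \<in> K) \<and> (\<exists>t\<in>{..card I}. c r t \<noteq> 0) \<and> (\<forall>i\<in>I0. (\<Sum>t\<le>card I. c r t * L i (r, t)) = 0)" ..
 have c: "\<And>r t. t \<in> {..card I} \<Longrightarrow> c r t \<in> K" "\<And>r. \<exists>t\<in>{..card I}. c r t \<noteq> 0"
  "\<And>r i. i \<in> I0 \<Longrightarrow> (\<Sum>t\<le>card I. c r t * L i (r, t)) = 0" using cc by (fast, fast, fast)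
 define y where "y r x = (\<Sum>t\<le>card I. c r t * \<omega> (r, t) x)" for r x
 let ?E = "fracs B"
 have E: "subfield_set ?E" by (rule fracs_subfield[OF B])
 have BE: "B \<subseteq> ?E" by (rule fracs_base[OF B])
 note Es = sf_sr[OF E]
 have Ecl: "?E \<subseteq> alg_cl K X" by (rule fracs_least[OF cl_subfield[OF Ks] B_cl])
 have hB: "h j x \<in> B" if "x \<in> X" for j x using is_form_bd[OF h that] bd_A AB by blast
 have \<omega>E: "\<omega> j x \<in> ?E" if "x \<in> X" for j x unfolding \<omega>_def
  using hB[OF that] \<gamma>A AB RBs[OF sD(6)] BE by (intro sf_divide[OF E] sr_mult[OF Es]) blast+
 have KE: "K \<subseteq> ?E" using BE RB ga_base(1)[of K X] by blast
 have yE: "y r x \<in> ?E" if "x \<in> X" for r x unfolding y_def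
  using c(1) KE by (intro sr_sum[OF Es] sr_mult[OF Es] \<omega>E[OF that]) blast
 have y1: "(\<Sum>x\<in>X. y r x * \<delta> x) = 0" if \<delta>: "\<delta> \<in> \<Delta>" for r \<delta>
 proof -
  have "0 = (\<Sum>t\<le>card I. c r t * L (Inl \<delta>) (r, t))" using c(3)[of "Inl \<delta>" r] \<delta> by (simp add: I0_def)
  also have "\<dots> = \<gamma> * D * (\<Sum>t\<le>card I. \<Sum>x\<in>X. c r t * \<omega> (r, t) x * \<delta> x)" by (simp add: L_def sum_distrib_left mult_ac)
  also have "\<dots> = \<gamma> * D * (\<Sum>x\<in>X. y r x * \<delta> x)" by (subst sum.swap) (simp add: y_def sum_distrib_right)
  finally show ?thesis using \<gamma>_nz D(2) by simp
 qed
 have y2: "pd u (y r x) = pd x (y r u)" if x: "x \<in> X" and u: "u \<in> X" for r x u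
 proof -
  have e: "pd u' (y r x') = (\<Sum>t\<le>card I. c r t * pd u' (\<omega> (r, t) x'))" if "u' \<in> X" for u' x'
   unfolding y_def derivation_sum[OF pd(1)[OF that]] derivation_mult[OF pd(1)[OF that]]
   using pd(2)[OF that c(1)] by (intro sum.cong) auto
  have "0 = (\<Sum>t\<le>card I. c r t * L (Inr (x, u)) (r, t))" using c(3)[of "Inr (x, u)" r] x u by (simp add: I0_def)
  also have "\<dots> = \<gamma> ^ 3 * (pd u (y r x) - pd x (y r u))" unfolding e[OF x] e[OF u]
   by (simp add: L_def sum_distrib_left sum_subtractf right_diff_distrib mult_ac)
  finally show ?thesis using \<gamma>_nz by simp
 qed
 \<comment> \<open>Cartan's formula: the Lie derivative along \<open>\<delta>\<close> of a closed
   form that \<open>\<delta>\<close> annihilates is 0. Written in coordinates this is a linear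
   system with the same matrix for all \<open>r\<close>.\<close>
 have ode: "\<delta> (y r x) = (\<Sum>l\<in>X. - pd x (\<delta> l) * y r l)" if \<delta>: "\<delta> \<in> \<Delta>" and x: "x \<in> X" for \<delta> r x
 proof -
  have "\<delta> (y r x) = (\<Sum>l\<in>X. \<delta> l * pd l (y r x))"
   by (rule derivation_chain_rule[OF ch Ks fX pd \<Delta>(2,3)[OF \<delta>] subsetD[OF Ecl yE[OF x]]])
  also have "\<dots> = (\<Sum>l\<in>X. \<delta> l * pd x (y r l))" by (rule sum.cong) (auto simp: y2[OF x])
  finally have 1: "\<delta> (y r x) = (\<Sum>l\<in>X. \<delta> l * pd x (y r l))" .
  have "pd x (\<Sum>l\<in>X. y r l * \<delta> l) = 0" using y1[OF \<delta>] derivation_zero[OF pd(1)[OF x]] by simp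
  then have "(\<Sum>l\<in>X. y r l * pd x (\<delta> l)) + (\<Sum>l\<in>X. pd x (y r l) * \<delta> l) = 0"
   by (simp add: derivation_sum[OF pd(1)[OF x]] derivation_mult[OF pd(1)[OF x]] sum.distrib)
  then show ?thesis unfolding 1 by (simp add: sum_negf mult.commute eq_neg_iff_add_eq_0 add.commute)
 qed
 have \<Delta>E: "\<delta> ` ?E \<subseteq> ?E" if \<delta>: "\<delta> \<in> \<Delta>" for \<delta>
 proof
  fix z assume "z \<in> \<delta> ` ?E"
  then obtain z0 where z0: "z0 \<in> ?E" "z = \<delta> z0" by blast
  obtain u v where uv: "u \<in> B" "v \<in> B" "v \<noteq> 0" "z0 = u / v" using fracsE[OF z0(1) B] .
  have "\<delta> u \<in> ?E" "\<delta> v \<in> ?E" "u \<in> ?E" "v \<in> ?E" using \<Delta>(4)[OF \<delta>] uv BE by blast+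
  then show "z \<in> ?E" unfolding z0(2) uv(4) derivation_divide[OF \<Delta>(2)[OF \<delta>] uv(3)]
   by (intro sf_divide[OF E] sr_diff[OF Es] sr_mult[OF Es] sr_power[OF Es])
 qed
 have cX: "card X < card {..card X}" by simp
 obtain f0 where f0: "\<And>r. r \<in> {..card X} \<Longrightarrow> f0 r \<in> ?E" "\<exists>r\<in>{..card X}. f0 r \<noteq> 0" "\<And>x. x \<in> X \<Longrightarrow> (\<Sum>r\<le>card X. f0 r * y r x) = 0"
  by (rule linear_relation[OF E fX finite_atMost cX yE]) (assumption | rule that)+
 obtain f where f: "\<And>r. r \<in> {..card X} \<Longrightarrow> f r \<in> ?E" "\<exists>r\<in>{..card X}. f r \<noteq> 0" "\<And>x. x \<in> X \<Longrightarrow> (\<Sum>r\<le>card X. f r * y r x) = 0"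
  "\<And>r \<delta>. r \<in> {..card X} \<Longrightarrow> \<delta> \<in> \<Delta> \<Longrightarrow> \<delta> (f r) = 0"
  by (rule constant_relation[OF E \<Delta>(2) \<Delta>E ode finite_atMost f0]) (assumption | rule that)+
 have fK: "f r \<in> acl K" if "r \<in> {..card X}" for r using C[of "f r"] f(1)[OF that] f(4)[OF that] by blast
 let ?J = "{..card X} \<times> {..card I}"
 \<comment> \<open>The combined coefficient of form \<open>(r, t)\<close>; it is nonzero where both
   factors are.\<close>
 define b where "b j = f (fst j) * c (fst j) (snd j)" for j
 obtain r0 where r0: "r0 \<in> {..card X}" "f r0 \<noteq> 0" using f(2) by blast
 obtain t0 where t0: "t0 \<in> {..card I}" "c r0 t0 \<noteq> 0" using c(2) by blast
 have fJ: "finite ?J" by simp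
 have "b (r0, t0) = 0"
 proof (rule form_independent[OF fJ s h dist])
  show "b j \<in> acl K" if "j \<in> ?J" for j unfolding b_def
   using that c(1) fK acl_base[OF Ks] by (intro sr_mult[OF sf_sr[OF acl_subfield[OF Ks]]]) auto
  show "(\<Sum>j\<in>?J. b j * (h j x / (\<gamma> * p j))) = 0" if "x \<in> X" for x
  proof -
   have "(\<Sum>j\<in>?J. b j * (h j x / (\<gamma> * p j))) = (\<Sum>r\<le>card X. \<Sum>t\<le>card I. f r * (c r t * \<omega> (r, t) x))"
    unfolding sum.cartesian_product by (rule sum.cong) (auto simp: b_def \<omega>_def)
   also have "\<dots> = (\<Sum>r\<le>card X. f r * y r x)" by (simp add: y_def sum_distrib_left)
   finally show ?thesis using f(3)[OF that] by simp
  qed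
  show "(r0, t0) \<in> ?J" using r0 t0 by simp
 qed
 then show False using r0 t0 by (simp add: b_def)
qed

end

section \<open>Finitely many specializations\<close>

lemma prime_elt_assoc:
 assumes R: "subring_set (R :: 'a::idom set)" and p: "prime_elt R p" and q: "prime_elt R q" and d: "dvd_in R p q"
 shows "dvd_in R q p"
proof -
 obtain c where c: "c \<in> R" "q = p * c" using d by (auto simp: dvd_in_def)
 have qR: "q \<in> R" "q \<noteq> 0" and pR: "p \<in> R" using p q by (auto simp: prime_elt_def)
 have "dvd_in R q (p * c)" using c sr_one[OF R] by (force simp: dvd_in_def)
 then have "dvd_in R q p \<or> dvd_in R q c" using q pR c(1) by (auto simp: prime_elt_def)
 moreover have False if "dvd_in R q c"
 proof -
  obtain e where e: "e \<in> R" "c = q * e" using \<open>dvd_in R q c\<close> by (auto simp: dvd_in_def)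
  then have "q = p * (q * e)" using c(2) by (simp only:)
  then have "q * (p * e) = q * 1" by (simp only: mult.left_commute mult_1_right)
  then have "1 = p * e" using qR(2) by simp
  then show False using p e(1) by (auto simp: prime_elt_def dvd_in_def)
 qed
 ultimately show ?thesis by blast
qed

text \<open>Splitting off the prime elements one after the other lowers the degree by at least one
  each time.\<close>

lemma prime_divisors_card:
 assumes K: "subfield_set K" and X: "indep K X" and I: "finite I" and p: "\<And>i. i \<in> I \<Longrightarrow> prime_elt (gen_alg K X) (p i)"
  and nd: "\<And>i j. i \<in> I \<Longrightarrow> j \<in> I \<Longrightarrow> i \<noteq> j \<Longrightarrow> \<not> dvd_in (gen_alg K X) (p i) (p j)"
  and r: "r \<in> gen_alg K X" "r \<noteq> 0" "\<And>i. i \<in> I \<Longrightarrow> dvd_in (gen_alg K X) (p i) r"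
 shows "card I \<le> tdeg K X r"
 using I p nd r
proof (induction I arbitrary: r rule: finite_induct)
 case (insert i I)
 have pi: "prime_elt (gen_alg K X) (p i)" using insert.prems(1) by simp
 then have piR: "p i \<in> gen_alg K X" "p i \<noteq> 0" by (auto simp: prime_elt_def)
 obtain r' where r': "r' \<in> gen_alg K X" "r = p i * r'" using insert.prems(5)[of i] by (auto simp: dvd_in_def)
 have "r' \<noteq> 0" using r' insert.prems(4) by auto
 moreover have "dvd_in (gen_alg K X) (p j) r'" if j: "j \<in> I" for j
 proof -
  have "j \<noteq> i" using j insert.hyps(2) by blast
  then have "\<not> dvd_in (gen_alg K X) (p j) (p i)" using insert.prems(2)[of j i] j by blast
  moreover have "dvd_in (gen_alg K X) (p j) (p i * r')" using insert.prems(5)[of j] j r'(2) by simp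
  moreover have "prime_elt (gen_alg K X) (p j)" using insert.prems(1)[of j] j by blast
  ultimately show ?thesis using piR(1) r'(1) by (auto simp: prime_elt_def)
 qed
 ultimately have "card I \<le> tdeg K X r'" using insert.prems(1,2) r'(1) by (intro insert.IH) auto
 moreover have "tdeg K X r = tdeg K X (p i) + tdeg K X r'" unfolding r'(2) by (rule tdeg_mult[OF K X piR(1) r'(1) piR(2) \<open>r' \<noteq> 0\<close>])
 moreover have "tdeg K X (p i) > 0" by (rule prime_elt_tdeg_pos[OF K X pi])
 ultimately show ?case using insert.hyps by simp
qed simp

lemma integral_image:
 fixes f :: "'a::idom \<Rightarrow> 'b::idom"
 assumes B: "subring_set B" and f: "rhom B f" and R: "R \<subseteq> B" and b: "b \<in> B" "integral_over R b"
 shows "integral_over (f ` R) (f b)"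
proof -
 obtain q where q: "q \<in> polys R" "lead_coeff q = 1" "poly q b = 0" using b(2) by (auto simp: integral_over_def)
 have qB: "q \<in> polys B" using q(1) polys_mono[OF R] by blast
 have d: "degree (map_poly f q) = degree q" using mp_degree[OF B f, of q] q(2) rhom_one[OF B f] by simp
 show ?thesis
 proof (rule integral_overI[of "map_poly f q"])
  show "map_poly f q \<in> polys (f ` R)" using q(1) by (intro polysI) (simp add: rhom_map_coeff[OF B f] polysD)
  show "lead_coeff (map_poly f q) = 1" unfolding d using q(2) rhom_one[OF B f] by (simp add: rhom_map_coeff[OF B f])
  show "poly (map_poly f q) (f b) = 0" using mp_eval[OF B f qB b(1)] q(3) rhom_zero[OF B f] by simp
 qed
qed

context affine_domain
begin

text \<open>A homomorphism can be changed by an automorphism of the residue field so that it has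
prescribed values on \<open>R\<close>; integral generators then have finitely many possible images.\<close>

lemma specialization_align:
 fixes R Z :: "'b set" and \<pi> :: "'b \<Rightarrow> 'b"
 assumes R: "subring_set R" and Z: "finite Z" "\<And>z. z \<in> Z \<Longrightarrow> integral_over R z"
  and \<pi>: "rhom (gen_alg R Z) \<pi>" and \<pi>0: "rhom R \<pi>0" and ker: "\<And>r. r \<in> R \<Longrightarrow> \<pi> r = 0 \<longleftrightarrow> \<pi>0 r = (0::'b)"
 obtains \<chi> where "rhom (gen_alg R Z) \<chi>" "\<And>r. r \<in> R \<Longrightarrow> \<chi> r = \<pi>0 r" "\<And>b. b \<in> gen_alg R Z \<Longrightarrow> \<chi> b = 0 \<longleftrightarrow> \<pi> b = 0"
proof -
 let ?B = "gen_alg R Z"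
 have B: "subring_set ?B" by (rule ga_subring[OF R])
 have RB: "R \<subseteq> ?B" and ZB: "Z \<subseteq> ?B" by (rule ga_base)+
 have \<pi>R: "rhom R \<pi>" by (rule rhom_subset[OF \<pi> RB])
 define \<sigma> where "\<sigma> y = \<pi>0 (inv_into R \<pi> y)" for y
 have \<sigma>: "\<sigma> (\<pi> r) = \<pi>0 r" if r: "r \<in> R" for r
 proof -
  let ?r = "inv_into R \<pi> (\<pi> r)"
  have r': "?r \<in> R" "\<pi> ?r = \<pi> r" using r by (auto intro: inv_into_into f_inv_into_f)
  then have "\<pi> (?r - r) = 0" using rhom_diff[OF R \<pi>R r'(1) r] by simp
  then have "\<pi>0 (?r - r) = 0" using ker sr_diff[OF R r'(1) r] by blast
  then show ?thesis using rhom_diff[OF R \<pi>0 r'(1) r] by (simp add: \<sigma>_def)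
 qed
 let ?D = "\<pi> ` R"
 have D: "subring_set ?D" by (rule rhom_image[OF R \<pi>R])
 have \<sigma>h: "rhom ?D \<sigma>"
 proof (rule rhomI)
  show "\<sigma> 1 = 1" using \<sigma>[OF sr_one[OF R]] rhom_one[OF R \<pi>R] rhom_one[OF R \<pi>0] by simp
  fix x y assume "x \<in> ?D" "y \<in> ?D"
  then obtain r s where rs: "r \<in> R" "s \<in> R" "x = \<pi> r" "y = \<pi> s" by blast
  show "\<sigma> (x + y) = \<sigma> x + \<sigma> y" using \<sigma>[OF sr_add[OF R rs(1,2)]] rhom_add[OF R \<pi>R rs(1,2)] rhom_add[OF R \<pi>0 rs(1,2)] \<sigma>[OF rs(1)] \<sigma>[OF rs(2)] rs by simp
  show "\<sigma> (x * y) = \<sigma> x * \<sigma> y" using \<sigma>[OF sr_mult[OF R rs(1,2)]] rhom_mult[OF R \<pi>R rs(1,2)] rhom_mult[OF R \<pi>0 rs(1,2)] \<sigma>[OF rs(1)] \<sigma>[OF rs(2)] rs by simp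
 qed
 have \<sigma>inj: "y = 0" if "y \<in> ?D" "\<sigma> y = 0" for y
  using that \<sigma> ker by auto
 let ?E = "gen_alg ?D (\<pi> ` Z)"
 have E: "subring_set ?E" by (rule ga_subring[OF D])
 have bE: "\<pi> b \<in> ?E" if "b \<in> ?B" for b using rhom_ga[OF B \<pi> that RB ZB] .
 have intB: "integral_over ?D (\<pi> b)" if "b \<in> ?B" for b
  using integral_image[OF B \<pi> RB that] integral_over_gen_alg[OF R _ that] Z(2) by blast
 have "\<pi> ` Z \<subseteq> acl ?D" using intB[THEN integral_imp_algebraic] ZB by (auto simp: acl_def)
 from generic_extension[OF D finite_imageI[OF Z(1)] this]
 obtain c where c: "c \<in> ?D" "c \<noteq> 0" "\<forall>f :: 'b \<Rightarrow> 'b. rhom ?D f \<longrightarrow> f c \<noteq> 0 \<longrightarrow> (\<exists>g. rhom ?E g \<and> (\<forall>d\<in>?D. g d = f d))"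
  by (elim bexE conjE) (rule that; assumption)
 obtain g where g: "rhom ?E g" "\<And>d. d \<in> ?D \<Longrightarrow> g d = \<sigma> d" using c(3)[rule_format, OF \<sigma>h] \<sigma>inj[OF c(1)] c(2) by metis
 show thesis
 proof (rule that[of "\<lambda>b. g (\<pi> b)"])
  show "rhom ?B (\<lambda>b. g (\<pi> b))"
   by (rule rhomI) (simp_all add: rhom_one[OF B \<pi>] rhom_one[OF E g(1)] rhom_add[OF B \<pi>] rhom_mult[OF B \<pi>] rhom_add[OF E g(1)] rhom_mult[OF E g(1)] bE)
  show "g (\<pi> r) = \<pi>0 r" if "r \<in> R" for r using g(2) \<sigma> that by simp
  show "g (\<pi> b) = 0 \<longleftrightarrow> \<pi> b = 0" if b: "b \<in> ?B" for b
  proof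
   assume z: "g (\<pi> b) = 0"
   show "\<pi> b = 0"
   proof (rule ccontr)
    assume nz: "\<pi> b \<noteq> 0"
    obtain r where r: "r \<in> ?D" "r \<noteq> 0" "g r = 0"
     by (rule integral_restrict_nonzero[OF E g(1) D ga_base(1) intB[OF b] bE[OF b] nz z])
    then show False using \<sigma>inj[OF r(1)] g(2)[OF r(1)] by simp
   qed
  qed (simp add: rhom_zero[OF E g(1)])
 qed
qed

lemma finite_specializations:
 fixes R Z :: "'b set"
 assumes R: "subring_set R" and Z: "finite Z" "\<And>z. z \<in> Z \<Longrightarrow> integral_over R z" and \<pi>0: "rhom R (\<pi>0 :: 'b \<Rightarrow> 'b)"
 shows "finite {{b \<in> gen_alg R Z. \<pi> b = 0} | \<pi> :: 'b \<Rightarrow> 'b. rhom (gen_alg R Z) \<pi> \<and> (\<forall>r\<in>R. \<pi> r = 0 \<longleftrightarrow> \<pi>0 r = 0)}" (is "finite ?K")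
proof -
 let ?B = "gen_alg R Z"
 have B: "subring_set ?B" by (rule ga_subring[OF R])
 have RB: "R \<subseteq> ?B" and ZB: "Z \<subseteq> ?B" by (rule ga_base)+
 have "\<exists>q. q \<in> polys R \<and> lead_coeff q = 1 \<and> poly q z = 0" if "z \<in> Z" for z using Z(2)[OF that] by (auto simp: integral_over_def)
 then obtain q where q: "\<And>z. z \<in> Z \<Longrightarrow> q z \<in> polys R \<and> lead_coeff (q z) = 1 \<and> poly (q z) z = 0" by metis
 define rt where "rt z = {x. poly (map_poly \<pi>0 (q z)) x = 0}" for z
 have frt: "finite (rt z)" if "z \<in> Z" for z unfolding rt_def
 proof (rule poly_roots_finite)
  have "coeff (map_poly \<pi>0 (q z)) (degree (q z)) = 1" using q[OF that] rhom_one[OF R \<pi>0] by (simp add: rhom_map_coeff[OF R \<pi>0])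
  then show "map_poly \<pi>0 (q z) \<noteq> 0" by auto
 qed
 define good where "good v \<chi> \<longleftrightarrow> rhom ?B \<chi> \<and> (\<forall>r\<in>R. \<chi> r = \<pi>0 r) \<and> (\<forall>z\<in>Z. \<chi> z = v z)" for v and \<chi> :: "'b \<Rightarrow> 'b"
 \<comment> \<open>Homomorphisms that are good for the same \<open>v\<close> agree on
   \<open>gen_alg R Z\<close>, so the kernel does not depend on the choice.\<close>
 define G where "G v = {b \<in> ?B. (SOME \<chi>. good v \<chi>) b = 0}" for v
 have "?K \<subseteq> G ` PiE Z rt"
 proof
  fix k assume "k \<in> ?K"
  then obtain \<pi> :: "'b \<Rightarrow> 'b" where \<pi>: "k = {b \<in> ?B. \<pi> b = 0}" "rhom ?B \<pi>" "\<forall>r\<in>R. \<pi> r = 0 \<longleftrightarrow> \<pi>0 r = 0" by (elim CollectE exE conjE)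
  obtain \<chi> where \<chi>: "rhom ?B \<chi>" "\<And>r. r \<in> R \<Longrightarrow> \<chi> r = \<pi>0 r" "\<And>b. b \<in> ?B \<Longrightarrow> \<chi> b = 0 \<longleftrightarrow> \<pi> b = 0"
   by (rule specialization_align[OF R Z \<pi>(2) \<pi>0 \<pi>(3)[rule_format]]) (assumption | rule that)+
  define v where "v = restrict \<chi> Z"
  have gd: "good v \<chi>" using \<chi> by (simp add: good_def v_def)
  then have gs: "good v (SOME \<chi>. good v \<chi>)" by (rule someI[of "good v"])
  have eq: "(SOME \<chi>. good v \<chi>) b = \<chi> b" if "b \<in> ?B" for b
   by (rule rhom_eq_on_ga[OF R _ \<chi>(1) _ that]) (use gd gs in \<open>auto simp: good_def\<close>)
  have "k = G v" unfolding \<pi>(1) G_def using eq \<chi>(3) by auto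
  moreover have "v \<in> PiE Z rt"
  proof (rule PiE_I)
   fix z assume z: "z \<in> Z"
   have qB: "q z \<in> polys ?B" using q[OF z] polys_mono[OF RB] by blast
   have "map_poly \<chi> (q z) = map_poly \<pi>0 (q z)" using q[OF z] \<chi>(2)
    by (intro poly_eqI) (simp add: rhom_map_coeff[OF R \<pi>0] rhom_map_coeff[OF B \<chi>(1)] polysD)
   moreover have "poly (map_poly \<chi> (q z)) (\<chi> z) = 0"
    using mp_eval[OF B \<chi>(1) qB subsetD[OF ZB z]] q[OF z] rhom_zero[OF B \<chi>(1)] by simp
   ultimately show "v z \<in> rt z" using z by (simp add: v_def rt_def)
  qed (simp add: v_def)
  ultimately show "k \<in> G ` PiE Z rt" by blast
 qed
 moreover have "finite (G ` PiE Z rt)" using Z(1) frt by (intro finite_imageI finite_PiE)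
 ultimately show ?thesis by (rule finite_subset)
qed

text \<open>Going down gives a prime strictly above \<open>P\<close> and inside \<open>Q\<close>
  that contracts to \<open>(p)\<close>; by dimension it is \<open>Q\<close>.\<close>

lemma codim_one_specialization:
 assumes \<phi>: "point \<phi> P" "range \<phi> \<subseteq> acl (range \<iota>)" and X: "X \<subseteq> range \<phi>" "indep k X" "\<And>b. integral_over (gen_alg k X) (\<phi> b)"
  and Q: "prime_ideal Q" "P \<subseteq> Q" "pdim P = pdim Q + 1"
 obtains \<pi> p where "rhom (range \<phi>) \<pi>" "\<And>c. c \<in> k \<Longrightarrow> \<pi> c = c" "\<And>a. \<pi> (\<phi> a) = 0 \<longleftrightarrow> a \<in> Q" "\<pi> ` range \<phi> \<subseteq> acl (range \<iota>)"
  "prime_elt (gen_alg k X) p" "\<And>r. r \<in> gen_alg k X \<Longrightarrow> \<pi> r = 0 \<longleftrightarrow> dvd_in (gen_alg k X) p r"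
proof -
 let ?R = "gen_alg k X"
 have Rs: "subring_set ?R" by (rule ga_subring[OF k_sr])
 note \<phi>D = pointD[OF \<phi>(1)]
 have RB: "?R \<subseteq> range \<phi>" by (rule ga_least[OF \<phi>D(5,6) X(1)])
 obtain \<psi> where \<psi>: "point \<psi> Q" "range \<psi> \<subseteq> acl (range \<iota>)" using point_ex[OF Q(1)] .
 obtain \<pi> where \<pi>: "rhom (range \<phi>) \<pi>" "\<And>a. \<pi> (\<phi> a) = \<psi> a" "\<And>c. c \<in> k \<Longrightarrow> \<pi> c = c"
  by (rule point_factor[OF \<phi>(1) \<psi>(1) Q(2)]) (rule that)
 have ker: "\<pi> (\<phi> a) = 0 \<longleftrightarrow> a \<in> Q" for a unfolding \<pi>(2) by (rule pointD(3)[OF \<psi>(1)])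
 have "P \<noteq> Q" using Q(3) by auto
 then obtain u where u: "u \<in> Q" "u \<notin> P" using Q(2) by blast
 have unz: "\<phi> u \<noteq> 0" using \<phi>D(3) u(2) by blast
 have u0: "\<pi> (\<phi> u) = 0" using ker u(1) by blast
 obtain r0 where r0: "r0 \<in> ?R" "r0 \<noteq> 0" "\<pi> r0 = 0"
  by (rule integral_restrict_nonzero[OF \<phi>D(5) \<pi>(1) Rs RB X(3)[of u] rangeI unz u0])
 obtain p v x0 where p: "prime_elt ?R p" "\<pi> p = 0" "v ` X \<subseteq> k" "x0 \<in> X" "v x0 \<noteq> 0"
  "\<And>a. a \<in> gen_alg k (dbase X v x0) \<Longrightarrow> dvd_in ?R p a \<Longrightarrow> a = 0"
  by (rule monic_prime_elt[OF k_sf k_inf X(2) rhom_subset[OF \<pi>(1) RB] \<pi>(3) r0]) (assumption | rule that)+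
 have pR: "p \<in> ?R" "p \<noteq> 0" using p(1) by (auto simp: prime_elt_def)
 obtain ph where ph: "\<phi> ph = p" using pR(1) RB by blast
 have phQ: "ph \<in> Q" using ker[of ph] ph p(2) by simp
 obtain P1 where P1: "prime_ideal P1" "P \<subseteq> P1" "P1 \<subseteq> Q" "ph \<in> P1" "\<And>a. \<phi> a \<in> ?R \<Longrightarrow> a \<in> P1 \<longleftrightarrow> dvd_in ?R p (\<phi> a)"
  by (rule going_down[OF \<phi>(1) X(2,1,3) p(1) Q(1,2) ph phQ]) (assumption | rule that)+
 have "P1 = Q"
 proof (rule ccontr)
  assume "P1 \<noteq> Q"
  then have "pdim Q < pdim P1" using pdim_less[OF P1(1) Q(1)] P1(3) by blast
  moreover have "ph \<notin> P" using \<phi>D(3)[of ph] ph pR(2) by simp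
  then have "P \<subset> P1" using P1(2,4) by blast
  then have "pdim P1 < pdim P" by (rule pdim_less[OF \<phi>D(8) P1(1)])
  ultimately show False using Q(3) by simp
 qed
 have "\<pi> r = 0 \<longleftrightarrow> dvd_in ?R p r" if r: "r \<in> ?R" for r
 proof -
  obtain a where "r = \<phi> a" using r RB by blast
  then show ?thesis using ker[of a] P1(5)[of a] r \<open>P1 = Q\<close> by simp
 qed
 moreover have "\<pi> ` range \<phi> \<subseteq> acl (range \<iota>)" using \<psi>(2) by (auto simp: \<pi>(2))
 ultimately show thesis using that[OF \<pi>(1,3) ker _ p(1)] by blast
qed

end

section \<open>Rationality implies finiteness\<close>

context affine_domain
begin

lemma rational_imp_finite:
 assumes br: "poisson_bracket K br" and ch: "\<And>n. n > 0 \<Longrightarrow> of_nat n \<noteq> (0::'a)"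
  and P: "poisson_prime br P" and rat: "poisson_rational K br P"
 shows "finite {Q. poisson_prime br Q \<and> P \<subseteq> Q \<and> height Q = height P + 1}" (is "finite ?Q")
proof (rule ccontr)
 assume infQ: "infinite ?Q"
 have PP: "prime_ideal P" using P by (simp add: poisson_prime_def)
 have chb: "of_nat n \<noteq> (0::'b)" if "n > 0" for n
  using \<iota>(2)[of "of_nat n"] ch[OF that] rhom_of_nat[OF UNIV_sr \<iota>(1), of n] by auto
 obtain \<phi> where \<phi>: "point \<phi> P" "range \<phi> \<subseteq> acl (range \<iota>)" using point_ex[OF PP] .
 note \<phi>D = pointD[OF \<phi>(1)]
 obtain X where X: "X \<subseteq> range \<phi>" "indep k X" "\<And>b. integral_over (gen_alg k X) (\<phi> b)" "tbasis k X (range \<phi>)"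
  by (rule point_normalization[OF \<phi>]) (rule that)
 let ?B = "range \<phi>"
 let ?R = "gen_alg k X"
 have Rs: "subring_set ?R" by (rule ga_subring[OF k_sr])
 have RB: "?R \<subseteq> ?B" by (rule ga_least[OF \<phi>D(5,6) X(1)])
 have int: "integral_over ?R b" if "b \<in> ?B" for b using X(3) that by blast
 have BR: "?B \<subseteq> acl ?R" using int[THEN integral_imp_algebraic] by (auto simp: acl_def)
 have dbr: "derivation (\<lambda>x. br y x)" for y
 proof -
  have "br y x = - br x y" for x by (rule poisson_skew[OF br])
  then show ?thesis using poisson_derivation[OF br, of y] by (simp add: derivation_def)
 qed
 have brP: "br y a \<in> P" if "a \<in> P" for y a
  using P that prime_ideal_uminus[OF PP] poisson_skew[OF br, of y a] by (auto simp: poisson_prime_def)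
 \<comment> \<open>The bracket with \<open>y\<close> descends to \<open>A/P\<close> because
   \<open>P\<close> is Poisson, so the chosen preimage does not matter.\<close>
 define d0 where "d0 y z = \<phi> (br y (inv_into UNIV \<phi> z))" for y z
 have d0: "d0 y (\<phi> x) = \<phi> (br y x)" for y x
 proof -
  let ?x = "inv_into UNIV \<phi> (\<phi> x)"
  have "\<phi> ?x = \<phi> x" by (rule f_inv_into_f) simp
  then have "?x - x \<in> P" by (simp add: point_diff[OF \<phi>(1)])
  then have "br y (?x - x) \<in> P" by (rule brP)
  moreover have "br y ?x = br y (?x - x) + br y x" using derivation_add[OF dbr, of y "?x - x" x] by simp
  ultimately have "br y ?x - br y x \<in> P" by simp
  then show ?thesis by (simp add: d0_def point_diff[OF \<phi>(1)])
 qed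
 have \<phi>add: "\<phi> (x + y) = \<phi> x + \<phi> y" and \<phi>mult: "\<phi> (x * y) = \<phi> x * \<phi> y" for x y
  using rhom_add[OF UNIV_sr \<phi>D(1)] rhom_mult[OF UNIV_sr \<phi>D(1)] by simp_all
 have "deriv_on ?B (d0 y)" for y unfolding deriv_on_def
 proof (intro ballI)
  fix u v assume "u \<in> ?B" "v \<in> ?B"
  then obtain a b where ab: "u = \<phi> a" "v = \<phi> b" by blast
  show "d0 y (u + v) = d0 y u + d0 y v \<and> d0 y (u * v) = u * d0 y v + d0 y u * v"
   unfolding ab \<phi>add[symmetric] \<phi>mult[symmetric] d0 derivation_add[OF dbr] derivation_mult[OF dbr] by (simp add: \<phi>add \<phi>mult)
 qed
 then have "\<exists>d. derivation d \<and> (\<forall>x\<in>?B. d x = d0 y x)" for y using derivation_extend[OF chb \<phi>D(5)] by metis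
 then obtain \<delta> where \<delta>: "\<And>y. derivation (\<delta> y)" "\<And>y x. x \<in> ?B \<Longrightarrow> \<delta> y x = d0 y x" by metis
 have \<delta>\<phi>: "\<delta> y (\<phi> x) = \<phi> (br y x)" for y x using \<delta>(2)[of "\<phi> x" y] d0 by simp
 \<comment> \<open>The Hamiltonians of the generators suffice: a fraction they kill is killed by all
   of them, by the Leibniz rule and induction over \<open>gen_alg K S\<close>. Rationality then
   makes the common constants algebraic.\<close>
 define \<Delta> where "\<Delta> = \<delta> ` S"
 have f\<Delta>: "finite \<Delta>" using gen(1) by (simp add: \<Delta>_def)
 have \<Delta>d: "derivation d" if "d \<in> \<Delta>" for d using that \<delta>(1) by (auto simp: \<Delta>_def)
 have \<Delta>B: "d ` ?B \<subseteq> ?B" if "d \<in> \<Delta>" for d using that \<delta>\<phi> by (auto simp: \<Delta>_def)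
 have \<Delta>k: "d c = 0" if d: "d \<in> \<Delta>" and c: "c \<in> k" for d c
 proof -
  obtain y where y: "d = \<delta> y" using d by (auto simp: \<Delta>_def)
  obtain c0 where c0: "c0 \<in> K" "c = \<iota> c0" using c by blast
  have "br y (c0 * 1) = c0 * br y 1" using br c0(1) unfolding poisson_bracket_def by blast
  then have "br y c0 = 0" using derivation_one[OF dbr, of y] by simp
  then show ?thesis using \<delta>\<phi>[of y c0] \<phi>D(2)[OF c0(1)] c0(2) y rhom_zero[OF UNIV_sr \<phi>D(1)] by simp
 qed
 have const: "f \<in> acl k" if f: "f \<in> fracs ?B" "\<And>d. d \<in> \<Delta> \<Longrightarrow> d f = 0" for f
 proof -
  obtain u v where uv: "u \<in> ?B" "v \<in> ?B" "v \<noteq> 0" "f = u / v" using fracsE[OF f(1) \<phi>D(5)] .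
  then obtain a b where ab: "u = \<phi> a" "v = \<phi> b" by blast
  have b: "b \<notin> P" using \<phi>D(3)[of b] uv(3) ab by blast
  have s0: "b * br s a - a * br s b \<in> P" if s: "s \<in> S" for s
  proof -
   have "\<delta> s f = 0" using f(2) s by (simp add: \<Delta>_def)
   then have "\<delta> s u * v = u * \<delta> s v" using uv(3) unfolding uv(4) derivation_divide[OF \<delta>(1) uv(3)] by simp
   then have "\<phi> (br s a * b) = \<phi> (a * br s b)" unfolding ab \<delta>\<phi> by (simp add: \<phi>mult)
   then show ?thesis using point_diff[OF \<phi>(1)] by (simp add: mult.commute)
  qed
  have all: "b * br y a - a * br y b \<in> P" for y
  proof -
   have add: "br (x + y) z = br x z + br y z" for x y z using derivation_add[OF poisson_derivation[OF br]] .
   have mul: "br (x * y) z = x * br y z + br x z * y" for x y z using derivation_mult[OF poisson_derivation[OF br]] .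
   have neg: "br (- x) z = - br x z" for x z
    using add[of x "- x" z] derivation_zero[OF poisson_derivation[OF br], of z] by (simp add: eq_neg_iff_add_eq_0 add.commute)
   have "y \<in> gen_alg K S" by (simp add: gen(2))
   then show ?thesis
   proof (induction y)
    case (base_K c)
    have "br c z = 0" for z
    proof -
     have "br (c * 1) z = c * br 1 z" using br base_K unfolding poisson_bracket_def by blast
     then show ?thesis using derivation_one[OF poisson_derivation[OF br], of z] by simp
    qed
    then show ?case using prime_idealD(1)[OF PP] by simp
   next
    case (base_S s)
    then show ?case by (rule s0)
   next
    case (add x y)
    have "b * br (x + y) a - a * br (x + y) b = (b * br x a - a * br x b) + (b * br y a - a * br y b)"
     unfolding \<open>\<And>x y z. br (x + y) z = br x z + br y z\<close> by (simp add: algebra_simps)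
    then show ?case using prime_idealD(3)[OF PP add.IH] by simp
   next
    case (mult x y)
    have "b * br (x * y) a - a * br (x * y) b = x * (b * br y a - a * br y b) + (b * br x a - a * br x b) * y"
     unfolding mul by (simp add: algebra_simps)
    then show ?case using prime_idealD(3)[OF PP prime_idealD(4)[OF PP mult.IH(2)] prime_idealD(5)[OF PP mult.IH(1)]] by simp
   next
    case (neg x)
    have "b * br (- x) a - a * br (- x) b = - (b * br x a - a * br x b)"
     unfolding \<open>\<And>x z. br (- x) z = - br x z\<close> by (simp add: algebra_simps)
    then show ?case using prime_ideal_uminus[OF PP neg.IH] by simp
   qed
  qed
  have all': "b * br a y - a * br b y \<in> P" for y
  proof -
   have "b * br a y - a * br b y = - (b * br y a - a * br y b)"
    unfolding poisson_skew[OF br, of a y] poisson_skew[OF br, of b y] by simp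
   then show ?thesis using prime_ideal_uminus[OF PP all[of y]] by simp
  qed
  have "(a, b) \<in> frac_poisson_centre br P" unfolding frac_poisson_centre_def
  proof (intro CollectI conjI ballI)
   show "(a, b) \<in> frac_elems P" using b by (simp add: frac_elems_def)
   fix w assume "w \<in> frac_elems P"
   obtain c d where w: "w = (c, d)" by (cases w)
   have "d * (b * br a c - a * br b c) - c * (b * br a d - a * br b d) \<in> P"
    by (intro prime_ideal_diff[OF PP] prime_idealD(4)[OF PP] all')
   moreover have "br a c * b * d - a * br b c * d - c * br a d * b + a * c * br b d
    = d * (b * br a c - a * br b c) - c * (b * br a d - a * br b d)" by (simp add: algebra_simps)
   ultimately show "frac_eq P (frac_br br (a, b) w) (0, 1)" by (simp add: w frac_eq_def frac_br_def)
  qed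
  then have "frac_algebraic K P (a, b)" using rat by (simp add: poisson_rational_def)
  then show ?thesis using frac_algebraic_imp_algebraic[OF \<phi>(1) b] uv(4) ab by simp
 qed
 let ?F = "fracs ?R"
 have F: "subfield_set ?F" by (rule fracs_subfield[OF Rs])
 have RF: "?R \<subseteq> ?F" by (rule fracs_base[OF Rs])
 have kR: "k \<subseteq> ?R" by (rule ga_base)
 \<comment> \<open>These values enter the contractions of the forms with \<open>\<Delta>\<close>;
   \<open>\<alpha>\<close> is chosen to generate exactly what they require.\<close>
 define U where "U = (\<lambda>(d, x). d x) ` (\<Delta> \<times> X)"
 have fU: "finite U" unfolding U_def using f\<Delta> indep_finite[OF X(2)] by simp
 have "d x \<in> ?B" if "d \<in> \<Delta>" "x \<in> X" for d x using \<Delta>B[OF that(1)] X(1) that(2) by blast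
 then have UB: "U \<subseteq> ?B" unfolding U_def by auto
 have UF: "U \<subseteq> acl ?F" using UB BR acl_mono[OF RF] by blast
 obtain \<alpha> where \<alpha>: "\<alpha> \<in> gen_alg k U" "U \<subseteq> gen_alg ?F {\<alpha>}"
  using primitive_element[OF chb F k_sr subset_trans[OF kR RF] k_inf fU UF] .
 have \<alpha>B: "\<alpha> \<in> ?B" using \<alpha>(1) ga_least[OF \<phi>D(5,6) UB] by blast
 have "\<alpha> \<in> acl ?F" using \<alpha>B BR acl_mono[OF RF] by blast
 then obtain g where g: "minpoly ?F \<alpha> g" by (rule minpoly_ex[OF F])
 obtain pd where pd: "\<And>x. x \<in> X \<Longrightarrow> derivation (pd x)" "\<And>x c. x \<in> X \<Longrightarrow> c \<in> k \<Longrightarrow> pd x c = 0"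
  "\<And>x y. x \<in> X \<Longrightarrow> y \<in> X \<Longrightarrow> pd x y = (if y = x then 1 else 0)"
  by (rule partial_derivatives[OF chb k_sr X(2)]) (assumption | rule that)+
 interpret prim: primitive_integral k X ?B pd \<alpha> T g
  by unfold_locales (use chb k_sf k_inf X(2) pd \<phi>D(5) RB int \<alpha>B g in blast)+
 have "\<exists>c\<in>?R. c \<noteq> 0 \<and> c * u \<in> prim.A" if u: "u \<in> U" for u
 proof -
  obtain q where q: "q \<in> polys ?F" "u = poly q \<alpha>" using \<alpha>(2) u ga_singleton[OF sf_sr[OF F]] by blast
  obtain e where e: "e \<in> ?R" "e \<noteq> 0" "smult e q \<in> polys ?R" using clear_denominators[OF Rs q(1)] .
  have "e * u \<in> prim.A" using prim.polyA[OF e(3)] q(2) by simp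
  then show ?thesis using e by blast
 qed
 moreover have "c * z \<in> prim.A" if "c \<in> ?R" "z \<in> prim.A" for c z using sr_mult[OF prim.As] prim.RA that by blast
 ultimately obtain D where D: "D \<in> ?R" "D \<noteq> 0" "\<And>u. u \<in> U \<Longrightarrow> D * u \<in> prim.A"
  using common_denominator[OF Rs fU, of "\<lambda>z. z \<in> prim.A" "\<lambda>u. u"] by blast
 have D': "D * d x \<in> prim.A" if "d \<in> \<Delta>" "x \<in> X" for d x
 proof (rule D(3))
  show "d x \<in> U" unfolding U_def using that by (intro image_eqI[of _ _ "(d, x)"]) auto
 qed
 have "prim.\<gamma> \<in> acl ?R" using prim.\<gamma>A prim.AB BR by blast
 \<comment> \<open>\<open>r1\<close> is a nonzero multiple of \<open>\<gamma>\<close> in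
   \<open>R\<close>. Primes whose contraction contains it are discarded, which secures the last
   clause of \<open>spec\<close> for the others.\<close>
 then obtain r1 q where r1: "r1 \<in> ?R" "r1 \<noteq> 0" "q \<in> polys ?R" "r1 + prim.\<gamma> * poly q prim.\<gamma> = 0"
  using algebraic_nonzero_const[OF Rs _ prim.\<gamma>_nz] by blast
 define c' where "c' = - poly q prim.\<gamma>"
 have c'A: "c' \<in> prim.A" unfolding c'_def
  by (intro sr_uminus[OF prim.As] po_eval[OF prim.As _ prim.\<gamma>A]) (use r1(3) polys_mono[OF prim.RA] in blast)
 have c'r: "prim.\<gamma> * c' = r1" using r1(4) unfolding add_eq_0_iff by (simp add: c'_def)
 have Qp: "prime_ideal Q \<and> P \<subseteq> Q \<and> pdim P = pdim Q + 1" if "Q \<in> ?Q" for Q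
 proof -
  have Q: "prime_ideal Q" "P \<subseteq> Q" "height Q = height P + 1" using that by (auto simp: poisson_prime_def)
  then show ?thesis using height_succ[OF PP Q(1,2)] by blast
 qed
 define ok where "ok Q \<pi> p \<longleftrightarrow> rhom ?B \<pi> \<and> (\<forall>c\<in>k. \<pi> c = c) \<and> (\<forall>a. \<pi> (\<phi> a) = 0 \<longleftrightarrow> a \<in> Q) \<and> \<pi> ` ?B \<subseteq> acl (range \<iota>) \<and>
  prime_elt ?R p \<and> (\<forall>r\<in>?R. \<pi> r = 0 \<longleftrightarrow> dvd_in ?R p r)" for Q \<pi> p
 have "\<exists>\<pi> p. ok Q \<pi> p" if Q: "Q \<in> ?Q" for Q
 proof -
  obtain \<pi> p where "rhom (range \<phi>) \<pi>" "\<And>c. c \<in> k \<Longrightarrow> \<pi> c = c" "\<And>a. \<pi> (\<phi> a) = 0 \<longleftrightarrow> a \<in> Q" "\<pi> ` range \<phi> \<subseteq> acl (range \<iota>)"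
   "prime_elt (gen_alg k X) p" "\<And>r. r \<in> gen_alg k X \<Longrightarrow> \<pi> r = 0 \<longleftrightarrow> dvd_in (gen_alg k X) p r"
   by (rule codim_one_specialization[OF \<phi> X(1,2,3), of Q]) (use Qp[OF Q] in \<open>assumption | blast | rule that\<close>)+
  then have "ok Q \<pi> p" unfolding ok_def by blast
  then show ?thesis by blast
 qed
 then obtain \<pi> p where ok: "\<And>Q. Q \<in> ?Q \<Longrightarrow> ok Q (\<pi> Q) (p Q)" by metis
 \<comment> \<open>The contraction of \<open>Q\<close> to \<open>R\<close>. Forms are known to be
   independent only for different contractions, so infinitely many contractions are wanted rather
   than infinitely many \<open>Q\<close>.\<close>
 define \<kappa> where "\<kappa> Q = {r \<in> ?R. \<pi> Q r = 0}" for Q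
 have BZ: "?B = gen_alg ?R (\<phi> ` S)"
 proof
  show "?B \<subseteq> gen_alg ?R (\<phi> ` S)" unfolding \<phi>D(7) using kR by (rule ga_mono) simp
  show "gen_alg ?R (\<phi> ` S) \<subseteq> ?B" by (intro ga_least \<phi>D(5) RB) auto
 qed
 \<comment> \<open>Only finitely many \<open>Q\<close> lie over one contraction, so infinitely many
   \<open>Q\<close> give infinitely many contractions.\<close>
 have fib: "finite {Q \<in> ?Q. \<kappa> Q = \<kappa> Q0}" if Q0: "Q0 \<in> ?Q" for Q0
 proof -
  let ?K = "{{b \<in> gen_alg ?R (\<phi> ` S). \<pi>' b = 0} | \<pi>' :: 'b \<Rightarrow> 'b. rhom (gen_alg ?R (\<phi> ` S)) \<pi>' \<and> (\<forall>r\<in>?R. \<pi>' r = 0 \<longleftrightarrow> \<pi> Q0 r = 0)}"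
  have "finite ?K"
  proof (rule finite_specializations[OF Rs])
   show "rhom ?R (\<pi> Q0)" by (rule rhom_subset[OF ok[OF Q0, unfolded ok_def, THEN conjunct1] RB])
  qed (use gen(1) X(3) in auto)
  then have "finite ((\<lambda>W. {a. \<phi> a \<in> W}) ` ?K)" by (rule finite_imageI)
  moreover have "{Q \<in> ?Q. \<kappa> Q = \<kappa> Q0} \<subseteq> (\<lambda>W. {a. \<phi> a \<in> W}) ` ?K"
  proof
   fix Q assume Q: "Q \<in> {Q \<in> ?Q. \<kappa> Q = \<kappa> Q0}"
   then have o: "ok Q (\<pi> Q) (p Q)" using ok by blast
   have k0: "\<forall>r\<in>?R. \<pi> Q r = 0 \<longleftrightarrow> \<pi> Q0 r = 0" using Q by (auto simp: \<kappa>_def)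
   have "Q = {a. \<phi> a \<in> {b \<in> ?B. \<pi> Q b = 0}}" using o by (auto simp: ok_def)
   moreover have "{b \<in> ?B. \<pi> Q b = 0} \<in> ?K" unfolding BZ[symmetric] using o k0 unfolding ok_def by blast
   ultimately show "Q \<in> (\<lambda>W. {a. \<phi> a \<in> W}) ` ?K" by (rule image_eqI)
  qed
  ultimately show ?thesis by (rule rev_finite_subset)
 qed
 have inf\<kappa>: "infinite (\<kappa> ` ?Q)"
 proof
  assume "finite (\<kappa> ` ?Q)"
  then have "finite (\<Union>c\<in>\<kappa> ` ?Q. {Q \<in> ?Q. \<kappa> Q = c})" by (rule finite_UN_I) (use fib in blast)
  moreover have "?Q \<subseteq> (\<Union>c\<in>\<kappa> ` ?Q. {Q \<in> ?Q. \<kappa> Q = c})" by blast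
  ultimately show False using infQ finite_subset by blast
 qed
 have assoc: "\<kappa> Q = \<kappa> Q'" if Q: "Q \<in> ?Q" "Q' \<in> ?Q" and d: "dvd_in ?R (p Q) (p Q')" for Q Q'
 proof -
  have o: "ok Q (\<pi> Q) (p Q)" "ok Q' (\<pi> Q') (p Q')" using ok Q by blast+
  have d': "dvd_in ?R (p Q') (p Q)" by (rule prime_elt_assoc[OF Rs _ _ d]) (use o in \<open>auto simp: ok_def\<close>)
  have tr: "dvd_in ?R x z" if "dvd_in ?R x y" "dvd_in ?R y z" for x y z

  proof -
   obtain u v where uv: "u \<in> ?R" "y = x * u" "v \<in> ?R" "z = y * v" using \<open>dvd_in ?R x y\<close> \<open>dvd_in ?R y z\<close> unfolding dvd_in_def by blast
   then show ?thesis unfolding dvd_in_def using sr_mult[OF Rs uv(1,3)] by (intro bexI[of _ "u * v"]) (simp_all only: mult.assoc)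
  qed
  have "\<pi> Q r = 0 \<longleftrightarrow> \<pi> Q' r = 0" if r: "r \<in> ?R" for r
  proof -
   have "\<pi> Q r = 0 \<longleftrightarrow> dvd_in ?R (p Q) r" "\<pi> Q' r = 0 \<longleftrightarrow> dvd_in ?R (p Q') r" using o r by (simp_all add: ok_def)
   then show ?thesis using tr[OF d, of r] tr[OF d', of r] by argo
  qed
  then show ?thesis by (auto simp: \<kappa>_def)
 qed
 \<comment> \<open>Contractions that contain \<open>r1\<close> belong to pairwise non-associated
   prime divisors of \<open>r1\<close>, whose number is at most its degree.\<close>
 have "finite {c \<in> \<kappa> ` ?Q. r1 \<in> c}"
 proof (rule ccontr)
  assume "infinite {c \<in> \<kappa> ` ?Q. r1 \<in> c}"
  from infinite_arbitrarily_large[OF this, of "tdeg k X r1 + 1"]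
  obtain W where W: "finite W" "card W = tdeg k X r1 + 1" "W \<subseteq> {c \<in> \<kappa> ` ?Q. r1 \<in> c}" by (elim exE conjE) (rule that)
  define q where "q = inv_into ?Q \<kappa>"
  have W\<kappa>: "c \<in> \<kappa> ` ?Q" if "c \<in> W" for c using subsetD[OF W(3) that] by simp
  have q: "\<And>c. c \<in> W \<Longrightarrow> q c \<in> ?Q" "\<And>c. c \<in> W \<Longrightarrow> \<kappa> (q c) = c"
   unfolding q_def by (rule inv_into_into, erule W\<kappa>) (rule f_inv_into_f, erule W\<kappa>)
  have "card W \<le> tdeg k X r1"
  proof (rule prime_divisors_card[OF k_sf X(2) W(1) _ _ r1(1,2), of "\<lambda>c. p (q c)"])
   show "prime_elt ?R (p (q c))" if "c \<in> W" for c using ok[OF q(1)[OF that]] by (simp add: ok_def)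
   show "\<not> dvd_in ?R (p (q c)) (p (q c'))" if "c \<in> W" "c' \<in> W" "c \<noteq> c'" for c c'
    using assoc[OF q(1)[OF that(1)] q(1)[OF that(2)]] q(2) that by auto
   show "dvd_in ?R (p (q c)) r1" if c: "c \<in> W" for c
   proof -
    have "r1 \<in> \<kappa> (q c)" using W(3) q(2)[OF c] c by auto
    then show ?thesis using ok[OF q(1)[OF c]] r1(1) by (simp add: ok_def \<kappa>_def)
   qed
  qed
  then show False using W(2) by simp
 qed
 then have "infinite (\<kappa> ` ?Q - {c \<in> \<kappa> ` ?Q. r1 \<in> c})" using inf\<kappa> by (rule Diff_infinite_finite)
 from infinite_countable_subset[OF this]
 obtain f :: "nat \<Rightarrow> 'b set" where f: "inj f" "range f \<subseteq> \<kappa> ` ?Q - {c \<in> \<kappa> ` ?Q. r1 \<in> c}"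
  by (elim exE conjE) (rule that)
 have f\<kappa>: "f i \<in> \<kappa> ` ?Q" "r1 \<notin> f i" for i using subsetD[OF f(2) rangeI[of f i]] by simp_all
 define q where "q i = inv_into ?Q \<kappa> (f i)" for i
 have q: "\<And>i. q i \<in> ?Q" "\<And>i. \<kappa> (q i) = f i" unfolding q_def by (rule inv_into_into[OF f\<kappa>(1)], rule f_inv_into_f[OF f\<kappa>(1)])
 then have q3: "\<And>i. r1 \<notin> \<kappa> (q i)" using f\<kappa>(2) by simp
 \<comment> \<open>The sequence is reindexed by pairs to match the two roles of the index in
   \<open>specializations_contradiction\<close>.\<close>
 define q2 where "q2 j = q (prod_encode j)" for j :: "nat \<times> nat"
 have o: "ok (q2 j) (\<pi> (q2 j)) (p (q2 j))" for j unfolding q2_def by (rule ok[OF q(1)])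
 show False
 proof (rule prim.specializations_contradiction[where \<Delta> = \<Delta> and D = D and \<pi> = "\<lambda>j. \<pi> (q2 j)" and p = "\<lambda>j. p (q2 j)"])
  show "finite \<Delta>" "D \<in> ?R" "D \<noteq> 0" by (rule f\<Delta> D)+
  show "derivation d" "d ` ?B \<subseteq> ?B" if "d \<in> \<Delta>" for d using that by (rule \<Delta>d, rule \<Delta>B)
  show "d c = 0" if "d \<in> \<Delta>" "c \<in> k" for d c using that by (rule \<Delta>k)
  show "D * d x \<in> prim.A" if "d \<in> \<Delta>" "x \<in> X" for d x using that by (rule D')
  show "f \<in> acl k" if "f \<in> fracs ?B" "\<And>d. d \<in> \<Delta> \<Longrightarrow> d f = 0" for f using that by (rule const)
  fix j
  have oj: "rhom ?B (\<pi> (q2 j))" "\<forall>c\<in>k. \<pi> (q2 j) c = c" "\<forall>a. \<pi> (q2 j) (\<phi> a) = 0 \<longleftrightarrow> a \<in> q2 j" "\<pi> (q2 j) ` ?B \<subseteq> acl (range \<iota>)"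
   "prime_elt ?R (p (q2 j))" "\<forall>r\<in>?R. \<pi> (q2 j) r = 0 \<longleftrightarrow> dvd_in ?R (p (q2 j)) r" using o[of j] unfolding ok_def by blast+
  have "\<pi> (q2 j) ` ?R \<subseteq> acl (range \<iota>)" using oj(4) RB by blast
  then have "acl (\<pi> (q2 j) ` ?R) \<subseteq> acl (range \<iota>)" using rhom_image[OF UNIV_sr \<iota>(1)] by (intro acl_subset)
  then have "T \<notin> acl (\<pi> (q2 j) ` ?R)" using T by blast
  moreover have "\<pi> (q2 j) r1 \<noteq> 0" using q3[of "prod_encode j"] r1(1) by (simp add: q2_def \<kappa>_def)
  then have "\<exists>c\<in>prim.A. prim.\<gamma> * c \<in> ?R \<and> \<pi> (q2 j) (prim.\<gamma> * c) \<noteq> 0"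
   using c'A r1(1) by (intro bexI[of _ c'] conjI) (simp_all only: c'r not_False_eq_True)
  ultimately show "prim.spec (\<pi> (q2 j)) (p (q2 j))" unfolding prim.spec_def using oj by blast
  show "\<pi> (q2 j) (p (q2 l)) \<noteq> 0" if "j \<noteq> l" for l
  proof
   assume z: "\<pi> (q2 j) (p (q2 l)) = 0"
   have "p (q2 l) \<in> ?R" using o[of l] by (simp add: ok_def prime_elt_def)
   then have "dvd_in ?R (p (q2 j)) (p (q2 l))" using oj(6) z by blast
   then have "\<kappa> (q2 j) = \<kappa> (q2 l)" unfolding q2_def by (rule assoc[OF q(1) q(1)])
   then have "prod_encode j = prod_encode l" unfolding q2_def q(2) using f(1) by (simp add: inj_eq)
   then show False using that by simp
  qed
  show "\<pi> (q2 j) (d b) = 0" if d: "d \<in> \<Delta>" and b: "b \<in> ?B" "\<pi> (q2 j) b = 0" for d b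
  proof -
   obtain y where y: "d = \<delta> y" using d by (auto simp: \<Delta>_def)
   obtain a where a: "b = \<phi> a" using b(1) by blast
   have "a \<in> q2 j" using oj(3) b(2) a by blast
   moreover have "poisson_prime br (q2 j)" using q(1) by (simp add: q2_def)
   ultimately have "br a y \<in> q2 j" "prime_ideal (q2 j)" by (simp_all add: poisson_prime_def)
   then have "br y a \<in> q2 j" using prime_ideal_uminus[of "q2 j" "br a y"] by (simp add: poisson_skew[OF br, of a y])
   then show ?thesis using oj(3) by (simp add: y a \<delta>\<phi>)
  qed
 qed
qed

end

section \<open>The ambient field and the theorem\<close>

lemma transcendental_embedding:
 obtains \<iota> :: "'a::idom \<Rightarrow> 'a fract poly fract alg_closure" and T
  where "rhom UNIV \<iota>" "\<And>x. \<iota> x = 0 \<Longrightarrow> x = 0" "T \<notin> acl (range \<iota>)"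
proof -
 \<comment> \<open>The field is an algebraic closure of the rational functions in one variable over
   the fraction field of \<open>A\<close>; \<open>T\<close> is that variable.\<close>
 define j :: "'a fract poly \<Rightarrow> 'a fract poly fract alg_closure" where "j q = to_ac (to_fract q)" for q
 have j: "j 0 = 0" "j 1 = 1" "j (p + q) = j p + j q" "j (p * q) = j p * j q" "j p = 0 \<longleftrightarrow> p = 0" for p q
  by (simp_all add: j_def)
 have jp: "j (q ^ n) = j q ^ n" for q n by (induction n) (simp_all add: j)
 have js: "j (\<Sum>i\<in>A. f i) = (\<Sum>i\<in>A. j (f i))" for f :: "nat \<Rightarrow> 'a fract poly" and A
  by (induction A rule: infinite_finite_induct) (simp_all add: j)
 define \<iota> where "\<iota> x = j [:to_fract x:]" for x :: 'a
 have const: "[:to_fract (x + y):] = [:to_fract x:] + [:to_fract y:]" "[:to_fract (x * y):] = [:to_fract x:] * [:to_fract y:]" for x y :: 'a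
  by simp_all
 have "j [:0, 1:] \<notin> acl (range \<iota>)"
 proof
  assume "j [:0, 1:] \<in> acl (range \<iota>)"
  then obtain p where p: "p \<in> polys (range \<iota>)" "p \<noteq> 0" "poly p (j [:0, 1:]) = 0" by (auto simp: acl_def algebraic_over_def)
  have "\<exists>c. coeff p i = \<iota> c" for i using polysD[OF p(1), of i] by auto
  then obtain c where c: "\<And>i. coeff p i = \<iota> (c i)" by metis
  define q where "q = (\<Sum>i\<le>degree p. monom (to_fract (c i)) i)"
  have m: "monom a i = [:a:] * [:0, 1:] ^ i" for a :: "'a fract" and i by (simp add: monom_altdef)
  have "j q = (\<Sum>i\<le>degree p. \<iota> (c i) * j [:0, 1:] ^ i)" unfolding q_def js m by (simp only: j(4) jp \<iota>_def)
  also have "\<dots> = poly p (j [:0, 1:])" by (simp add: poly_altdef c)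
  finally have q0: "q = 0" using p(3) j(5) by simp
  have "coeff q i = to_fract (c i)" if "i \<le> degree p" for i using that by (simp add: q_def coeff_sum_monom)
  then have "c (degree p) = 0" using q0 by (metis coeff_0 order_refl to_fract_eq_0_iff)
  then have "lead_coeff p = 0" by (simp add: c \<iota>_def j)
  then show False using p(2) by simp
 qed
 moreover have "\<iota> x = 0 \<Longrightarrow> x = 0" for x by (simp add: \<iota>_def j)
 moreover have "rhom UNIV \<iota>"
 proof (rule rhomI)
  show "\<iota> 1 = 1" using j(2) by (simp add: \<iota>_def one_pCons)
  show "\<iota> (x + y) = \<iota> x + \<iota> y" "\<iota> (x * y) = \<iota> x * \<iota> y" for x y unfolding \<iota>_def const j by (rule refl)+
 qed
 ultimately show thesis using that by blast
qed

lemma subfield_infinite: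
 assumes K: "subfield (K :: 'a::idom set)" and ch: "\<And>n. n > 0 \<Longrightarrow> of_nat n \<noteq> (0::'a)"
 shows "infinite K"
proof -
 have "subring_set K" using K unfolding subfield_def by (intro subring_setI) blast+
 then have "range of_nat \<subseteq> K" using sr_of_nat by blast
 moreover have "inj (of_nat :: nat \<Rightarrow> 'a)"
 proof (rule linorder_injI)
  fix m n :: nat assume "m < n"
  then have "of_nat n = (of_nat m + of_nat (n - m) :: 'a)" by (simp flip: of_nat_add)
  then show "of_nat m \<noteq> (of_nat n :: 'a)" using ch[of "n - m"] \<open>m < n\<close> by simp
 qed
 ultimately show ?thesis using range_inj_infinite infinite_super by blast
qed

theorem theorem8p3:
 fixes K :: "'a::idom set" and br :: "'a \<Rightarrow> 'a \<Rightarrow> 'a" and P :: "'a set"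
 assumes "subfield K"
  and "\<forall>n::nat. n > 0 \<longrightarrow> of_nat n \<noteq> (0::'a)"
  and "affine_over K"
  and "poisson_bracket K br"
  and "poisson_prime br P"
 shows "poisson_rational K br P \<longleftrightarrow>
  finite {Q. poisson_prime br Q \<and> P \<subseteq> Q \<and> height Q = height P + 1}"
proof -
 have ch: "\<And>n. n > 0 \<Longrightarrow> of_nat n \<noteq> (0::'a)" using assms(2) by blast
 obtain S where S: "finite S" "gen_alg K S = UNIV" using assms(3) by (auto simp: affine_over_def)
 obtain \<iota> :: "'a \<Rightarrow> 'a fract poly fract alg_closure" and T
  where \<iota>: "rhom UNIV \<iota>" "\<And>x. \<iota> x = 0 \<Longrightarrow> x = 0" "T \<notin> acl (range \<iota>)" by (rule transcendental_embedding) (rule that)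
 interpret affine_domain K \<iota> T S
  by (rule affine_domain.intro[OF assms(1) subfield_infinite[OF assms(1) ch] S \<iota>])
 show ?thesis
  using rational_imp_finite[OF assms(4) ch assms(5)] finite_imp_rational[OF assms(4) ch assms(5)] by (rule iffI)
qed

end
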